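(* Let $\mathcal{G}$ be an ultragraph, let $K$ be a field and let $I$ be an ideal of $L_K(\mathcal{G})$. Put $H:=H_I=\{A\in\mathcal{G}^0: p_A\in I\}$. Then $I$ is a non-graded prime ideal if and only if the following hold: (1) $\mathcal{G}^0\setminus H$ is downward directed; (2) $\mathcal{G}^0\setminus H$ contains a loop $\gamma$ without exits in $\mathcal{G}^0\setminus H$; and (3) $I=I_{\langle H,B_H,f(s_\gamma)\rangle}$, where $f(x)$ is an irreducible polynomial in $K[x,x^{-1}]$.
   Context: An ultragraph $\mathcal{G}=(G^0,\mathcal{G}^1,r_{\mathcal{G}},s_{\mathcal{G}})$ consists of a countable set of vertices $G^0$, a countable set of edges $\mathcal{G}^1$, a source map $s_{\mathcal{G}}:\mathcal{G}^1\to G^0$ and a range map $r_{\mathcal{G}}:\mathcal{G}^1\to\mathcal{P}(G^0)\setminus\{\emptyset\}$. An algebra in $\mathcal{P}(X)$ is a collection of subsets of $X$ closed under $\cup,\cap,\setminus$. $\mathcal{G}^0$ (not to be confused with $G^0$) is the smallest algebra in $\mathcal{P}(G^0)$ containing all $\{v\}$, $v\in G^0$, and all $r_{\mathcal{G}}(e)$, $e\in\mathcal{G}^1$. A path of positive length in $\mathcal{G}$ is a sequence of edges $\alpha=e_1\cdots e_n$ ($n\ge1$) with $s_{\mathcal{G}}(e_{i+1})\in r_{\mathcal{G}}(e_i)$ for $1\le i\le n-1$; $s_{\mathcal{G}}(\alpha)=s_{\mathcal{G}}(e_1)$, $r_{\mathcal{G}}(\alpha)=r_{\mathcal{G}}(e_n)$.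 It is a loop if $s_{\mathcal{G}}(\alpha)\in r_{\mathcal{G}}(\alpha)$; for a loop put $e_{n+1}:=e_1$. A subcollection $H\subseteq\mathcal{G}^0$ (with $\emptyset\in H$) is hereditary if (1) $\{s_{\mathcal{G}}(e)\}\in H$ implies $r_{\mathcal{G}}(e)\in H$ for all $e\in\mathcal{G}^1$; (2) $A\cup B\in H$ for all $A,B\in H$; (3) $A\in H$, $B\in\mathcal{G}^0$, $B\subseteq A$ imply $B\in H$. It is saturated if, whenever $v\in G^0$ satisfies $0<|s_{\mathcal{G}}^{-1}(v)|<\infty$ and $r_{\mathcal{G}}(e)\in H$ for all $e\in s_{\mathcal{G}}^{-1}(v)$, then $\{v\}\in H$. For saturated hereditary $H$, the set of breaking vertices is $$B_H=\{v\in G^0: |s_{\mathcal{G}}^{-1}(v)|=\infty \text{ and } 0<|s_{\mathcal{G}}^{-1}(v)\cap\{e: r_{\mathcal{G}}(e)\notin H\}|<\infty\}.$$ (For any ideal $I$, $H_I$ is a saturated hereditary subcollection.) The ultragraph Leavitt path algebra $L_K(\mathcal{G})$ is the universal $K$-algebra generated by elements $p_A$ ($A\in\mathcal{G}^0$), $s_e,s_{e^*}$ ($e\in\mathcal{G}^1$) subject to: (1) $p_\emptyset=0$, $p_Ap_B=p_{A\cap B}$, $p_{A\cup B}=p_A+p_B-p_{A\cap B}$; (2) $p_{s_{\mathcal{G}}(e)}s_e=s_ep_{r_{\mathcal{G}}(e)}=s_e$ and $p_{r_{\mathcal{G}}(e)}s_{e^*}=s_{e^*}p_{s_{\mathcal{G}}(e)}=s_{e^*}$;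 (3) $s_{e^*}s_f=\delta_{e,f}p_{r_{\mathcal{G}}(e)}$; (4) $p_v=\sum_{s_{\mathcal{G}}(e)=v}s_es_{e^*}$ whenever $0<|s_{\mathcal{G}}^{-1}(v)|<\infty$ (writing $p_v=p_{\{v\}}$). It is $\mathbb{Z}$-graded, with $p_A$, $s_e$, $s_{e^*}$ of degree $0,1,-1$; non-graded means not graded for this grading. Ideals are two-sided. For a path $\gamma=e_1\cdots e_n$, $s_\gamma=s_{e_1}\cdots s_{e_n}$ and $s_{\gamma^*}=s_{e_n^*}\cdots s_{e_1^*}$. For saturated hereditary $H$, $S\subseteq B_H$ and $w\in B_H$ put $p_w^H=p_w-\sum_{s_{\mathcal{G}}(e)=w,\ r_{\mathcal{G}}(e)\notin H}s_es_{e^*}$. $I_{(H,S)}$ is the ideal of $L_K(\mathcal{G})$ generated by $\{p_A:A\in H\}\cup\{p_w^H:w\in S\}$. For $y\in L_K(\mathcal{G})$, $I_{\langle H,S,y\rangle}$ is the ideal of $L_K(\mathcal{G})$ generated by $I_{(H,S)}\cup\{y\}$. For $f(x)=\sum_k a_kx^k\in K[x,x^{-1}]$ and a loop $\gamma$, $f(s_\gamma)$ is obtained by substituting $x^0\mapsto p_{s_{\mathcal{G}}(\gamma)}$, $x^k\mapsto s_\gamma^k$, $x^{-k}\mapsto s_{\gamma^*}^k$ ($k\geq1$). For $A,B\in\mathcal{G}^0$ write $A\geq B$ if either $B\subseteq A$ or there is a path $\alpha$ of positive length with $s_{\mathcal{G}}(\alpha)\in A$ and $B\subseteq r_{\mathcal{G}}(\alpha)$.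 A nonempty subset $M\subseteq\mathcal{G}^0$ is downward directed if for all $A,B\in M$ there exists $\emptyset\ne C\in M$ with $A\geq C$ and $B\geq C$. For saturated hereditary $H$, a loop $\gamma=e_1\cdots e_n$ in $\mathcal{G}$ is a loop in $\mathcal{G}^0\setminus H$ (is contained in $\mathcal{G}^0\setminus H$) if $r_{\mathcal{G}}(\gamma)\in\mathcal{G}^0\setminus H$. It has an exit in $\mathcal{G}^0\setminus H$ if either $r_{\mathcal{G}}(e_i)\setminus\{s_{\mathcal{G}}(e_{i+1})\}\in\mathcal{G}^0\setminus H$ for some $1\le i\le n$, or there exist an edge $f\in\mathcal{G}^1$ and an index $i$ such that $r_{\mathcal{G}}(f)\in\mathcal{G}^0\setminus H$, $s_{\mathcal{G}}(f)\in r_{\mathcal{G}}(e_i)$ and $f\neq e_{i+1}$.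
   Formalization: The loop γ in (2) and (3) is required to be simple (its edges have pairwise distinct sources). Without this the "if" direction fails: for one vertex with one loop e, γ=ee and f=1−x give I=(1−x²), which is not prime. *)

theory Defs
  imports
    "HOL-Library.Poly_Mapping"
    "HOL-Library.Countable_Set"
    "HOL-Computational_Algebra.Factorial_Ring"
    "HOL-Algebra.QuotRing"
    "HOL-Algebra.Module"
begin

section \<open>Ultragraphs\<close>

record ('v, 'e) ultragraph =
  verts :: "'v set"
  edges :: "'e set"
  src :: "'e \<Rightarrow> 'v"
  rng :: "'e \<Rightarrow> 'v set"

locale ultragraph =
  fixes G :: "('v, 'e) ultragraph"
  assumes countable_verts: "countable (verts G)"
    and countable_edges: "countable (edges G)"
    and src_closed: "e \<in> edges G \<Longrightarrow> src G e \<in> verts G"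
    and rng_closed: "e \<in> edges G \<Longrightarrow> rng G e \<subseteq> verts G"
    and rng_nonempty: "e \<in> edges G \<Longrightarrow> rng G e \<noteq> {}"

text \<open>The smallest algebra of sets containing all singletons and all ranges of edges. The rule
  \<open>empty\<close> is derivable as soon as there is a vertex; it only fixes the convention that the
  empty set belongs to the algebra also when there are no vertices at all.\<close>

inductive_set gen_verts :: "('v, 'e) ultragraph \<Rightarrow> 'v set set" for G where
  empty: "{} \<in> gen_verts G"
| vertex: "v \<in> verts G \<Longrightarrow> {v} \<in> gen_verts G"
| range: "e \<in> edges G \<Longrightarrow> rng G e \<in> gen_verts G"
| union: "A \<in> gen_verts G \<Longrightarrow> B \<in> gen_verts G \<Longrightarrow> A \<union> B \<in> gen_verts G"
| inter: "A \<in> gen_verts G \<Longrightarrow> B \<in> gen_verts G \<Longrightarrow> A \<inter> B \<in> gen_verts G"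
| diff: "A \<in> gen_verts G \<Longrightarrow> B \<in> gen_verts G \<Longrightarrow> A - B \<in> gen_verts G"

definition out_edges :: "('v, 'e) ultragraph \<Rightarrow> 'v \<Rightarrow> 'e set" where
  "out_edges G v = {e \<in> edges G. src G e = v}"

definition is_path :: "('v, 'e) ultragraph \<Rightarrow> 'e list \<Rightarrow> bool" where
  "is_path G \<alpha> \<longleftrightarrow> \<alpha> \<noteq> [] \<and> set \<alpha> \<subseteq> edges G \<and>
     (\<forall>i. Suc i < length \<alpha> \<longrightarrow> src G (\<alpha> ! Suc i) \<in> rng G (\<alpha> ! i))"

definition path_src :: "('v, 'e) ultragraph \<Rightarrow> 'e list \<Rightarrow> 'v" where
  "path_src G \<alpha> = src G (hd \<alpha>)"

definition path_rng :: "('v, 'e) ultragraph \<Rightarrow> 'e list \<Rightarrow> 'v set" where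
  "path_rng G \<alpha> = rng G (last \<alpha>)"

definition is_loop :: "('v, 'e) ultragraph \<Rightarrow> 'e list \<Rightarrow> bool" where
  "is_loop G \<gamma> \<longleftrightarrow> is_path G \<gamma> \<and> path_src G \<gamma> \<in> path_rng G \<gamma>"

definition loop_outside :: "('v, 'e) ultragraph \<Rightarrow> 'v set set \<Rightarrow> 'e list \<Rightarrow> bool" where
  "loop_outside G H \<gamma> \<longleftrightarrow> is_loop G \<gamma> \<and> path_rng G \<gamma> \<in> gen_verts G - H"

text \<open>A loop may run through a closed path several times. A loop without exits that is a proper
  power \<open>\<delta>\<^sup>m\<close> does not determine a prime ideal via an irreducible \<open>f\<close>, since \<open>f(x\<^sup>m)\<close> may be
  reducible (for example \<open>1 - x\<^sup>2\<close>). Theorems about prime ideals therefore have to ask in addition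
  that the edges of the loop have distinct sources.\<close>

text \<open>The edge following \<open>\<gamma> ! i\<close> is taken cyclically, that is, the last edge of a loop is followed
  by the first one.\<close>

definition has_exit_outside :: "('v, 'e) ultragraph \<Rightarrow> 'v set set \<Rightarrow> 'e list \<Rightarrow> bool" where
  "has_exit_outside G H \<gamma> \<longleftrightarrow>
     (\<exists>i < length \<gamma>.
        rng G (\<gamma> ! i) - {src G (\<gamma> ! (Suc i mod length \<gamma>))} \<in> gen_verts G - H) \<or>
     (\<exists>f \<in> edges G. \<exists>i < length \<gamma>.
        rng G f \<in> gen_verts G - H \<and> src G f \<in> rng G (\<gamma> ! i) \<and> f \<noteq> \<gamma> ! (Suc i mod length \<gamma>))"

definition uge :: "('v, 'e) ultragraph \<Rightarrow> 'v set \<Rightarrow> 'v set \<Rightarrow> bool" where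
  "uge G A B \<longleftrightarrow> B \<subseteq> A \<or> (\<exists>\<alpha>. is_path G \<alpha> \<and> path_src G \<alpha> \<in> A \<and> B \<subseteq> path_rng G \<alpha>)"

definition downward_directed :: "('v, 'e) ultragraph \<Rightarrow> 'v set set \<Rightarrow> bool" where
  "downward_directed G M \<longleftrightarrow> M \<subseteq> gen_verts G \<and> M \<noteq> {} \<and>
     (\<forall>A \<in> M. \<forall>B \<in> M. \<exists>C \<in> M. C \<noteq> {} \<and> uge G A C \<and> uge G B C)"

definition breaking_verts :: "('v, 'e) ultragraph \<Rightarrow> 'v set set \<Rightarrow> 'v set" where
  "breaking_verts G H = {v \<in> verts G. infinite (out_edges G v) \<and>
     finite {e \<in> out_edges G v. rng G e \<notin> H} \<and> {e \<in> out_edges G v. rng G e \<notin> H} \<noteq> {}}"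


section \<open>Two-sided ideals of not necessarily unital rings\<close>

text \<open>The locale \<^locale>\<open>ideal\<close> is only available for unital rings. The notions below use only the
  fields \<^const>\<open>carrier\<close>, \<^const>\<open>mult\<close>, \<^const>\<open>zero\<close> and \<^const>\<open>add\<close> of a ring record, never
  \<^const>\<open>one\<close>.\<close>

definition two_sided_ideal :: "('a, 'm) ring_scheme \<Rightarrow> 'a set \<Rightarrow> bool" where
  "two_sided_ideal R I \<longleftrightarrow> additive_subgroup I R \<and>
     (\<forall>a \<in> carrier R. \<forall>x \<in> I. a \<otimes>\<^bsub>R\<^esub> x \<in> I \<and> x \<otimes>\<^bsub>R\<^esub> a \<in> I)"

definition ideal_gen :: "('a, 'm) ring_scheme \<Rightarrow> 'a set \<Rightarrow> 'a set" where
  "ideal_gen R X = \<Inter>{I. two_sided_ideal R I \<and> X \<subseteq> I}"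

text \<open>An ideal contains the product of two ideals \<open>A\<close>, \<open>B\<close> iff it contains all products \<open>a b\<close> with
  \<open>a\<close> in \<open>A\<close> and \<open>b\<close> in \<open>B\<close>.\<close>

definition prime_two_sided_ideal :: "('a, 'm) ring_scheme \<Rightarrow> 'a set \<Rightarrow> bool" where
  "prime_two_sided_ideal R P \<longleftrightarrow> two_sided_ideal R P \<and> P \<noteq> carrier R \<and>
     (\<forall>A B. two_sided_ideal R A \<longrightarrow> two_sided_ideal R B \<longrightarrow>
        (\<forall>a \<in> A. \<forall>b \<in> B. a \<otimes>\<^bsub>R\<^esub> b \<in> P) \<longrightarrow> A \<subseteq> P \<or> B \<subseteq> P)"

text \<open>Products of nonempty lists; the value on the empty list is irrelevant.\<close>

fun nelist_prod :: "('a, 'm) ring_scheme \<Rightarrow> 'a list \<Rightarrow> 'a" where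
  "nelist_prod R [] = \<zero>\<^bsub>R\<^esub>"
| "nelist_prod R [x] = x"
| "nelist_prod R (x # y # xs) = x \<otimes>\<^bsub>R\<^esub> nelist_prod R (y # xs)"


section \<open>Free non-unital algebras\<close>

text \<open>The free monoid on \<open>'a\<close>, written additively because \<^typ>\<open>'b \<Rightarrow>\<^sub>0 'k\<close> is the monoid algebra of
  an additive monoid \<open>'b\<close>. Thus \<open>'a free_monoid \<Rightarrow>\<^sub>0 'k\<close> is the free unital associative algebra.\<close>

datatype 'a free_monoid = Wd (letters: "'a list")

instantiation free_monoid :: (type) monoid_add
begin

definition zero_free_monoid :: "'a free_monoid" where
  "0 = Wd []"

definition plus_free_monoid :: "'a free_monoid \<Rightarrow> 'a free_monoid \<Rightarrow> 'a free_monoid" where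
  "u + w = Wd (letters u @ letters w)"

instance
  by standard (simp_all add: zero_free_monoid_def plus_free_monoid_def)

end

text \<open>The free non-unital algebra over \<open>'k\<close> on the set \<open>X\<close>: linear combinations of nonempty words
  over \<open>X\<close>. It has no unit, so the field \<^const>\<open>one\<close> of the record is meaningless.\<close>

definition free_alg :: "'x set \<Rightarrow> ('k::field, 'x free_monoid \<Rightarrow>\<^sub>0 'k) module" where
  "free_alg X = \<lparr>carrier = {f. \<forall>w \<in> Poly_Mapping.keys f. letters w \<noteq> [] \<and> set (letters w) \<subseteq> X},
     mult = (*), one = undefined, zero = 0, add = (+),
     smult = (\<lambda>c f. Poly_Mapping.single 0 c * f)\<rparr>"

definition free_gen :: "'x \<Rightarrow> 'x free_monoid \<Rightarrow>\<^sub>0 'k::field" where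
  "free_gen x = Poly_Mapping.single (Wd [x]) 1"


section \<open>Ultragraph Leavitt path algebras\<close>

datatype ('v, 'e) lpa_gen = Proj "'v set" | Edge 'e | Ghost 'e

definition lpa_gens :: "('v, 'e) ultragraph \<Rightarrow> ('v, 'e) lpa_gen set" where
  "lpa_gens G = Proj ` gen_verts G \<union> Edge ` edges G \<union> Ghost ` edges G"

type_synonym ('v, 'e, 'k) lpa_free = "('v, 'e) lpa_gen free_monoid \<Rightarrow>\<^sub>0 'k"

type_synonym ('v, 'e, 'k) lpa_elem = "('v, 'e, 'k) lpa_free set"

text \<open>A relation \<open>a = b\<close> is recorded as the element \<open>a - b\<close>.\<close>

definition lpa_relations :: "('v, 'e) ultragraph \<Rightarrow> ('v, 'e, 'k::field) lpa_free set" where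
  "lpa_relations G =
     (let p = \<lambda>A. free_gen (Proj A); s = \<lambda>e. free_gen (Edge e); t = \<lambda>e. free_gen (Ghost e) in
        {p {}}
      \<union> {p A * p B - p (A \<inter> B) | A B. A \<in> gen_verts G \<and> B \<in> gen_verts G}
      \<union> {p (A \<union> B) - (p A + p B - p (A \<inter> B)) | A B. A \<in> gen_verts G \<and> B \<in> gen_verts G}
      \<union> {p {src G e} * s e - s e | e. e \<in> edges G}
      \<union> {s e * p (rng G e) - s e | e. e \<in> edges G}
      \<union> {p (rng G e) * t e - t e | e. e \<in> edges G}
      \<union> {t e * p {src G e} - t e | e. e \<in> edges G}
      \<union> {t e * s f - (if e = f then p (rng G e) else 0) | e f. e \<in> edges G \<and> f \<in> edges G}
      \<union> {p {v} - (\<Sum>e \<in> out_edges G v. s e * t e) | v.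
           v \<in> verts G \<and> finite (out_edges G v) \<and> out_edges G v \<noteq> {}})"

abbreviation lpa_free_alg ::
    "('v, 'e) ultragraph \<Rightarrow> ('k::field, ('v, 'e, 'k) lpa_free) module" where
  "lpa_free_alg G \<equiv> free_alg (lpa_gens G)"

text \<open>Taking all scalar multiples of the relations makes the generated ring ideal a subspace; without
  a unit this is not automatic.\<close>

definition lpa_rel_ideal :: "('v, 'e) ultragraph \<Rightarrow> ('v, 'e, 'k::field) lpa_free set" where
  "lpa_rel_ideal G = ideal_gen (lpa_free_alg G)
     {c \<odot>\<^bsub>lpa_free_alg G\<^esub> x | c x. x \<in> lpa_relations G}"

definition lpa_class ::
    "('v, 'e) ultragraph \<Rightarrow> ('v, 'e, 'k::field) lpa_free \<Rightarrow> ('v, 'e, 'k) lpa_elem" where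
  "lpa_class G x = lpa_rel_ideal G +>\<^bsub>lpa_free_alg G\<^esub> x"

text \<open>The universal algebra: the free non-unital algebra modulo the relations. In general it has no
  unit, and the field \<^const>\<open>one\<close> of the record is again meaningless.\<close>

definition lpa :: "('v, 'e) ultragraph \<Rightarrow> ('k::field, ('v, 'e, 'k) lpa_elem) module" where
  "lpa G = \<lparr>carrier = a_rcosets\<^bsub>lpa_free_alg G\<^esub> (lpa_rel_ideal G),
     mult = rcoset_mult (lpa_free_alg G) (lpa_rel_ideal G),
     one = undefined,
     zero = lpa_rel_ideal G,
     add = set_add (lpa_free_alg G),
     smult = (\<lambda>c X. \<Union>x \<in> X. lpa_class G (c \<odot>\<^bsub>lpa_free_alg G\<^esub> x))\<rparr>"

definition lpa_p :: "('v, 'e) ultragraph \<Rightarrow> 'v set \<Rightarrow> ('v, 'e, 'k::field) lpa_elem" where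
  "lpa_p G A = lpa_class G (free_gen (Proj A))"

definition lpa_s :: "('v, 'e) ultragraph \<Rightarrow> 'e \<Rightarrow> ('v, 'e, 'k::field) lpa_elem" where
  "lpa_s G e = lpa_class G (free_gen (Edge e))"

definition lpa_t :: "('v, 'e) ultragraph \<Rightarrow> 'e \<Rightarrow> ('v, 'e, 'k::field) lpa_elem" where
  "lpa_t G e = lpa_class G (free_gen (Ghost e))"

definition lpa_path :: "('v, 'e) ultragraph \<Rightarrow> 'e list \<Rightarrow> ('v, 'e, 'k::field) lpa_elem" where
  "lpa_path G \<gamma> = nelist_prod (lpa G) (map (lpa_s G) \<gamma>)"

definition lpa_ghost_path :: "('v, 'e) ultragraph \<Rightarrow> 'e list \<Rightarrow> ('v, 'e, 'k::field) lpa_elem" where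
  "lpa_ghost_path G \<gamma> = nelist_prod (lpa G) (map (lpa_t G) (rev \<gamma>))"


subsection \<open>Grading\<close>

fun gen_degree :: "('v, 'e) lpa_gen \<Rightarrow> int" where
  "gen_degree (Proj A) = 0"
| "gen_degree (Edge e) = 1"
| "gen_degree (Ghost e) = -1"

definition lpa_component ::
    "('v, 'e) ultragraph \<Rightarrow> int \<Rightarrow> ('v, 'e, 'k::field) lpa_elem set" where
  "lpa_component G n = lpa_class G ` {x \<in> carrier (lpa_free_alg G).
     \<forall>w \<in> Poly_Mapping.keys x. sum_list (map gen_degree (letters w)) = n}"

text \<open>An ideal is graded if it is the sum of its intersections with the homogeneous components.\<close>

definition graded_ideal ::
    "('v, 'e) ultragraph \<Rightarrow> ('v, 'e, 'k::field) lpa_elem set \<Rightarrow> bool" where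
  "graded_ideal G I \<longleftrightarrow> two_sided_ideal (lpa G) I \<and>
     (\<forall>x \<in> I. \<exists>N c. finite N \<and> (\<forall>n \<in> N. c n \<in> I \<inter> lpa_component G n) \<and>
        x = finsum (lpa G) c N)"


subsection \<open>Ideals attached to hereditary and saturated subcollections\<close>

definition ideal_verts ::
    "('v, 'e) ultragraph \<Rightarrow> ('v, 'e, 'k::field) lpa_elem set \<Rightarrow> 'v set set" where
  "ideal_verts G I = {A \<in> gen_verts G. lpa_p G A \<in> I}"

definition lpa_pH ::
    "('v, 'e) ultragraph \<Rightarrow> 'v set set \<Rightarrow> 'v \<Rightarrow> ('v, 'e, 'k::field) lpa_elem" where
  "lpa_pH G H w = lpa_p G {w} \<ominus>\<^bsub>lpa G\<^esub>
     finsum (lpa G) (\<lambda>e. lpa_s G e \<otimes>\<^bsub>lpa G\<^esub> lpa_t G e) {e \<in> out_edges G w. rng G e \<notin> H}"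

definition ideal_HS ::
    "('v, 'e) ultragraph \<Rightarrow> 'v set set \<Rightarrow> 'v set \<Rightarrow> ('v, 'e, 'k::field) lpa_elem set" where
  "ideal_HS G H S = ideal_gen (lpa G) (lpa_p G ` H \<union> lpa_pH G H ` S)"

definition ideal_HSy ::
    "('v, 'e) ultragraph \<Rightarrow> 'v set set \<Rightarrow> 'v set \<Rightarrow> ('v, 'e, 'k::field) lpa_elem
      \<Rightarrow> ('v, 'e, 'k) lpa_elem set" where
  "ideal_HSy G H S y = ideal_gen (lpa G) (ideal_HS G H S \<union> {y})"

text \<open>The Laurent polynomial ring over \<open>'k\<close> is \<^typ>\<open>int \<Rightarrow>\<^sub>0 'k\<close>, the group algebra of the integers;
  \<open>Poly_Mapping.lookup f k\<close> is the coefficient of the \<open>k\<close>-th power of the variable.\<close>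

definition loop_power :: "('v, 'e) ultragraph \<Rightarrow> 'e list \<Rightarrow> int \<Rightarrow> ('v, 'e, 'k::field) lpa_elem" where
  "loop_power G \<gamma> k =
     (if k = 0 then lpa_p G {path_src G \<gamma>}
      else if k > 0 then nelist_prod (lpa G) (replicate (nat k) (lpa_path G \<gamma>))
      else nelist_prod (lpa G) (replicate (nat (- k)) (lpa_ghost_path G \<gamma>)))"

definition laurent_eval ::
    "('v, 'e) ultragraph \<Rightarrow> (int \<Rightarrow>\<^sub>0 'k::field) \<Rightarrow> 'e list \<Rightarrow> ('v, 'e, 'k) lpa_elem" where
  "laurent_eval G f \<gamma> =
     finsum (lpa G) (\<lambda>k. Poly_Mapping.lookup f k \<odot>\<^bsub>lpa G\<^esub> loop_power G \<gamma> k) (Poly_Mapping.keys f)"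

end

theory Submission
  imports Defs "HOL.Vector_Spaces"
begin

text \<open>
  Write \<open>R\<close> for \<open>L\<^sub>K(\<G>)\<close>, \<open>N\<close> for an ideal of \<open>R\<close> and \<open>H\<close> for the collection of all \<open>A\<close> with \<open>p\<^sub>A \<in> N\<close>. All
  calculations take place in the quotient by \<open>N\<close>. There \<open>p\<^sub>A \<noteq> 0\<close> holds exactly for the \<open>A\<close> outside
  \<open>H\<close>, by definition, so that no concrete representation of \<open>R\<close> is needed. If moreover
  \<open>p\<^sub>w\<^sup>H \<in> N\<close> for all breaking vertices \<open>w\<close>, then the Cuntz--Krieger relation holds at every vertex that
  emits finitely many, but at least one, edges with range outside \<open>H\<close>. The argument rests on three facts
  about such a quotient.

  \<^item> Real paths (\<open>real_reduction\<close>): every \<open>x \<noteq> 0\<close> has a nonzero right multiple which is a combination of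
    elements \<open>s\<^sub>\<alpha> p\<^sub>B\<close> with distinct paths \<open>\<alpha>\<close> and one common set \<open>B\<close>. Ghost edges are removed one
    after the other by multiplying with edges. If all products \<open>x s\<^sub>e\<close> vanish, then
    \<open>x = y (1 - \<Sum> s\<^sub>e s\<^sub>e\<^sub>*)\<close> with a finite sum and \<open>y\<close> free of ghosts, and cutting down to a small
    set of vertices makes the sum disappear.
  \<^item> No exitless loop (\<open>reduces_to_projection\<close>): every \<open>x \<noteq> 0\<close> has a multiple \<open>a x b = p\<^sub>A \<noteq> 0\<close>. It
    suffices to treat \<open>c p\<^sub>v + \<Sum> c\<^sub>\<beta> s\<^sub>\<beta>\<close> with closed paths \<open>\<beta>\<close> at \<open>v\<close>. Compress with \<open>s\<^sub>\<eta>\<close> for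
    \<open>\<eta> = \<beta>\<^sub>0\<^sup>k \<eta>'\<close> and \<open>k\<close> large. If a term other than the first always survives, then
    periodicity of words shows that every surviving path from \<open>v\<close> follows \<open>\<beta>\<^sub>0\<close>, and the shortest closed prefix
    of \<open>\<beta>\<^sub>0\<close> is a loop without exits.
  \<^item> An exitless loop \<open>\<gamma>\<close> at \<open>v\<close>, everything directed to it (\<open>corner_essential\<close>): the corner
    \<open>p\<^sub>v R p\<^sub>v\<close> is a quotient of the Laurent polynomials, via \<open>x \<mapsto> s\<^sub>\<gamma>\<close>, and every \<open>x \<noteq> 0\<close> has
    a nonzero multiple in this corner.

  Let \<open>I\<close> be prime and not graded. Downward directedness is primeness applied to \<open>p\<^sub>A R p\<^sub>B\<close>. A prime
  ideal is graded as soon as it is graded on one corner \<open>q R q\<close> with \<open>q \<notin> I\<close> (\<open>graded_by_corner\<close>).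
  The corner at \<open>q = p\<^sub>w\<^sup>H\<close> is, modulo \<open>I\<close>, spanned by \<open>q\<close>, which forces \<open>p\<^sub>w\<^sup>H \<in> I\<close>. Without
  exitless loops, the second fact modulo the graded ideal generated by the \<open>p\<^sub>A\<close>, \<open>A \<in> H\<close>, and the
  \<open>p\<^sub>w\<^sup>H\<close> shows that \<open>I\<close> equals this ideal. So there is an exitless loop \<open>\<gamma>\<close>, and the evaluation
  \<open>f \<mapsto> f(s\<^sub>\<gamma>)\<close> modulo \<open>I\<close> is not injective, as otherwise the corner at \<open>v\<close> would be graded. Its
  kernel is a nonzero prime ideal of a principal ideal domain, hence generated by an irreducible \<open>f\<close>. The
  third fact, modulo the ideal generated by the same elements and \<open>f(s\<^sub>\<gamma>)\<close>, shows that this ideal is all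
  of \<open>I\<close> (\<open>nongraded_prime_imp\<close>).

  Conversely, irreducibility of \<open>f\<close> makes the corner at \<open>v\<close> a field modulo \<open>I\<close>. Two ideals not
  contained in \<open>I\<close> both contain nonzero elements of this field, and their product is again nonzero.
  Finally, the nonzero homogeneous components of \<open>f(s\<^sub>\<gamma>)\<close> are scalar multiples of powers of \<open>s\<^sub>\<gamma>\<close> or
  \<open>s\<^sub>\<gamma>\<^sub>*\<close>, or of \<open>p\<^sub>v\<close>, and none of these lies in \<open>I\<close> (\<open>nongraded_prime_if\<close>).

  To calculate with equations instead of congruences, the quotient is realized by additive endomorphisms of
  the free algebra (\<open>exists_quotient_rep\<close>).
\<close>

section \<open>Families satisfying the Leavitt relations\<close>

lemma gen_verts_subset: "A \<in> gen_verts G \<Longrightarrow> ultragraph G \<Longrightarrow> A \<subseteq> verts G"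
  by (induction rule: gen_verts.induct) (auto dest: ultragraph.rng_closed)

text \<open>A family of elements of a unital ring satisfying the relations of \<open>L\<^sub>K(\<G>)\<close>, except for the
  Cuntz--Krieger relation. The map \<open>sc\<close> is the action of the scalars; its values commute with the family
  but need not lie in the generated subalgebra, and neither does the unit of the ring.\<close>

locale leavitt_family = ultragraph G
  for G :: "('v, 'e) ultragraph" +
  fixes P :: "'v set \<Rightarrow> 'r::ring_1"
    and S T :: "'e \<Rightarrow> 'r"
    and sc :: "'k::field \<Rightarrow> 'r"
  assumes P_empty [simp]: "P {} = 0"
    and P_mult: "A \<in> gen_verts G \<Longrightarrow> B \<in> gen_verts G \<Longrightarrow> P A * P B = P (A \<inter> B)"
    and P_Un: "A \<in> gen_verts G \<Longrightarrow> B \<in> gen_verts G \<Longrightarrow> P (A \<union> B) = P A + P B - P (A \<inter> B)"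
    and PS_src: "e \<in> edges G \<Longrightarrow> P {src G e} * S e = S e"
    and SP_rng: "e \<in> edges G \<Longrightarrow> S e * P (rng G e) = S e"
    and PT_rng: "e \<in> edges G \<Longrightarrow> P (rng G e) * T e = T e"
    and TP_src: "e \<in> edges G \<Longrightarrow> T e * P {src G e} = T e"
    and TS: "e \<in> edges G \<Longrightarrow> f \<in> edges G \<Longrightarrow> T e * S f = (if e = f then P (rng G e) else 0)"
    and sc_1 [simp]: "sc 1 = 1"
    and sc_add: "sc (a + b) = sc a + sc b"
    and sc_mult: "sc (a * b) = sc a * sc b"
    and sc_P: "A \<in> gen_verts G \<Longrightarrow> P A * sc c = sc c * P A"
    and sc_S: "e \<in> edges G \<Longrightarrow> S e * sc c = sc c * S e"
    and sc_T: "e \<in> edges G \<Longrightarrow> T e * sc c = sc c * T e"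
begin

abbreviation "E \<equiv> edges G"
abbreviation "V0 \<equiv> gen_verts G"
abbreviation "s \<equiv> src G"
abbreviation "r \<equiv> rng G"

lemmas gv_intros = gen_verts.range gen_verts.union gen_verts.inter gen_verts.diff gen_verts.empty

lemma sc_0 [simp]: "sc 0 = 0"
  using sc_add[of 0 0] by simp

lemma src_gv [simp]: "e \<in> E \<Longrightarrow> {s e} \<in> V0"
  by (simp add: gen_verts.vertex src_closed)

lemma rng_gv [simp]: "e \<in> E \<Longrightarrow> r e \<in> V0"
  by (rule gen_verts.range)

lemma gv_sub: "A \<in> V0 \<Longrightarrow> A \<subseteq> verts G"
  using gen_verts_subset ultragraph_axioms by blast

lemma P_idem: "A \<in> V0 \<Longrightarrow> P A * P A = P A"
  by (simp add: P_mult)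

lemma P_split: "A \<in> V0 \<Longrightarrow> B \<in> V0 \<Longrightarrow> P A = P (A \<inter> B) + P (A - B)"
proof -
  assume A: "A \<in> V0" and B: "B \<in> V0"
  have "P ((A \<inter> B) \<union> (A - B)) = P (A \<inter> B) + P (A - B) - P ((A \<inter> B) \<inter> (A - B))"
    using A B by (intro P_Un gv_intros)
  moreover have "(A \<inter> B) \<union> (A - B) = A" "(A \<inter> B) \<inter> (A - B) = {}" by auto
  ultimately show ?thesis by simp
qed

lemma P_zero_mono: "P A = 0 \<Longrightarrow> B \<subseteq> A \<Longrightarrow> A \<in> V0 \<Longrightarrow> B \<in> V0 \<Longrightarrow> P B = 0"
  using P_mult[of B A] by (simp add: inf.absorb1)

lemma PS: "A \<in> V0 \<Longrightarrow> e \<in> E \<Longrightarrow> P A * S e = (if s e \<in> A then S e else 0)"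
proof -
  assume A: "A \<in> V0" and e: "e \<in> E"
  have "P A * S e = P A * P {s e} * S e" using PS_src e by (simp add: mult.assoc)
  also have "\<dots> = P (A \<inter> {s e}) * S e" using A e by (simp add: P_mult)
  finally show ?thesis using PS_src[OF e] by (cases "s e \<in> A") simp_all
qed

lemma TP: "A \<in> V0 \<Longrightarrow> e \<in> E \<Longrightarrow> T e * P A = (if s e \<in> A then T e else 0)"
proof -
  assume A: "A \<in> V0" and e: "e \<in> E"
  have "T e * P A = T e * P {s e} * P A" using TP_src e by simp
  also have "\<dots> = T e * P ({s e} \<inter> A)" using A e by (simp add: P_mult mult.assoc)
  finally show ?thesis using TP_src[OF e] by (cases "s e \<in> A") simp_all
qed

lemma S_zero_iff: "e \<in> E \<Longrightarrow> S e = 0 \<longleftrightarrow> P (r e) = 0"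
  using SP_rng[of e] TS[of e e] by force

text \<open>\<open>s\<^sub>\<alpha>\<close> and \<open>s\<^sub>\<alpha>\<^sub>*\<close> for an arbitrary word \<open>\<alpha>\<close> in the edges; both are the unit of the ring for the
  empty word. By the relations, \<open>Sp \<alpha>\<close> vanishes unless \<open>\<alpha>\<close> is empty or a path whose range is not
  null (\<open>Sp_nz_iff_path\<close>), so it is not required beforehand that \<open>\<alpha>\<close> be a path.\<close>

definition Sp :: "'e list \<Rightarrow> 'r" where "Sp \<alpha> = prod_list (map S \<alpha>)"
definition Tp :: "'e list \<Rightarrow> 'r" where "Tp \<alpha> = prod_list (map T (rev \<alpha>))"

lemma Sp_Nil [simp]: "Sp [] = 1" and Sp_Cons: "Sp (e # \<alpha>) = S e * Sp \<alpha>"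
  and Sp_append: "Sp (\<alpha> @ \<beta>) = Sp \<alpha> * Sp \<beta>"
  by (simp_all add: Sp_def)

lemma Tp_Nil [simp]: "Tp [] = 1" and Tp_Cons: "Tp (e # \<alpha>) = Tp \<alpha> * T e"
  and Tp_append: "Tp (\<alpha> @ \<beta>) = Tp \<beta> * Tp \<alpha>"
  by (simp_all add: Tp_def)

lemma P_Sp: "\<alpha> \<noteq> [] \<Longrightarrow> set \<alpha> \<subseteq> E \<Longrightarrow> A \<in> V0 \<Longrightarrow>
    P A * Sp \<alpha> = (if s (hd \<alpha>) \<in> A then Sp \<alpha> else 0)"
  by (cases \<alpha>) (auto simp: Sp_Cons mult.assoc[symmetric] PS)

lemma Tp_P: "\<alpha> \<noteq> [] \<Longrightarrow> set \<alpha> \<subseteq> E \<Longrightarrow> A \<in> V0 \<Longrightarrow>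
    Tp \<alpha> * P A = (if s (hd \<alpha>) \<in> A then Tp \<alpha> else 0)"
  by (cases \<alpha>) (auto simp: Tp_Cons mult.assoc TP)

lemma Sp_rng: "\<alpha> \<noteq> [] \<Longrightarrow> set \<alpha> \<subseteq> E \<Longrightarrow> Sp \<alpha> * P (r (last \<alpha>)) = Sp \<alpha>"
  by (cases \<alpha> rule: rev_cases) (auto simp: Sp_append Sp_Cons mult.assoc SP_rng)

lemma rng_Tp: "\<alpha> \<noteq> [] \<Longrightarrow> set \<alpha> \<subseteq> E \<Longrightarrow> P (r (last \<alpha>)) * Tp \<alpha> = Tp \<alpha>"
  by (cases \<alpha> rule: rev_cases) (auto simp: Tp_append Tp_Cons mult.assoc[symmetric] PT_rng)

lemma last_E: "\<alpha> \<noteq> [] \<Longrightarrow> set \<alpha> \<subseteq> E \<Longrightarrow> last \<alpha> \<in> E"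
  by (meson last_in_set subset_iff)

lemma hd_E: "\<alpha> \<noteq> [] \<Longrightarrow> set \<alpha> \<subseteq> E \<Longrightarrow> hd \<alpha> \<in> E"
  by (meson hd_in_set subset_iff)

lemma Sp_P: "\<alpha> \<noteq> [] \<Longrightarrow> set \<alpha> \<subseteq> E \<Longrightarrow> A \<in> V0 \<Longrightarrow> Sp \<alpha> * P A = Sp \<alpha> * P (r (last \<alpha>) \<inter> A)"
  using P_mult[of "r (last \<alpha>)" A] Sp_rng[of \<alpha>] last_E[of \<alpha>] by (metis mult.assoc rng_gv)

lemma sc_Sp: "set \<alpha> \<subseteq> E \<Longrightarrow> Sp \<alpha> * sc c = sc c * Sp \<alpha>"
proof (induction \<alpha>)
  case (Cons a \<alpha>)
  then show ?case by (simp add: Sp_Cons mult.assoc) (simp add: mult.assoc[symmetric] sc_S)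
qed simp

lemma sc_Tp: "set \<alpha> \<subseteq> E \<Longrightarrow> Tp \<alpha> * sc c = sc c * Tp \<alpha>"
proof (induction \<alpha>)
  case (Cons a \<alpha>)
  have "Tp (a # \<alpha>) * sc c = (Tp \<alpha> * sc c) * T a" using Cons.prems by (simp add: Tp_Cons mult.assoc sc_T)
  also have "\<dots> = sc c * Tp (a # \<alpha>)" using Cons by (simp add: Tp_Cons mult.assoc[symmetric])
  finally show ?case .
qed simp

lemma Sp_append_nz:
  assumes "set \<alpha> \<subseteq> E" "set \<beta> \<subseteq> E" "\<alpha> \<noteq> []" "\<beta> \<noteq> []" "Sp (\<alpha> @ \<beta>) \<noteq> 0"
  shows "Sp \<alpha> \<noteq> 0" "Sp \<beta> \<noteq> 0" "s (hd \<beta>) \<in> r (last \<alpha>)"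
proof -
  show "Sp \<alpha> \<noteq> 0" "Sp \<beta> \<noteq> 0" using assms(5) by (auto simp: Sp_append)
  have "Sp (\<alpha> @ \<beta>) = Sp \<alpha> * (P (r (last \<alpha>)) * Sp \<beta>)"
    using Sp_rng[OF assms(3,1)] by (simp add: Sp_append mult.assoc[symmetric])
  then show "s (hd \<beta>) \<in> r (last \<alpha>)"
    using assms P_Sp[OF assms(4,2), of "r (last \<alpha>)"] last_E[OF assms(3,1)] by (auto split: if_splits)
qed

lemma Tp_Sp_same: "set \<alpha> \<subseteq> E \<Longrightarrow> \<alpha> \<noteq> [] \<Longrightarrow> Sp \<alpha> \<noteq> 0 \<Longrightarrow> Tp \<alpha> * Sp \<alpha> = P (r (last \<alpha>))"
proof (induction \<alpha>)
  case (Cons e \<alpha>)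
  show ?case
  proof (cases "\<alpha> = []")
    case True
    then show ?thesis using Cons by (simp add: Sp_Cons Tp_Cons TS)
  next
    case False
    have nz: "Sp \<alpha> \<noteq> 0" "s (hd \<alpha>) \<in> r e"
      using Sp_append_nz[of "[e]" \<alpha>] Cons False by auto
    have "Tp (e # \<alpha>) * Sp (e # \<alpha>) = Tp \<alpha> * (T e * S e) * Sp \<alpha>"
      by (simp add: Sp_Cons Tp_Cons mult.assoc)
    also have "\<dots> = Tp \<alpha> * (P (r e) * Sp \<alpha>)" using Cons.prems by (simp add: TS mult.assoc)
    also have "\<dots> = Tp \<alpha> * Sp \<alpha>" using P_Sp[of \<alpha> "r e"] Cons.prems nz False by simp
    finally show ?thesis using Cons False nz by simp
  qed
qed simp

lemma Sp_nz_rng: "set \<alpha> \<subseteq> E \<Longrightarrow> \<alpha> \<noteq> [] \<Longrightarrow> Sp \<alpha> \<noteq> 0 \<Longrightarrow> P (r (last \<alpha>)) \<noteq> 0"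
  using Sp_rng[of \<alpha>] by auto

lemma Sp_append_nzI:
  assumes "set \<alpha> \<subseteq> E" "set \<beta> \<subseteq> E" "\<alpha> \<noteq> []" "\<beta> \<noteq> []"
    and "Sp \<alpha> \<noteq> 0" "Sp \<beta> \<noteq> 0" "s (hd \<beta>) \<in> r (last \<alpha>)"
  shows "Sp (\<alpha> @ \<beta>) \<noteq> 0"
proof
  assume "Sp (\<alpha> @ \<beta>) = 0"
  then have "Tp \<alpha> * Sp \<alpha> * Sp \<beta> = 0" by (simp add: Sp_append mult.assoc)
  then show False
    using Tp_Sp_same[of \<alpha>] P_Sp[of \<beta> "r (last \<alpha>)"] assms last_E[of \<alpha>] by auto
qed

lemma Sp_nz_iff_path:
  assumes "set \<alpha> \<subseteq> E" "\<alpha> \<noteq> []"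
  shows "Sp \<alpha> \<noteq> 0 \<longleftrightarrow> is_path G \<alpha> \<and> P (r (last \<alpha>)) \<noteq> 0"
  using assms
proof (induction \<alpha>)
  case (Cons e \<alpha>)
  show ?case
  proof (cases "\<alpha> = []")
    case True
    with Cons.prems show ?thesis by (simp add: Sp_Cons S_zero_iff is_path_def)
  next
    case False
    then have IH: "Sp \<alpha> \<noteq> 0 \<longleftrightarrow> is_path G \<alpha> \<and> P (r (last \<alpha>)) \<noteq> 0" using Cons by auto
    have path: "is_path G (e # \<alpha>) \<longleftrightarrow> is_path G \<alpha> \<and> s (hd \<alpha>) \<in> r e"
    proof -
      have "(\<forall>i. Suc i < length (e # \<alpha>) \<longrightarrow> s ((e # \<alpha>) ! Suc i) \<in> r ((e # \<alpha>) ! i)) \<longleftrightarrow>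
          s (hd \<alpha>) \<in> r e \<and> (\<forall>i. Suc i < length \<alpha> \<longrightarrow> s (\<alpha> ! Suc i) \<in> r (\<alpha> ! i))" (is "?l \<longleftrightarrow> ?r")
      proof
        assume l: ?l
        have "s (hd \<alpha>) \<in> r e" using l[rule_format, of 0] False by (simp add: hd_conv_nth)
        moreover have "s (\<alpha> ! Suc i) \<in> r (\<alpha> ! i)" if "Suc i < length \<alpha>" for i
          using l[rule_format, of "Suc i"] that by simp
        ultimately show ?r by blast
      next
        assume r: ?r
        show ?l
        proof (intro allI impI)
          fix i assume "Suc i < length (e # \<alpha>)"
          then show "s ((e # \<alpha>) ! Suc i) \<in> r ((e # \<alpha>) ! i)"
            using r False by (cases i) (simp_all add: hd_conv_nth)
        qed
      qed
      moreover have "set (e # \<alpha>) \<subseteq> E \<longleftrightarrow> set \<alpha> \<subseteq> E" using Cons.prems by simp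
      moreover have "e # \<alpha> \<noteq> []" by simp
      ultimately show ?thesis unfolding is_path_def using False by argo
    qed
    have "S e \<noteq> 0" if "Sp \<alpha> \<noteq> 0" "s (hd \<alpha>) \<in> r e"
    proof
      assume "S e = 0"
      then have "P (r e) = 0" using Cons.prems by (simp add: S_zero_iff)
      then show False using P_Sp[of \<alpha> "r e"] that Cons.prems False by auto
    qed
    then have S: "S e \<noteq> 0" if "Sp \<alpha> \<noteq> 0" "s (hd \<alpha>) \<in> r e" using that by blast
    have E: "set [e] \<subseteq> E" "set \<alpha> \<subseteq> E" using Cons.prems by auto
    have "Sp (e # \<alpha>) \<noteq> 0 \<longleftrightarrow> Sp \<alpha> \<noteq> 0 \<and> s (hd \<alpha>) \<in> r e"
    proof
      assume "Sp (e # \<alpha>) \<noteq> 0"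
      then show "Sp \<alpha> \<noteq> 0 \<and> s (hd \<alpha>) \<in> r e"
        using Sp_append_nz(2,3)[OF E _ False] by simp
    next
      assume "Sp \<alpha> \<noteq> 0 \<and> s (hd \<alpha>) \<in> r e"
      then show "Sp (e # \<alpha>) \<noteq> 0"
        using Sp_append_nzI[OF E _ False] S by (simp add: Sp_Cons)
    qed
    then show ?thesis unfolding IH path using False by auto
  qed
qed simp

lemma Tp_Sp_append:
  assumes "set \<alpha> \<subseteq> E" "\<alpha> \<noteq> []" "Sp \<alpha> \<noteq> 0"
  shows "Tp \<alpha> * Sp (\<alpha> @ \<beta>) = P (r (last \<alpha>)) * Sp \<beta>"
  using Tp_Sp_same[OF assms] by (simp add: Sp_append mult.assoc[symmetric])

lemma Tp_nz_Sp: "set \<alpha> \<subseteq> E \<Longrightarrow> Tp \<alpha> \<noteq> 0 \<Longrightarrow> Sp \<alpha> \<noteq> 0"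
proof (induction \<alpha>)
  case (Cons e \<alpha>)
  then have "Tp \<alpha> \<noteq> 0" by (auto simp: Tp_Cons)
  then have nz: "Sp \<alpha> \<noteq> 0" using Cons by simp
  have "P (r e) * T e = T e" using Cons.prems by (simp add: PT_rng)
  then have Pr: "P (r e) \<noteq> 0" using Cons.prems by (auto simp: Tp_Cons)
  show ?case
  proof (cases "\<alpha> = []")
    case True
    then show ?thesis using Cons.prems Pr by (simp add: Sp_Cons S_zero_iff)
  next
    case False
    have "Tp (e # \<alpha>) = Tp \<alpha> * P (r e) * T e"
      using Cons.prems by (simp add: Tp_Cons mult.assoc PT_rng)
    then have "s (hd \<alpha>) \<in> r e" using Tp_P[of \<alpha> "r e"] Cons.prems False by (auto split: if_splits)
    then show ?thesis
      using Sp_append_nzI[of "[e]" \<alpha>] Cons.prems False nz Pr by (simp add: Sp_Cons S_zero_iff)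
  qed
qed simp

text \<open>A product \<open>s\<^sub>\<alpha>\<^sub>* s\<^sub>\<beta>\<close> survives only if one of the words is a prefix of the other.\<close>

lemma Tp_Sp_nz_prefix:
  "set \<alpha> \<subseteq> E \<Longrightarrow> set \<beta> \<subseteq> E \<Longrightarrow> Tp \<alpha> * Sp \<beta> \<noteq> 0 \<Longrightarrow> (\<exists>\<zeta>. \<beta> = \<alpha> @ \<zeta>) \<or> (\<exists>\<zeta>. \<alpha> = \<beta> @ \<zeta>)"
proof (induction \<alpha> arbitrary: \<beta>)
  case (Cons a \<alpha>)
  show ?case
  proof (cases \<beta>)
    case (Cons b \<beta>')
    have eq: "Tp (a # \<alpha>) * Sp \<beta> = Tp \<alpha> * (T a * S b) * Sp \<beta>'"
      using Cons by (simp add: Sp_Cons Tp_Cons mult.assoc)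
    then have ab: "a = b" using Cons.prems Cons by (auto simp: TS split: if_splits)
    show ?thesis
    proof (cases "\<beta>' = []")
      case True
      then show ?thesis using ab Cons by auto
    next
      case False
      have "Tp \<alpha> * (P (r a) * Sp \<beta>') \<noteq> 0"
        using Cons.prems Cons eq ab by (auto simp: TS mult.assoc)
      then have "Tp \<alpha> * Sp \<beta>' \<noteq> 0"
        using P_Sp[of \<beta>' "r a"] False Cons.prems Cons by (auto split: if_splits)
      then show ?thesis using Cons.IH[of \<beta>'] Cons.prems Cons ab by auto
    qed
  qed simp
qed simp


subsection \<open>The subalgebra generated by the family\<close>

text \<open>The generated subalgebra, which in general does not contain the unit of the ring.\<close>

inductive_set alg :: "'r set" where
  alg_P: "A \<in> V0 \<Longrightarrow> P A \<in> alg"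
| alg_S: "e \<in> E \<Longrightarrow> S e \<in> alg"
| alg_T: "e \<in> E \<Longrightarrow> T e \<in> alg"
| alg_add: "x \<in> alg \<Longrightarrow> y \<in> alg \<Longrightarrow> x + y \<in> alg"
| alg_mult: "x \<in> alg \<Longrightarrow> y \<in> alg \<Longrightarrow> x * y \<in> alg"
| alg_sc: "x \<in> alg \<Longrightarrow> sc c * x \<in> alg"

lemma alg_0: "0 \<in> alg"
  using alg_P[of "{}"] by (simp add: gen_verts.empty)

lemma alg_Sp: "set \<alpha> \<subseteq> E \<Longrightarrow> \<alpha> \<noteq> [] \<Longrightarrow> Sp \<alpha> \<in> alg"
proof (induction \<alpha>)
  case (Cons a \<alpha>)
  then show ?case by (cases "\<alpha> = []") (auto simp: Sp_Cons alg_S alg_mult)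
qed simp

lemma alg_Tp: "set \<alpha> \<subseteq> E \<Longrightarrow> \<alpha> \<noteq> [] \<Longrightarrow> Tp \<alpha> \<in> alg"
proof (induction \<alpha>)
  case (Cons a \<alpha>)
  then show ?case by (cases "\<alpha> = []") (auto simp: Tp_Cons alg_T alg_mult)
qed simp

lemma alg_Sp_P: "set \<alpha> \<subseteq> E \<Longrightarrow> A \<in> V0 \<Longrightarrow> Sp \<alpha> * P A \<in> alg"
  by (cases "\<alpha> = []") (auto simp: alg_Sp alg_P alg_mult)

lemma alg_P_Tp: "set \<alpha> \<subseteq> E \<Longrightarrow> A \<in> V0 \<Longrightarrow> P A * Tp \<alpha> \<in> alg"
  by (cases "\<alpha> = []") (auto simp: alg_Tp alg_P alg_mult)

lemma alg_sc_comm: "x \<in> alg \<Longrightarrow> x * sc c = sc c * x"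
proof (induction rule: alg.induct)
  case (alg_mult x y)
  then show ?case by (metis mult.assoc)
next
  case (alg_sc x d)
  have "sc d * x * sc c = sc (d * c) * x" using alg_sc by (simp add: mult.assoc sc_mult)
  also have "\<dots> = sc c * (sc d * x)" by (simp add: mult.commute[of d c] sc_mult mult.assoc)
  finally show ?case .
qed (auto simp: sc_P sc_S sc_T distrib_left distrib_right)

text \<open>Up to scalars, a word in the generators is zero or a monomial \<open>s\<^sub>\<alpha> p\<^sub>A s\<^sub>\<beta>\<^sup>*\<close>. The predicate
  records its degree \<open>d\<close> and a bound \<open>m\<close> for the number of ghost edges.\<close>

definition monomial :: "int \<Rightarrow> nat \<Rightarrow> 'r \<Rightarrow> bool" where
  "monomial d m x \<longleftrightarrow> x = 0 \<or> (\<exists>\<alpha> A \<beta>. set \<alpha> \<subseteq> E \<and> set \<beta> \<subseteq> E \<and> A \<in> V0 \<and>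
     x = Sp \<alpha> * P A * Tp \<beta> \<and> d = int (length \<alpha>) - int (length \<beta>) \<and> length \<beta> \<le> m)"

lemma monomialI: "set \<alpha> \<subseteq> E \<Longrightarrow> set \<beta> \<subseteq> E \<Longrightarrow> A \<in> V0 \<Longrightarrow> length \<beta> \<le> m \<Longrightarrow>
    d = int (length \<alpha>) - int (length \<beta>) \<Longrightarrow> monomial d m (Sp \<alpha> * P A * Tp \<beta>)"
  unfolding monomial_def by blast

lemma monomial_mono: "monomial d m x \<Longrightarrow> m \<le> n \<Longrightarrow> monomial d n x"
  unfolding monomial_def by fastforce

lemma monomial_P: "A \<in> V0 \<Longrightarrow> monomial 0 0 (P A)"
  using monomialI[of "[]" "[]" A 0 0] by simp

lemma monomial_S: "e \<in> E \<Longrightarrow> monomial 1 0 (S e)"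
  using monomialI[of "[e]" "[]" "r e" 0 1] by (simp add: Sp_Cons SP_rng)

lemma monomial_T: "e \<in> E \<Longrightarrow> monomial (-1) 1 (T e)"
  using monomialI[of "[]" "[e]" "r e" 1 "-1"] by (simp add: Tp_Cons PT_rng)

lemma P_monomial:
  assumes B: "B \<in> V0" and x: "monomial d m x"
  shows "monomial d m (P B * x)"
proof (cases "x = 0")
  case True then show ?thesis by (simp add: monomial_def)
next
  case False
  then obtain \<alpha> A \<beta> where *: "set \<alpha> \<subseteq> E" "set \<beta> \<subseteq> E" "A \<in> V0" "x = Sp \<alpha> * P A * Tp \<beta>"
    "d = int (length \<alpha>) - int (length \<beta>)" "length \<beta> \<le> m" using x by (auto simp: monomial_def)
  show ?thesis
  proof (cases "\<alpha> = []")
    case True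
    then have "P B * x = Sp [] * P (B \<inter> A) * Tp \<beta>" using * B by (simp add: P_mult mult.assoc[symmetric])
    then show ?thesis using * True B by (simp only:) (intro monomialI; simp add: gen_verts.inter)
  next
    case False
    have "P B * x = (P B * Sp \<alpha>) * P A * Tp \<beta>" using * by (simp add: mult.assoc)
    also have "\<dots> = (if s (hd \<alpha>) \<in> B then x else 0)" using P_Sp[OF False, of B] * B by simp
    finally show ?thesis using x by (auto simp: monomial_def)
  qed
qed

lemma S_monomial:
  assumes e: "e \<in> E" and x: "monomial d m x"
  shows "monomial (d + 1) m (S e * x)"
proof (cases "x = 0")
  case True then show ?thesis by (simp add: monomial_def)
next
  case False
  then obtain \<alpha> A \<beta> where *: "set \<alpha> \<subseteq> E" "set \<beta> \<subseteq> E" "A \<in> V0" "x = Sp \<alpha> * P A * Tp \<beta>"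
    "d = int (length \<alpha>) - int (length \<beta>)" "length \<beta> \<le> m" using x by (auto simp: monomial_def)
  have "S e * x = Sp (e # \<alpha>) * P A * Tp \<beta>" using * by (simp add: Sp_Cons mult.assoc)
  then show ?thesis using * e by (simp only:) (intro monomialI; simp)
qed

lemma T_monomial:
  assumes e: "e \<in> E" and x: "monomial d m x"
  shows "monomial (d - 1) (Suc m) (T e * x)"
proof (cases "x = 0")
  case True then show ?thesis by (simp add: monomial_def)
next
  case False
  then obtain \<alpha> A \<beta> where *: "set \<alpha> \<subseteq> E" "set \<beta> \<subseteq> E" "A \<in> V0" "x = Sp \<alpha> * P A * Tp \<beta>"
    "d = int (length \<alpha>) - int (length \<beta>)" "length \<beta> \<le> m" using x by (auto simp: monomial_def)
  show ?thesis
  proof (cases \<alpha>)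
    case Nil
    have "T e * x = (T e * P A) * Tp \<beta>" using * Nil by (simp add: mult.assoc)
    also have "\<dots> = (if s e \<in> A then T e * Tp \<beta> else 0)" using TP * e by simp
    also have "T e * Tp \<beta> = Sp [] * P (r e) * Tp (\<beta> @ [e])"
      using e by (simp add: Tp_append Tp_Cons mult.assoc[symmetric] PT_rng)
    finally have eq: "T e * x = (if s e \<in> A then Sp [] * P (r e) * Tp (\<beta> @ [e]) else 0)" .
    have "monomial (d - 1) (Suc m) (Sp [] * P (r e) * Tp (\<beta> @ [e]))"
      using * e Nil by (intro monomialI) auto
    then show ?thesis using eq by (auto simp: monomial_def)
  next
    case (Cons f \<alpha>')
    have "T e * x = (T e * S f) * (Sp \<alpha>' * P A * Tp \<beta>)" using * Cons by (simp add: Sp_Cons mult.assoc)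
    also have "\<dots> = (if e = f then P (r e) * (Sp \<alpha>' * P A * Tp \<beta>) else 0)"
      using TS e * Cons by simp
    finally have eq: "T e * x = (if e = f then P (r e) * (Sp \<alpha>' * P A * Tp \<beta>) else 0)" .
    have "monomial (d - 1) (Suc m) (Sp \<alpha>' * P A * Tp \<beta>)" using * e Cons by (intro monomialI) auto
    then have "monomial (d - 1) (Suc m) (P (r e) * (Sp \<alpha>' * P A * Tp \<beta>))"
      using P_monomial e by simp
    then show ?thesis using eq by (auto simp: monomial_def)
  qed
qed

lemma monomial_S_right:
  assumes e: "e \<in> E" and x: "monomial d (Suc m) x"
  shows "monomial (d + 1) m (x * S e)"
proof (cases "x = 0")
  case True then show ?thesis by (simp add: monomial_def)
next
  case False
  then obtain \<alpha> A \<beta> where *: "set \<alpha> \<subseteq> E" "set \<beta> \<subseteq> E" "A \<in> V0" "x = Sp \<alpha> * P A * Tp \<beta>"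
    "d = int (length \<alpha>) - int (length \<beta>)" "length \<beta> \<le> Suc m" using x by (auto simp: monomial_def)
  show ?thesis
  proof (cases \<beta>)
    case Nil
    have "x * S e = Sp \<alpha> * (P A * S e)" using * Nil by (simp add: mult.assoc)
    also have "\<dots> = (if s e \<in> A then Sp (\<alpha> @ [e]) * P (r e) * Tp [] else 0)"
      using * e by (simp add: PS Sp_append Sp_Cons mult.assoc SP_rng)
    finally have eq: "x * S e = (if s e \<in> A then Sp (\<alpha> @ [e]) * P (r e) * Tp [] else 0)" .
    have "monomial (d + 1) m (Sp (\<alpha> @ [e]) * P (r e) * Tp [])"
      using * e Nil by (intro monomialI) auto
    then show ?thesis using eq by (auto simp: monomial_def)
  next
    case (Cons f \<beta>')
    have fE: "f \<in> E" "set \<beta>' \<subseteq> E" using * Cons by auto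
    have "x * S e = Sp \<alpha> * P A * Tp \<beta>' * (T f * S e)" using * Cons by (simp add: Tp_Cons mult.assoc)
    also have "\<dots> = (if e = f then Sp \<alpha> * P A * (Tp \<beta>' * P (r e)) else 0)"
      using TS e fE by (simp add: mult.assoc)
    finally have eq: "x * S e = (if e = f then Sp \<alpha> * P A * (Tp \<beta>' * P (r e)) else 0)" .
    have "monomial (d + 1) m (Sp \<alpha> * P A * (Tp \<beta>' * P (r e)))"
    proof (cases "\<beta>' = []")
      case True
      have "Sp \<alpha> * P A * (Tp \<beta>' * P (r e)) = Sp \<alpha> * P (A \<inter> r e) * Tp []"
        using True * e by (simp add: mult.assoc P_mult)
      moreover have "monomial (d + 1) m (Sp \<alpha> * P (A \<inter> r e) * Tp [])"
        using * e Cons True by (intro monomialI) (auto simp: gen_verts.inter)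
      ultimately show ?thesis by simp
    next
      case False
      have "monomial (d + 1) m (Sp \<alpha> * P A * Tp \<beta>')" using * Cons by (intro monomialI) auto
      then show ?thesis using Tp_P[OF False fE(2), of "r e"] e by (auto simp: monomial_def)
    qed
    then show ?thesis using eq by (auto simp: monomial_def)
  qed
qed

text \<open>The span of the monomials with at most \<open>m\<close> ghost edges.\<close>

inductive_set spn :: "nat \<Rightarrow> 'r set" for m where
  spn_0: "0 \<in> spn m"
| spn_add: "x \<in> spn m \<Longrightarrow> y \<in> spn m \<Longrightarrow> x + y \<in> spn m"
| spn_mono: "monomial d m x \<Longrightarrow> sc c * x \<in> spn m"

lemma spn_monoI: "monomial d m x \<Longrightarrow> x \<in> spn m"
  using spn_mono[of d m x 1] by simp

lemma spn_le: "x \<in> spn m \<Longrightarrow> m \<le> n \<Longrightarrow> x \<in> spn n"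
  by (induction rule: spn.induct) (auto intro: spn.intros monomial_mono)

lemma spn_sc: "x \<in> spn m \<Longrightarrow> sc c * x \<in> spn m"
proof (induction rule: spn.induct)
  case (spn_mono d x b)
  then show ?case using spn.spn_mono[of d m x "c * b"] by (simp add: sc_mult mult.assoc)
qed (auto simp: distrib_left intro: spn.intros)

lemma spn_left:
  assumes g: "\<And>d x. monomial d m x \<Longrightarrow> \<exists>d'. monomial d' n (g * x)" "\<And>c. g * sc c = sc c * g"
  shows "x \<in> spn m \<Longrightarrow> g * x \<in> spn n"
proof (induction rule: spn.induct)
  case (spn_mono d x c)
  then obtain d' where "monomial d' n (g * x)" using g by blast
  then have "sc c * (g * x) \<in> spn n" by (rule spn.spn_mono)
  then show ?case by (simp add: mult.assoc[symmetric] g(2))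
qed (auto simp: distrib_left intro: spn.intros)

lemma spn_S_right: "x \<in> spn (Suc m) \<Longrightarrow> e \<in> E \<Longrightarrow> x * S e \<in> spn m"
proof (induction rule: spn.induct)
  case (spn_mono d x c)
  then have "monomial (d + 1) m (x * S e)" by (simp add: monomial_S_right)
  then show ?case using spn.spn_mono[of "d + 1" m "x * S e" c] by (simp add: mult.assoc)
qed (auto simp: distrib_right intro: spn.intros)

text \<open>The second conjunct makes the induction over products go through.\<close>

lemma alg_spn: "x \<in> alg \<Longrightarrow> (\<exists>n. x \<in> spn n) \<and> (\<forall>m. \<forall>y\<in>spn m. \<exists>n. x * y \<in> spn n)"
proof (induction rule: alg.induct)
  case (alg_P A)
  then show ?case
    using spn_monoI[OF monomial_P] spn_left[where g = "P A"] by (meson P_monomial sc_P)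
next
  case (alg_S e)
  then show ?case
    using spn_monoI[OF monomial_S] spn_left[where g = "S e"] by (meson S_monomial sc_S)
next
  case (alg_T e)
  then show ?case
    using spn_monoI[OF monomial_T] spn_left[where g = "T e"] by (meson T_monomial sc_T)
next
  case (alg_add x y)
  have *: "\<exists>n. a + b \<in> spn n" if "a \<in> spn k" "b \<in> spn l" for a b k l
    using that spn_le[of a k "max k l"] spn_le[of b l "max k l"] spn_add by fastforce
  show ?case
  proof (intro conjI allI ballI)
    show "\<exists>n. x + y \<in> spn n" using alg_add.IH * by meson
    fix m z assume "z \<in> spn m"
    then obtain k l where "x * z \<in> spn k" "y * z \<in> spn l" using alg_add.IH by meson
    then show "\<exists>n. (x + y) * z \<in> spn n" using * by (simp add: distrib_right)
  qed
next
  case (alg_mult x y)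
  then show ?case by (metis mult.assoc)
next
  case (alg_sc x c)
  then show ?case by (metis spn_sc mult.assoc)
qed

lemma monomial_alg: "monomial d m x \<Longrightarrow> x \<in> alg"
  unfolding monomial_def
  by (auto simp: alg_0 mult.assoc intro!: alg_Sp_P alg_P_Tp)
    (metis alg_P alg_P_Tp alg_Sp alg_mult Sp_Nil mult_1_left)

lemma spn_alg: "x \<in> spn m \<Longrightarrow> x \<in> alg"
  by (induction rule: spn.induct) (auto intro: alg.intros alg_0 monomial_alg)

lemma alg_sum: "(\<And>i. i \<in> I \<Longrightarrow> f i \<in> alg) \<Longrightarrow> sum f I \<in> alg"
  by (induction I rule: infinite_finite_induct) (auto intro: alg_0 alg_add)

text \<open>Every element has a local unit among the \<open>p\<^sub>A\<close>.\<close>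

lemma monomial_local_unit:
  assumes "monomial d m x"
  shows "\<exists>A\<in>V0. \<forall>B\<in>V0. A \<subseteq> B \<longrightarrow> P B * x = x \<and> x * P B = x"
proof (cases "x = 0")
  case True then show ?thesis using gen_verts.empty by auto
next
  case False
  then obtain \<alpha> A \<beta> where *: "set \<alpha> \<subseteq> E" "set \<beta> \<subseteq> E" "A \<in> V0" "x = Sp \<alpha> * P A * Tp \<beta>"
    using assms by (auto simp: monomial_def)
  define U where "U = A \<union> (if \<alpha> = [] then {} else {s (hd \<alpha>)}) \<union> (if \<beta> = [] then {} else {s (hd \<beta>)})"
  have UV: "U \<in> V0" using * hd_E[of \<alpha>] hd_E[of \<beta>] unfolding U_def by (auto simp del:
      Un_insert_right intro!: gv_intros)
  have "P B * x = x \<and> x * P B = x" if B: "B \<in> V0" "U \<subseteq> B" for B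
  proof
    show "P B * x = x"
    proof (cases "\<alpha> = []")
      case True
      have "B \<inter> A = A" using B by (auto simp: U_def)
      then show ?thesis using True * B by (simp add: mult.assoc[symmetric] P_mult)
    next
      case False
      then show ?thesis using * B P_Sp[OF False *(1) B(1)] by (simp add: mult.assoc[symmetric] U_def)
    qed
    show "x * P B = x"
    proof (cases "\<beta> = []")
      case True
      have "A \<inter> B = A" using B by (auto simp: U_def)
      then show ?thesis using True * B by (simp add: mult.assoc P_mult)
    next
      case False
      then show ?thesis using * B Tp_P[OF False *(2) B(1)] by (simp add: mult.assoc U_def)
    qed
  qed
  then show ?thesis using UV by blast
qed

lemma spn_local_unit:
  "x \<in> spn m \<Longrightarrow> \<exists>A\<in>V0. \<forall>B\<in>V0. A \<subseteq> B \<longrightarrow> P B * x = x \<and> x * P B = x"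
proof (induction rule: spn.induct)
  case spn_0
  then show ?case using gen_verts.empty by auto
next
  case (spn_add x y)
  then obtain A A' where "A \<in> V0" "A' \<in> V0" "\<forall>B\<in>V0. A \<subseteq> B \<longrightarrow> P B * x = x \<and> x * P B = x"
    "\<forall>B\<in>V0. A' \<subseteq> B \<longrightarrow> P B * y = y \<and> y * P B = y" by auto
  then show ?case
    by (intro bexI[of _ "A \<union> A'"]) (auto simp: distrib_left distrib_right intro: gen_verts.union)
next
  case (spn_mono d x c)
  from monomial_local_unit[OF this] obtain A where A: "A \<in> V0"
    "\<forall>B\<in>V0. A \<subseteq> B \<longrightarrow> P B * x = x \<and> x * P B = x" by blast
  have "P B * (sc c * x) = sc c * x" if "B \<in> V0" "A \<subseteq> B" for B
    using A that sc_P[of B c] by (metis mult.assoc)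
  moreover have "sc c * x * P B = sc c * x" if "B \<in> V0" "A \<subseteq> B" for B
    using A that by (simp add: mult.assoc)
  ultimately show ?case using A by blast
qed

lemma local_unit: "x \<in> alg \<Longrightarrow> \<exists>A\<in>V0. P A * x = x \<and> x * P A = x"
  using alg_spn spn_local_unit by blast

lemma spn_P_right: "x \<in> spn 0 \<Longrightarrow> B \<in> V0 \<Longrightarrow> x * P B \<in> spn 0"
proof (induction rule: spn.induct)
  case (spn_mono d x c)
  show ?case
  proof (cases "x = 0")
    case False
    then obtain \<alpha> A \<beta> where *: "set \<alpha> \<subseteq> E" "A \<in> V0" "x = Sp \<alpha> * P A * Tp []"
      using spn_mono by (auto simp: monomial_def)
    then have "x * P B = Sp \<alpha> * P (A \<inter> B) * Tp []" using spn_mono by (simp add: P_mult mult.assoc)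
    moreover have "monomial (int (length \<alpha>)) 0 (Sp \<alpha> * P (A \<inter> B) * Tp [])"
      using * spn_mono by (intro monomialI) (auto simp: gen_verts.inter)
    ultimately have "monomial (int (length \<alpha>)) 0 (x * P B)" by simp
    then show ?thesis using spn.spn_mono by (metis mult.assoc)
  qed (simp add: spn_0)
qed (auto simp: distrib_right intro: spn.intros)

end

section \<open>Reduction to linear combinations of real paths\<close>

text \<open>\<open>B\<close> lies in an atom of the Boolean algebra generated by the family \<open>\<A>\<close>.\<close>

definition atomic :: "'v set set \<Rightarrow> 'v set \<Rightarrow> bool" where
  "atomic \<A> B \<longleftrightarrow> (\<forall>C\<in>\<A>. B \<subseteq> C \<or> B \<inter> C = {})"

lemma atomic_subset: "atomic \<A> B \<Longrightarrow> C \<subseteq> B \<Longrightarrow> atomic \<A> C"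
  unfolding atomic_def by blast

context leavitt_family
begin

lemma exists_atomic:
  assumes "finite \<A>" "\<A> \<subseteq> V0" "A \<in> V0" "x * P A \<noteq> 0"
  shows "\<exists>B\<in>V0. B \<subseteq> A \<and> x * P B \<noteq> 0 \<and> atomic \<A> B"
  using assms
proof (induction \<A> rule: finite_induct)
  case empty
  then show ?case by (auto simp: atomic_def)
next
  case (insert C \<A>)
  then obtain B where B: "B \<in> V0" "B \<subseteq> A" "x * P B \<noteq> 0" "atomic \<A> B" by auto
  have "x * P B = x * P (B \<inter> C) + x * P (B - C)"
    using P_split[OF B(1), of C] insert.prems by (simp add: distrib_left)
  then have "x * P (B \<inter> C) \<noteq> 0 \<or> x * P (B - C) \<noteq> 0" using B(3) by auto
  then obtain D where D: "D = B \<inter> C \<or> D = B - C" "x * P D \<noteq> 0" by blast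
  then have "D \<in> V0" using B insert.prems by (auto intro: gv_intros)
  moreover have "atomic (insert C \<A>) D"
    using atomic_subset[OF B(4), of D] D by (auto simp: atomic_def)
  ultimately show ?case using D B(2) by blast
qed

text \<open>On a sufficiently small set \<open>B\<close>, a ghost-free element is a combination of the \<open>s\<^sub>\<alpha> p\<^sub>B\<close> for
  distinct words \<open>\<alpha>\<close>.\<close>

lemma real_form:
  "x \<in> spn 0 \<Longrightarrow> \<exists>\<A>. finite \<A> \<and> \<A> \<subseteq> V0 \<and> (\<forall>B\<in>V0. atomic \<A> B \<longrightarrow>
     (\<exists>W c. finite W \<and> (\<forall>\<alpha>\<in>W. set \<alpha> \<subseteq> E) \<and> x * P B = (\<Sum>\<alpha>\<in>W. sc (c \<alpha>) * Sp \<alpha> * P B)))"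
proof (induction rule: spn.induct)
  case spn_0
  then show ?case by (intro exI[of _ "{}"]) (auto intro!: exI[of _ "{}"])
next
  case (spn_add x y)
  from spn_add.IH(1) obtain \<A> where A: "finite \<A>" "\<A> \<subseteq> V0"
    and x: "\<forall>B\<in>V0. atomic \<A> B \<longrightarrow> (\<exists>W c. finite W \<and> (\<forall>\<alpha>\<in>W. set \<alpha> \<subseteq> E) \<and>
       x * P B = (\<Sum>\<alpha>\<in>W. sc (c \<alpha>) * Sp \<alpha> * P B))" by (elim exE conjE) (rule that)
  from spn_add.IH(2) obtain \<B> where A': "finite \<B>" "\<B> \<subseteq> V0"
    and y: "\<forall>B\<in>V0. atomic \<B> B \<longrightarrow> (\<exists>W c. finite W \<and> (\<forall>\<alpha>\<in>W. set \<alpha> \<subseteq> E) \<and>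
       y * P B = (\<Sum>\<alpha>\<in>W. sc (c \<alpha>) * Sp \<alpha> * P B))" by (elim exE conjE) (rule that)
  have "\<exists>W c. finite W \<and> (\<forall>\<alpha>\<in>W. set \<alpha> \<subseteq> E) \<and> (x + y) * P B = (\<Sum>\<alpha>\<in>W. sc (c \<alpha>) * Sp \<alpha> * P B)"
    if B: "B \<in> V0" "atomic (\<A> \<union> \<B>) B" for B
  proof -
    have "atomic \<A> B" "atomic \<B> B" using B(2) by (auto simp: atomic_def)
    with x y B(1) have ex: "\<exists>W c. finite W \<and> (\<forall>\<alpha>\<in>W. set \<alpha> \<subseteq> E) \<and> x * P B = (\<Sum>\<alpha>\<in>W. sc (c \<alpha>) * Sp \<alpha>
        * P B)"
      "\<exists>W c. finite W \<and> (\<forall>\<alpha>\<in>W. set \<alpha> \<subseteq> E) \<and> y * P B = (\<Sum>\<alpha>\<in>W. sc (c \<alpha>) * Sp \<alpha> * P B)" by blast+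
    from ex(1) obtain W c where W1: "finite W" "\<forall>\<alpha>\<in>W. set \<alpha> \<subseteq> E"
      "x * P B = (\<Sum>\<alpha>\<in>W. sc (c \<alpha>) * Sp \<alpha> * P B)" by (elim exE conjE) (rule that)
    from ex(2) obtain W' c' where W2: "finite W'" "\<forall>\<alpha>\<in>W'. set \<alpha> \<subseteq> E"
      "y * P B = (\<Sum>\<alpha>\<in>W'. sc (c' \<alpha>) * Sp \<alpha> * P B)" by (elim exE conjE) (rule that)
    note W = W1(1,2) W2(1,2) W1(3) W2(3)
    have "x * P B = (\<Sum>\<alpha>\<in>W \<union> W'. sc (if \<alpha> \<in> W then c \<alpha> else 0) * Sp \<alpha> * P B)"
      unfolding W(5) using W by (intro sum.mono_neutral_cong_left) auto
    moreover have "y * P B = (\<Sum>\<alpha>\<in>W \<union> W'. sc (if \<alpha> \<in> W' then c' \<alpha> else 0) * Sp \<alpha> * P B)"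
      unfolding W(6) using W by (intro sum.mono_neutral_cong_left) auto
    ultimately have "(x + y) * P B =
        (\<Sum>\<alpha>\<in>W \<union> W'. sc ((if \<alpha> \<in> W then c \<alpha> else 0) + (if \<alpha> \<in> W' then c' \<alpha> else 0)) * Sp \<alpha> * P B)"
      by (simp only: distrib_right sc_add sum.distrib)
    then show ?thesis
      using W by (intro exI[of _ "W \<union> W'"] exI[of _ "\<lambda>\<alpha>. (if \<alpha> \<in> W then c \<alpha> else 0) + (if \<alpha> \<in> W'
          then c' \<alpha> else 0)"]) auto
  qed
  then show ?case using A A' by (intro exI[of _ "\<A> \<union> \<B>"]) auto
next
  case (spn_mono d x c)
  show ?case
  proof (cases "x = 0")
    case True
    then show ?thesis by (intro exI[of _ "{}"]) (auto intro!: exI[of _ "{}"])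
  next
    case False
    then obtain \<alpha> A where *: "set \<alpha> \<subseteq> E" "A \<in> V0" "x = Sp \<alpha> * P A"
      using spn_mono by (auto simp: monomial_def)
    have "\<exists>W c'. finite W \<and> (\<forall>\<alpha>\<in>W. set \<alpha> \<subseteq> E) \<and> (sc c * x) * P B = (\<Sum>\<alpha>\<in>W. sc (c' \<alpha>) * Sp \<alpha> * P B)"
      if B: "B \<in> V0" "atomic {A} B" for B
    proof (cases "B \<subseteq> A")
      case True
      then have "A \<inter> B = B" by auto
      then have "(sc c * x) * P B = sc c * Sp \<alpha> * P B" using * B by (simp add: mult.assoc P_mult)
      then show ?thesis using * by (intro exI[of _ "{\<alpha>}"] exI[of _ "\<lambda>_. c"]) simp
    next
      case False
      then have "A \<inter> B = {}" using B(2) by (auto simp: atomic_def)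
      then have "(sc c * x) * P B = 0" using * B by (simp add: mult.assoc P_mult)
      then show ?thesis by (intro exI[of _ "{}"]) auto
    qed
    then show ?thesis using * by (intro exI[of _ "{A}"]) auto
  qed
qed

text \<open>Splitting off the rightmost ghost edge of every monomial.\<close>

lemma ghost_decomposition:
  "x \<in> spn (Suc n) \<Longrightarrow> \<exists>y\<in>spn 0. \<exists>F z. finite F \<and> F \<subseteq> E \<and> x = y + (\<Sum>e\<in>F. z e * T e) \<and>
     (\<forall>e\<in>F. z e * P (r e) = z e)"
proof (induction rule: spn.induct)
  case spn_0
  then show ?case by (intro bexI[of _ 0] exI[of _ "{}"]) (auto intro: spn.spn_0)
next
  case (spn_add x x')
  then obtain y F z y' F' z' where *: "y \<in> spn 0" "finite F" "F \<subseteq> E" "x = y + (\<Sum>e\<in>F. z e * T e)"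
    "\<forall>e\<in>F. z e * P (r e) = z e" "y' \<in> spn 0" "finite F'" "F' \<subseteq> E" "x' = y' + (\<Sum>e\<in>F'. z' e * T e)"
    "\<forall>e\<in>F'. z' e * P (r e) = z' e" by meson
  define w where "w e = (if e \<in> F then z e else 0) + (if e \<in> F' then z' e else 0)" for e
  have "(\<Sum>e\<in>F. z e * T e) = (\<Sum>e\<in>F \<union> F'. (if e \<in> F then z e else 0) * T e)"
    using * by (intro sum.mono_neutral_cong_left) auto
  moreover have "(\<Sum>e\<in>F'. z' e * T e) = (\<Sum>e\<in>F \<union> F'. (if e \<in> F' then z' e else 0) * T e)"
    using * by (intro sum.mono_neutral_cong_left) auto
  ultimately have "x + x' = (y + y') + (\<Sum>e\<in>F \<union> F'. w e * T e)"
    unfolding w_def distrib_right sum.distrib using *(4,9) by simp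
  moreover have "\<forall>e\<in>F \<union> F'. w e * P (r e) = w e" using * by (auto simp: w_def distrib_right)
  ultimately show ?case
    using * by (intro bexI[of _ "y + y'"] exI[of _ "F \<union> F'"] exI[of _ w]) (auto intro: spn.spn_add)
next
  case (spn_mono d x c)
  show ?case
  proof (cases "x = 0")
    case True
    then show ?thesis by (intro bexI[of _ 0] exI[of _ "{}"]) (auto intro: spn.spn_0)
  next
    case False
    then obtain \<alpha> A \<beta> where *: "set \<alpha> \<subseteq> E" "set \<beta> \<subseteq> E" "A \<in> V0" "x = Sp \<alpha> * P A * Tp \<beta>"
      using spn_mono by (auto simp: monomial_def)
    show ?thesis
    proof (cases \<beta>)
      case Nil
      then have "monomial (int (length \<alpha>)) 0 x" using * monomialI[of \<alpha> "[]" A 0] by simp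
      then have "sc c * x \<in> spn 0" by (rule spn.spn_mono)
      then show ?thesis by (intro bexI[of _ "sc c * x"] exI[of _ "{}"]) auto
    next
      case (Cons b \<beta>')
      have b: "b \<in> E" using * Cons by auto
      define z where "z = sc c * Sp \<alpha> * P A * Tp \<beta>' * P (r b)"
      have "sc c * x = z * T b"
        using * Cons b by (simp add: z_def Tp_Cons mult.assoc PT_rng)
      moreover have "z * P (r b) = z" using b by (simp add: z_def mult.assoc P_idem)
      ultimately show ?thesis using b
        by (intro bexI[of _ 0] exI[of _ "{b}"] exI[of _ "\<lambda>_. z"]) (auto intro: spn.spn_0)
    qed
  qed
qed

text \<open>An edge that does not occur in the words involved separates them.\<close>

lemma T_mult_Sp_foreign:
  assumes "set \<alpha> \<subseteq> E" "set \<beta> \<subseteq> E" "e \<in> E" "e \<notin> set \<alpha>" "e \<notin> set \<beta>" "\<alpha> \<noteq> \<beta>"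
  shows "Tp (\<beta> @ [e]) * Sp (\<alpha> @ [e]) = 0"
proof (rule ccontr)
  assume "Tp (\<beta> @ [e]) * Sp (\<alpha> @ [e]) \<noteq> 0"
  then have "(\<exists>\<zeta>. \<alpha> @ [e] = (\<beta> @ [e]) @ \<zeta>) \<or> (\<exists>\<zeta>. \<beta> @ [e] = (\<alpha> @ [e]) @ \<zeta>)"
    using Tp_Sp_nz_prefix[of "\<beta> @ [e]" "\<alpha> @ [e]"] assms by auto
  then obtain \<zeta> where \<zeta>: "\<alpha> @ [e] = (\<beta> @ [e]) @ \<zeta> \<or> \<beta> @ [e] = (\<alpha> @ [e]) @ \<zeta>" by blast
  show False
  proof (cases \<zeta> rule: rev_cases)
    case Nil then show ?thesis using \<zeta> assms by auto
  next
    case (snoc \<zeta>' x)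
    have "\<alpha> = \<beta> @ [e] @ \<zeta>' \<or> \<beta> = \<alpha> @ [e] @ \<zeta>'" using \<zeta> snoc by auto
    then show ?thesis using assms by auto
  qed
qed

end

text \<open>The Cuntz--Krieger relation at \<open>v\<close>, restricted to the edges whose range survives. For the
  image of \<open>L\<^sub>K(\<G>)\<close> modulo an ideal containing \<open>p\<^sub>w\<^sup>H\<close> for all breaking vertices \<open>w\<close> this is the
  original relation at vertices with finitely many edges, and the vanishing of \<open>p\<^sub>w\<^sup>H\<close> at breaking
  vertices.\<close>

locale leavitt_full = leavitt_family G P S T sc
  for G :: "('v, 'e) ultragraph" and P :: "'v set \<Rightarrow> 'r::ring_1"
    and S T :: "'e \<Rightarrow> 'r" and sc :: "'k::field \<Rightarrow> 'r" +
  assumes CK: "v \<in> verts G \<Longrightarrow> finite {e \<in> out_edges G v. P (rng G e) \<noteq> 0} \<Longrightarrow>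
    {e \<in> out_edges G v. P (rng G e) \<noteq> 0} \<noteq> {} \<Longrightarrow>
    P {v} = (\<Sum>e \<in> {e \<in> out_edges G v. P (rng G e) \<noteq> 0}. S e * T e)"
begin

text \<open>Let \<open>x = y (1 - \<Sum> s\<^sub>e s\<^sub>e\<^sub>*)\<close> be killed by all edges. At a vertex \<open>v\<close> with \<open>x p\<^sub>v \<noteq> 0\<close> the
  sum does not matter: by the Cuntz--Krieger relation \<open>v\<close> cannot emit a positive finite number of
      surviving
  edges; if it emitted infinitely many, one of them would not occur in the sum or in the words of
      \<open>y\<close>, and
  multiplying with it would show \<open>y p\<^sub>v = 0\<close> and thus \<open>x p\<^sub>v = 0\<close>. So \<open>v\<close> emits no surviving edge, and
  the terms of the sum at \<open>v\<close> vanish.\<close>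

lemma realize_vertex:
  assumes x: "x = y - (\<Sum>e\<in>F. y * S e * T e)" "x * P {v} \<noteq> 0" and F: "finite F" "F \<subseteq> E"
    and v: "v \<in> verts G" and xS: "\<And>e. e \<in> E \<Longrightarrow> x * S e = 0"
    and W: "finite W" "\<forall>\<alpha>\<in>W. set \<alpha> \<subseteq> E" "y * P {v} = (\<Sum>\<alpha>\<in>W. sc (c \<alpha>) * Sp \<alpha> * P {v})"
  shows "x * P {v} = y * P {v}"
proof -
  let ?O = "{e \<in> out_edges G v. P (r e) \<noteq> 0}"
  have vV: "{v} \<in> V0" using v by (rule gen_verts.vertex)
  have "finite ?O \<Longrightarrow> ?O = {}"
  proof (rule ccontr)
    assume "finite ?O" "?O \<noteq> {}"
    then have "x * P {v} = (\<Sum>e\<in>?O. x * (S e * T e))" using CK v by (simp add: sum_distrib_left)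
    also have "\<dots> = 0" using xS
      by (intro sum.neutral) (auto simp: out_edges_def mult.assoc[symmetric])
    finally show False using x by simp
  qed
  moreover have "finite ?O"
  proof (rule ccontr)
    assume inf: "infinite ?O"
    \<comment> \<open>a surviving edge that is new to the sum and to all words of \<open>y\<close>\<close>
    have fin: "finite (F \<union> (\<Union>\<alpha>\<in>W. set \<alpha>))" using F W by auto
    then have "infinite (?O - (F \<union> (\<Union>\<alpha>\<in>W. set \<alpha>)))" using inf by (simp add: Diff_infinite_finite)
    then have "?O - (F \<union> (\<Union>\<alpha>\<in>W. set \<alpha>)) \<noteq> {}" using infinite_imp_nonempty by blast
    then obtain e where e: "e \<in> ?O" "e \<notin> F" "\<forall>\<alpha>\<in>W. e \<notin> set \<alpha>" by blast
    then have eE: "e \<in> E" and se: "s e = v" and re: "P (r e) \<noteq> 0" by (auto simp: out_edges_def)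
    have "(\<Sum>f\<in>F. y * S f * T f) * S e = (\<Sum>f\<in>F. y * S f * (T f * S e))"
      by (simp add: sum_distrib_right mult.assoc)
    also have "\<dots> = 0" using TS eE e(2) F by (intro sum.neutral) auto
    finally have yS: "y * S e = 0" using x(1) xS[OF eE] by (simp add: left_diff_distrib)
    have PvS: "P {v} * S e = S e" using PS_src[OF eE] se by simp
    have "sc (c \<alpha>) * Sp \<alpha> * P {v} = 0" if \<alpha>: "\<alpha> \<in> W" for \<alpha>
    proof (rule ccontr)
      assume nz: "sc (c \<alpha>) * Sp \<alpha> * P {v} \<noteq> 0"
      have \<alpha>E: "set \<alpha> \<subseteq> E" using \<alpha> W by auto
      have S\<alpha>: "Sp \<alpha> * P {v} \<noteq> 0" using nz by (auto simp: mult.assoc)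
      have Se: "S e \<noteq> 0" using S_zero_iff[OF eE] re by simp
      have S\<alpha>e: "Sp (\<alpha> @ [e]) \<noteq> 0"
      proof (cases "\<alpha> = []")
        case False
        have "v \<in> r (last \<alpha>)"
        proof (rule ccontr)
          assume "v \<notin> r (last \<alpha>)"
          then have "r (last \<alpha>) \<inter> {v} = {}" by simp
          then show False using S\<alpha> Sp_P[OF False \<alpha>E vV] by simp
        qed
        moreover have "Sp \<alpha> \<noteq> 0" using S\<alpha> by auto
        ultimately show ?thesis using Sp_append_nzI[of \<alpha> "[e]"] False \<alpha>E eE Se se by (simp add: Sp_Cons)
      qed (simp add: Sp_Cons Se)
      have "0 = Tp (\<alpha> @ [e]) * (y * P {v} * S e)" using yS PvS by (simp add: mult.assoc)
      also have "\<dots> = (\<Sum>\<beta>\<in>W. Tp (\<alpha> @ [e]) * (sc (c \<beta>) * Sp \<beta> * P {v} * S e))"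
        unfolding W(3) by (simp add: sum_distrib_left sum_distrib_right)
      also have "\<dots> = (\<Sum>\<beta>\<in>W. sc (c \<beta>) * (Tp (\<alpha> @ [e]) * Sp (\<beta> @ [e])))"
      proof (intro sum.cong refl)
        fix \<beta> assume "\<beta> \<in> W"
        have "Tp (\<alpha> @ [e]) * (sc (c \<beta>) * Sp \<beta> * P {v} * S e) = (Tp (\<alpha> @ [e]) * sc (c \<beta>)) * Sp \<beta> *
            (P {v} * S e)"
          by (simp add: mult.assoc)
        also have "Tp (\<alpha> @ [e]) * sc (c \<beta>) = sc (c \<beta>) * Tp (\<alpha> @ [e])" using \<alpha>E eE by (intro sc_Tp) auto
        finally show "Tp (\<alpha> @ [e]) * (sc (c \<beta>) * Sp \<beta> * P {v} * S e) = sc (c \<beta>) * (Tp (\<alpha> @ [e]) *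
            Sp (\<beta> @ [e]))"
          unfolding PvS by (simp add: Sp_append Sp_Cons mult.assoc)
      qed
      also have "\<dots> = (\<Sum>\<beta>\<in>W. if \<beta> = \<alpha> then sc (c \<alpha>) * P (r e) else 0)"
      proof (intro sum.cong refl)
        fix \<beta> assume \<beta>: "\<beta> \<in> W"
        show "sc (c \<beta>) * (Tp (\<alpha> @ [e]) * Sp (\<beta> @ [e])) = (if \<beta> = \<alpha> then sc (c \<alpha>) * P (r e) else 0)"
        proof (cases "\<beta> = \<alpha>")
          case True
          have "Tp (\<alpha> @ [e]) * Sp (\<alpha> @ [e]) = P (r (last (\<alpha> @ [e])))"
            using \<alpha>E eE S\<alpha>e by (intro Tp_Sp_same) auto
          then show ?thesis using True by simp
        next
          case False
          have "Tp (\<alpha> @ [e]) * Sp (\<beta> @ [e]) = 0"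
            using T_mult_Sp_foreign[of \<beta> \<alpha> e] \<alpha>E eE \<beta> \<alpha> W e False by auto
          then show ?thesis using False by simp
        qed
      qed
      also have "\<dots> = sc (c \<alpha>) * P (r e)" using W(1) \<alpha> by simp
      finally have "sc (c \<alpha>) * P (r e) = 0" by simp
      moreover have "c \<alpha> \<noteq> 0" using nz by auto
      ultimately have "sc (inverse (c \<alpha>) * c \<alpha>) * P (r e) = 0" by (simp only: sc_mult mult.assoc
          mult_zero_right)
      then show False using \<open>c \<alpha> \<noteq> 0\<close> re by simp
    qed
    then have "y * P {v} = 0" unfolding W(3) by (intro sum.neutral) auto
    then have "y * S f = 0" if "f \<in> F" "s f = v" for f
      using PS_src[of f] F that by (metis mult.assoc mult_zero_left subsetD)
    then have "y * S f * T f * P {v} = 0" if "f \<in> F" for f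
      using that F TP[OF vV, of f] by (cases "s f = v") (auto simp: mult.assoc subset_iff)
    then have "(\<Sum>f\<in>F. y * S f * T f) * P {v} = 0" by (simp add: sum_distrib_right)
    then show False using x \<open>y * P {v} = 0\<close> by (simp add: left_diff_distrib)
  qed
  ultimately have O: "?O = {}" by blast
  have "S f * T f * P {v} = 0" if f: "f \<in> F" for f
  proof (cases "s f = v")
    case True
    then have "f \<in> out_edges G v" using f F by (auto simp: out_edges_def)
    then have "P (r f) = 0" using O by blast
    then show ?thesis using S_zero_iff[of f] f F by (auto simp: mult.assoc)
  next
    case False
    then show ?thesis using TP[OF vV, of f] f F by (auto simp: mult.assoc)
  qed
  then have "(\<Sum>f\<in>F. y * S f * T f) * P {v} = 0" by (simp add: sum_distrib_right mult.assoc)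
  then show ?thesis using x(1) by (simp add: left_diff_distrib)
qed

text \<open>Removal of the ghost edges by induction on their number.\<close>

lemma realize: "x \<in> spn n \<Longrightarrow> x \<noteq> 0 \<Longrightarrow> \<exists>b\<in>alg. x * b \<noteq> 0 \<and> x * b \<in> spn 0"
proof (induction n arbitrary: x)
  case 0
  then obtain A where "A \<in> V0" "x * P A = x" using local_unit spn_alg by blast
  then show ?case using 0 by (intro bexI[of _ "P A"]) (auto intro: alg_P)
next
  case (Suc n)
  show ?case
  proof (cases "\<exists>e\<in>E. x * S e \<noteq> 0")
    case True
    then obtain e where e: "e \<in> E" "x * S e \<noteq> 0" by blast
    then obtain b where "b \<in> alg" "x * S e * b \<noteq> 0" "x * S e * b \<in> spn 0"
      using Suc.IH[of "x * S e"] spn_S_right[OF Suc.prems(1)] by blast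
    then show ?thesis using e
      by (intro bexI[of _ "S e * b"]) (auto simp: mult.assoc intro: alg_S alg_mult)
  next
    case False
    then have xS: "\<And>e. e \<in> E \<Longrightarrow> x * S e = 0" by blast
    obtain y F z where y: "y \<in> spn 0" and F: "finite F" "F \<subseteq> E" and xy: "x = y + (\<Sum>e\<in>F. z e * T e)"
      and z: "\<forall>e\<in>F. z e * P (r e) = z e" using ghost_decomposition[OF Suc.prems(1)] by blast
    \<comment> \<open>\<open>x s\<^sub>e = 0\<close> determines the coefficients of the ghost edges\<close>
    have "z e = - (y * S e)" if e: "e \<in> F" for e
    proof -
      have eE: "e \<in> E" using e F by auto
      have "(\<Sum>f\<in>F. z f * T f) * S e = (\<Sum>f\<in>F. if f = e then z e * P (r e) else 0)"
        unfolding sum_distrib_right using TS eE F by (intro sum.cong) (auto simp: mult.assoc)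
      also have "\<dots> = z e" using F e z by simp
      finally have "y * S e + z e = 0" using xS[OF eE] xy by (simp add: distrib_right)
      then show ?thesis by (simp add: eq_neg_iff_add_eq_0 add.commute)
    qed
    then have x: "x = y - (\<Sum>e\<in>F. y * S e * T e)"
      using xy by (simp add: sum_negf)
    obtain \<A> where \<A>: "finite \<A>" "\<A> \<subseteq> V0" "\<And>B. B \<in> V0 \<Longrightarrow> atomic \<A> B \<Longrightarrow>
      \<exists>W c. finite W \<and> (\<forall>\<alpha>\<in>W. set \<alpha> \<subseteq> E) \<and> y * P B = (\<Sum>\<alpha>\<in>W. sc (c \<alpha>) * Sp \<alpha> * P B)"
      using real_form[OF y] by meson
    obtain A where A: "A \<in> V0" "x * P A \<noteq> 0"
      using local_unit spn_alg Suc.prems by metis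
    have "finite (\<A> \<union> (\<lambda>e. {s e}) ` F)" "\<A> \<union> (\<lambda>e. {s e}) ` F \<subseteq> V0" using \<A> F by auto
    from exists_atomic[OF this A] obtain B where B: "B \<in> V0" "x * P B \<noteq> 0"
      "atomic (\<A> \<union> (\<lambda>e. {s e}) ` F) B" by blast
    have "x * P B = y * P B"
    proof (cases "\<exists>e\<in>F. s e \<in> B")
      case True
      then obtain e where e: "e \<in> F" "s e \<in> B" by blast
      then have "{s e} \<in> \<A> \<union> (\<lambda>e. {s e}) ` F" by blast
      from bspec[OF B(3)[unfolded atomic_def] this] have "B \<subseteq> {s e} \<or> B \<inter> {s e} = {}" .
      then have Be: "B = {s e}" using e by auto
      have "atomic \<A> {s e}" using B(3) Be by (auto simp: atomic_def)
      then obtain W c where "finite W" "\<forall>\<alpha>\<in>W. set \<alpha> \<subseteq> E" "y * P {s e} = (\<Sum>\<alpha>\<in>W. sc (c \<alpha>) * Sp \<alpha> * P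
          {s e})"
        using \<A>(3)[of "{s e}"] B(1) Be by auto
      then show ?thesis unfolding Be
        using realize_vertex[OF x _ F _ xS, of "s e" W c] B(2) Be e F src_closed by auto
    next
      case False
      have "(\<Sum>e\<in>F. y * S e * T e) * P B = (\<Sum>e\<in>F. y * S e * (T e * P B))"
        by (simp add: sum_distrib_right mult.assoc)
      also have "\<dots> = 0" using False F B by (intro sum.neutral) (auto simp: TP subset_iff)
      finally show ?thesis using x by (simp add: left_diff_distrib)
    qed
    then show ?thesis using B y spn_P_right by (intro bexI[of _ "P B"]) (auto intro: alg_P)
  qed
qed

text \<open>Every nonzero element can be multiplied from the right to a nonzero combination of real
  paths ending in one common \<open>p\<^sub>B\<close>. Moreover \<open>B\<close> is a singleton or disjoint from a given finite set \<open>D\<close>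
  of vertices, and likewise for the sources of the edges that occur.\<close>

lemma real_reduction:
  assumes "x \<in> alg" "x \<noteq> 0" "finite D" "D \<subseteq> verts G"
  obtains b W c B where "b \<in> alg" "finite W" "W \<noteq> {}" "B \<in> V0" "P B \<noteq> 0"
    "x * b = (\<Sum>\<alpha>\<in>W. sc (c \<alpha>) * Sp \<alpha> * P B)" "x * b \<noteq> 0"
    "\<And>\<alpha>. \<alpha> \<in> W \<Longrightarrow> c \<alpha> \<noteq> 0 \<and> set \<alpha> \<subseteq> E \<and> Sp \<alpha> * P B \<noteq> 0"
    "\<And>\<alpha>. \<alpha> \<in> W \<Longrightarrow> \<alpha> \<noteq> [] \<Longrightarrow> B \<subseteq> r (last \<alpha>)"
    "\<And>v. v \<in> D \<Longrightarrow> v \<in> B \<Longrightarrow> B = {v}"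
    "\<And>\<alpha> e. \<alpha> \<in> W \<Longrightarrow> e \<in> set \<alpha> \<Longrightarrow> s e \<in> B \<Longrightarrow> B = {s e}"
proof -
  obtain n where "x \<in> spn n" using alg_spn assms(1) by blast
  then obtain b1 where b1: "b1 \<in> alg" "x * b1 \<noteq> 0" "x * b1 \<in> spn 0" using realize assms(2) by blast
  define y where "y = x * b1"
  obtain \<A> where \<A>: "finite \<A>" "\<A> \<subseteq> V0" "\<And>B. B \<in> V0 \<Longrightarrow> atomic \<A> B \<Longrightarrow>
      \<exists>W c. finite W \<and> (\<forall>\<alpha>\<in>W. set \<alpha> \<subseteq> E) \<and> y * P B = (\<Sum>\<alpha>\<in>W. sc (c \<alpha>) * Sp \<alpha> * P B)"
    using real_form b1(3) y_def by meson
  obtain A where A: "A \<in> V0" "y * P A \<noteq> 0" using local_unit spn_alg b1 unfolding y_def by metis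
  obtain B where B: "B \<in> V0" "y * P B \<noteq> 0" "atomic \<A> B" using exists_atomic[OF \<A>(1,2) A] by blast
  obtain W c where W: "finite W" "\<forall>\<alpha>\<in>W. set \<alpha> \<subseteq> E" "y * P B = (\<Sum>\<alpha>\<in>W. sc (c \<alpha>) * Sp \<alpha> * P B)"
    using \<A>(3)[OF B(1,3)] by blast
  define \<C> where "\<C> = (\<lambda>\<alpha>. r (last \<alpha>)) ` (W - {[]}) \<union> (\<lambda>e. {s e}) ` (\<Union>\<alpha>\<in>W. set \<alpha>) \<union> (\<lambda>v. {v}) ` D"
  have "finite \<C>" using W assms by (auto simp: \<C>_def)
  moreover have "\<C> \<subseteq> V0"
  proof
    fix C assume "C \<in> \<C>"
    then consider \<alpha> where "\<alpha> \<in> W" "\<alpha> \<noteq> []" "C = r (last \<alpha>)"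
      | \<alpha> e where "\<alpha> \<in> W" "e \<in> set \<alpha>" "C = {s e}" | v where "v \<in> D" "C = {v}"
      unfolding \<C>_def by blast
    then show "C \<in> V0"
    proof cases
      case 1 then show ?thesis using W last_E[of \<alpha>] by simp
    next
      case 2 then show ?thesis using W src_gv[of e] by blast
    next
      case 3 then show ?thesis using assms gen_verts.vertex[of v G] by auto
    qed
  qed
  ultimately obtain C where C: "C \<in> V0" "C \<subseteq> B" "y * P C \<noteq> 0" "atomic \<C> C"
    using exists_atomic[OF _ _ B(1,2)] by metis
  have "B \<inter> C = C" using C by auto
  then have BC: "P B * P C = P C" using B C by (simp add: P_mult)
  define W' where "W' = {\<alpha>\<in>W. c \<alpha> \<noteq> 0 \<and> Sp \<alpha> * P C \<noteq> 0}"
  have "y * P C = y * P B * P C" using BC by (simp add: mult.assoc)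
  also have "\<dots> = (\<Sum>\<alpha>\<in>W. sc (c \<alpha>) * Sp \<alpha> * P C)" unfolding W(3) by (simp add: sum_distrib_right
      mult.assoc BC)
  also have "\<dots> = (\<Sum>\<alpha>\<in>W'. sc (c \<alpha>) * Sp \<alpha> * P C)"
    using W(1) by (intro sum.mono_neutral_right) (auto simp: W'_def mult.assoc)
  finally have yC: "x * (b1 * P C) = (\<Sum>\<alpha>\<in>W'. sc (c \<alpha>) * Sp \<alpha> * P C)" by (simp add: y_def mult.assoc)
  have nz: "x * (b1 * P C) \<noteq> 0" using C y_def by (simp add: mult.assoc)
  show ?thesis
  proof (rule that)
    show "b1 * P C \<in> alg" using b1 C by (auto intro: alg_mult alg_P)
    show "finite W'" using W by (simp add: W'_def)
    show "W' \<noteq> {}" using yC nz by auto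
    show "P C \<noteq> 0" using C(3) by auto
    show "C \<subseteq> r (last \<alpha>)" if "\<alpha> \<in> W'" "\<alpha> \<noteq> []" for \<alpha>
    proof -
      have "C \<subseteq> r (last \<alpha>) \<or> C \<inter> r (last \<alpha>) = {}" using C(4) that by (auto simp: atomic_def \<C>_def
          W'_def)
      moreover have "r (last \<alpha>) \<inter> C \<noteq> {}"
        using that Sp_P[of \<alpha> C] W C(1) by (auto simp: W'_def)
      ultimately show ?thesis by blast
    qed
    show "C = {v}" if "v \<in> D" "v \<in> C" for v
    proof -
      have "{v} \<in> \<C>" using that by (simp add: \<C>_def)
      from bspec[OF C(4)[unfolded atomic_def] this] show ?thesis using that by blast
    qed
    show "C = {s e}" if "\<alpha> \<in> W'" "e \<in> set \<alpha>" "s e \<in> C" for \<alpha> e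
    proof -
      have "\<alpha> \<in> W" using that by (simp add: W'_def)
      then have "{s e} \<in> \<C>" using that(2) unfolding \<C>_def by blast
      from bspec[OF C(4)[unfolded atomic_def] this] show ?thesis using that by blast
    qed
  qed (use C yC nz W in \<open>auto simp: W'_def\<close>)
qed

lemma sc_cancel: "a \<noteq> 0 \<Longrightarrow> sc a * x = 0 \<longleftrightarrow> x = 0"
proof
  assume "a \<noteq> 0" "sc a * x = 0"
  then have "sc (inverse a * a) * x = 0" by (simp only: sc_mult mult.assoc mult_zero_right)
  then show "x = 0" using \<open>a \<noteq> 0\<close> by simp
qed simp

end

section \<open>Cycles without exits\<close>

text \<open>A loop with distinct sources and without exits. Null sets, those \<open>A\<close> with \<open>P A = 0\<close>, take the
  place of the members of \<open>H\<close>.\<close>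

locale exitless_cycle = leavitt_full G P S T sc
  for G :: "('v, 'e) ultragraph" and P :: "'v set \<Rightarrow> 'r::ring_1"
    and S T :: "'e \<Rightarrow> 'r" and sc :: "'k::field \<Rightarrow> 'r" +
  fixes \<gamma> :: "'e list"
  assumes cycle_ne: "\<gamma> \<noteq> []" and cycle_edges: "set \<gamma> \<subseteq> edges G"
    and cycle_distinct: "distinct (map (src G) \<gamma>)"
    and cycle_live: "i < length \<gamma> \<Longrightarrow> P (rng G (\<gamma> ! i)) \<noteq> 0"
    and cycle_next: "i < length \<gamma> \<Longrightarrow> src G (\<gamma> ! (Suc i mod length \<gamma>)) \<in> rng G (\<gamma> ! i)"
    and cycle_rng: "i < length \<gamma> \<Longrightarrow> P (rng G (\<gamma> ! i) - {src G (\<gamma> ! (Suc i mod length \<gamma>))}) = 0"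
    and cycle_edge: "f \<in> edges G \<Longrightarrow> i < length \<gamma> \<Longrightarrow> src G f \<in> rng G (\<gamma> ! i) \<Longrightarrow>
      P (rng G f) \<noteq> 0 \<Longrightarrow> f = \<gamma> ! (Suc i mod length \<gamma>)"
begin

abbreviation n where "n \<equiv> length \<gamma>"

text \<open>The edges and vertices of the cycle, continued periodically.\<close>

definition cyc :: "nat \<Rightarrow> 'e" where "cyc j = \<gamma> ! (j mod n)"

abbreviation u :: "nat \<Rightarrow> 'v" where "u j \<equiv> s (cyc j)"
abbreviation v :: 'v where "v \<equiv> u 0"

declare cycle_ne [simp]

lemma n_pos: "0 < n" using cycle_ne by simp

lemma mod_n [simp]: "j mod n < n" using n_pos by simp

lemma cyc_E [simp]: "cyc j \<in> E"
  using cycle_edges nth_mem[of "j mod n" \<gamma>] unfolding cyc_def by auto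

lemma cyc_add: "cyc (j + k * n) = cyc j" "cyc (j + n) = cyc j" by (simp_all add: cyc_def)

lemma cyc_Suc: "cyc (Suc j) = \<gamma> ! (Suc (j mod n) mod n)" by (simp add: cyc_def mod_Suc_eq)

lemma u_gv [simp]: "{u j} \<in> V0" by simp

lemma cyc_live: "P (r (cyc j)) \<noteq> 0"
  using cycle_live[of "j mod n"] unfolding cyc_def by simp

lemma u_rng: "u (Suc j) \<in> r (cyc j)"
  using cycle_next[of "j mod n"] unfolding cyc_Suc by (simp add: cyc_def)

lemma cyc_edge: "f \<in> E \<Longrightarrow> s f \<in> r (cyc j) \<Longrightarrow> P (r f) \<noteq> 0 \<Longrightarrow> f = cyc (Suc j)"
  using cycle_edge[of f "j mod n"] unfolding cyc_Suc by (simp add: cyc_def)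

lemma P_rng_cyc: "P (r (cyc j)) = P {u (Suc j)}"
proof -
  have "P (r (cyc j)) = P (r (cyc j) \<inter> {u (Suc j)}) + P (r (cyc j) - {u (Suc j)})"
    by (rule P_split) auto
  moreover have "P (r (cyc j) - {u (Suc j)}) = 0"
    using cycle_rng[of "j mod n"] unfolding cyc_Suc by (simp add: cyc_def)
  moreover have "r (cyc j) \<inter> {u (Suc j)} = {u (Suc j)}" using u_rng by auto
  ultimately show ?thesis by simp
qed

lemma P_u_nz: "P {u j} \<noteq> 0"
proof -
  have "P {u (Suc (j + (n - 1)))} \<noteq> 0" using cyc_live[of "j + (n - 1)"] P_rng_cyc by simp
  moreover have "Suc (j + (n - 1)) = j + n" using n_pos by linarith
  ultimately show ?thesis by (simp add: cyc_add)
qed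

lemma cyc_out: "f \<in> E \<Longrightarrow> s f = u j \<Longrightarrow> P (r f) \<noteq> 0 \<Longrightarrow> f = cyc j"
proof -
  assume f: "f \<in> E" "s f = u j" "P (r f) \<noteq> 0"
  have *: "Suc (j + (n - 1)) = j + n" using n_pos by linarith
  have "s f \<in> r (cyc (j + (n - 1)))" using u_rng[of "j + (n - 1)"] f(2) unfolding * by (simp add:
      cyc_add)
  then show "f = cyc j" using cyc_edge[of f "j + (n - 1)"] f unfolding * by (simp add: cyc_add)
qed

lemma u_inj: "u i = u j \<Longrightarrow> i mod n = j mod n"
  using cycle_distinct nth_eq_iff_index_eq[of "map s \<gamma>" "i mod n" "j mod n"]
  by (simp add: cyc_def)

lemma P_u_CK: "P {u j} = S (cyc j) * T (cyc j)"
proof -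
  have "{e \<in> out_edges G (u j). P (r e) \<noteq> 0} = {cyc j}"
    using cyc_out cyc_live by (auto simp: out_edges_def)
  then show ?thesis using CK[of "u j"] src_closed by simp
qed

text \<open>\<open>seg j m\<close> is the path of length \<open>m\<close> along the cycle that starts at \<open>u j\<close>.\<close>

definition seg :: "nat \<Rightarrow> nat \<Rightarrow> 'e list" where "seg j m = map cyc [j..<j + m]"

lemma seg_0 [simp]: "seg j 0 = []" and seg_Suc: "seg j (Suc m) = cyc j # seg (Suc j) m"
  and length_seg [simp]: "length (seg j m) = m"
  by (simp_all add: seg_def upt_conv_Cons del: upt_Suc)

lemma seg_E [simp]: "set (seg j m) \<subseteq> E" by (auto simp: seg_def)

lemma seg_period: "seg (j + k * n) m = seg j m"
  by (induction m arbitrary: j) (simp_all add: seg_Suc cyc_add del: add_Suc add: add_Suc[symmetric])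

lemma seg_last: "m \<noteq> 0 \<Longrightarrow> last (seg j m) = cyc (j + m - 1)"
  by (cases m) (auto simp: seg_def last_map)

lemma seg_gamma: "seg 0 n = \<gamma>"
  by (rule nth_equalityI) (auto simp: seg_def cyc_def)

text \<open>A surviving path that starts on the cycle never leaves it.\<close>

lemma follow_cycle:
  "set \<alpha> \<subseteq> E \<Longrightarrow> Sp \<alpha> \<noteq> 0 \<Longrightarrow> (\<alpha> \<noteq> [] \<Longrightarrow> s (hd \<alpha>) = u j) \<Longrightarrow> \<alpha> = seg j (length \<alpha>)"
proof (induction \<alpha> arbitrary: j)
  case (Cons e \<alpha>)
  have "S e \<noteq> 0" using Cons.prems by (auto simp: Sp_Cons)
  then have "P (r e) \<noteq> 0" using Cons.prems S_zero_iff by auto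
  then have e: "e = cyc j" using cyc_out[of e j] Cons.prems by auto
  have nz: "Sp \<alpha> \<noteq> 0" using Cons.prems by (auto simp: Sp_Cons)
  have "s (hd \<alpha>) = u (Suc j)" if ne: "\<alpha> \<noteq> []"
  proof -
    have "s (hd \<alpha>) \<in> r e" using Sp_append_nz(3)[of "[e]" \<alpha>] Cons.prems ne by auto
    moreover have "S (hd \<alpha>) \<noteq> 0" using nz ne by (cases \<alpha>) (auto simp: Sp_Cons)
    ultimately show ?thesis
      using cyc_edge[of "hd \<alpha>" j] S_zero_iff hd_E[OF ne] Cons.prems e by auto
  qed
  then have "\<alpha> = seg (Suc j) (length \<alpha>)" using Cons.IH[of "Suc j"] Cons.prems nz by auto
  then show ?case using e by (simp add: seg_Suc)
qed simp

text \<open>The elements \<open>s\<^sub>\<alpha>\<close> and \<open>s\<^sub>\<alpha>\<^sub>*\<close> for \<open>\<alpha> = seg j m\<close>, where the empty path at \<open>u j\<close> yields the vertex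
  projection instead of the unit of the ring. They are mutually inverse partial isometries.\<close>

definition Cp :: "nat \<Rightarrow> nat \<Rightarrow> 'r" where "Cp j m = P {u j} * Sp (seg j m)"
definition Cq :: "nat \<Rightarrow> nat \<Rightarrow> 'r" where "Cq j m = Tp (seg j m) * P {u j}"

lemma Cp_0: "Cp j 0 = P {u j}" and Cq_0: "Cq j 0 = P {u j}" by (simp_all add: Cp_def Cq_def)

lemma S_cyc: "P {u j} * S (cyc j) = S (cyc j)" "S (cyc j) * P {u (Suc j)} = S (cyc j)"
  using PS_src[of "cyc j"] SP_rng[of "cyc j"] by (simp_all add: P_rng_cyc)

lemma T_cyc: "T (cyc j) * P {u j} = T (cyc j)" "P {u (Suc j)} * T (cyc j) = T (cyc j)"
  using TP_src[of "cyc j"] PT_rng[of "cyc j"] by (simp_all add: P_rng_cyc)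

lemma TS_cyc: "T (cyc j) * S (cyc j) = P {u (Suc j)}"
  using TS[of "cyc j" "cyc j"] by (simp add: P_rng_cyc)

lemma Cp_Suc: "Cp j (Suc m) = S (cyc j) * Cp (Suc j) m"
  by (simp add: Cp_def seg_Suc Sp_Cons mult.assoc[symmetric] S_cyc)

lemma Cq_Suc: "Cq j (Suc m) = Cq (Suc j) m * T (cyc j)"
  by (simp add: Cq_def seg_Suc Tp_Cons mult.assoc T_cyc)

lemma P_Cp: "P {u j} * Cp j m = Cp j m" and Cq_P: "Cq j m * P {u j} = Cq j m"
  by (simp_all add: Cp_def Cq_def mult.assoc P_idem) (simp add: mult.assoc[symmetric] P_idem)

lemma Cp_P: "Cp j m * P {u (j + m)} = Cp j m"
proof (induction m arbitrary: j)
  case 0 then show ?case by (simp add: Cp_0 P_idem)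
next
  case (Suc m)
  then show ?case using Suc[of "Suc j"] by (simp add: Cp_Suc mult.assoc)
qed

lemma P_Cq: "P {u (j + m)} * Cq j m = Cq j m"
proof (induction m arbitrary: j)
  case 0 then show ?case by (simp add: Cq_0 P_idem)
next
  case (Suc m)
  then show ?case using Suc[of "Suc j"] by (simp add: Cq_Suc mult.assoc[symmetric])
qed

lemma Cp_Cq: "Cp j m * Cq j m = P {u j}"
proof (induction m arbitrary: j)
  case 0 then show ?case by (simp add: Cp_0 Cq_0 P_idem)
next
  case (Suc m)
  have "Cp j (Suc m) * Cq j (Suc m) = S (cyc j) * (Cp (Suc j) m * Cq (Suc j) m) * T (cyc j)"
    by (simp add: Cp_Suc Cq_Suc mult.assoc)
  also have "\<dots> = S (cyc j) * T (cyc j)" unfolding Suc by (simp add: S_cyc)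
  finally show ?case by (simp add: P_u_CK)
qed

lemma Cq_Cp: "Cq j m * Cp j m = P {u (j + m)}"
proof (induction m arbitrary: j)
  case 0 then show ?case by (simp add: Cp_0 Cq_0 P_idem)
next
  case (Suc m)
  have "Cq j (Suc m) * Cp j (Suc m) = Cq (Suc j) m * (T (cyc j) * S (cyc j)) * Cp (Suc j) m"
    by (simp add: Cp_Suc Cq_Suc mult.assoc)
  also have "\<dots> = Cq (Suc j) m * Cp (Suc j) m" by (simp add: TS_cyc Cq_P)
  finally show ?case using Suc[of "Suc j"] by simp
qed

lemma Cp_add: "Cp j (m + m') = Cp j m * Cp (j + m) m'"
proof (induction m arbitrary: j)
  case 0 then show ?case by (simp add: Cp_0 P_Cp)
next
  case (Suc m)
  then show ?case using Suc[of "Suc j"] by (simp add: Cp_Suc mult.assoc)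
qed

lemma Cq_add: "Cq j (m + m') = Cq (j + m) m' * Cq j m"
proof (induction m arbitrary: j)
  case 0 then show ?case by (simp add: Cq_0 Cq_P)
next
  case (Suc m)
  then show ?case using Suc[of "Suc j"] by (simp add: Cq_Suc mult.assoc)
qed

lemma Cp_period: "Cp (j + k * n) m = Cp j m" and Cq_period: "Cq (j + k * n) m = Cq j m"
  by (simp_all add: Cp_def Cq_def seg_period cyc_add)

lemma Cp_alg: "Cp j m \<in> alg" and Cq_alg: "Cq j m \<in> alg"
proof (induction m arbitrary: j)
  case 0
  { case 1 show ?case by (simp add: Cp_0 alg_P) }
  { case 2 show ?case by (simp add: Cq_0 alg_P) }
next
  case (Suc m)
  { case 1 show ?case using Suc by (simp add: Cp_Suc alg_S alg_mult) }
  { case 2 show ?case using Suc by (simp add: Cq_Suc alg_T alg_mult) }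
qed


subsection \<open>The corner at the cycle\<close>

text \<open>The corner at \<open>v\<close> is a quotient of the Laurent polynomial ring; \<open>lp k\<close> is the image of the
  \<open>k\<close>-th power of the variable.\<close>

definition lp :: "int \<Rightarrow> 'r" where
  "lp k = (if 0 \<le> k then Cp 0 (nat k * n) else Cq 0 (nat (- k) * n))"

lemma lp_0: "lp 0 = P {v}" by (simp add: lp_def Cp_0)

lemma Cp_mult_n: "Cp 0 (a * n) * Cp 0 m = Cp 0 (a * n + m)"
  using Cp_period[of 0 a m] Cp_add[of 0 "a * n" m] by simp

lemma Cq_mult_n: "Cq 0 m * Cq 0 (a * n) = Cq 0 (a * n + m)"
  using Cq_period[of 0 a m] Cq_add[of 0 "a * n" m] by simp

lemma Cp_Cq_mod:
  assumes "int a - int b = k * int n"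
  shows "Cp 0 a * Cq 0 b = lp k"
proof (cases "0 \<le> k")
  case True
  then obtain l where l: "k = int l" using nonneg_int_cases by blast
  have "int a = int (l * n + b)" using assms l by simp
  then have a: "a = l * n + b" by (simp only: of_nat_eq_iff)
  have "Cp 0 a * Cq 0 b = Cp 0 (l * n) * (Cp 0 b * Cq 0 b)"
    unfolding a Cp_mult_n[symmetric] by (simp add: mult.assoc)
  also have "\<dots> = Cp 0 (l * n)"
    using Cp_P[of 0 "l * n"] cyc_add(1)[of 0 l] by (simp add: Cp_Cq)
  finally show ?thesis using l by (simp add: lp_def)
next
  case False
  then obtain l where l: "k = - int l" "l > 0" using neg_int_cases by (metis not_le)
  have "int b = int (l * n + a)" using assms l by simp
  then have b: "b = l * n + a" by (simp only: of_nat_eq_iff)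
  have "Cp 0 a * Cq 0 b = (Cp 0 a * Cq 0 a) * Cq 0 (l * n)"
    unfolding b Cq_mult_n[symmetric] by (simp add: mult.assoc)
  also have "\<dots> = Cq 0 (l * n)"
    using P_Cq[of 0 "l * n"] cyc_add(1)[of 0 l] by (simp add: Cp_Cq)
  finally show ?thesis using l by (simp add: lp_def)
qed

lemma lp_eq: "\<exists>a b. lp k = Cp 0 (a * n) * Cq 0 (b * n) \<and> k = int a - int b"
proof -
  have "lp k = Cp 0 (nat k * n) * Cq 0 (nat (- k) * n)"
    by (rule Cp_Cq_mod[symmetric]) (auto simp: left_diff_distrib[symmetric])
  then show ?thesis by (intro exI[of _ "nat k"] exI[of _ "nat (- k)"]) auto
qed

lemma Cq_Cp_comm: "Cq 0 (b * n) * Cp 0 (a * n) = Cp 0 (a * n) * Cq 0 (b * n)"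
proof -
  have swap: "Cq 0 (b * n) * Cp 0 (a * n) = lp (int a - int b)"
  proof (cases "b \<le> a")
    case True
    then obtain l where a: "a = b + l" using le_iff_add by blast
    have "Cq 0 (b * n) * Cp 0 (a * n) = Cq 0 (b * n) * Cp 0 (b * n) * Cp 0 (l * n)"
      unfolding a distrib_right Cp_mult_n[symmetric] by (simp add: mult.assoc)
    also have "\<dots> = Cp 0 (l * n)" using cyc_add(1)[of 0 b] by (simp add: Cq_Cp P_Cp)
    finally show ?thesis using a by (simp add: lp_def)
  next
    case False
    then obtain l where b: "b = a + l" "l > 0" using less_imp_add_positive not_le by metis
    have b': "b * n = a * n + l * n" by (simp add: b distrib_right)
    have "Cq 0 (b * n) * Cp 0 (a * n) = Cq 0 (l * n) * (Cq 0 (a * n) * Cp 0 (a * n))"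
      unfolding b' Cq_mult_n[symmetric] by (simp add: mult.assoc)
    also have "\<dots> = Cq 0 (l * n)" using cyc_add(1)[of 0 a] by (simp add: Cq_Cp Cq_P)
    finally show ?thesis using b by (simp add: lp_def)
  qed
  show ?thesis unfolding swap by (rule Cp_Cq_mod[symmetric]) (simp add: left_diff_distrib)
qed

lemma lp_add: "lp (k + l) = lp k * lp l"
proof -
  obtain a b where 1: "lp k = Cp 0 (a * n) * Cq 0 (b * n)" "k = int a - int b" using lp_eq by blast
  obtain c d where 2: "lp l = Cp 0 (c * n) * Cq 0 (d * n)" "l = int c - int d" using lp_eq by blast
  have "lp k * lp l = Cp 0 (a * n) * (Cq 0 (b * n) * Cp 0 (c * n)) * Cq 0 (d * n)"
    unfolding 1(1) 2(1) by (simp only: mult.assoc)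
  also have "\<dots> = (Cp 0 (a * n) * Cp 0 (c * n)) * (Cq 0 (b * n) * Cq 0 (d * n))"
    unfolding Cq_Cp_comm by (simp add: mult.assoc)
  also have "\<dots> = Cp 0 (a * n + c * n) * Cq 0 (d * n + b * n)" by (simp only: Cp_mult_n Cq_mult_n)
  also have "\<dots> = lp (k + l)" unfolding 1(2) 2(2) by (intro Cp_Cq_mod) (simp add: algebra_simps)
  finally show ?thesis by simp
qed

lemma lp_nz: "lp k \<noteq> 0"
  using lp_add[of k "- k"] P_u_nz[of 0] by (auto simp: lp_0)

lemma lp_alg: "lp k \<in> alg" by (simp add: lp_def Cp_alg Cq_alg)

lemma P_Sp_cycle:
  assumes "set \<alpha> \<subseteq> E" "P {u j} * Sp \<alpha> \<noteq> 0"
  shows "\<alpha> = seg j (length \<alpha>)"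
proof -
  have "s (hd \<alpha>) = u j" if "\<alpha> \<noteq> []"
    using P_Sp[OF that assms(1), of "{u j}"] assms(2) by (auto split: if_splits)
  moreover have "Sp \<alpha> \<noteq> 0" using mult_not_zero[OF assms(2)] by blast
  ultimately show ?thesis using follow_cycle[of \<alpha> j] assms by blast
qed

lemma Tp_P_cycle:
  assumes "set \<alpha> \<subseteq> E" "Tp \<alpha> * P {u j} \<noteq> 0"
  shows "\<alpha> = seg j (length \<alpha>)"
proof -
  have "s (hd \<alpha>) = u j" if "\<alpha> \<noteq> []"
    using Tp_P[OF that assms(1), of "{u j}"] assms(2) by (auto split: if_splits)
  moreover have "Sp \<alpha> \<noteq> 0" using Tp_nz_Sp[OF assms(1)] mult_not_zero[OF assms(2)] by blast
  ultimately show ?thesis using follow_cycle[of \<alpha> j] assms by blast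
qed

lemma corner_monomial:
  assumes "monomial d m x"
  shows "P {v} * x * P {v} = 0 \<or> (\<exists>k. P {v} * x * P {v} = lp k \<and> d = k * int n)"
proof (rule disjCI)
  assume nz: "\<not> (\<exists>k. P {v} * x * P {v} = lp k \<and> d = k * int n)"
  show "P {v} * x * P {v} = 0"
  proof (rule ccontr)
    assume *: "P {v} * x * P {v} \<noteq> 0"
    then obtain \<alpha> A \<beta> where x: "set \<alpha> \<subseteq> E" "set \<beta> \<subseteq> E" "A \<in> V0" "x = Sp \<alpha> * P A * Tp \<beta>"
      "d = int (length \<alpha>) - int (length \<beta>)" using assms by (auto simp: monomial_def)
    define a b where "a = length \<alpha>" and "b = length \<beta>"
    have eq: "P {v} * x * P {v} = (P {v} * Sp \<alpha>) * P A * (Tp \<beta> * P {v})" by (simp add: x mult.assoc)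
    have "P {v} * Sp \<alpha> \<noteq> 0" "Tp \<beta> * P {v} \<noteq> 0" using * unfolding eq by auto
    then have "\<alpha> = seg 0 a" "\<beta> = seg 0 b" using P_Sp_cycle Tp_P_cycle x a_def b_def by blast+
    then have "P {v} * x * P {v} = Cp 0 a * P A * Cq 0 b" unfolding eq by (simp add: Cp_def Cq_def)
    also have "\<dots> = (Cp 0 a * P {u a}) * P A * (P {u b} * Cq 0 b)"
      using Cp_P[of 0 a] P_Cq[of 0 b] by simp
    also have "\<dots> = Cp 0 a * (P {u a} * P A * P {u b}) * Cq 0 b" by (simp only: mult.assoc)
    also have "P {u a} * P A * P {u b} = P ({u a} \<inter> A \<inter> {u b})" using x by (simp add: P_mult
        gen_verts.inter)
    finally have e2: "P {v} * x * P {v} = Cp 0 a * P ({u a} \<inter> A \<inter> {u b}) * Cq 0 b" .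
    have "{u a} \<inter> A \<inter> {u b} \<noteq> {}"
    proof
      assume "{u a} \<inter> A \<inter> {u b} = {}"
      then show False using * e2 by (simp only: P_empty) simp
    qed
    then have ab: "u a = u b" and int: "{u a} \<inter> A \<inter> {u b} = {u a}" by auto
    have fin: "P {v} * x * P {v} = Cp 0 a * Cq 0 b" using e2 int Cp_P[of 0 a] by simp
    have "int a mod int n = int b mod int n" using u_inj[OF ab] by (simp flip: zmod_int)
    then have "int n dvd int a - int b" by (simp add: mod_eq_dvd_iff)
    then obtain k where "int a - int b = k * int n" by (metis dvd_def mult.commute)
    then show False using nz fin Cp_Cq_mod[of a b k] x a_def b_def by metis
  qed
qed

text \<open>Evaluation of Laurent polynomials at the cycle.\<close>

definition ev :: "(int \<Rightarrow>\<^sub>0 'k) \<Rightarrow> 'r" where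
  "ev f = (\<Sum>k\<in>Poly_Mapping.keys f. sc (Poly_Mapping.lookup f k) * lp k)"

lemma ev_superset: "finite K \<Longrightarrow> Poly_Mapping.keys f \<subseteq> K \<Longrightarrow>
    ev f = (\<Sum>k\<in>K. sc (Poly_Mapping.lookup f k) * lp k)"
  unfolding ev_def by (rule sum.mono_neutral_left) (auto simp: in_keys_iff)

lemma ev_0 [simp]: "ev 0 = 0" by (simp add: ev_def)

lemma ev_add: "ev (f + g) = ev f + ev g"
proof -
  let ?K = "Poly_Mapping.keys f \<union> Poly_Mapping.keys g"
  have "ev (f + g) = (\<Sum>k\<in>?K. sc (Poly_Mapping.lookup (f + g) k) * lp k)"
    by (rule ev_superset) (auto simp: Poly_Mapping.keys_add)
  also have "\<dots> = ev f + ev g"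
    by (simp add: ev_superset[of ?K f] ev_superset[of ?K g] lookup_add sc_add distrib_right sum.distrib)
  finally show ?thesis .
qed

lemma ev_single: "ev (Poly_Mapping.single k c) = sc c * lp k"
  by (cases "c = 0") (simp_all add: ev_def)

lemma ev_sum: "ev (sum f I) = (\<Sum>i\<in>I. ev (f i))"
  by (induction I rule: infinite_finite_induct) (simp_all add: ev_add)

lemma ev_1: "ev 1 = P {v}" using ev_single[of 0 1] by (simp add: lp_0)

lemma ev_mult: "ev (f * g) = ev f * ev g"
proof -
  have f: "f = (\<Sum>k\<in>Poly_Mapping.keys f. Poly_Mapping.single k (Poly_Mapping.lookup f k))" for f ::
      "int \<Rightarrow>\<^sub>0 'k"
    by (rule poly_mapping_eqI)
      (simp add: lookup_sum lookup_single when_def in_keys_iff sum.delta)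
  have sl: "sc a * lp k * (sc b * lp l) = sc (a * b) * lp (k + l)" for a b k l
  proof -
    have "sc a * lp k * (sc b * lp l) = sc a * (lp k * sc b) * lp l" by (simp add: mult.assoc)
    also have "lp k * sc b = sc b * lp k" using alg_sc_comm[OF lp_alg] .
    finally show ?thesis by (simp add: sc_mult lp_add mult.assoc)
  qed
  have "f * g = (\<Sum>k\<in>Poly_Mapping.keys f. \<Sum>l\<in>Poly_Mapping.keys g.
      Poly_Mapping.single (k + l) (Poly_Mapping.lookup f k * Poly_Mapping.lookup g l))"
    by (subst (1) f, subst (1) f[of g]) (simp add: sum_product mult_single)
  then have "ev (f * g) = (\<Sum>k\<in>Poly_Mapping.keys f. \<Sum>l\<in>Poly_Mapping.keys g.
      sc (Poly_Mapping.lookup f k) * lp k * (sc (Poly_Mapping.lookup g l) * lp l))"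
    by (simp add: ev_sum ev_single sl)
  then show ?thesis by (simp add: ev_def sum_product)
qed

lemma ev_minus: "ev (f - g) = ev f - ev g"
  using ev_add[of "f - g" g] by (simp add: algebra_simps)

lemma corner_spn: "x \<in> spn m \<Longrightarrow> \<exists>g. P {v} * x * P {v} = ev g"
proof (induction rule: spn.induct)
  case spn_0
  then show ?case by (intro exI[of _ 0]) simp
next
  case (spn_add x y)
  then obtain f g where "P {v} * x * P {v} = ev f" "P {v} * y * P {v} = ev g" by blast
  then have "P {v} * (x + y) * P {v} = ev (f + g)" by (simp add: ev_add distrib_left distrib_right)
  then show ?case by blast
next
  case (spn_mono d x c)
  have eq: "P {v} * (sc c * x) * P {v} = sc c * (P {v} * x * P {v})"
  proof -
    have "P {v} * (sc c * x) * P {v} = (P {v} * sc c) * x * P {v}" by (simp only: mult.assoc)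
    then show ?thesis by (simp only: sc_P[OF u_gv] mult.assoc)
  qed
  show ?case
  proof (cases "P {v} * x * P {v} = 0")
    case True
    then show ?thesis unfolding eq by (intro exI[of _ 0]) simp
  next
    case False
    then obtain k where "P {v} * x * P {v} = lp k" using corner_monomial[OF spn_mono] by blast
    then show ?thesis unfolding eq by (intro exI[of _ "Poly_Mapping.single k c"]) (simp add: ev_single)
  qed
qed

lemma corner: "x \<in> alg \<Longrightarrow> \<exists>g. P {v} * x * P {v} = ev g"
  using alg_spn corner_spn by blast


subsection \<open>The corner at the cycle is essential\<close>

text \<open>If \<open>d = p\<^sub>v s\<^sub>\<alpha>\<^sub>* s\<^sub>\<beta> p\<^sub>v \<noteq> 0\<close>, then \<open>\<alpha>\<close> and \<open>\<beta>\<close> differ by a power of the cycle, and \<open>s\<^sub>\<beta> p\<^sub>v\<close> can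
  be recovered from \<open>d\<close>.\<close>

lemma detect_term:
  assumes E: "set \<alpha> \<subseteq> E" "set \<beta> \<subseteq> E" and nz: "P {v} * Tp \<alpha> * Sp \<beta> * P {v} \<noteq> 0"
  shows "Sp \<alpha> * (P {v} * Tp \<alpha> * Sp \<beta> * P {v}) = Sp \<beta> * P {v}"
proof -
  have ts: "Tp \<alpha> * Sp \<beta> \<noteq> 0" using nz by (metis mult.assoc mult_zero_left mult_zero_right)
  consider \<zeta> where "\<beta> = \<alpha> @ \<zeta>" | \<zeta> where "\<alpha> = \<beta> @ \<zeta>" using Tp_Sp_nz_prefix[OF E ts] by blast
  then show ?thesis
  proof cases
    case 1
    have \<zeta>E: "set \<zeta> \<subseteq> E" using 1 E by auto
    have d: "P {v} * Tp \<alpha> * Sp \<beta> * P {v} = P {v} * Sp \<zeta> * P {v}"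
    proof (cases "\<alpha> = []")
      case False
      have S\<alpha>: "Sp \<alpha> \<noteq> 0" using ts 1 by (auto simp: Sp_append)
      have "P {v} * Tp \<alpha> * Sp \<beta> * P {v} = (P {v} * P (r (last \<alpha>))) * Sp \<zeta> * P {v}"
        using Tp_Sp_append[OF E(1) False S\<alpha>, of \<zeta>] 1 by (simp add: mult.assoc)
      also have "\<dots> = P ({v} \<inter> r (last \<alpha>)) * Sp \<zeta> * P {v}" using last_E[OF False E(1)] by (simp
          add: P_mult)
      finally show ?thesis using nz by (cases "v \<in> r (last \<alpha>)") auto
    qed (use 1 in simp)
    have "P {v} * Sp \<zeta> * P {v} = Sp \<zeta> * P {v}"
      using nz P_Sp[OF _ \<zeta>E u_gv, of 0] unfolding d by (cases "\<zeta> = []") (auto simp: P_idem split: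
          if_splits)
    then show ?thesis unfolding d using 1 by (simp add: Sp_append mult.assoc)
  next
    case 2
    have \<zeta>E: "set \<zeta> \<subseteq> E" using 2 E by auto
    have d: "P {v} * Tp \<alpha> * Sp \<beta> * P {v} = P {v} * Tp \<zeta> * P {v}"
    proof (cases "\<beta> = []")
      case False
      have S\<beta>: "Sp \<beta> \<noteq> 0" using ts by auto
      have "P {v} * Tp \<alpha> * Sp \<beta> * P {v} = P {v} * Tp \<zeta> * (P (r (last \<beta>)) * P {v})"
        using Tp_Sp_same[OF E(2) False S\<beta>] 2 by (simp add: mult.assoc Tp_append)
      also have "\<dots> = P {v} * Tp \<zeta> * P (r (last \<beta>) \<inter> {v})" using last_E[OF False E(2)] by (simp
          add: P_mult)
      finally show ?thesis using nz by (cases "v \<in> r (last \<beta>)") auto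
    qed (use 2 in simp)
    have "Tp \<zeta> * P {v} \<noteq> 0" using nz unfolding d by (auto simp: mult.assoc)
    then have \<zeta>: "\<zeta> = seg 0 (length \<zeta>)" using Tp_P_cycle \<zeta>E by blast
    have q: "Tp \<zeta> * P {v} = Cq 0 (length \<zeta>)" by (subst \<zeta>) (simp add: Cq_def)
    have "P {v} * Cq 0 (length \<zeta>) = P {v} * (P {u (length \<zeta>)} * Cq 0 (length \<zeta>))"
      using P_Cq[of 0 "length \<zeta>"] by simp
    also have "\<dots> = P ({v} \<inter> {u (length \<zeta>)}) * Cq 0 (length \<zeta>)" by (simp add: P_mult
        mult.assoc[symmetric])
    finally have "P {v} * Cq 0 (length \<zeta>) = P ({v} \<inter> {u (length \<zeta>)}) * Cq 0 (length \<zeta>)" .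
    then have uv: "u (length \<zeta>) = v" using nz unfolding d by (cases "u (length \<zeta>) = v") (auto
        simp: mult.assoc q)
    have "P {v} * Cq 0 (length \<zeta>) = Cq 0 (length \<zeta>)" using P_Cq[of 0 "length \<zeta>"] uv by simp
    then have d': "P {v} * Tp \<alpha> * Sp \<beta> * P {v} = Cq 0 (length \<zeta>)" unfolding d by (simp add:
        mult.assoc q)
    have pz: "Sp \<zeta> * P {v} * Tp \<zeta> * P {v} = P {v}"
    proof (cases "\<zeta> = []")
      case False
      have "Sp \<zeta> = Cp 0 (length \<zeta>)"
      proof -
        have "s (hd (seg 0 (length \<zeta>))) = v" using False by (cases \<zeta>) (auto simp: seg_Suc)
        then show ?thesis unfolding Cp_def using P_Sp[of "seg 0 (length \<zeta>)" "{v}"] False \<zeta>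
          by (metis singletonI u_gv seg_E)
      qed
      then show ?thesis using Cp_Cq[of 0 "length \<zeta>"] Cp_P[of 0 "length \<zeta>"] uv q by (simp add:
          mult.assoc)
    qed (simp add: P_idem)
    have "Sp \<alpha> * (P {v} * Tp \<alpha> * Sp \<beta> * P {v}) = Sp \<beta> * (Sp \<zeta> * P {v} * Tp \<zeta> * P {v})"
      unfolding d using 2 by (simp add: Sp_append mult.assoc)
    then show ?thesis unfolding pz .
  qed
qed

text \<open>A combination of real paths ending at \<open>v\<close> that is killed by all \<open>p\<^sub>v s\<^sub>\<alpha>\<^sub>*\<close> is zero. The terms
    that do
  not vanish under \<open>p\<^sub>v s\<^sub>\<alpha>\<^sub>*\<close> add up to zero by \<open>detect_term\<close> and can be dropped, so the number of terms
  decreases.\<close>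

lemma detect:
  assumes "finite W" "\<forall>\<alpha>\<in>W. set \<alpha> \<subseteq> E" "x = (\<Sum>\<alpha>\<in>W. sc (c \<alpha>) * Sp \<alpha> * P {v})"
    and "\<And>\<alpha>. set \<alpha> \<subseteq> E \<Longrightarrow> P {v} * Tp \<alpha> * x = 0"
  shows "x = 0"
  using assms
proof (induction W rule: finite_psubset_induct)
  case (psubset W)
  show ?case
  proof (cases "W = {}")
    case True
    then show ?thesis using psubset by simp
  next
    case False
    then obtain \<alpha> where \<alpha>: "\<alpha> \<in> W" "set \<alpha> \<subseteq> E" using psubset by blast
    define d where "d \<beta> = P {v} * Tp \<alpha> * Sp \<beta> * P {v}" for \<beta>
    have hyp: "P {v} * Tp \<alpha> * x = (\<Sum>\<beta>\<in>W. sc (c \<beta>) * d \<beta>)"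
    proof -
      have "P {v} * Tp \<alpha> * (sc (c \<beta>) * Sp \<beta> * P {v}) = sc (c \<beta>) * d \<beta>" for \<beta>
      proof -
        have "P {v} * Tp \<alpha> * (sc (c \<beta>) * Sp \<beta> * P {v}) = P {v} * (Tp \<alpha> * sc (c \<beta>)) * Sp \<beta> * P {v}"
          by (simp add: mult.assoc)
        also have "\<dots> = (P {v} * sc (c \<beta>)) * Tp \<alpha> * Sp \<beta> * P {v}" using \<alpha> by (simp add: sc_Tp mult.assoc)
        also have "\<dots> = sc (c \<beta>) * d \<beta>" by (simp add: sc_P d_def mult.assoc)
        finally show ?thesis .
      qed
      then show ?thesis unfolding psubset.prems(2) by (simp add: sum_distrib_left)
    qed
    define W' where "W' = {\<beta>\<in>W. d \<beta> = 0 \<and> Sp \<beta> * P {v} \<noteq> 0}"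
    have "\<alpha> \<notin> W'"
    proof
      assume "\<alpha> \<in> W'"
      then have dz: "d \<alpha> = 0" and nz: "Sp \<alpha> * P {v} \<noteq> 0" by (auto simp: W'_def)
      have "d \<alpha> = P {v}"
      proof (cases "\<alpha> = []")
        case False
        have "d \<alpha> = P {v} * (Tp \<alpha> * Sp \<alpha>) * P {v}" by (simp add: d_def mult.assoc)
        also have "\<dots> = P {v} * P (r (last \<alpha>)) * P {v}"
          using Tp_Sp_same[OF \<alpha>(2) False] mult_not_zero[OF nz] by simp
        also have "\<dots> = P ({v} \<inter> r (last \<alpha>) \<inter> {v})"
          using last_E[OF False \<alpha>(2)] by (simp add: P_mult gen_verts.inter)
        finally show ?thesis
          using Sp_P[OF False \<alpha>(2), of "{v}"] nz by (cases "v \<in> r (last \<alpha>)") auto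
      qed (simp add: d_def P_idem)
      then show False using dz P_u_nz by simp
    qed
    then have sub: "W' \<subset> W" using \<alpha> by (auto simp: W'_def)
    have "0 = Sp \<alpha> * (P {v} * Tp \<alpha> * x)" using psubset.prems(3)[OF \<alpha>(2)] by simp
    also have "\<dots> = (\<Sum>\<beta>\<in>W. sc (c \<beta>) * (Sp \<alpha> * d \<beta>))"
      unfolding hyp using \<alpha> by (simp add: sum_distrib_left mult.assoc[symmetric] sc_Sp)
    also have "\<dots> = (\<Sum>\<beta>\<in>W - W'. sc (c \<beta>) * Sp \<beta> * P {v})"
    proof (intro sum.mono_neutral_cong_right)
      show "sc (c \<beta>) * (Sp \<alpha> * d \<beta>) = sc (c \<beta>) * Sp \<beta> * P {v}" if "\<beta> \<in> W - W'" for \<beta>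
      proof (cases "d \<beta> = 0")
        case True
        then show ?thesis using that by (auto simp: W'_def mult.assoc)
      next
        case False
        then show ?thesis using detect_term[OF \<alpha>(2), of \<beta>] psubset.prems that
          unfolding d_def by (simp add: mult.assoc)
      qed
    qed (use psubset in \<open>auto simp: W'_def\<close>)
    finally have z: "(\<Sum>\<beta>\<in>W - W'. sc (c \<beta>) * Sp \<beta> * P {v}) = 0" by simp
    have "x = (\<Sum>\<beta>\<in>W - W'. sc (c \<beta>) * Sp \<beta> * P {v}) + (\<Sum>\<beta>\<in>W'. sc (c \<beta>) * Sp \<beta> * P {v})"
      unfolding psubset.prems(2) using psubset.hyps sub by (intro sum.subset_diff) auto
    then have "x = (\<Sum>\<beta>\<in>W'. sc (c \<beta>) * Sp \<beta> * P {v})" using z by simp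
    then show ?thesis using psubset.IH[OF sub] psubset.prems sub by blast
  qed
qed

lemma to_multiple: "j + (n - j mod n) = (j div n + 1) * n"
proof -
  have "j mod n < n" by simp
  moreover have "j = j div n * n + j mod n" by simp
  moreover have "(j div n + 1) * n = j div n * n + n" by simp
  ultimately show ?thesis by linarith
qed

text \<open>Corners at different vertices of the cycle are equivalent.\<close>

lemma to_base:
  assumes z: "P {u j} * z * P {u j} \<noteq> 0"
  shows "\<exists>a\<in>alg. \<exists>b\<in>alg. P {v} * a * z * b * P {v} \<noteq> 0"
proof -
  define m where "m = n - j mod n"
  have "j + m = (j div n + 1) * n" unfolding m_def by (rule to_multiple)
  then have uv: "u (j + m) = v" using cyc_add(1)[of 0 "j div n + 1"] by simp
  have "P {v} * Cq j m = Cq j m" "Cp j m * P {v} = Cp j m" using P_Cq[of j m] Cp_P[of j m] uv by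
      simp_all
  moreover have "Cq j m * z * Cp j m \<noteq> 0"
  proof
    assume *: "Cq j m * z * Cp j m = 0"
    have "P {u j} * z * P {u j} = (Cp j m * Cq j m) * z * (Cp j m * Cq j m)" by (simp only: Cp_Cq)
    also have "\<dots> = Cp j m * (Cq j m * z * Cp j m) * Cq j m" by (simp only: mult.assoc)
    finally show False using z * by simp
  qed
  ultimately have "P {v} * Cq j m * z * (Cp j m * P {v}) \<noteq> 0" by simp
  then have "P {v} * Cq j m * z * Cp j m * P {v} \<noteq> 0" by (simp only: mult.assoc) simp
  then show ?thesis using Cq_alg Cp_alg by blast
qed

lemma reach_cycle:
  assumes dd: "\<And>B. B \<in> V0 \<Longrightarrow> P B \<noteq> 0 \<Longrightarrow> \<exists>C\<in>V0. P C \<noteq> 0 \<and> uge G B C \<and> uge G {v} C"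
    and B: "B \<in> V0" "P B \<noteq> 0"
  shows "(\<exists>j. u j \<in> B) \<or> (\<exists>\<eta>. \<eta> \<noteq> [] \<and> set \<eta> \<subseteq> E \<and> Sp \<eta> \<noteq> 0 \<and> s (hd \<eta>) \<in> B \<and> (\<exists>j. u j \<in> r (last \<eta>)))"
proof -
  obtain C where C: "C \<in> V0" "P C \<noteq> 0" "uge G B C" "uge G {v} C" using dd[OF B] by blast
  have live: "Sp \<alpha> \<noteq> 0 \<and> set \<alpha> \<subseteq> E \<and> \<alpha> \<noteq> []" if "is_path G \<alpha>" "C \<subseteq> path_rng G \<alpha>" for \<alpha>
  proof -
    have a: "\<alpha> \<noteq> []" "set \<alpha> \<subseteq> E" using that by (auto simp: is_path_def)
    moreover have "P (r (last \<alpha>)) \<noteq> 0"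
      using P_zero_mono[of "r (last \<alpha>)" C] C last_E[OF a] that by (auto simp: path_rng_def)
    ultimately show ?thesis using Sp_nz_iff_path[OF a(2,1)] that by auto
  qed
  have "\<exists>j. u j \<in> C"
  proof (cases "C \<subseteq> {v}")
    case True
    moreover have "C \<noteq> {}" using C by auto
    ultimately show ?thesis by auto
  next
    case False
    then obtain \<alpha> where \<alpha>: "is_path G \<alpha>" "path_src G \<alpha> = v" "C \<subseteq> path_rng G \<alpha>"
      using C(4) by (auto simp: uge_def)
    note l = live[OF \<alpha>(1,3)]
    then have "\<alpha> = seg 0 (length \<alpha>)" using follow_cycle[of \<alpha> 0] \<alpha>(2) by (auto simp: path_src_def)
    then have "last \<alpha> = cyc (length \<alpha> - 1)" using seg_last[of "length \<alpha>" 0] l by (metis add_0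
        length_0_conv)
    then have Cr: "C \<subseteq> r (cyc (length \<alpha> - 1))" using \<alpha>(3) by (simp add: path_rng_def)
    have "u (Suc (length \<alpha> - 1)) \<in> C"
    proof (rule ccontr)
      assume no: "u (Suc (length \<alpha> - 1)) \<notin> C"
      have "r (cyc (length \<alpha> - 1)) \<inter> C = C" using Cr by auto
      then have "P C = P (r (cyc (length \<alpha> - 1))) * P C" using C by (simp add: P_mult)
      also have "\<dots> = P ({u (Suc (length \<alpha> - 1))} \<inter> C)" unfolding P_rng_cyc using C by (simp add: P_mult)
      finally show False using no C by simp
    qed
    then show ?thesis by blast
  qed
  then obtain j where j: "u j \<in> C" by blast
  show ?thesis
  proof (cases "C \<subseteq> B")
    case False
    then obtain \<eta> where "is_path G \<eta>" "path_src G \<eta> \<in> B" "C \<subseteq> path_rng G \<eta>"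
      using C(3) by (auto simp: uge_def)
    then have "\<eta> \<noteq> [] \<and> set \<eta> \<subseteq> E \<and> Sp \<eta> \<noteq> 0 \<and> s (hd \<eta>) \<in> B \<and> u j \<in> r (last \<eta>)"
      using live[of \<eta>] j by (auto simp: path_src_def path_rng_def)
    then show ?thesis by blast
  qed (use j in blast)
qed

text \<open>A shortest path from \<open>B\<close> to the cycle enters the cycle with its last edge.\<close>

lemma first_entry:
  assumes dd: "\<And>B. B \<in> V0 \<Longrightarrow> P B \<noteq> 0 \<Longrightarrow> \<exists>C\<in>V0. P C \<noteq> 0 \<and> uge G B C \<and> uge G {v} C"
    and B: "B \<in> V0" "P B \<noteq> 0" and no: "\<And>j. u j \<notin> B"
  shows "\<exists>\<eta> j. \<eta> \<noteq> [] \<and> set \<eta> \<subseteq> E \<and> Sp \<eta> \<noteq> 0 \<and> s (hd \<eta>) \<in> B \<and> u j \<in> r (last \<eta>) \<and> (\<forall>i. s (last \<eta>) \<noteq> u i)"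
proof -
  define Q where "Q \<eta> \<longleftrightarrow> \<eta> \<noteq> [] \<and> set \<eta> \<subseteq> E \<and> Sp \<eta> \<noteq> 0 \<and> s (hd \<eta>) \<in> B \<and> (\<exists>j. u j \<in> r (last \<eta>))" for \<eta>
  have "\<exists>\<eta>. Q \<eta>" using reach_cycle[OF dd B] no unfolding Q_def by blast
  then obtain \<eta> where \<eta>: "Q \<eta>" "\<And>\<eta>'. Q \<eta>' \<Longrightarrow> length \<eta> \<le> length \<eta>'" by (metis arg_min_natI arg_min_nat_le)
  have "s (last \<eta>) \<noteq> u i" for i
  proof
    assume i: "s (last \<eta>) = u i"
    obtain \<eta>' e where e: "\<eta> = \<eta>' @ [e]" using \<eta>(1) unfolding Q_def by (metis append_butlast_last_id)
    show False
    proof (cases "\<eta>' = []")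
      case True
      then show False using e i no \<eta>(1) by (auto simp: Q_def)
    next
      case False
      have "Q \<eta>'"
        using Sp_append_nz[of \<eta>' "[e]"] e i \<eta>(1) False unfolding Q_def by auto
      then show False using \<eta>(2) e by fastforce
    qed
  qed
  then show ?thesis using \<eta>(1) unfolding Q_def by blast
qed

text \<open>If every \<open>p\<^sub>B \<noteq> 0\<close> is connected to the cycle, the corner at the cycle detects every nonzero
  element. Consider a nonzero combination of real paths ending in \<open>B\<close>. If \<open>B\<close> is a vertex of the cycle,
  \<open>detect\<close> applies. Otherwise the paths are continued by a path that enters the cycle only with its
  last edge, so that no two of the continued paths interfere.\<close>

theorem corner_essential:
  assumes dd: "\<And>B. B \<in> V0 \<Longrightarrow> P B \<noteq> 0 \<Longrightarrow> \<exists>C\<in>V0. P C \<noteq> 0 \<and> uge G B C \<and> uge G {v} C"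
    and x: "x \<in> alg" "x \<noteq> 0"
  shows "\<exists>a\<in>alg. \<exists>b\<in>alg. P {v} * a * x * b * P {v} \<noteq> 0"
proof -
  have D: "finite (s ` set \<gamma>)" "s ` set \<gamma> \<subseteq> verts G" using cycle_edges src_closed by auto
  have uD: "u j \<in> s ` set \<gamma>" for j by (auto simp: cyc_def)
  obtain b W c B where b: "b \<in> alg" and W: "finite W" "W \<noteq> {}" and B: "B \<in> V0" "P B \<noteq> 0"
    and xb: "x * b = (\<Sum>\<alpha>\<in>W. sc (c \<alpha>) * Sp \<alpha> * P B)" and xb_nz: "x * b \<noteq> 0"
    and W_nz: "\<And>\<alpha>. \<alpha> \<in> W \<Longrightarrow> c \<alpha> \<noteq> 0 \<and> set \<alpha> \<subseteq> E \<and> Sp \<alpha> * P B \<noteq> 0"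
    and W_rng: "\<And>\<alpha>. \<alpha> \<in> W \<Longrightarrow> \<alpha> \<noteq> [] \<Longrightarrow> B \<subseteq> r (last \<alpha>)"
    and B_D: "\<And>w. w \<in> s ` set \<gamma> \<Longrightarrow> w \<in> B \<Longrightarrow> B = {w}"
    by (rule real_reduction[OF x D]) (rule that; assumption)
  have "\<exists>j. \<exists>a\<in>alg. \<exists>b\<in>alg. P {u j} * (a * x * b) * P {u j} \<noteq> 0"
  proof (cases "\<exists>j. u j \<in> B")
    case True
    then obtain j where j: "B = {u j}" using B_D uD by metis
    define m where "m = n - j mod n"
    have "j + m = (j div n + 1) * n" unfolding m_def by (rule to_multiple)
    then have uv: "u (j + m) = v" using cyc_add(1)[of 0 "j div n + 1"] by simp
    define y where "y = x * b * Cp j m"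
    have "x * b * P {u j} = x * b"
      unfolding xb j by (simp add: sum_distrib_right mult.assoc P_idem)
    then have "y * Cq j m = x * b" by (simp add: y_def mult.assoc Cp_Cq)
    then have "y \<noteq> 0" using xb_nz by auto
    have "y = (\<Sum>\<alpha>\<in>W. sc (c \<alpha>) * Sp \<alpha> * (P {u j} * Cp j m * P {u (j + m)}))"
      unfolding y_def xb j P_Cp Cp_P by (simp add: sum_distrib_right mult.assoc P_Cp)
    also have "\<dots> = (\<Sum>\<alpha>\<in>W. sc (c \<alpha>) * Sp (\<alpha> @ seg j m) * P {v})"
    proof (intro sum.cong refl)
      fix \<alpha> assume "\<alpha> \<in> W"
      have "P {u j} * Sp (seg j m) = Sp (seg j m)"
      proof -
        have "j mod n < n" by simp
        then have "m \<noteq> 0" unfolding m_def by linarith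
        then have "seg j m \<noteq> [] \<and> s (hd (seg j m)) = u j" by (cases m) (auto simp: seg_Suc)
        then show ?thesis using P_Sp[of "seg j m" "{u j}"] by simp
      qed
      then have "P {u j} * Cp j m * P {u (j + m)} = Sp (seg j m) * P {v}"
        using uv P_Cp[of j m] by (simp add: Cp_def)
      then show "sc (c \<alpha>) * Sp \<alpha> * (P {u j} * Cp j m * P {u (j + m)}) = sc (c \<alpha>) * Sp (\<alpha> @ seg j
          m) * P {v}"
        by (simp add: Sp_append mult.assoc)
    qed
    also have "\<dots> = (\<Sum>\<beta>\<in>(\<lambda>\<alpha>. \<alpha> @ seg j m) ` W. sc (c (take (length \<beta> - m) \<beta>)) * Sp \<beta> * P {v})"
      by (subst sum.reindex) (auto simp: inj_on_def)
    finally have "y = (\<Sum>\<beta>\<in>(\<lambda>\<alpha>. \<alpha> @ seg j m) ` W. sc (c (take (length \<beta> - m) \<beta>)) * Sp \<beta> * P {v})" .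
    from detect[OF _ _ this] \<open>y \<noteq> 0\<close> W(1) W_nz seg_E[of j m]
    obtain \<alpha> where \<alpha>: "set \<alpha> \<subseteq> E" "P {v} * Tp \<alpha> * y \<noteq> 0" by fastforce
    have "P {v} * ((P {v} * Tp \<alpha>) * x * (b * Cp j m)) * P {v} = (P {v} * P {v}) * Tp \<alpha> * x * b *
        (Cp j m * P {u (j + m)})"
      unfolding uv by (simp only: mult.assoc)
    also have "\<dots> = P {v} * Tp \<alpha> * y" unfolding y_def Cp_P P_idem[OF u_gv] by (simp only: mult.assoc)
    finally have "P {v} * ((P {v} * Tp \<alpha>) * x * (b * Cp j m)) * P {v} \<noteq> 0" using \<alpha>(2) by simp
    moreover have "P {v} * Tp \<alpha> \<in> alg" "b * Cp j m \<in> alg" using \<alpha> b by (auto intro: alg_P_Tp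
        alg_mult Cp_alg)
    ultimately show ?thesis by blast
  next
    case False
    then obtain \<eta> j where \<eta>: "\<eta> \<noteq> []" "set \<eta> \<subseteq> E" "Sp \<eta> \<noteq> 0" "s (hd \<eta>) \<in> B" "u j \<in> r (last \<eta>)"
      "\<And>i. s (last \<eta>) \<noteq> u i" using first_entry[OF dd B] by metis
    obtain \<alpha> where \<alpha>: "\<alpha> \<in> W" using W by blast
    have \<alpha>E: "set (\<alpha> @ \<eta>) \<subseteq> E" using W_nz \<alpha> \<eta> by auto
    define z where "z = (P {u j} * Tp (\<alpha> @ \<eta>)) * x * (b * Sp \<eta> * P {u j})"
    have PB\<eta>: "P B * Sp \<eta> = Sp \<eta>" using P_Sp[OF \<eta>(1,2) B(1)] \<eta>(4) by simp
    \<comment> \<open>a path along the cycle cannot end with the last edge of \<open>\<eta>\<close>\<close>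
    have no_\<zeta>: "s (hd \<zeta>) \<noteq> u j" if "\<zeta> \<noteq> []" "set \<zeta> \<subseteq> E" "Sp \<zeta> \<noteq> 0" "last \<zeta> = last \<eta>" for \<zeta>
    proof
      assume "s (hd \<zeta>) = u j"
      then have "\<zeta> = seg j (length \<zeta>)" using follow_cycle[of \<zeta> j] that by blast
      then have "last \<zeta> = cyc (j + length \<zeta> - 1)" using seg_last[of "length \<zeta>" j] that(1) by
          (metis length_0_conv)
      then show False using \<eta>(6) that(4) by metis
    qed
    have rl: "r (last \<eta>) \<in> V0" using last_E \<eta> by auto
    have off: "P {u j} * Tp (\<alpha> @ \<eta>) * Sp (\<beta> @ \<eta>) * P {u j} = 0" if \<beta>: "\<beta> \<in> W" "\<beta> \<noteq> \<alpha>" for \<beta>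
    proof (rule ccontr)
      assume nz: "P {u j} * Tp (\<alpha> @ \<eta>) * Sp (\<beta> @ \<eta>) * P {u j} \<noteq> 0"
      have \<beta>E: "set (\<beta> @ \<eta>) \<subseteq> E" using W_nz \<beta> \<eta> by auto
      have ts: "Tp (\<alpha> @ \<eta>) * Sp (\<beta> @ \<eta>) \<noteq> 0"
        using nz by (metis mult.assoc mult_zero_left mult_zero_right)
      consider \<zeta> where "\<beta> @ \<eta> = (\<alpha> @ \<eta>) @ \<zeta>" | \<zeta> where "\<alpha> @ \<eta> = (\<beta> @ \<eta>) @ \<zeta>"
        using Tp_Sp_nz_prefix[OF \<alpha>E \<beta>E ts] by blast
      then show False
      proof cases
        case 1
        have \<zeta>: "\<zeta> \<noteq> []" "set \<zeta> \<subseteq> E" using 1 \<beta>(2) \<beta>E by auto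
        have "Sp (\<beta> @ \<eta>) = Sp (\<alpha> @ \<eta>) * Sp \<zeta>" unfolding 1 by (rule Sp_append)
        then have "Tp (\<alpha> @ \<eta>) * (Sp (\<alpha> @ \<eta>) * Sp \<zeta>) \<noteq> 0" using ts by simp
        then have S: "Sp (\<alpha> @ \<eta>) \<noteq> 0" "Sp \<zeta> \<noteq> 0" using mult_not_zero by blast+
        have "Tp (\<alpha> @ \<eta>) * Sp (\<beta> @ \<eta>) = P (r (last \<eta>)) * Sp \<zeta>"
          using Tp_Sp_append[OF \<alpha>E _ S(1), of \<zeta>] 1 \<eta>(1) by simp
        then have "(P {u j} * P (r (last \<eta>))) * Sp \<zeta> * P {u j} \<noteq> 0" using nz by (simp only:
            mult.assoc) simp
        moreover have "P {u j} * P (r (last \<eta>)) = P {u j}" using P_mult[OF u_gv rl, of j] \<eta>(5) by simp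
        ultimately have "P {u j} * Sp \<zeta> \<noteq> 0" by auto
        then have "s (hd \<zeta>) = u j" using P_Sp[OF \<zeta> u_gv, of j] by (auto split: if_splits)
        moreover have "last \<zeta> = last \<eta>" using 1 \<zeta>(1) \<eta>(1) by (metis last_appendR)
        ultimately show False using no_\<zeta>[OF \<zeta> S(2)] by blast
      next
        case 2
        have \<zeta>: "\<zeta> \<noteq> []" "set \<zeta> \<subseteq> E" using 2 \<beta>(2) \<alpha>E by auto
        have S: "Sp (\<beta> @ \<eta>) \<noteq> 0" using ts by auto
        have "Tp (\<alpha> @ \<eta>) * Sp (\<beta> @ \<eta>) = Tp \<zeta> * P (r (last \<eta>))"
          using Tp_Sp_same[OF \<beta>E _ S] 2 \<eta>(1) by (simp add: Tp_append mult.assoc)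
        then have "P {u j} * Tp \<zeta> * (P (r (last \<eta>)) * P {u j}) \<noteq> 0" using nz by (simp add: mult.assoc)
        then have t: "Tp \<zeta> * P {u j} \<noteq> 0" using P_mult[OF rl u_gv, of j] \<eta>(5) by (auto simp: mult.assoc)
        then have "s (hd \<zeta>) = u j" using Tp_P[OF \<zeta> u_gv, of j] by (auto split: if_splits)
        moreover have "Sp \<zeta> \<noteq> 0" using Tp_nz_Sp[OF \<zeta>(2)] mult_not_zero[OF t] by blast
        moreover have "last \<zeta> = last \<eta>" using 2 \<zeta>(1) \<eta>(1) by (metis last_appendR)
        ultimately show False using no_\<zeta>[OF \<zeta>] by blast
      qed
    qed
    have S\<alpha>\<eta>: "Sp (\<alpha> @ \<eta>) \<noteq> 0"
    proof (cases "\<alpha> = []")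
      case False
      have "Sp \<alpha> \<noteq> 0" using W_nz[OF \<alpha>] mult_not_zero by blast
      then show ?thesis using Sp_append_nzI[of \<alpha> \<eta>] W_nz[OF \<alpha>] W_rng[OF \<alpha>] \<eta> False by auto
    qed (use \<eta> in simp)
    have "z = P {u j} * Tp (\<alpha> @ \<eta>) * (\<Sum>\<beta>\<in>W. sc (c \<beta>) * Sp \<beta> * P B) * Sp \<eta> * P {u j}"
      unfolding z_def xb[symmetric] by (simp only: mult.assoc)
    also have "\<dots> = (\<Sum>\<beta>\<in>W. sc (c \<beta>) * (P {u j} * Tp (\<alpha> @ \<eta>) * Sp (\<beta> @ \<eta>) * P {u j}))"
    proof -
      have "P {u j} * Tp (\<alpha> @ \<eta>) * (sc (c \<beta>) * Sp \<beta> * P B) * Sp \<eta> * P {u j} =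
          sc (c \<beta>) * (P {u j} * Tp (\<alpha> @ \<eta>) * Sp (\<beta> @ \<eta>) * P {u j})" for \<beta>
      proof -
        have "P {u j} * Tp (\<alpha> @ \<eta>) * (sc (c \<beta>) * Sp \<beta> * P B) * Sp \<eta> * P {u j} =
          P {u j} * (Tp (\<alpha> @ \<eta>) * sc (c \<beta>)) * Sp \<beta> * (P B * Sp \<eta>) * P {u j}" by (simp only: mult.assoc)
        also have "\<dots> = (P {u j} * sc (c \<beta>)) * Tp (\<alpha> @ \<eta>) * Sp \<beta> * Sp \<eta> * P {u j}"
          unfolding PB\<eta> sc_Tp[OF \<alpha>E] by (simp only: mult.assoc)
        finally show ?thesis by (simp only: sc_P[OF u_gv] Sp_append mult.assoc)
      qed
      then show ?thesis by (simp add: sum_distrib_left sum_distrib_right)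
    qed
    also have "\<dots> = (\<Sum>\<beta>\<in>W. if \<beta> = \<alpha> then sc (c \<alpha>) * P {u j} else 0)"
    proof (intro sum.cong refl)
      fix \<beta> assume \<beta>: "\<beta> \<in> W"
      show "sc (c \<beta>) * (P {u j} * Tp (\<alpha> @ \<eta>) * Sp (\<beta> @ \<eta>) * P {u j}) = (if \<beta> = \<alpha> then sc (c \<alpha>) * P
          {u j} else 0)"
      proof (cases "\<beta> = \<alpha>")
        case True
        have "Tp (\<alpha> @ \<eta>) * Sp (\<alpha> @ \<eta>) = P (r (last \<eta>))"
          using Tp_Sp_same[OF \<alpha>E _ S\<alpha>\<eta>] \<eta>(1) by simp
        then have "P {u j} * Tp (\<alpha> @ \<eta>) * Sp (\<alpha> @ \<eta>) * P {u j} = P {u j} * P (r (last \<eta>)) * P {u j}"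
          by (simp add: mult.assoc)
        also have "\<dots> = P {u j}" using rl \<eta>(5) by (simp add: P_mult gen_verts.inter)
        finally show ?thesis using True by simp
      qed (use off \<beta> in simp)
    qed
    also have "\<dots> = sc (c \<alpha>) * P {u j}" using W(1) \<alpha> by simp
    finally have "z \<noteq> 0" using sc_cancel[of "c \<alpha>"] W_nz[OF \<alpha>] P_u_nz[of j] by simp
    moreover have "P {u j} * z * P {u j} = z"
    proof -
      have "P {u j} * z * P {u j} = (P {u j} * P {u j}) * Tp (\<alpha> @ \<eta>) * x * b * Sp \<eta> * (P {u j} * P
          {u j})"
        unfolding z_def by (simp only: mult.assoc)
      then show ?thesis unfolding P_idem[OF u_gv] z_def by (simp only: mult.assoc)
    qed
    moreover have "P {u j} * Tp (\<alpha> @ \<eta>) \<in> alg" "b * Sp \<eta> * P {u j} \<in> alg"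
      using alg_P_Tp[OF \<alpha>E u_gv] alg_mult[OF alg_mult[OF b alg_Sp[OF \<eta>(2,1)]] alg_P[OF u_gv]] by blast+
    ultimately show ?thesis unfolding z_def by metis
  qed
  then obtain j a b where ab: "a \<in> alg" "b \<in> alg" "P {u j} * (a * x * b) * P {u j} \<noteq> 0" by blast
  from to_base[OF this(3)] obtain a' b' where "a' \<in> alg" "b' \<in> alg" "P {v} * a' * (a * x * b) * b'
      * P {v} \<noteq> 0"
    by blast
  then show ?thesis using ab
    by (intro bexI[of _ "a' * a"] bexI[of _ "b * b'"]) (auto simp: mult.assoc intro: alg_mult)
qed

end

section \<open>Reduction to a projection in the absence of exitless cycles\<close>

lemma nth_concat_replicate:
  "i < k * length xs \<Longrightarrow> concat (replicate k xs) ! i = xs ! (i mod length xs)"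
proof (induction k arbitrary: i)
  case (Suc k)
  show ?case
  proof (cases "i < length xs")
    case True
    then show ?thesis by (simp add: nth_append)
  next
    case False
    then have "concat (replicate k xs) ! (i - length xs) = xs ! ((i - length xs) mod length xs)"
      using Suc by simp
    then show ?thesis using False by (simp add: nth_append le_mod_geq)
  qed
qed simp

text \<open>If a word starts with a sufficiently high power of \<open>\<delta>\<close> and \<open>\<beta> \<eta> = \<eta> \<zeta>\<close> for a short \<open>\<beta>\<close>, then
  the whole word follows \<open>\<delta>\<close> periodically.\<close>

lemma periodic_word:
  assumes eq: "\<beta> @ \<eta> = \<eta> @ \<zeta>" and \<eta>: "\<eta> = concat (replicate k \<delta>) @ \<eta>'"
    and k: "length \<beta> + length \<delta> \<le> k * length \<delta>" and ne: "\<delta> \<noteq> []" "\<beta> \<noteq> []"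
  shows "j < length \<eta>' \<Longrightarrow> \<eta>' ! j = \<delta> ! (j mod length \<delta>)"
proof -
  let ?m = "length \<delta>"
  have len: "length (concat (replicate k \<delta>)) = k * ?m" by (induction k) auto
  have shift: "\<eta> ! i = \<eta> ! (i - length \<beta>)" if "length \<beta> \<le> i" "i < length \<eta>" for i
  proof -
    have "(\<beta> @ \<eta>) ! i = (\<eta> @ \<zeta>) ! i" using eq by simp
    then show ?thesis using that by (simp add: nth_append)
  qed
  have all: "i < length \<eta> \<Longrightarrow> \<eta> ! i = \<delta> ! (i mod ?m)" for i
  proof (induction i rule: less_induct)
    case (less i)
    show ?case
    proof (cases "i < k * ?m")
      case True
      then show ?thesis using nth_concat_replicate[OF True] by (simp add: \<eta> nth_append len)
    next
      case False
      then have i: "length \<beta> + ?m \<le> i" using k by linarith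
      have pos: "0 < ?m" "0 < length \<beta>" using ne by auto
      then have lt: "i - length \<beta> < i" "i - length \<beta> - ?m < i" "i - ?m < i" using i by linarith+
      have "\<eta> ! i = \<eta> ! (i - length \<beta>)" using shift i less.prems by simp
      also have "\<dots> = \<delta> ! ((i - length \<beta>) mod ?m)" using less.IH[OF lt(1)] lt less.prems by simp
      also have "(i - length \<beta>) mod ?m = (i - length \<beta> - ?m) mod ?m" using i by (simp add: le_mod_geq)
      also have "\<delta> ! \<dots> = \<eta> ! (i - length \<beta> - ?m)" using less.IH[OF lt(2)] lt less.prems by simp
      also have "\<dots> = \<eta> ! (i - ?m)"
        using shift[of "i - ?m"] i less.prems by (simp add: add.commute)
      also have "\<dots> = \<delta> ! ((i - ?m) mod ?m)" using less.IH[OF lt(3)] lt less.prems by simp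
      also have "(i - ?m) mod ?m = i mod ?m" using i by (simp add: le_mod_geq)
      finally show ?thesis .
    qed
  qed
  show "\<eta>' ! j = \<delta> ! (j mod ?m)" if "j < length \<eta>'"
    using all[of "k * ?m + j"] that by (simp add: \<eta> nth_append len)
qed

context leavitt_full
begin

lemma Sp_prefix_nz: "Sp (\<alpha> @ \<beta>) \<noteq> 0 \<Longrightarrow> Sp \<alpha> \<noteq> 0" "Sp (\<alpha> @ \<beta>) \<noteq> 0 \<Longrightarrow> Sp \<beta> \<noteq> 0"
  by (auto simp: Sp_append)

lemma Sp_nth_live:
  assumes "set \<alpha> \<subseteq> E" "Sp \<alpha> \<noteq> 0" "i < length \<alpha>"
  shows "P (r (\<alpha> ! i)) \<noteq> 0"
proof -
  have "Sp (take (Suc i) \<alpha>) \<noteq> 0"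
    using Sp_prefix_nz(1)[of "take (Suc i) \<alpha>" "drop (Suc i) \<alpha>"] assms(2) by simp
  then have "P (r (last (take (Suc i) \<alpha>))) \<noteq> 0"
    using Sp_nz_rng[of "take (Suc i) \<alpha>"] assms set_take_subset[of "Suc i" \<alpha>] by fastforce
  then show ?thesis using assms(3) by (simp add: take_Suc_conv_app_nth)
qed

text \<open>Let \<open>v\<close> be the base of a closed path \<open>\<beta>\<^sub>0\<close>, and suppose that every surviving path from \<open>v\<close> follows
  \<open>\<beta>\<^sub>0\<close> periodically and that the ranges met on the way are, up to null sets, the next vertex. Then
  the shortest closed prefix of \<open>\<beta>\<^sub>0\<close> is an exitless cycle.\<close>

lemma exitless_cycle_of_periodic:
  assumes \<beta>: "\<beta>\<^sub>0 \<noteq> []" "set \<beta>\<^sub>0 \<subseteq> E" "Sp \<beta>\<^sub>0 \<noteq> 0" "s (hd \<beta>\<^sub>0) = v" "v \<in> r (last \<beta>\<^sub>0)"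
    and E1: "\<And>\<eta> j. set \<eta> \<subseteq> E \<Longrightarrow> Sp \<eta> \<noteq> 0 \<Longrightarrow> \<eta> \<noteq> [] \<Longrightarrow> s (hd \<eta>) = v \<Longrightarrow> j < length \<eta> \<Longrightarrow>
      \<eta> ! j = \<beta>\<^sub>0 ! (j mod length \<beta>\<^sub>0)"
    and E2: "\<And>\<eta>. set \<eta> \<subseteq> E \<Longrightarrow> Sp \<eta> \<noteq> 0 \<Longrightarrow> \<eta> \<noteq> [] \<Longrightarrow> s (hd \<eta>) = v \<Longrightarrow>
      P (r (last \<eta>) - {s (\<beta>\<^sub>0 ! (length \<eta> mod length \<beta>\<^sub>0))}) = 0"
  shows "\<exists>\<gamma>. exitless_cycle G P S T sc \<gamma>"
proof -
  let ?m = "length \<beta>\<^sub>0"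
  define n where "n = (LEAST n. 0 < n \<and> n \<le> ?m \<and> v \<in> r (\<beta>\<^sub>0 ! (n - 1)))"
  have ex: "0 < ?m \<and> ?m \<le> ?m \<and> v \<in> r (\<beta>\<^sub>0 ! (?m - 1))" using \<beta> by (simp add: last_conv_nth)
  have n: "0 < n" "n \<le> ?m" "v \<in> r (\<beta>\<^sub>0 ! (n - 1))" using LeastI[of "\<lambda>n. 0 < n \<and> n \<le> ?m \<and> v \<in> r (\<beta>\<^sub>0
      ! (n - 1))", OF ex]
    unfolding n_def by auto
  have n_least: "n \<le> k" if "0 < k" "k \<le> ?m" "v \<in> r (\<beta>\<^sub>0 ! (k - 1))" for k
    unfolding n_def using that by (intro Least_le) auto
  define \<gamma> where "\<gamma> = take n \<beta>\<^sub>0"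
  have len: "length \<gamma> = n" using n by (simp add: \<gamma>_def)
  have nth: "\<gamma> ! i = \<beta>\<^sub>0 ! i" if "i < n" for i using that by (simp add: \<gamma>_def)
  have pre: "set (take (Suc i) \<beta>\<^sub>0) \<subseteq> E" "Sp (take (Suc i) \<beta>\<^sub>0) \<noteq> 0" "take (Suc i) \<beta>\<^sub>0 \<noteq> []" "s (hd
      (take (Suc i) \<beta>\<^sub>0)) = v" for i
    using \<beta> Sp_prefix_nz(1)[of "take (Suc i) \<beta>\<^sub>0" "drop (Suc i) \<beta>\<^sub>0"] set_take_subset[of "Suc i" \<beta>\<^sub>0]
        by auto
  have last_take: "last (take (Suc i) \<beta>\<^sub>0) = \<beta>\<^sub>0 ! i" if "i < ?m" for i using that by (simp add:
      take_Suc_conv_app_nth)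
  have edge: "f = \<beta>\<^sub>0 ! (Suc i mod ?m)" if f: "f \<in> E" "i < ?m" "s f \<in> r (\<beta>\<^sub>0 ! i)" "P (r f) \<noteq> 0" for f i
  proof -
    have "Sp [f] \<noteq> 0" using f S_zero_iff by (simp add: Sp_Cons)
    then have "Sp (take (Suc i) \<beta>\<^sub>0 @ [f]) \<noteq> 0"
      using Sp_append_nzI[OF pre(1) _ pre(3), of "[f]" i] pre(2)[of i] f last_take[of i] by auto
    moreover have "set (take (Suc i) \<beta>\<^sub>0 @ [f]) \<subseteq> E" using pre(1)[of i] f by simp
    moreover have "s (hd (take (Suc i) \<beta>\<^sub>0 @ [f])) = v" using pre(3,4)[of i] by (simp add: hd_append)
    ultimately have "(take (Suc i) \<beta>\<^sub>0 @ [f]) ! Suc i = \<beta>\<^sub>0 ! (Suc i mod ?m)"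
      using E1[of "take (Suc i) \<beta>\<^sub>0 @ [f]" "Suc i"] f(2) by auto
    then show ?thesis using f(2) by (simp add: nth_append)
  qed
  have live: "P (r (\<beta>\<^sub>0 ! i)) \<noteq> 0" if "i < ?m" for i using Sp_nth_live[OF \<beta>(2,3) that] .
  have \<beta>E: "\<beta>\<^sub>0 ! i \<in> E" if "i < ?m" for i using \<beta>(2) that nth_mem by blast
  have nxt: "\<beta>\<^sub>0 ! (Suc i mod ?m) = \<gamma> ! (Suc i mod n)" if i: "i < n" for i
  proof (cases "Suc i < n")
    case True
    then show ?thesis using n nth by simp
  next
    case False
    then have i: "Suc i = n" "i = n - 1" using that by auto
    have "s (\<beta>\<^sub>0 ! 0) \<in> r (\<beta>\<^sub>0 ! i)" using n(3) i \<beta>(1,4) by (simp add: hd_conv_nth)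
    then have "\<beta>\<^sub>0 ! 0 = \<beta>\<^sub>0 ! (Suc i mod ?m)" using edge[of "\<beta>\<^sub>0 ! 0" i] live \<beta>E \<beta>(1) n i by simp
    then show ?thesis using i n nth by simp
  qed
  have path: "is_path G \<beta>\<^sub>0" using Sp_nz_iff_path[OF \<beta>(2,1)] \<beta>(3) by simp
  have "exitless_cycle G P S T sc \<gamma>"
  proof unfold_locales
    show "\<gamma> \<noteq> []" using n by (auto simp: \<gamma>_def)
    show "set \<gamma> \<subseteq> E" using \<beta>(2) set_take_subset[of n \<beta>\<^sub>0] by (auto simp: \<gamma>_def)
    show "P (r (\<gamma> ! i)) \<noteq> 0" if "i < length \<gamma>" for i using live that len nth n by simp
    show "s (\<gamma> ! (Suc i mod length \<gamma>)) \<in> r (\<gamma> ! i)" if "i < length \<gamma>" for i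
    proof (cases "Suc i < n")
      case True
      then show ?thesis using path n nth len by (simp add: is_path_def)
    next
      case False
      then have "Suc i = n" using that len by simp
      then show ?thesis using n(3) nth len n \<beta>(1,4) by (auto simp: hd_conv_nth)
    qed
    show "P (r (\<gamma> ! i) - {s (\<gamma> ! (Suc i mod length \<gamma>))}) = 0" if i: "i < length \<gamma>" for i
    proof -
      have im: "i < ?m" using i len n by simp
      have l: "length (take (Suc i) \<beta>\<^sub>0) = Suc i" using im by simp
      show ?thesis using E2[OF pre, of i] nxt[of i] i len nth unfolding l last_take[OF im] by simp
    qed
    show "f = \<gamma> ! (Suc i mod length \<gamma>)"
      if "f \<in> E" "i < length \<gamma>" "s f \<in> r (\<gamma> ! i)" "P (r f) \<noteq> 0" for f i
      using edge[of f i] that nxt[of i] len nth n by simp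
    show "distinct (map s \<gamma>)"
    proof (rule ccontr)
      assume "\<not> distinct (map s \<gamma>)"
      then obtain p q where pq: "p < n" "q < n" "p \<noteq> q" "s (\<gamma> ! p) = s (\<gamma> ! q)"
        using len by (auto simp: distinct_conv_nth)
      obtain i j where ij: "i < j" "j < n" "s (\<beta>\<^sub>0 ! i) = s (\<beta>\<^sub>0 ! j)"
      proof (cases "p < q")
        case True then show ?thesis using that[of p q] pq nth by simp
      next
        case False then show ?thesis using that[of q p] pq nth by simp
      qed
      \<comment> \<open>Jumping back from the second occurrence of the vertex to the first gives a surviving path. It
        follows \<open>\<beta>\<^sub>0\<close>, so the edge with index \<open>n - (j - i) - 1\<close> is the last edge of \<open>\<gamma>\<close>, and the
            prefix of
        length \<open>n - (j - i)\<close> is already closed.\<close>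
      obtain j' where j': "j = Suc j'" using ij by (cases j) auto
      define \<eta> where "\<eta> = take j \<beta>\<^sub>0 @ drop i (take n \<beta>\<^sub>0)"
      have A: "set (take j \<beta>\<^sub>0) \<subseteq> E" "take j \<beta>\<^sub>0 \<noteq> []" "Sp (take j \<beta>\<^sub>0) \<noteq> 0" "s (hd (take j \<beta>\<^sub>0)) = v"
          using pre j' by auto
      have "Sp (take n \<beta>\<^sub>0) \<noteq> 0" using Sp_prefix_nz(1)[of "take n \<beta>\<^sub>0" "drop n \<beta>\<^sub>0"] \<beta>(3) by simp
      then have B: "Sp (drop i (take n \<beta>\<^sub>0)) \<noteq> 0"
        using Sp_prefix_nz(2)[of "take i (take n \<beta>\<^sub>0)" "drop i (take n \<beta>\<^sub>0)"] unfolding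
            append_take_drop_id by blast
      have B': "set (drop i (take n \<beta>\<^sub>0)) \<subseteq> E" "drop i (take n \<beta>\<^sub>0) \<noteq> []"
        using \<beta>(2) ij n set_drop_subset[of i "take n \<beta>\<^sub>0"] set_take_subset[of n \<beta>\<^sub>0] by auto
      have hdB: "hd (drop i (take n \<beta>\<^sub>0)) = \<beta>\<^sub>0 ! i" using ij n by (simp add: hd_drop_conv_nth)
      have "s (\<beta>\<^sub>0 ! j) \<in> r (\<beta>\<^sub>0 ! j')" using path ij n j' by (simp add: is_path_def)
      moreover have "last (take j \<beta>\<^sub>0) = \<beta>\<^sub>0 ! j'" using last_take[of j'] j' ij n by simp
      ultimately have "s (hd (drop i (take n \<beta>\<^sub>0))) \<in> r (last (take j \<beta>\<^sub>0))" using hdB ij by simp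
      then have nz: "Sp \<eta> \<noteq> 0" unfolding \<eta>_def using Sp_append_nzI[OF A(1) B'(1) A(2) B'(2)] A B
          by blast
      have l\<eta>: "length \<eta> = j + (n - i)" using ij n by (simp add: \<eta>_def)
      have "\<eta> ! (n - 1) = \<beta>\<^sub>0 ! ((n - 1) mod ?m)"
      proof (rule E1)
        show "set \<eta> \<subseteq> E" "\<eta> \<noteq> []" "s (hd \<eta>) = v" unfolding \<eta>_def using A B' by (simp_all add: hd_append)
        show "n - 1 < length \<eta>" using l\<eta> ij by simp
      qed (rule nz)
      moreover have "\<eta> ! (n - 1) = \<beta>\<^sub>0 ! (n - (j - i) - 1)"
        using ij n by (simp add: \<eta>_def nth_append add.commute)
      moreover have "(n - 1) mod ?m = n - 1" using n by simp
      ultimately have "v \<in> r (\<beta>\<^sub>0 ! (n - (j - i) - 1))" using n(3) by simp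
      then have "n \<le> n - (j - i)" using n_least[of "n - (j - i)"] ij n by simp
      then show False using ij by simp
    qed
  qed
  then show ?thesis by blast
qed

text \<open>If no compression \<open>p\<^sub>C s\<^sub>\<eta>\<^sub>* y s\<^sub>\<eta> p\<^sub>C\<close> reduces \<open>y = c\<^sub>0 p\<^sub>v + \<dots>\<close> to its first term, then for all
  long \<open>\<eta>\<close> and all surviving \<open>C \<subseteq> r(\<eta>)\<close> there is an equation \<open>\<beta> \<eta> = \<eta> \<zeta>\<close> with \<open>\<zeta>\<close> starting
  in \<open>C\<close>, and \<open>periodic_word\<close> applies.\<close>

lemma vertex_reduction:
  assumes v: "{v} \<in> V0" "P {v} \<noteq> 0" and c0: "c0 \<noteq> 0" and W: "finite W"
    and W': "\<And>\<beta>. \<beta> \<in> W \<Longrightarrow> \<beta> \<noteq> [] \<and> set \<beta> \<subseteq> E \<and> Sp \<beta> * P {v} \<noteq> 0 \<and> s (hd \<beta>) = v"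
    and y: "y = sc c0 * P {v} + (\<Sum>\<beta>\<in>W. sc (c \<beta>) * Sp \<beta> * P {v})"
    and no: "\<And>\<eta> C. set \<eta> \<subseteq> E \<Longrightarrow> C \<in> V0 \<Longrightarrow> P C \<noteq> 0 \<Longrightarrow> P C * Tp \<eta> * y * Sp \<eta> * P C \<noteq> sc c0 * P C"
  shows "\<exists>\<gamma>. exitless_cycle G P S T sc \<gamma>"
proof -
  have "W \<noteq> {}"
  proof
    assume "W = {}"
    then have "P {v} * Tp [] * y * Sp [] * P {v} = (P {v} * sc c0) * P {v} * P {v}"
      using y by (simp add: mult.assoc)
    also have "\<dots> = sc c0 * P {v}" unfolding sc_P[OF v(1)] by (simp add: mult.assoc P_idem[OF v(1)])
    finally have "P {v} * Tp [] * y * Sp [] * P {v} = sc c0 * P {v}" .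
    then show False using no[of "[]" "{v}"] v by simp
  qed
  then obtain \<beta>\<^sub>0 where \<beta>0: "\<beta>\<^sub>0 \<in> W" by blast
  have closed: "v \<in> r (last \<beta>)" "Sp \<beta> \<noteq> 0" if "\<beta> \<in> W" for \<beta>
  proof -
    show "Sp \<beta> \<noteq> 0" using W'[OF that] mult_not_zero by blast
    have "Sp \<beta> * P (r (last \<beta>) \<inter> {v}) \<noteq> 0" using W'[OF that] Sp_P[of \<beta> "{v}"] v by auto
    then show "v \<in> r (last \<beta>)" by (cases "v \<in> r (last \<beta>)") auto
  qed
  have step: "\<exists>\<beta>\<in>W. \<exists>\<zeta>. \<beta> @ \<eta> = \<eta> @ \<zeta> \<and> \<zeta> \<noteq> [] \<and> s (hd \<zeta>) \<in> C"
    if \<eta>: "set \<eta> \<subseteq> E" "\<eta> \<noteq> []" "Sp \<eta> \<noteq> 0" "s (hd \<eta>) = v" and C: "C \<in> V0" "C \<subseteq> r (last \<eta>)" "P C \<noteq> 0"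
    for \<eta> C
  proof (rule ccontr)
    assume none: "\<not> ?thesis"
    have rV: "r (last \<eta>) \<in> V0" using last_E \<eta> by simp
    have PC: "P C * P (r (last \<eta>)) = P C" using P_mult[OF C(1) rV] C(2) by (simp add: inf.absorb1)
    have Pv: "P {v} * Sp \<eta> = Sp \<eta>" using P_Sp[OF \<eta>(2,1) v(1)] \<eta>(4) by simp
    have CTE: "P C * Tp \<eta> * (sc d * x) = sc d * (P C * Tp \<eta> * x)" for d x
    proof -
      have "P C * Tp \<eta> * (sc d * x) = P C * (Tp \<eta> * sc d) * x" by (simp only: mult.assoc)
      also have "\<dots> = (P C * sc d) * Tp \<eta> * x" unfolding sc_Tp[OF \<eta>(1)] by (simp only: mult.assoc)
      finally show ?thesis unfolding sc_P[OF C(1)] by (simp only: mult.assoc)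
    qed
    have zero: "P C * Tp \<eta> * (sc (c \<beta>) * Sp \<beta> * P {v}) * Sp \<eta> * P C = 0" if \<beta>: "\<beta> \<in> W" for \<beta>
    proof (rule ccontr)
      assume "P C * Tp \<eta> * (sc (c \<beta>) * Sp \<beta> * P {v}) * Sp \<eta> * P C \<noteq> 0"
      moreover have "P C * Tp \<eta> * (sc (c \<beta>) * Sp \<beta> * P {v}) * Sp \<eta> * P C =
          sc (c \<beta>) * (P C * (Tp \<eta> * Sp (\<beta> @ \<eta>)) * P C)"
        using CTE[of "c \<beta>" "Sp \<beta> * (P {v} * Sp \<eta>) * P C"] Pv by (simp add: Sp_append mult.assoc)
      ultimately have nz: "P C * (Tp \<eta> * Sp (\<beta> @ \<eta>)) * P C \<noteq> 0" by auto
      then have ts: "Tp \<eta> * Sp (\<beta> @ \<eta>) \<noteq> 0" by auto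
      have \<beta>E: "set (\<beta> @ \<eta>) \<subseteq> E" using W'[OF \<beta>] \<eta> by auto
      consider \<zeta> where "\<beta> @ \<eta> = \<eta> @ \<zeta>" | \<zeta> where "\<eta> = (\<beta> @ \<eta>) @ \<zeta>"
        using Tp_Sp_nz_prefix[OF \<eta>(1) \<beta>E ts] by blast
      then show False
      proof cases
        case 1
        have "length \<beta> = length \<zeta>" using arg_cong[OF 1, of length] by simp
        then have \<zeta>: "\<zeta> \<noteq> []" "set \<zeta> \<subseteq> E" using W'[OF \<beta>] \<beta>E 1 by auto
        have "P C * (Tp \<eta> * Sp (\<beta> @ \<eta>)) * P C = (P C * P (r (last \<eta>))) * Sp \<zeta> * P C"
          unfolding 1 using Tp_Sp_append[OF \<eta>(1,2,3), of \<zeta>] by (simp add: mult.assoc)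
        then have "P C * Sp \<zeta> \<noteq> 0" using nz PC by auto
        then have "s (hd \<zeta>) \<in> C" using P_Sp[OF \<zeta> C(1)] by (auto split: if_splits)
        then show False using none \<beta> 1 \<zeta> by blast
      next
        case 2
        have "length \<beta> = 0" using arg_cong[OF 2, of length] by simp
        then show False using W'[OF \<beta>] by simp
      qed
    qed
    have "P C * Tp \<eta> * y * Sp \<eta> * P C = P C * Tp \<eta> * (sc c0 * P {v}) * Sp \<eta> * P C +
        (\<Sum>\<beta>\<in>W. P C * Tp \<eta> * (sc (c \<beta>) * Sp \<beta> * P {v}) * Sp \<eta> * P C)"
      unfolding y by (simp add: distrib_left distrib_right sum_distrib_left sum_distrib_right)
    also have "\<dots> = P C * Tp \<eta> * (sc c0 * P {v}) * Sp \<eta> * P C" using zero by simp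
    also have "\<dots> = sc c0 * (P C * (Tp \<eta> * (P {v} * Sp \<eta>)) * P C)" using CTE by (simp add: mult.assoc)
    also have "P C * (Tp \<eta> * (P {v} * Sp \<eta>)) * P C = P C"
      unfolding Pv using Tp_Sp_same[OF \<eta>(1,2,3)] PC P_idem[OF C(1)] by simp
    finally show False using no[OF \<eta>(1) C(1) C(3)] by simp
  qed
  define M where "M = (\<Sum>\<beta>\<in>W. length \<beta>)"
  have M: "length \<beta> \<le> M" if "\<beta> \<in> W" for \<beta> unfolding M_def using that W by (intro member_le_sum) auto
  \<comment> \<open>a power of \<open>\<beta>\<^sub>0\<close> exceeding every word of \<open>W\<close> by at least one period\<close>
  define pw where "pw = concat (replicate (Suc M) \<beta>\<^sub>0)"
  have \<beta>0': "\<beta>\<^sub>0 \<noteq> []" "set \<beta>\<^sub>0 \<subseteq> E" "s (hd \<beta>\<^sub>0) = v" using W'[OF \<beta>0] by auto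
  have long: "length \<beta> + length \<beta>\<^sub>0 \<le> Suc M * length \<beta>\<^sub>0" if "\<beta> \<in> W" for \<beta>
  proof -
    have "1 \<le> length \<beta>\<^sub>0" using \<beta>0' by (simp add: Suc_le_eq)
    then have "M * 1 \<le> M * length \<beta>\<^sub>0" by (rule mult_le_mono2)
    moreover have "Suc M * length \<beta>\<^sub>0 = length \<beta>\<^sub>0 + M * length \<beta>\<^sub>0" by simp
    ultimately show ?thesis using M[OF that] by linarith
  qed
  have pow: "Sp (concat (replicate k \<beta>\<^sub>0) @ \<eta>) \<noteq> 0 \<and> set (concat (replicate k \<beta>\<^sub>0) @ \<eta>) \<subseteq> E \<and>
      concat (replicate k \<beta>\<^sub>0) @ \<eta> \<noteq> [] \<and> s (hd (concat (replicate k \<beta>\<^sub>0) @ \<eta>)) = v"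
    if "set \<eta> \<subseteq> E" "\<eta> \<noteq> []" "Sp \<eta> \<noteq> 0" "s (hd \<eta>) = v" for \<eta> k
  proof (induction k)
    case (Suc k)
    have "Sp (\<beta>\<^sub>0 @ (concat (replicate k \<beta>\<^sub>0) @ \<eta>)) \<noteq> 0"
      by (rule Sp_append_nzI) (use Suc closed[OF \<beta>0] \<beta>0' in auto)
    then show ?case using Suc \<beta>0' by (simp add: hd_append)
  qed (use that in simp)
  have pw: "Sp (pw @ \<eta>) \<noteq> 0" "set (pw @ \<eta>) \<subseteq> E" "pw @ \<eta> \<noteq> []" "s (hd (pw @ \<eta>)) = v"
    if "set \<eta> \<subseteq> E" "\<eta> \<noteq> []" "Sp \<eta> \<noteq> 0" "s (hd \<eta>) = v" for \<eta>
    using pow[OF that, of "Suc M"] unfolding pw_def by blast+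
  have E1: "\<eta> ! j = \<beta>\<^sub>0 ! (j mod length \<beta>\<^sub>0)"
    if \<eta>: "set \<eta> \<subseteq> E" "Sp \<eta> \<noteq> 0" "\<eta> \<noteq> []" "s (hd \<eta>) = v" and j: "j < length \<eta>" for \<eta> j
  proof -
    have l: "last (pw @ \<eta>) \<in> E" "last (pw @ \<eta>) = last \<eta>" using last_E \<eta> by auto
    then have "P (r (last (pw @ \<eta>))) \<noteq> 0" using Sp_nz_rng[OF \<eta>(1,3,2)] by simp
    then obtain \<beta> \<zeta> where "\<beta> \<in> W" "\<beta> @ (pw @ \<eta>) = (pw @ \<eta>) @ \<zeta>"
      using step[OF pw(2,3,1,4)[OF \<eta>(1,3,2,4)], of "r (last (pw @ \<eta>))"] l by auto
    then show ?thesis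
      using periodic_word[of \<beta> "pw @ \<eta>" \<zeta> "Suc M" \<beta>\<^sub>0 \<eta>] long W' \<beta>0' j unfolding pw_def by blast
  qed
  have E2: "P (r (last \<eta>) - {s (\<beta>\<^sub>0 ! (length \<eta> mod length \<beta>\<^sub>0))}) = 0"
    if \<eta>: "set \<eta> \<subseteq> E" "Sp \<eta> \<noteq> 0" "\<eta> \<noteq> []" "s (hd \<eta>) = v" for \<eta>
  proof (rule ccontr)
    let ?C = "r (last \<eta>) - {s (\<beta>\<^sub>0 ! (length \<eta> mod length \<beta>\<^sub>0))}"
    assume nz: "P ?C \<noteq> 0"
    have "\<beta>\<^sub>0 ! (length \<eta> mod length \<beta>\<^sub>0) \<in> E" using \<beta>0' by (meson length_greater_0_conv
        mod_less_divisor nth_mem subsetD)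
    then have CV: "?C \<in> V0" using last_E \<eta> by (intro gen_verts.diff) auto
    have l: "last (pw @ \<eta>) = last \<eta>" using \<eta> by simp
    note p = pw[OF \<eta>(1,3,2,4)]
    obtain \<beta> \<zeta> where \<beta>: "\<beta> \<in> W" "\<beta> @ (pw @ \<eta>) = (pw @ \<eta>) @ \<zeta>" "\<zeta> \<noteq> []" "s (hd \<zeta>) \<in> ?C"
      using step[OF p(2,3,1,4) CV _ nz] l by auto
    have "Sp (\<beta> @ (pw @ \<eta>)) \<noteq> 0"
      by (rule Sp_append_nzI) (use p W'[OF \<beta>(1)] closed[OF \<beta>(1)] in auto)
    then have "Sp (pw @ ((\<eta> @ [hd \<zeta>]) @ tl \<zeta>)) \<noteq> 0" using \<beta>(2,3) by simp
    then have nz': "Sp (\<eta> @ [hd \<zeta>]) \<noteq> 0" using Sp_prefix_nz by blast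
    have "set (\<beta> @ (pw @ \<eta>)) \<subseteq> E" using p(2) W'[OF \<beta>(1)] by simp
    then have "set \<zeta> \<subseteq> E" unfolding \<beta>(2) by simp
    then have "set (\<eta> @ [hd \<zeta>]) \<subseteq> E" using \<eta> hd_E \<beta>(3) by auto
    then have "(\<eta> @ [hd \<zeta>]) ! length \<eta> = \<beta>\<^sub>0 ! (length \<eta> mod length \<beta>\<^sub>0)"
      using E1[of "\<eta> @ [hd \<zeta>]" "length \<eta>"] nz' \<eta> by (simp add: hd_append)
    then show False using \<beta>(4) by simp
  qed
  show ?thesis
    by (rule exitless_cycle_of_periodic[OF \<beta>0'(1,2) closed(2)[OF \<beta>0] \<beta>0'(3) closed(1)[OF \<beta>0] E1 E2])
qed

text \<open>Multiplying a real combination by \<open>s\<^sub>\<alpha>\<^sub>*\<close> for a shortest path \<open>\<alpha>\<close> in it produces a term \<open>c p\<^sub>B\<close>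
  with \<open>c \<noteq> 0\<close> without creating ghosts. Either all other terms are killed by \<open>p\<^sub>B\<close>, or \<open>B\<close> is a vertex.\<close>

theorem reduces_to_projection:
  assumes x: "x \<in> alg" "x \<noteq> 0" and no_cycle: "\<And>\<gamma>. \<not> exitless_cycle G P S T sc \<gamma>"
  shows "\<exists>a\<in>alg. \<exists>b\<in>alg. \<exists>A\<in>V0. P A \<noteq> 0 \<and> a * x * b = P A"
proof -
  obtain b W c B where b: "b \<in> alg" and W: "finite W" "W \<noteq> {}" and B: "B \<in> V0" "P B \<noteq> 0"
    and xb: "x * b = (\<Sum>\<alpha>\<in>W. sc (c \<alpha>) * Sp \<alpha> * P B)" and xb_nz: "x * b \<noteq> 0"
    and W_nz: "\<And>\<alpha>. \<alpha> \<in> W \<Longrightarrow> c \<alpha> \<noteq> 0 \<and> set \<alpha> \<subseteq> E \<and> Sp \<alpha> * P B \<noteq> 0"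
    and W_rng: "\<And>\<alpha>. \<alpha> \<in> W \<Longrightarrow> \<alpha> \<noteq> [] \<Longrightarrow> B \<subseteq> r (last \<alpha>)"
    and B_e: "\<And>\<alpha> e. \<alpha> \<in> W \<Longrightarrow> e \<in> set \<alpha> \<Longrightarrow> s e \<in> B \<Longrightarrow> B = {s e}"
    by (rule real_reduction[OF x finite.emptyI empty_subsetI]) (rule that; assumption)
  obtain \<alpha> where \<alpha>: "\<alpha> \<in> W" "\<And>\<beta>. \<beta> \<in> W \<Longrightarrow> length \<alpha> \<le> length \<beta>"
    using ex_has_least_nat[of "\<lambda>\<alpha>. \<alpha> \<in> W" _ length] W(2) by blast
  have \<alpha>E: "set \<alpha> \<subseteq> E" using W_nz \<alpha> by auto
  define y where "y = P B * Tp \<alpha> * (x * b) * P B"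
  have PTsc: "P B * Tp \<alpha> * (sc d * z) = sc d * (P B * Tp \<alpha> * z)" for d z
  proof -
    have "P B * Tp \<alpha> * (sc d * z) = P B * (Tp \<alpha> * sc d) * z" by (simp only: mult.assoc)
    also have "\<dots> = (P B * sc d) * Tp \<alpha> * z" unfolding sc_Tp[OF \<alpha>E] by (simp only: mult.assoc)
    finally show ?thesis unfolding sc_P[OF B(1)] by (simp only: mult.assoc)
  qed
  have y: "y = (\<Sum>\<beta>\<in>W. sc (c \<beta>) * (P B * Tp \<alpha> * Sp \<beta> * P B))"
  proof -
    have "P B * Tp \<alpha> * (sc (c \<beta>) * Sp \<beta> * P B) * P B = sc (c \<beta>) * (P B * Tp \<alpha> * Sp \<beta> * P B)" for \<beta>
      using PTsc[of "c \<beta>" "Sp \<beta> * P B"] P_idem[OF B(1)] by (simp add: mult.assoc)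
    then show ?thesis unfolding y_def xb by (simp add: sum_distrib_left sum_distrib_right)
  qed
  have PBr: "P B * P (r (last \<alpha>)) = P B" if "\<alpha> \<noteq> []"
    using W_rng[OF \<alpha>(1) that] P_mult[OF B(1), of "r (last \<alpha>)"] last_E[OF that \<alpha>E] by (simp add:
        inf.absorb1)
  have S\<alpha>: "Sp \<alpha> \<noteq> 0" using W_nz[OF \<alpha>(1)] mult_not_zero by blast
  have app: "P B * Tp \<alpha> * Sp (\<alpha> @ \<zeta>) = P B * Sp \<zeta>" for \<zeta>
  proof (cases "\<alpha> = []")
    case False
    have "P B * Tp \<alpha> * Sp (\<alpha> @ \<zeta>) = (P B * P (r (last \<alpha>))) * Sp \<zeta>"
      using Tp_Sp_append[OF \<alpha>E False S\<alpha>, of \<zeta>] by (simp add: mult.assoc)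
    then show ?thesis using PBr[OF False] by simp
  qed simp
  define W' where "W' = {\<zeta>. \<zeta> \<noteq> [] \<and> \<alpha> @ \<zeta> \<in> W \<and> P B * Sp \<zeta> * P B \<noteq> 0}"
  have fin: "finite W'"
  proof -
    have "finite ((\<lambda>\<zeta>. \<alpha> @ \<zeta>) -` W)" using W(1) by (intro finite_vimageI) (auto simp: inj_def)
    then show ?thesis by (rule rev_finite_subset) (auto simp: W'_def)
  qed
  have outside: "P B * Tp \<alpha> * Sp \<beta> * P B = 0" if \<beta>: "\<beta> \<in> W" "\<beta> \<notin> insert \<alpha> ((\<lambda>\<zeta>. \<alpha> @ \<zeta>) ` W')" for \<beta>
  proof (rule ccontr)
    assume nz: "P B * Tp \<alpha> * Sp \<beta> * P B \<noteq> 0"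
    then have "Tp \<alpha> * Sp \<beta> \<noteq> 0" by (metis mult.assoc mult_zero_left mult_zero_right)
    then consider \<zeta> where "\<beta> = \<alpha> @ \<zeta>" | \<zeta> where "\<alpha> = \<beta> @ \<zeta>"
      using Tp_Sp_nz_prefix[OF \<alpha>E, of \<beta>] W_nz \<beta> by blast
    then show False
    proof cases
      case 1
      then have "\<zeta> \<in> W'" using \<beta> nz app[of \<zeta>] unfolding W'_def by auto
      then show False using \<beta> 1 by blast
    next
      case 2
      then have "\<zeta> = []" using \<alpha>(2)[OF \<beta>(1)] by simp
      then show False using 2 \<beta> by simp
    qed
  qed
  have "y = (\<Sum>\<beta>\<in>insert \<alpha> ((\<lambda>\<zeta>. \<alpha> @ \<zeta>) ` W'). sc (c \<beta>) * (P B * Tp \<alpha> * Sp \<beta> * P B))"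
    unfolding y using W(1) \<alpha> outside by (intro sum.mono_neutral_right) (auto simp: W'_def)
  also have "\<dots> = sc (c \<alpha>) * (P B * Tp \<alpha> * Sp \<alpha> * P B) +
      (\<Sum>\<beta>\<in>(\<lambda>\<zeta>. \<alpha> @ \<zeta>) ` W'. sc (c \<beta>) * (P B * Tp \<alpha> * Sp \<beta> * P B))"
    using fin by (intro sum.insert) (auto simp: W'_def)
  also have "(\<Sum>\<beta>\<in>(\<lambda>\<zeta>. \<alpha> @ \<zeta>) ` W'. sc (c \<beta>) * (P B * Tp \<alpha> * Sp \<beta> * P B)) =
      (\<Sum>\<zeta>\<in>W'. sc (c (\<alpha> @ \<zeta>)) * (P B * Sp \<zeta> * P B))"
    by (subst sum.reindex) (auto simp: inj_on_def app)
  also have "P B * Tp \<alpha> * Sp \<alpha> * P B = P B" using app[of "[]"] P_idem[OF B(1)] by simp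
  finally have y': "y = sc (c \<alpha>) * P B + (\<Sum>\<zeta>\<in>W'. sc (c (\<alpha> @ \<zeta>)) * (P B * Sp \<zeta> * P B))" .
  have c\<alpha>: "c \<alpha> \<noteq> 0" using W_nz \<alpha> by blast
  have "\<exists>\<eta> C. set \<eta> \<subseteq> E \<and> C \<in> V0 \<and> P C \<noteq> 0 \<and> P C * Tp \<eta> * y * Sp \<eta> * P C = sc (c \<alpha>) * P C"
  proof (cases "W' = {}")
    case True
    have "P B * Tp [] * y * Sp [] * P B = y"
      unfolding y_def using P_idem[OF B(1)] by (simp add: mult.assoc) (simp add: mult.assoc[symmetric])
    then show ?thesis using True y' B by (intro exI[of _ "[]"] exI[of _ B]) simp
  next
    case False
    have hdB: "s (hd \<zeta>) \<in> B \<and> B = {s (hd \<zeta>)} \<and> set \<zeta> \<subseteq> E \<and> P B * Sp \<zeta> = Sp \<zeta>" if \<zeta>: "\<zeta> \<in> W'" for \<zeta>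
    proof -
      have z: "\<zeta> \<noteq> []" "\<alpha> @ \<zeta> \<in> W" "P B * Sp \<zeta> * P B \<noteq> 0" using \<zeta> by (auto simp: W'_def)
      then have E: "set \<zeta> \<subseteq> E" using W_nz by fastforce
      have "P B * Sp \<zeta> \<noteq> 0" using z(3) mult_not_zero by blast
      then have "s (hd \<zeta>) \<in> B" "P B * Sp \<zeta> = Sp \<zeta>" using P_Sp[OF z(1) E B(1)] by (auto split: if_splits)
      moreover have "hd \<zeta> \<in> set (\<alpha> @ \<zeta>)" using z(1) by simp
      ultimately show ?thesis using B_e[OF z(2)] E by blast
    qed
    then obtain v where v: "B = {v}" using False by blast
    have yv: "y = sc (c \<alpha>) * P {v} + (\<Sum>\<zeta>\<in>W'. sc (c (\<alpha> @ \<zeta>)) * Sp \<zeta> * P {v})"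
    proof -
      have "sc (c (\<alpha> @ \<zeta>)) * (P B * Sp \<zeta> * P B) = sc (c (\<alpha> @ \<zeta>)) * Sp \<zeta> * P B" if "\<zeta> \<in> W'" for \<zeta>
      proof -
        have "P B * Sp \<zeta> = Sp \<zeta>" using hdB[OF that] by blast
        then show ?thesis by (simp only: mult.assoc)
      qed
      then show ?thesis unfolding y' v[symmetric] by simp
    qed
    have z: "\<zeta> \<noteq> [] \<and> set \<zeta> \<subseteq> E \<and> Sp \<zeta> * P {v} \<noteq> 0 \<and> s (hd \<zeta>) = v" if "\<zeta> \<in> W'" for \<zeta>
    proof -
      have "B = {s (hd \<zeta>)}" "set \<zeta> \<subseteq> E" using hdB[OF that] by blast+
      moreover have "\<zeta> \<noteq> []" "P B * (Sp \<zeta> * P B) \<noteq> 0" using that by (simp_all add: W'_def mult.assoc)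
      moreover from this(2) have "Sp \<zeta> * P B \<noteq> 0" using mult_not_zero by blast
      ultimately show ?thesis using v by simp
    qed
    have vB: "{v} \<in> V0" "P {v} \<noteq> 0" using B v by auto
    show ?thesis
    proof (rule ccontr)
      assume no: "\<not> ?thesis"
      have "\<exists>\<gamma>. exitless_cycle G P S T sc \<gamma>"
      proof (rule vertex_reduction[OF vB c\<alpha> fin z yv])
        fix \<eta> C assume *: "set \<eta> \<subseteq> E" "C \<in> V0" "P C \<noteq> 0"
        show "P C * Tp \<eta> * y * Sp \<eta> * P C \<noteq> sc (c \<alpha>) * P C"
        proof
          assume "P C * Tp \<eta> * y * Sp \<eta> * P C = sc (c \<alpha>) * P C"
          with * have "\<exists>\<eta> C. set \<eta> \<subseteq> E \<and> C \<in> V0 \<and> P C \<noteq> 0 \<and> P C * Tp \<eta> * y * Sp \<eta> * P C = sc (c \<alpha>)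
              * P C"
            by (intro exI conjI)
          with no show False by (rule notE)
        qed
      qed
      then show False using no_cycle by blast
    qed
  qed
  then obtain \<eta> C where \<eta>: "set \<eta> \<subseteq> E" and C: "C \<in> V0" "P C \<noteq> 0"
    and eq: "P C * Tp \<eta> * y * Sp \<eta> * P C = sc (c \<alpha>) * P C" by blast
  define a' where "a' = sc (inverse (c \<alpha>)) * (P C * Tp \<eta> * (P B * Tp \<alpha>))"
  define b' where "b' = b * P B * (Sp \<eta> * P C)"
  have "a' * x * b' = sc (inverse (c \<alpha>)) * (P C * Tp \<eta> * y * Sp \<eta> * P C)"
    unfolding a'_def b'_def y_def by (simp only: mult.assoc)
  also have "\<dots> = sc (inverse (c \<alpha>) * c \<alpha>) * P C" unfolding eq by (simp only: sc_mult mult.assoc)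
  finally have "a' * x * b' = P C" using c\<alpha> by simp
  moreover have "a' \<in> alg" unfolding a'_def
    by (rule alg_sc, rule alg_mult; rule alg_P_Tp) (use \<eta> C B \<alpha>E in auto)
  moreover have "b' \<in> alg" unfolding b'_def
    by (rule alg_mult[OF alg_mult[OF b alg_P[OF B(1)]] alg_Sp_P[OF \<eta> C(1)]])
  ultimately show ?thesis using C by blast
qed

end

section \<open>Laurent polynomials\<close>

lemma poly_mapping_eq_sum_single:
  "f = (\<Sum>k\<in>Poly_Mapping.keys f. Poly_Mapping.single k (Poly_Mapping.lookup f k))"
  by (rule poly_mapping_eqI) (simp add: lookup_sum lookup_single when_def in_keys_iff sum.delta)

lemma lookup_single_mult_int:
  "Poly_Mapping.lookup (Poly_Mapping.single d c * f) k = c * Poly_Mapping.lookup f (k - d)"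
  for f :: "int \<Rightarrow>\<^sub>0 'k::comm_semiring_1"
proof -
  have "Poly_Mapping.single d c * f =
      (\<Sum>l\<in>Poly_Mapping.keys f. Poly_Mapping.single (d + l) (c * Poly_Mapping.lookup f l))"
    by (subst (1) poly_mapping_eq_sum_single) (simp add: sum_distrib_left mult_single)
  then have "Poly_Mapping.lookup (Poly_Mapping.single d c * f) k =
      (\<Sum>l\<in>Poly_Mapping.keys f. if d + l = k then c * Poly_Mapping.lookup f l else 0)"
    by (auto simp: lookup_sum lookup_single when_def intro!: sum.cong)
  also have "\<dots> = (\<Sum>l\<in>Poly_Mapping.keys f. if l = k - d then c * Poly_Mapping.lookup f l else 0)"
    by (intro sum.cong refl) (simp add: algebra_simps eq_diff_eq)
  finally show ?thesis by (simp add: in_keys_iff)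
qed

text \<open>Subtracting a monomial multiple of \<open>f\<close> removes the leading term of \<open>g\<close> and creates no term
  outside the range of exponents of \<open>g\<close>, provided that \<open>f\<close> is not longer than \<open>g\<close>.\<close>

lemma laurent_step:
  fixes f g :: "int \<Rightarrow>\<^sub>0 'k::field"
  assumes f: "f \<noteq> 0" and g: "g \<noteq> 0"
    and len: "Max (Poly_Mapping.keys f) - Min (Poly_Mapping.keys f) \<le>
      Max (Poly_Mapping.keys g) - Min (Poly_Mapping.keys g)"
  shows "\<exists>q. g - q * f = 0 \<or> Max (Poly_Mapping.keys (g - q * f)) - Min (Poly_Mapping.keys (g - q * f)) <
      Max (Poly_Mapping.keys g) - Min (Poly_Mapping.keys g)"
proof -
  let ?K = "Poly_Mapping.keys :: (int \<Rightarrow>\<^sub>0 'k) \<Rightarrow> int set"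
  have ne: "?K f \<noteq> {}" "?K g \<noteq> {}" using f g by auto
  define q where "q = Poly_Mapping.single (Max (?K g) - Max (?K f))
    (Poly_Mapping.lookup g (Max (?K g)) / Poly_Mapping.lookup f (Max (?K f)))"
  define h where "h = g - q * f"
  have fM: "Poly_Mapping.lookup f (Max (?K f)) \<noteq> 0" using Max_in[OF _ ne(1)] by (simp add: in_keys_iff)
  have h: "Poly_Mapping.lookup h k = Poly_Mapping.lookup g k -
      Poly_Mapping.lookup g (Max (?K g)) / Poly_Mapping.lookup f (Max (?K f)) *
      Poly_Mapping.lookup f (k - (Max (?K g) - Max (?K f)))" for k
    unfolding h_def q_def by (simp add: lookup_minus lookup_single_mult_int)
  have keys: "Min (?K g) \<le> k \<and> k < Max (?K g)" if k: "k \<in> ?K h" for k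
  proof -
    have "k \<in> ?K g \<or> k - (Max (?K g) - Max (?K f)) \<in> ?K f" using k h[of k] by (auto simp: in_keys_iff)
    then have "Min (?K g) \<le> k \<and> k \<le> Max (?K g)"
    proof
      assume "k - (Max (?K g) - Max (?K f)) \<in> ?K f"
      then have "Min (?K f) \<le> k - (Max (?K g) - Max (?K f))" "k - (Max (?K g) - Max (?K f)) \<le> Max
          (?K f)" by auto
      then show ?thesis using len by linarith
    qed auto
    moreover have "k \<noteq> Max (?K g)" using k h[of "Max (?K g)"] fM by (auto simp: in_keys_iff)
    ultimately show ?thesis by auto
  qed
  have "Max (?K h) - Min (?K h) < Max (?K g) - Min (?K g)" if "h \<noteq> 0"
  proof -
    have "?K h \<noteq> {}" using that by simp
    then have "Max (?K h) \<in> ?K h" "Min (?K h) \<in> ?K h" by auto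
    then show ?thesis using keys[of "Max (?K h)"] keys[of "Min (?K h)"] by linarith
  qed
  then show ?thesis unfolding h_def by blast
qed

text \<open>A nonzero element with the shortest range of exponents generates the ideal.\<close>

lemma laurent_principal:
  fixes J :: "(int \<Rightarrow>\<^sub>0 'k::field) set"
  assumes diff: "\<And>f g. f \<in> J \<Longrightarrow> g \<in> J \<Longrightarrow> f - g \<in> J" and mult: "\<And>q f. f \<in> J \<Longrightarrow> q * f \<in> J"
    and nonzero: "f\<^sub>0 \<in> J" "f\<^sub>0 \<noteq> 0"
  shows "\<exists>f\<in>J. f \<noteq> 0 \<and> (\<forall>g\<in>J. f dvd g)"
proof -
  define len where "len f = nat (Max (Poly_Mapping.keys f) - Min (Poly_Mapping.keys f))" for f ::
      "int \<Rightarrow>\<^sub>0 'k"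
  have pos: "0 \<le> Max (Poly_Mapping.keys f) - Min (Poly_Mapping.keys f)" if "f \<noteq> 0" for f :: "int \<Rightarrow>\<^sub>0 'k"
    using that by simp
  obtain f where f: "f \<in> J" "f \<noteq> 0" "\<And>g. g \<in> J \<Longrightarrow> g \<noteq> 0 \<Longrightarrow> len f \<le> len g"
    using ex_has_least_nat[of "\<lambda>f. f \<in> J \<and> f \<noteq> 0" f\<^sub>0 len] nonzero by blast
  have "g \<in> J \<Longrightarrow> f dvd g" for g
  proof (induction "len g" arbitrary: g rule: less_induct)
    case less
    show ?case
    proof (cases "g = 0")
      case False
      have "len f \<le> len g" using f(3) less.prems False by blast
      then have "Max (Poly_Mapping.keys f) - Min (Poly_Mapping.keys f) \<le>
          Max (Poly_Mapping.keys g) - Min (Poly_Mapping.keys g)"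
        using pos[OF False] by (simp add: len_def nat_le_eq_zle)
      then obtain q where q: "g - q * f = 0 \<or> Max (Poly_Mapping.keys (g - q * f)) - Min
          (Poly_Mapping.keys (g - q * f)) <
          Max (Poly_Mapping.keys g) - Min (Poly_Mapping.keys g)" using laurent_step[OF f(2) False]
              by blast
      have J: "g - q * f \<in> J" using diff mult less.prems f by blast
      have "f dvd g - q * f"
      proof (cases "g - q * f = 0")
        case ne: False
        have "len (g - q * f) < len g" using q ne pos[OF ne] unfolding len_def by linarith
        then show ?thesis using less.hyps J by blast
      qed simp
      then show ?thesis using dvd_add[of f "g - q * f" "q * f"] by simp
    qed simp
  qed
  then show ?thesis using f by blast
qed

lemma laurent_prime_principal:
  fixes J :: "(int \<Rightarrow>\<^sub>0 'k::field) set"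
  assumes "\<And>f g. f \<in> J \<Longrightarrow> g \<in> J \<Longrightarrow> f - g \<in> J" "\<And>q f. f \<in> J \<Longrightarrow> q * f \<in> J"
    and "f\<^sub>0 \<in> J" "f\<^sub>0 \<noteq> 0" and one: "1 \<notin> J"
    and prime: "\<And>f g. f * g \<in> J \<Longrightarrow> f \<in> J \<or> g \<in> J"
  shows "\<exists>f\<in>J. irreducible f \<and> (\<forall>g\<in>J. f dvd g)"
proof -
  obtain f where f: "f \<in> J" "f \<noteq> 0" "\<forall>g\<in>J. f dvd g" using laurent_principal[OF assms(1-4)] by blast
  have unit: "b dvd 1" if ab: "f = a * b" and a: "a \<in> J" for a b
  proof -
    obtain c where "a = f * c" using f a by blast
    then have "f * 1 = f * (c * b)" using ab by (metis mult.assoc mult_1_right)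
    then have "1 = c * b" using mult_left_cancel[OF f(2), of 1 "c * b"] by blast
    then show ?thesis by (metis dvd_triv_right)
  qed
  have "irreducible f"
  proof (rule irreducibleI)
    show "f \<noteq> 0" by (rule f)
    show "\<not> f dvd 1"
    proof
      assume "f dvd 1"
      then obtain c where "1 = f * c" by blast
      then show False using one assms(2)[OF f(1), of c] by (simp add: mult.commute)
    qed
    fix a b assume ab: "f = a * b"
    then have "a \<in> J \<or> b \<in> J" using prime f(1) by simp
    then show "a dvd 1 \<or> b dvd 1" using unit[of a b] unit[of b a] ab by (auto simp: mult.commute)
  qed
  then show ?thesis using f by blast
qed

lemma laurent_bezout:
  fixes f g :: "int \<Rightarrow>\<^sub>0 'k::field"
  assumes f: "irreducible f" and g: "\<not> f dvd g"
  shows "\<exists>a b. a * f + b * g = 1"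
proof -
  define J where "J = {a * f + b * g | a b. True}"
  have "f \<noteq> 0" using f by auto
  moreover have "f \<in> J" "g \<in> J"
    unfolding J_def by (auto intro: exI[of _ 0] exI[of _ 1] simp: exI[of _ 1])
  moreover have "x - y \<in> J" if "x \<in> J" "y \<in> J" for x y
  proof -
    obtain a b where "x = a * f + b * g" using \<open>x \<in> J\<close> unfolding J_def by blast
    moreover obtain a' b' where "y = a' * f + b' * g" using \<open>y \<in> J\<close> unfolding J_def by blast
    ultimately have "x - y = (a - a') * f + (b - b') * g" by (simp add: algebra_simps)
    then show ?thesis unfolding J_def by blast
  qed
  moreover have mult: "q * x \<in> J" if "x \<in> J" for q x
  proof -
    obtain a b where "x = a * f + b * g" using \<open>x \<in> J\<close> unfolding J_def by blast
    then have "q * x = (q * a) * f + (q * b) * g" by (simp add: algebra_simps)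
    then show ?thesis unfolding J_def by blast
  qed
  ultimately obtain d where d: "d \<in> J" "d dvd f" "d dvd g" using laurent_principal[of J f] by blast
  then obtain e where e: "f = d * e" by blast
  have "d dvd 1"
  proof (rule ccontr)
    assume "\<not> d dvd 1"
    then have "e dvd 1" using irreducibleD[OF f e] by blast
    then obtain e' where "1 = e * e'" by blast
    then have "d = f * e'" using e by (metis mult.assoc mult_1_right)
    then show False using g d(3) by (metis dvd_mult_left)
  qed
  then obtain c where "1 = c * d" by (auto simp: dvd_def mult.commute)
  then have "1 \<in> J" using mult[OF d(1), of c] by simp
  then obtain a b where "1 = a * f + b * g" unfolding J_def by blast
  then show ?thesis by metis
qed


section \<open>The ring of additive endomorphisms\<close>

text \<open>The additive endomorphisms of an abelian group, with composition as multiplication. The group is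
  assumed to be nontrivial because a unital ring is required to satisfy \<open>0 \<noteq> 1\<close>.\<close>

typedef (overloaded) 'a endo = "{f :: 'a::{ab_group_add, zero_neq_one} \<Rightarrow> 'a. \<forall>x y. f (x + y) = f x
    + f y}"
  morphisms app Endo
  by (intro exI[of _ id]) simp

setup_lifting type_definition_endo

instantiation endo :: ("{ab_group_add, zero_neq_one}") ring_1
begin

lift_definition zero_endo :: "'a endo" is "\<lambda>_. 0" by simp
lift_definition one_endo :: "'a endo" is "\<lambda>x. x" by simp
lift_definition plus_endo :: "'a endo \<Rightarrow> 'a endo \<Rightarrow> 'a endo" is "\<lambda>f g x. f x + g x"
  by (simp add: algebra_simps)
lift_definition minus_endo :: "'a endo \<Rightarrow> 'a endo \<Rightarrow> 'a endo" is "\<lambda>f g x. f x - g x"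
  by (simp add: algebra_simps)
lift_definition uminus_endo :: "'a endo \<Rightarrow> 'a endo" is "\<lambda>f x. - f x"
  by simp
lift_definition times_endo :: "'a endo \<Rightarrow> 'a endo \<Rightarrow> 'a endo" is "\<lambda>f g x. f (g x)"
  by simp

instance
proof
  show "(0 :: 'a endo) \<noteq> 1" by transfer (metis zero_neq_one)
qed (transfer; force simp: algebra_simps)+

end

lemma endo_eqI: "(\<And>x. app f x = app g x) \<Longrightarrow> f = g"
  by (simp add: app_inject[symmetric] ext)

section \<open>Ideals of the algebra in terms of the free algebra\<close>

text \<open>Scalar multiplication, available on the unital free algebra and not only on the carrier of the
  non-unital one.\<close>

definition scal :: "'k::field \<Rightarrow> ('x free_monoid \<Rightarrow>\<^sub>0 'k) \<Rightarrow> 'x free_monoid \<Rightarrow>\<^sub>0 'k" where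
  "scal c f = Poly_Mapping.single 0 c * f"

abbreviation FA :: "'x set \<Rightarrow> ('x free_monoid \<Rightarrow>\<^sub>0 'k::field) set" where
  "FA X \<equiv> carrier (free_alg X)"

lemma free_alg_simps [simp]:
  "f \<otimes>\<^bsub>free_alg X\<^esub> g = f * g" "f \<oplus>\<^bsub>free_alg X\<^esub> g = f + g" "\<zero>\<^bsub>free_alg X\<^esub> = 0" "c \<odot>\<^bsub>free_alg X\<^esub> f = scal c f"
  by (simp_all add: free_alg_def scal_def)

lemma mem_FA: "f \<in> FA X \<longleftrightarrow> (\<forall>w\<in>Poly_Mapping.keys f. letters w \<noteq> [] \<and> set (letters w) \<subseteq> X)"
  by (simp add: free_alg_def)

lemma letters_plus [simp]: "letters (a + b) = letters a @ letters b" "letters 0 = []"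
  by (simp_all add: plus_free_monoid_def zero_free_monoid_def)

lemma FA_0 [simp]: "0 \<in> FA X" by (simp add: mem_FA)

lemma FA_add: "f \<in> FA X \<Longrightarrow> g \<in> FA X \<Longrightarrow> f + g \<in> FA X"
  using Poly_Mapping.keys_add[of f g] unfolding mem_FA by blast

lemma FA_uminus: "f \<in> FA X \<Longrightarrow> - f \<in> FA X"
  by (simp add: mem_FA in_keys_iff)

lemma FA_diff: "f \<in> FA X \<Longrightarrow> g \<in> FA X \<Longrightarrow> f - g \<in> FA X"
  using FA_add[OF _ FA_uminus, of f X g] by simp

lemma FA_mult_words:
  assumes "f \<in> FA X" "\<forall>w\<in>Poly_Mapping.keys g. set (letters w) \<subseteq> X"
  shows "f * g \<in> FA X" "g * f \<in> FA X"
proof -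
  have fg: "letters a \<noteq> [] \<and> set (letters a) \<subseteq> X \<and> set (letters b) \<subseteq> X"
    if "a \<in> Poly_Mapping.keys f" "b \<in> Poly_Mapping.keys g" for a b
    using assms that unfolding mem_FA by blast
  show "f * g \<in> FA X" unfolding mem_FA
  proof
    fix w assume "w \<in> Poly_Mapping.keys (f * g)"
    then obtain a b where "w = a + b" "a \<in> Poly_Mapping.keys f" "b \<in> Poly_Mapping.keys g"
      using Poly_Mapping.keys_mult[of f g] by blast
    then show "letters w \<noteq> [] \<and> set (letters w) \<subseteq> X" using fg[of a b] by simp
  qed
  show "g * f \<in> FA X" unfolding mem_FA
  proof
    fix w assume "w \<in> Poly_Mapping.keys (g * f)"
    then obtain a b where "w = b + a" "a \<in> Poly_Mapping.keys f" "b \<in> Poly_Mapping.keys g"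
      using Poly_Mapping.keys_mult[of g f] by blast
    then show "letters w \<noteq> [] \<and> set (letters w) \<subseteq> X" using fg[of a b] by simp
  qed
qed

lemma FA_mult: "f \<in> FA X \<Longrightarrow> g \<in> FA X \<Longrightarrow> f * g \<in> FA X"
  by (rule FA_mult_words(1)) (auto simp: mem_FA)

lemma FA_scal: "f \<in> FA X \<Longrightarrow> scal c f \<in> FA X"
  unfolding scal_def by (rule FA_mult_words(2)) (auto simp: mem_FA)

lemma FA_gen: "x \<in> X \<Longrightarrow> free_gen x \<in> FA X"
  by (simp add: mem_FA free_gen_def)

lemma FA_sum: "(\<And>i. i \<in> I \<Longrightarrow> f i \<in> FA X) \<Longrightarrow> sum f I \<in> FA X"
  by (induction I rule: infinite_finite_induct) (auto intro: FA_add)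

lemma single_0_central: "Poly_Mapping.single 0 c * f = f * Poly_Mapping.single 0 c"
  for f :: "'x free_monoid \<Rightarrow>\<^sub>0 'k::field"
proof -
  have "Poly_Mapping.single 0 c * f = (\<Sum>w\<in>Poly_Mapping.keys f. Poly_Mapping.single w (c *
      Poly_Mapping.lookup f w))"
    by (subst (1) poly_mapping_eq_sum_single) (simp add: sum_distrib_left mult_single)
  moreover have "f * Poly_Mapping.single 0 c = (\<Sum>w\<in>Poly_Mapping.keys f. Poly_Mapping.single w
      (Poly_Mapping.lookup f w * c))"
    by (subst (1) poly_mapping_eq_sum_single) (simp add: sum_distrib_right mult_single)
  ultimately show ?thesis by (simp add: mult.commute)
qed

lemma scal_simps: "scal c (f + g) = scal c f + scal c g" "scal c (f - g) = scal c f - scal c g"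
  "scal c (f * g) = scal c f * g" "scal (a + b) f = scal a f + scal b f" "scal 1 f = f"
  "scal a (scal b f) = scal (a * b) f" "scal c 0 = 0" "scal 0 f = 0"
  by (simp_all add: scal_def distrib_left distrib_right right_diff_distrib mult.assoc single_add)
    (simp add: mult.assoc[symmetric] mult_single)

lemma scal_mult_right: "scal c (f * g) = f * scal c g"
proof -
  have "scal c (f * g) = (Poly_Mapping.single 0 c * f) * g" by (simp add: scal_def mult.assoc)
  then show ?thesis unfolding single_0_central[of c f] by (simp add: scal_def mult.assoc)
qed

lemma scal_single: "scal c (Poly_Mapping.single w d) = Poly_Mapping.single w (c * d)"
  by (simp add: scal_def mult_single)

text \<open>Two-sided ideals of the non-unital free algebra, in terms of the operations of the unital one.\<close>

definition raw_ideal :: "'x set \<Rightarrow> ('x free_monoid \<Rightarrow>\<^sub>0 'k::field) set \<Rightarrow> bool" where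
  "raw_ideal X N \<longleftrightarrow> N \<subseteq> FA X \<and> 0 \<in> N \<and> (\<forall>x\<in>N. \<forall>y\<in>N. x - y \<in> N) \<and>
     (\<forall>a\<in>FA X. \<forall>x\<in>N. a * x \<in> N \<and> x * a \<in> N)"

lemma raw_idealI:
  assumes "\<And>x. x \<in> N \<Longrightarrow> x \<in> FA X" "0 \<in> N" "\<And>x y. x \<in> N \<Longrightarrow> y \<in> N \<Longrightarrow> x - y \<in> N"
    "\<And>a x. a \<in> FA X \<Longrightarrow> x \<in> N \<Longrightarrow> a * x \<in> N" "\<And>a x. a \<in> FA X \<Longrightarrow> x \<in> N \<Longrightarrow> x * a \<in> N"
  shows "raw_ideal X N"
  unfolding raw_ideal_def using assms by blast

lemma raw_idealD:
  assumes "raw_ideal X N"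
  shows "x \<in> N \<Longrightarrow> x \<in> FA X" "0 \<in> N" "x \<in> N \<Longrightarrow> y \<in> N \<Longrightarrow> x - y \<in> N"
    "a \<in> FA X \<Longrightarrow> x \<in> N \<Longrightarrow> a * x \<in> N" "a \<in> FA X \<Longrightarrow> x \<in> N \<Longrightarrow> x * a \<in> N"
    "x \<in> N \<Longrightarrow> - x \<in> N" "x \<in> N \<Longrightarrow> y \<in> N \<Longrightarrow> x + y \<in> N"
proof -
  show 1: "x \<in> N \<Longrightarrow> x \<in> FA X" "0 \<in> N" "a \<in> FA X \<Longrightarrow> x \<in> N \<Longrightarrow> a * x \<in> N" "a \<in> FA X \<Longrightarrow> x \<in> N \<Longrightarrow> x * a \<in> N"
      for x a
    using assms unfolding raw_ideal_def by blast+
  show d: "x \<in> N \<Longrightarrow> y \<in> N \<Longrightarrow> x - y \<in> N" for x y using assms unfolding raw_ideal_def by blast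
  show u: "x \<in> N \<Longrightarrow> - x \<in> N" for x using d[OF 1(2), of x] by simp
  show "x \<in> N \<Longrightarrow> y \<in> N \<Longrightarrow> x + y \<in> N" using d[OF _ u, of x y] by simp
qed

lemma raw_ideal_sum: "raw_ideal X N \<Longrightarrow> (\<And>i. i \<in> I \<Longrightarrow> f i \<in> N) \<Longrightarrow> sum f I \<in> N"
  by (induction I rule: infinite_finite_induct) (auto intro: raw_idealD)

lemma two_sided_ideal_iff:
  "two_sided_ideal R N \<longleftrightarrow> N \<subseteq> carrier R \<and> \<zero>\<^bsub>R\<^esub> \<in> N \<and> (\<forall>x\<in>N. \<forall>y\<in>N. x \<oplus>\<^bsub>R\<^esub> y \<in> N) \<and>
     (\<forall>x\<in>N. \<ominus>\<^bsub>R\<^esub> x \<in> N) \<and> (\<forall>a\<in>carrier R. \<forall>x\<in>N. a \<otimes>\<^bsub>R\<^esub> x \<in> N \<and> x \<otimes>\<^bsub>R\<^esub> a \<in> N)"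
  unfolding two_sided_ideal_def additive_subgroup_def subgroup_def by (auto simp: a_inv_def)

lemma abelian_group_free_alg: "abelian_group (free_alg X)"
proof (rule abelian_groupI)
  fix x assume "x \<in> FA X"
  then show "\<exists>y\<in>FA X. y \<oplus>\<^bsub>free_alg X\<^esub> x = \<zero>\<^bsub>free_alg X\<^esub>" using FA_uminus by (intro bexI[of _ "- x"]) auto
qed (auto intro: FA_add simp: ac_simps)

lemma a_inv_free_alg: "x \<in> FA X \<Longrightarrow> \<ominus>\<^bsub>free_alg X\<^esub> x = - x"
  by (rule abelian_group.minus_equality[OF abelian_group_free_alg]) (auto intro: FA_uminus)

lemma two_sided_ideal_free_alg: "two_sided_ideal (free_alg X) N \<longleftrightarrow> raw_ideal X N"
proof
  assume l: "two_sided_ideal (free_alg X) N"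
  show "raw_ideal X N"
  proof (rule raw_idealI)
    fix x y assume "x \<in> N" "y \<in> N"
    then have "x + (- y) \<in> N" using l a_inv_free_alg[of y X] unfolding two_sided_ideal_iff
      by (metis free_alg_simps(2) subsetD)
    then show "x - y \<in> N" by simp
  qed (use l in \<open>auto simp: two_sided_ideal_iff\<close>)
next
  assume r: "raw_ideal X N"
  show "two_sided_ideal (free_alg X) N"
    unfolding two_sided_ideal_iff using raw_idealD[OF r] by (auto simp: a_inv_free_alg)
qed

lemma gen_FA: "A \<in> gen_verts G \<Longrightarrow> free_gen (Proj A) \<in> FA (lpa_gens G)"
  "e \<in> edges G \<Longrightarrow> free_gen (Edge e) \<in> FA (lpa_gens G)"
  "e \<in> edges G \<Longrightarrow> free_gen (Ghost e) \<in> FA (lpa_gens G)"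
  by (auto intro!: FA_gen simp: lpa_gens_def)

context ultragraph
begin

lemmas gen_verts_intros = gen_verts.vertex[OF src_closed] gen_verts.vertex gen_verts.range
  gen_verts.union gen_verts.inter gen_verts.empty

lemma relations_FA: "x \<in> lpa_relations G \<Longrightarrow> x \<in> FA (lpa_gens G)"
  unfolding lpa_relations_def Let_def
  by (auto simp: out_edges_def src_closed
      intro!: FA_diff FA_add FA_mult FA_sum gen_FA gen_verts_intros)

end

lemma raw_ideal_FA: "raw_ideal X (FA X)"
  by (intro raw_idealI) (auto intro: FA_diff FA_mult)

lemma raw_ideal_Inter:
  assumes "\<And>N. N \<in> \<N> \<Longrightarrow> raw_ideal X N" "\<N> \<noteq> {}"
  shows "raw_ideal X (\<Inter>\<N>)"
  using assms by (intro raw_idealI) (auto dest: raw_idealD)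

lemma rel_ideal_eq: "lpa_rel_ideal G = \<Inter>{N. raw_ideal (lpa_gens G) N \<and> {scal c x | c x. x \<in>
    lpa_relations G} \<subseteq> N}"
  unfolding lpa_rel_ideal_def ideal_gen_def two_sided_ideal_free_alg by simp

lemma rel_ideal_least:
  "raw_ideal (lpa_gens G) N \<Longrightarrow> (\<And>c x. x \<in> lpa_relations G \<Longrightarrow> scal c x \<in> N) \<Longrightarrow> lpa_rel_ideal G \<subseteq> N"
  unfolding rel_ideal_eq by blast

lemma relations_rel_ideal: "x \<in> lpa_relations G \<Longrightarrow> scal c x \<in> lpa_rel_ideal G"
  unfolding rel_ideal_eq by blast

context ultragraph
begin

lemma raw_rel_ideal: "raw_ideal (lpa_gens G) (lpa_rel_ideal G :: ('v, 'e, 'k::field) lpa_free set)"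
proof -
  have "FA (lpa_gens G) \<in> {N. raw_ideal (lpa_gens G) N \<and>
      {scal c x | (c::'k) x. x \<in> lpa_relations G} \<subseteq> N}"
    using raw_ideal_FA FA_scal relations_FA by blast
  then show ?thesis unfolding rel_ideal_eq by (intro raw_ideal_Inter) auto
qed

lemmas rel_idealD = raw_idealD[OF raw_rel_ideal]

lemma rel_ideal_scal:
  fixes x :: "('v, 'e, 'k::field) lpa_free"
  shows "x \<in> lpa_rel_ideal G \<Longrightarrow> scal c x \<in> lpa_rel_ideal G"
proof -
  let ?N = "{x :: ('v, 'e, 'k) lpa_free. x \<in> lpa_rel_ideal G \<and> (\<forall>c. scal c x \<in> lpa_rel_ideal G)}"
  have "raw_ideal (lpa_gens G) ?N"
  proof (rule raw_idealI)
    fix a x :: "('v, 'e, 'k) lpa_free" assume a: "a \<in> FA (lpa_gens G)" and x: "x \<in> ?N"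
    show "a * x \<in> ?N" using x rel_idealD(4)[OF a] by (simp add: scal_mult_right)
    show "x * a \<in> ?N" using x rel_idealD(5)[OF a] by (simp add: scal_simps)
  qed (auto simp: scal_simps intro: rel_idealD)
  then have "lpa_rel_ideal G \<subseteq> ?N"
    by (rule rel_ideal_least) (auto simp: scal_simps intro: relations_rel_ideal)
  then show "x \<in> lpa_rel_ideal G \<Longrightarrow> scal c x \<in> lpa_rel_ideal G" by blast
qed


subsection \<open>The quotient algebra\<close>

lemma lpa_class_eq: "lpa_class G x = {a + x | a. a \<in> lpa_rel_ideal G}"
  unfolding lpa_class_def a_r_coset_def' by auto

lemma lpa_class_eq_iff:
  fixes x y :: "('v, 'e, 'k::field) lpa_free"
  shows "lpa_class G x = lpa_class G y \<longleftrightarrow> x - y \<in> lpa_rel_ideal G"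
proof
  assume "lpa_class G x = lpa_class G y"
  moreover have "0 + x \<in> lpa_class G x" unfolding lpa_class_eq using rel_idealD(2) by blast
  ultimately obtain a where "x = a + y" "a \<in> lpa_rel_ideal G" unfolding lpa_class_eq by auto
  then show "x - y \<in> lpa_rel_ideal G" by simp
next
  assume d: "x - y \<in> lpa_rel_ideal G"
  have "lpa_class G x \<subseteq> lpa_class G y" if d: "x - y \<in> lpa_rel_ideal G" for x y :: "('v, 'e, 'k)
      lpa_free"
  proof
    fix z assume "z \<in> lpa_class G x"
    then obtain a where a: "z = a + x" "a \<in> lpa_rel_ideal G" by (auto simp: lpa_class_eq)
    have "z = (a + (x - y)) + y" by (simp add: a)
    then show "z \<in> lpa_class G y" unfolding lpa_class_eq using rel_idealD(7)[OF a(2) d] by blast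
  qed
  moreover have "y - x \<in> lpa_rel_ideal G" using rel_idealD(6)[OF d] by simp
  ultimately show "lpa_class G x = lpa_class G y" using d by (simp add: subset_antisym)
qed

lemma mem_lpa_class: "y \<in> lpa_class G x \<longleftrightarrow> y - x \<in> lpa_rel_ideal G"
  unfolding lpa_class_eq by (auto intro: exI[of _ "y - x"])

lemma lpa_class_FA: "x \<in> FA (lpa_gens G) \<Longrightarrow> y \<in> lpa_class G x \<Longrightarrow> y \<in> FA (lpa_gens G)"
  using FA_add[OF rel_idealD(1), of "y - x" x] by (simp add: mem_lpa_class)

lemma carrier_lpa: "carrier (lpa G) = lpa_class G ` FA (lpa_gens G)"
  by (auto simp: lpa_def A_RCOSETS_def' lpa_class_def)

lemma lpa_zero: "\<zero>\<^bsub>lpa G\<^esub> = lpa_class G 0"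
  by (auto simp: lpa_def lpa_class_eq)

lemma lpa_add:
  assumes "x \<in> FA (lpa_gens G)" "y \<in> FA (lpa_gens G)"
  shows "lpa_class G x \<oplus>\<^bsub>lpa G\<^esub> lpa_class G y = lpa_class G (x + y)"
proof -
  have "lpa_class G x \<oplus>\<^bsub>lpa G\<^esub> lpa_class G y = {a + b | a b. a \<in> lpa_class G x \<and> b \<in> lpa_class G y}"
    by (auto simp: lpa_def set_add_defs)
  also have "\<dots> = lpa_class G (x + y)"
  proof (intro equalityI subsetI)
    fix z assume "z \<in> {a + b | a b. a \<in> lpa_class G x \<and> b \<in> lpa_class G y}"
    then obtain a b where z: "z = a + b" "a - x \<in> lpa_rel_ideal G" "b - y \<in> lpa_rel_ideal G"
      by (auto simp: mem_lpa_class)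
    have "z - (x + y) = (a - x) + (b - y)" using z by simp
    then show "z \<in> lpa_class G (x + y)" unfolding mem_lpa_class by (simp only: rel_idealD(7)[OF z(2,3)])
  next
    fix z assume "z \<in> lpa_class G (x + y)"
    then have "z = (z - y) + y" "z - y \<in> lpa_class G x" "y \<in> lpa_class G y"
      using rel_idealD(2) by (simp_all add: mem_lpa_class algebra_simps)
    then show "z \<in> {a + b | a b. a \<in> lpa_class G x \<and> b \<in> lpa_class G y}" by blast
  qed
  finally show ?thesis .
qed

lemma lpa_mult:
  fixes x y :: "('v, 'e, 'k::field) lpa_free"
  assumes x: "x \<in> FA (lpa_gens G)" and y: "y \<in> FA (lpa_gens G)"
  shows "lpa_class G x \<otimes>\<^bsub>lpa G\<^esub> lpa_class G y = lpa_class G (x * y)"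
proof -
  have "lpa_class G x \<otimes>\<^bsub>lpa G\<^esub> lpa_class G y = (\<Union>a\<in>lpa_class G x. \<Union>b\<in>lpa_class G y. lpa_class G (a * b))"
    by (simp add: lpa_def rcoset_mult_def lpa_class_def)
  also have "\<dots> = (\<Union>a\<in>lpa_class G x. \<Union>b\<in>lpa_class G y. lpa_class G (x * y))"
  proof (intro SUP_cong refl)
    fix a b assume ab: "a \<in> lpa_class G x" "b \<in> lpa_class G y"
    have "a * b - x * y = (a - x) * b + x * (b - y)" by (simp add: algebra_simps)
    moreover have "(a - x) * b \<in> lpa_rel_ideal G" "x * (b - y) \<in> lpa_rel_ideal G"
      using ab lpa_class_FA[OF y] x by (auto simp: mem_lpa_class intro: rel_idealD)
    ultimately show "lpa_class G (a * b) = lpa_class G (x * y)"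
      using rel_idealD(7) by (simp add: lpa_class_eq_iff)
  qed
  also have "\<dots> = lpa_class G (x * y)"
    using rel_idealD(2) mem_lpa_class[of x x] mem_lpa_class[of y y] by auto
  finally show ?thesis .
qed

lemma lpa_smult: "c \<odot>\<^bsub>lpa G\<^esub> lpa_class G x = lpa_class G (scal c x)"
proof -
  have "lpa_class G (scal c a) = lpa_class G (scal c x)" if "a \<in> lpa_class G x" for a
    using rel_ideal_scal[of "a - x" c] that by (simp add: mem_lpa_class lpa_class_eq_iff scal_simps)
  then have "(\<Union>a\<in>lpa_class G x. lpa_class G (scal c a)) = (\<Union>a\<in>lpa_class G x. lpa_class G (scal c x))"
    by (intro SUP_cong refl)
  moreover have "x \<in> lpa_class G x" using rel_idealD(2) by (simp add: mem_lpa_class)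
  then have "(\<Union>a\<in>lpa_class G x. lpa_class G (scal c x)) = lpa_class G (scal c x)"
    by (metis cSUP_const empty_iff)
  ultimately show ?thesis by (simp add: lpa_def)
qed

lemma abelian_group_lpa: "abelian_group (lpa G)"
proof (rule abelian_groupI)
  fix x assume "x \<in> carrier (lpa G)"
  then obtain a where "x = lpa_class G a" "a \<in> FA (lpa_gens G)" by (auto simp: carrier_lpa)
  then show "\<exists>y\<in>carrier (lpa G). y \<oplus>\<^bsub>lpa G\<^esub> x = \<zero>\<^bsub>lpa G\<^esub>"
    by (intro bexI[of _ "lpa_class G (- a)"]) (auto simp: lpa_add lpa_zero carrier_lpa FA_uminus)
qed (auto simp: carrier_lpa lpa_zero lpa_add FA_add ac_simps)

lemma lpa_uminus: "x \<in> FA (lpa_gens G) \<Longrightarrow> \<ominus>\<^bsub>lpa G\<^esub> lpa_class G x = lpa_class G (- x)"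
  by (rule abelian_group.minus_equality[OF abelian_group_lpa])
    (auto simp: lpa_add lpa_zero carrier_lpa FA_uminus)

lemma lpa_minus: "x \<in> FA (lpa_gens G) \<Longrightarrow> y \<in> FA (lpa_gens G) \<Longrightarrow>
    lpa_class G x \<ominus>\<^bsub>lpa G\<^esub> lpa_class G y = lpa_class G (x - y)"
  by (simp add: a_minus_def lpa_uminus lpa_add FA_uminus)

lemma lpa_finsum:
  assumes "finite A" "\<And>i. i \<in> A \<Longrightarrow> f i \<in> FA (lpa_gens G)"
  shows "finsum (lpa G) (\<lambda>i. lpa_class G (f i)) A = lpa_class G (sum f A)"
proof -
  interpret abelian_group "lpa G" by (rule abelian_group_lpa)
  show ?thesis using assms
  proof (induction A rule: finite_induct)
    case (insert i A)
    then have "finsum (lpa G) (\<lambda>i. lpa_class G (f i)) (insert i A) =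
        lpa_class G (f i) \<oplus>\<^bsub>lpa G\<^esub> finsum (lpa G) (\<lambda>i. lpa_class G (f i)) A"
      by (intro finsum_insert) (auto simp: carrier_lpa)
    then show ?case using insert by (simp add: lpa_add FA_sum)
  qed (simp add: lpa_zero)
qed

text \<open>Ideals of the quotient correspond to ideals of the free algebra containing the relations.\<close>

definition pre :: "('v, 'e, 'k::field) lpa_elem set \<Rightarrow> ('v, 'e, 'k) lpa_free set" where
  "pre I = {x \<in> FA (lpa_gens G). lpa_class G x \<in> I}"

definition over_ideal :: "('v, 'e, 'k::field) lpa_free set \<Rightarrow> bool" where
  "over_ideal N \<longleftrightarrow> raw_ideal (lpa_gens G) N \<and> lpa_rel_ideal G \<subseteq> N"

lemma pre_mem: "x \<in> FA (lpa_gens G) \<Longrightarrow> x \<in> pre I \<longleftrightarrow> lpa_class G x \<in> I"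
  by (simp add: pre_def)

lemma over_ideal_pre:
  fixes I :: "('v, 'e, 'k::field) lpa_elem set"
  assumes "two_sided_ideal (lpa G) I"
  shows "over_ideal (pre I)"
  unfolding over_ideal_def
proof
  note I = assms[unfolded two_sided_ideal_iff]
  show "raw_ideal (lpa_gens G) (pre I)"
  proof (rule raw_idealI)
    fix x y assume "x \<in> pre I" "y \<in> pre I"
    then have xy: "x \<in> FA (lpa_gens G)" "y \<in> FA (lpa_gens G)" "lpa_class G x \<in> I" "lpa_class G y \<in> I"
      by (auto simp: pre_def)
    then have "lpa_class G x \<oplus>\<^bsub>lpa G\<^esub> \<ominus>\<^bsub>lpa G\<^esub> lpa_class G y \<in> I" using I by blast
    then show "x - y \<in> pre I" using xy by (simp add: pre_def lpa_uminus lpa_add FA_uminus FA_diff)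
  next
    fix a x :: "('v, 'e, 'k) lpa_free" assume "a \<in> FA (lpa_gens G)" "x \<in> pre I"
    then have *: "a \<in> FA (lpa_gens G)" "x \<in> FA (lpa_gens G)" "lpa_class G x \<in> I" "lpa_class G a \<in>
        carrier (lpa G)"
      by (auto simp: pre_def carrier_lpa)
    then have "lpa_class G a \<otimes>\<^bsub>lpa G\<^esub> lpa_class G x \<in> I" "lpa_class G x \<otimes>\<^bsub>lpa G\<^esub> lpa_class G a \<in> I"
      using I by blast+
    then show "a * x \<in> pre I" "x * a \<in> pre I" using * by (simp_all add: pre_def lpa_mult FA_mult)
  qed (use I in \<open>auto simp: pre_def lpa_zero\<close>)
  show "lpa_rel_ideal G \<subseteq> pre I"
  proof
    fix x :: "('v, 'e, 'k) lpa_free" assume x: "x \<in> lpa_rel_ideal G"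
    then have "lpa_class G x = lpa_class G 0" by (simp add: lpa_class_eq_iff)
    then show "x \<in> pre I" using I rel_idealD(1)[OF x] by (simp add: pre_def lpa_zero)
  qed
qed

lemma class_mem_over:
  assumes "over_ideal N" "x \<in> FA (lpa_gens G)"
  shows "lpa_class G x \<in> lpa_class G ` N \<longleftrightarrow> x \<in> N"
proof
  assume "lpa_class G x \<in> lpa_class G ` N"
  then obtain y where y: "y \<in> N" "x - y \<in> lpa_rel_ideal G" by (auto simp: lpa_class_eq_iff)
  then have "(x - y) + y \<in> N" using assms raw_idealD(7)[of "lpa_gens G" N "x - y" y] unfolding
      over_ideal_def by blast
  then show "x \<in> N" by simp
qed blast

lemma two_sided_ideal_image:
  assumes N: "over_ideal N"
  shows "two_sided_ideal (lpa G) (lpa_class G ` N)" "pre (lpa_class G ` N) = N"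
proof -
  have r: "raw_ideal (lpa_gens G) N" using N by (simp add: over_ideal_def)
  note D = raw_idealD[OF r]
  show "two_sided_ideal (lpa G) (lpa_class G ` N)"
    unfolding two_sided_ideal_iff carrier_lpa
  proof (intro conjI ballI)
    show "lpa_class G ` N \<subseteq> lpa_class G ` FA (lpa_gens G)" using D(1) by blast
    show "\<zero>\<^bsub>lpa G\<^esub> \<in> lpa_class G ` N" using D(2) by (simp add: lpa_zero)
  qed (use D in \<open>auto simp: lpa_add lpa_mult lpa_uminus\<close>)
  show "pre (lpa_class G ` N) = N" using class_mem_over[OF N] D(1) by (auto simp: pre_def)
qed

lemma image_pre: "two_sided_ideal (lpa G) I \<Longrightarrow> lpa_class G ` pre I = I"
  by (auto simp: pre_def two_sided_ideal_iff carrier_lpa)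

lemma ideal_gen_props:
  assumes "Y \<subseteq> carrier (lpa G)"
  shows "two_sided_ideal (lpa G) (ideal_gen (lpa G) Y)" "Y \<subseteq> ideal_gen (lpa G) Y"
proof -
  have FA: "over_ideal (FA (lpa_gens G) :: ('v, 'e, 'k::field) lpa_free set)"
    unfolding over_ideal_def using raw_ideal_FA rel_idealD(1) by blast
  have ne: "carrier (lpa G) \<in> {I. two_sided_ideal (lpa G) I \<and> Y \<subseteq> I}"
    using two_sided_ideal_image(1)[OF FA] assms by (simp add: carrier_lpa)
  show "Y \<subseteq> ideal_gen (lpa G) Y" unfolding ideal_gen_def by blast
  show "two_sided_ideal (lpa G) (ideal_gen (lpa G) Y)"
    unfolding two_sided_ideal_iff[of _ "ideal_gen (lpa G) Y"]
  proof (intro conjI ballI)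
    show "ideal_gen (lpa G) Y \<subseteq> carrier (lpa G)" using ne unfolding ideal_gen_def by blast
  qed (auto simp: ideal_gen_def two_sided_ideal_iff)
qed

lemma ideal_gen_least: "two_sided_ideal R I \<Longrightarrow> Y \<subseteq> I \<Longrightarrow> ideal_gen R Y \<subseteq> I"
  unfolding ideal_gen_def by blast


subsection \<open>Homogeneous components\<close>

text \<open>The degree of a word.\<close>

definition deg :: "('v, 'e) lpa_gen free_monoid \<Rightarrow> int" where
  "deg w = sum_list (map gen_degree (letters w))"

lemma deg_add: "deg (a + b) = deg a + deg b" and deg_0: "deg 0 = 0"
  by (simp_all add: deg_def)

text \<open>The component of degree \<open>n\<close> of an element of the free algebra.\<close>

definition hproj :: "int \<Rightarrow> ('v, 'e, 'k::field) lpa_free \<Rightarrow> ('v, 'e, 'k) lpa_free" where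
  "hproj n x = (\<Sum>w\<in>{w \<in> Poly_Mapping.keys x. deg w = n}. Poly_Mapping.single w
    (Poly_Mapping.lookup x w))"

lemma lookup_hproj: "Poly_Mapping.lookup (hproj n x) w = (if deg w = n then Poly_Mapping.lookup x
    w else 0)"
  by (auto simp: hproj_def lookup_sum lookup_single when_def in_keys_iff sum.delta)

lemma keys_hproj: "Poly_Mapping.keys (hproj n x) = {w \<in> Poly_Mapping.keys x. deg w = n}"
  by (auto simp: in_keys_iff lookup_hproj split: if_splits)

lemma hproj_FA: "x \<in> FA X \<Longrightarrow> hproj n x \<in> FA X"
  by (auto simp: mem_FA keys_hproj)

lemma hproj_0: "hproj n 0 = 0" by (simp add: hproj_def)

lemma hproj_add: "hproj n (x + y) = hproj n x + hproj n y"
  by (rule poly_mapping_eqI) (simp add: lookup_hproj lookup_add)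

lemma hproj_diff: "hproj n (x - y) = hproj n x - hproj n y"
  by (rule poly_mapping_eqI) (simp add: lookup_hproj lookup_minus)

lemma hproj_sum: "hproj n (sum f I) = (\<Sum>i\<in>I. hproj n (f i))"
  by (induction I rule: infinite_finite_induct) (simp_all add: hproj_0 hproj_add)

lemma hproj_single: "hproj n (Poly_Mapping.single w c) = (if deg w = n then Poly_Mapping.single w
    c else 0)"
  by (rule poly_mapping_eqI) (auto simp: lookup_hproj lookup_single when_def)

lemma hproj_homogeneous: "\<forall>w\<in>Poly_Mapping.keys x. deg w = d \<Longrightarrow> hproj n x = (if n = d then x else 0)"
  by (rule poly_mapping_eqI) (auto simp: lookup_hproj in_keys_iff)

lemma hproj_decomp: "x = (\<Sum>n\<in>deg ` Poly_Mapping.keys x. hproj n x)"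
  by (rule poly_mapping_eqI) (simp add: lookup_sum lookup_hproj, metis imageI in_keys_iff)

lemma hproj_single_mult:
  "hproj n (Poly_Mapping.single w c * x) = Poly_Mapping.single w c * hproj (n - deg w) x"
  "hproj n (x * Poly_Mapping.single w c) = hproj (n - deg w) x * Poly_Mapping.single w c"
proof -
  show "hproj n (Poly_Mapping.single w c * x) = Poly_Mapping.single w c * hproj (n - deg w) x"
  proof (subst (1 2) poly_mapping_eq_sum_single[of x])
    show "hproj n (Poly_Mapping.single w c * (\<Sum>k\<in>Poly_Mapping.keys x. Poly_Mapping.single k
        (Poly_Mapping.lookup x k))) =
      Poly_Mapping.single w c * hproj (n - deg w) (\<Sum>k\<in>Poly_Mapping.keys x. Poly_Mapping.single k
          (Poly_Mapping.lookup x k))"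
      unfolding sum_distrib_left hproj_sum by (intro sum.cong refl) (simp add: mult_single
          hproj_single deg_add)
  qed
  show "hproj n (x * Poly_Mapping.single w c) = hproj (n - deg w) x * Poly_Mapping.single w c"
  proof (subst (1 2) poly_mapping_eq_sum_single[of x])
    show "hproj n ((\<Sum>k\<in>Poly_Mapping.keys x. Poly_Mapping.single k (Poly_Mapping.lookup x k)) *
        Poly_Mapping.single w c) =
      hproj (n - deg w) (\<Sum>k\<in>Poly_Mapping.keys x. Poly_Mapping.single k (Poly_Mapping.lookup x k))
          * Poly_Mapping.single w c"
      unfolding sum_distrib_right hproj_sum by (intro sum.cong refl) (simp add: mult_single
          hproj_single deg_add)
  qed
qed

lemma single_FA: "x \<in> FA X \<Longrightarrow> w \<in> Poly_Mapping.keys x \<Longrightarrow> Poly_Mapping.single w c \<in> FA X"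
  by (auto simp: mem_FA split: if_splits)

text \<open>The largest graded ideal contained in a given ideal.\<close>

lemma hproj_closed_ideal:
  assumes N: "over_ideal N"
  shows "raw_ideal (lpa_gens G) {x \<in> FA (lpa_gens G). \<forall>n. hproj n x \<in> N}"
proof -
  have r: "raw_ideal (lpa_gens G) N" using N by (simp add: over_ideal_def)
  note D = raw_idealD[OF r]
  have "hproj n (a * x) \<in> N \<and> hproj n (x * a) \<in> N"
    if a: "a \<in> FA (lpa_gens G)" and x: "\<forall>n. hproj n x \<in> N" for a x n
  proof
    have "hproj n (a * x) = (\<Sum>w\<in>Poly_Mapping.keys a. Poly_Mapping.single w (Poly_Mapping.lookup a
        w) * hproj (n - deg w) x)"
      by (subst (1) poly_mapping_eq_sum_single[of a]) (simp add: sum_distrib_right hproj_sum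
          hproj_single_mult)
    also have "\<dots> \<in> N" by (rule raw_ideal_sum[OF r]) (use D(4) single_FA[OF a] x in blast)
    finally show "hproj n (a * x) \<in> N" .
    have "hproj n (x * a) = (\<Sum>w\<in>Poly_Mapping.keys a. hproj (n - deg w) x * Poly_Mapping.single w
        (Poly_Mapping.lookup a w))"
      by (subst (1) poly_mapping_eq_sum_single[of a]) (simp add: sum_distrib_left hproj_sum
          hproj_single_mult)
    also have "\<dots> \<in> N" by (rule raw_ideal_sum[OF r]) (use D(5) single_FA[OF a] x in blast)
    finally show "hproj n (x * a) \<in> N" .
  qed
  then show ?thesis using D
    by (intro raw_idealI) (auto simp: hproj_0 hproj_diff FA_diff FA_mult)
qed

text \<open>Homogeneous elements; zero is homogeneous of every degree.\<close>

definition homogeneous :: "int \<Rightarrow> ('v, 'e, 'k::field) lpa_free \<Rightarrow> bool" where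
  "homogeneous d x \<longleftrightarrow> (\<forall>w\<in>Poly_Mapping.keys x. deg w = d)"

lemma homogeneous_0: "homogeneous d 0"
  by (simp add: homogeneous_def)

lemma homogeneous_add: "homogeneous d x \<Longrightarrow> homogeneous d y \<Longrightarrow> homogeneous d (x + y)"
  using Poly_Mapping.keys_add[of x y] unfolding homogeneous_def by blast

lemma homogeneous_diff: "homogeneous d x \<Longrightarrow> homogeneous d y \<Longrightarrow> homogeneous d (x - y)"
  using Poly_Mapping.keys_diff[of x y] unfolding homogeneous_def by blast

lemma homogeneous_mult: "homogeneous a x \<Longrightarrow> homogeneous b y \<Longrightarrow> homogeneous (a + b) (x * y)"
  unfolding homogeneous_def
proof
  fix w assume *: "\<forall>w\<in>Poly_Mapping.keys x. deg w = a" "\<forall>w\<in>Poly_Mapping.keys y. deg w = b"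
  assume "w \<in> Poly_Mapping.keys (x * y)"
  then obtain k l where "w = k + l" "k \<in> Poly_Mapping.keys x" "l \<in> Poly_Mapping.keys y"
    using Poly_Mapping.keys_mult[of x y] by blast
  then show "deg w = a + b" using * by (simp add: deg_add)
qed

lemma homogeneous_sum: "(\<And>i. i \<in> I \<Longrightarrow> homogeneous d (f i)) \<Longrightarrow> homogeneous d (sum f I)"
  by (induction I rule: infinite_finite_induct) (auto intro: homogeneous_add homogeneous_0)

lemma homogeneous_gen: "homogeneous (gen_degree g) (free_gen g)"
  by (simp add: homogeneous_def free_gen_def deg_def)

lemma homogeneous_scal: "homogeneous d x \<Longrightarrow> homogeneous d (scal c x)"
  using homogeneous_mult[of 0 "Poly_Mapping.single 0 c" d x]
  by (simp add: scal_def homogeneous_def[of 0 "Poly_Mapping.single 0 c"] deg_0)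

lemma hproj_homogeneous': "homogeneous d x \<Longrightarrow> hproj n x = (if n = d then x else 0)"
  unfolding homogeneous_def by (rule hproj_homogeneous)

lemma homogeneous_relation:
  fixes x :: "('v, 'e, 'k::field) lpa_free"
  assumes x: "x \<in> lpa_relations G"
  shows "\<exists>d. homogeneous d x"
proof -
  have p: "homogeneous 0 (free_gen (Proj A))" for A using homogeneous_gen[of "Proj A"] by simp
  have s: "homogeneous 1 (free_gen (Edge e))" for e using homogeneous_gen[of "Edge e"] by simp
  have t: "homogeneous (-1) (free_gen (Ghost e))" for e using homogeneous_gen[of "Ghost e"] by simp
  have st: "homogeneous 0 (free_gen (Edge e) * free_gen (Ghost f))" for e f
    using homogeneous_mult[OF s[of e] t[of f]] by simp
  have ts: "homogeneous 0 (free_gen (Ghost e) * free_gen (Edge f))" for e f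
    using homogeneous_mult[OF t[of e] s[of f]] by simp
  have pp: "homogeneous 0 (free_gen (Proj A) * free_gen (Proj B))" for A B
    using homogeneous_mult[OF p[of A] p[of B]] by simp
  have ps: "homogeneous 1 (free_gen (Proj A) * free_gen (Edge e))" "homogeneous 1 (free_gen (Edge
      e) * free_gen (Proj A))" for A e
    using homogeneous_mult[OF p[of A] s[of e]] homogeneous_mult[OF s[of e] p[of A]] by simp_all
  have pt: "homogeneous (-1) (free_gen (Proj A) * free_gen (Ghost e))" "homogeneous (-1) (free_gen
      (Ghost e) * free_gen (Proj A))" for A e
    using homogeneous_mult[OF p[of A] t[of e]] homogeneous_mult[OF t[of e] p[of A]] by simp_all
  have hif: "homogeneous 0 (if b then y else 0)" if "homogeneous 0 y" for b and y :: "('v, 'e, 'k)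
      lpa_free"
    using that by (simp add: homogeneous_0)
  show "\<exists>d. homogeneous d x"
    using x unfolding lpa_relations_def Let_def
  proof (elim UnE)
    assume "x \<in> {free_gen (Proj {})}"
    then show ?thesis using p[of "{}"] by auto
  next
    assume "x \<in> {free_gen (Proj A) * free_gen (Proj B) - free_gen (Proj (A \<inter> B)) |A B. A \<in>
        gen_verts G \<and> B \<in> gen_verts G}"
    then show ?thesis using homogeneous_diff[OF pp p] by blast
  next
    assume "x \<in> {free_gen (Proj (A \<union> B)) - (free_gen (Proj A) + free_gen (Proj B) - free_gen (Proj
        (A \<inter> B))) |A B. A \<in> gen_verts G \<and> B \<in> gen_verts G}"
    then show ?thesis
      using homogeneous_diff[OF p homogeneous_diff[OF homogeneous_add[OF p p] p]] by blast
  next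
    assume "x \<in> {free_gen (Proj {src G e}) * free_gen (Edge e) - free_gen (Edge e) |e. e \<in> edges G}"
    then show ?thesis using homogeneous_diff[OF ps(1) s] by blast
  next
    assume "x \<in> {free_gen (Edge e) * free_gen (Proj (rng G e)) - free_gen (Edge e) |e. e \<in> edges G}"
    then show ?thesis using homogeneous_diff[OF ps(2) s] by blast
  next
    assume "x \<in> {free_gen (Proj (rng G e)) * free_gen (Ghost e) - free_gen (Ghost e) |e. e \<in> edges G}"
    then show ?thesis using homogeneous_diff[OF pt(1) t] by blast
  next
    assume "x \<in> {free_gen (Ghost e) * free_gen (Proj {src G e}) - free_gen (Ghost e) |e. e \<in> edges G}"
    then show ?thesis using homogeneous_diff[OF pt(2) t] by blast
  next
    assume "x \<in> {free_gen (Ghost e) * free_gen (Edge f) - (if e = f then free_gen (Proj (rng G e))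
        else 0) |e f. e \<in> edges G \<and> f \<in> edges G}"
    then show ?thesis using homogeneous_diff[OF ts hif[OF p]] by blast
  next
    assume "x \<in> {free_gen (Proj {v}) - (\<Sum>e\<in>out_edges G v. free_gen (Edge e) * free_gen (Ghost e)) |v.
        v \<in> verts G \<and> finite (out_edges G v) \<and> out_edges G v \<noteq> {}}"
    then obtain v where v: "x = free_gen (Proj {v}) - (\<Sum>e\<in>out_edges G v. free_gen (Edge e) *
        free_gen (Ghost e))" by blast
    show ?thesis unfolding v by (rule exI, rule homogeneous_diff[OF p homogeneous_sum[OF st]])
  qed
qed

lemma rel_ideal_hproj: "x \<in> lpa_rel_ideal G \<Longrightarrow> hproj n x \<in> lpa_rel_ideal G"
proof -
  have o: "over_ideal (lpa_rel_ideal G :: ('v, 'e, 'k::field) lpa_free set)" using raw_rel_ideal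
      by (simp add: over_ideal_def)
  have "scal c x \<in> {x \<in> FA (lpa_gens G). \<forall>n. hproj n x \<in> lpa_rel_ideal G}" if "x \<in> lpa_relations
      G" for c x
  proof -
    from homogeneous_relation[OF that] obtain d where "homogeneous d x" by blast
    then have "homogeneous d (scal c x)" by (rule homogeneous_scal)
    then show ?thesis using relations_rel_ideal[OF that] rel_idealD(1,2) by (auto simp:
        hproj_homogeneous')
  qed
  then have "lpa_rel_ideal G \<subseteq> {x \<in> FA (lpa_gens G). \<forall>n. hproj n x \<in> lpa_rel_ideal G}"
    using rel_ideal_least[OF hproj_closed_ideal[OF o]] by blast
  then show "x \<in> lpa_rel_ideal G \<Longrightarrow> hproj n x \<in> lpa_rel_ideal G" by blast
qed

text \<open>Since the relations are homogeneous, an ideal is graded iff its preimage in the free algebra is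
  closed under taking homogeneous components.\<close>

lemma graded_iff:
  assumes I: "two_sided_ideal (lpa G) I"
  shows "graded_ideal G I \<longleftrightarrow> (\<forall>x\<in>pre I. \<forall>n. hproj n x \<in> pre I)"
proof
  have o: "over_ideal (pre I)" by (rule over_ideal_pre[OF I])
  then have r: "raw_ideal (lpa_gens G) (pre I)" by (simp add: over_ideal_def)
  note D = raw_idealD[OF r]
  {
    assume g: "graded_ideal G I"
    show "\<forall>x\<in>pre I. \<forall>n. hproj n x \<in> pre I"
    proof (intro ballI allI)
      fix x n assume x: "x \<in> pre I"
      then have xF: "x \<in> FA (lpa_gens G)" by (rule D)
      obtain N c where N: "finite N" "\<forall>n\<in>N. c n \<in> I \<inter> lpa_component G n" "lpa_class G x = finsum
          (lpa G) c N"
        using g x unfolding graded_ideal_def pre_def by blast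
      have "\<forall>n\<in>N. \<exists>y. y \<in> FA (lpa_gens G) \<and> homogeneous n y \<and> c n = lpa_class G y"
        using N(2) unfolding lpa_component_def homogeneous_def deg_def by blast
      then obtain y where y: "\<forall>n\<in>N. y n \<in> FA (lpa_gens G) \<and> homogeneous n (y n) \<and> c n = lpa_class
          G (y n)"
        using bchoice by metis
      have "lpa_class G x = finsum (lpa G) (\<lambda>n. lpa_class G (y n)) N"
        unfolding N(3) using y abelian_group_lpa
        by (intro abelian_monoid.finsum_cong') (auto simp: abelian_group_def carrier_lpa)
      then have "lpa_class G x = lpa_class G (sum y N)" using lpa_finsum[OF N(1), of y] y by simp
      then have "hproj n (x - sum y N) \<in> lpa_rel_ideal G" by (simp add: lpa_class_eq_iff
          rel_ideal_hproj)
      then have 1: "hproj n x - hproj n (sum y N) \<in> pre I"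
        using o unfolding over_ideal_def hproj_diff by blast
      have yI: "y m \<in> pre I" if "m \<in> N" for m using y N(2) that by (auto simp: pre_def)
      have "hproj n (sum y N) = (\<Sum>m\<in>N. if n = m then y m else 0)"
        unfolding hproj_sum using y by (intro sum.cong) (auto simp: hproj_homogeneous')
      also have "\<dots> \<in> pre I" using yI D(2) by (intro raw_ideal_sum[OF r]) auto
      finally show "hproj n x \<in> pre I" using D(7)[OF 1, of "hproj n (sum y N)"] by simp
    qed
  }
  assume h: "\<forall>x\<in>pre I. \<forall>n. hproj n x \<in> pre I"
  show "graded_ideal G I"
    unfolding graded_ideal_def
  proof (intro conjI ballI I)
    fix X assume "X \<in> I"
    then obtain x where x: "x \<in> pre I" "X = lpa_class G x" using image_pre[OF I] by blast
    have xF: "x \<in> FA (lpa_gens G)" using x D by blast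
    define N where "N = deg ` Poly_Mapping.keys x"
    have "X = lpa_class G (\<Sum>n\<in>N. hproj n x)" using x(2) hproj_decomp[of x] by (simp add: N_def)
    also have "\<dots> = finsum (lpa G) (\<lambda>n. lpa_class G (hproj n x)) N"
      using xF by (intro lpa_finsum[symmetric]) (auto simp: N_def hproj_FA)
    finally have "X = finsum (lpa G) (\<lambda>n. lpa_class G (hproj n x)) N" .
    moreover have "lpa_class G (hproj n x) \<in> I \<inter> lpa_component G n" for n
      using h x hproj_FA[OF xF, of n] keys_hproj[of n x]
      by (auto simp: pre_def lpa_component_def deg_def)
    moreover have "finite N" by (simp add: N_def)
    ultimately show "\<exists>N c. finite N \<and> (\<forall>n\<in>N. c n \<in> I \<inter> lpa_component G n) \<and> X = finsum (lpa G) c N"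
      by (intro exI[of _ N] exI[of _ "\<lambda>n. lpa_class G (hproj n x)"] conjI ballI)
  qed
qed

end

section \<open>Faithful models of the quotients\<close>

lemma relations_intros:
  shows "free_gen (Proj {}) \<in> lpa_relations G"
    and "A \<in> gen_verts G \<Longrightarrow> B \<in> gen_verts G \<Longrightarrow> free_gen (Proj A) * free_gen (Proj B) - free_gen
      (Proj (A \<inter> B)) \<in> lpa_relations G"
    and "A \<in> gen_verts G \<Longrightarrow> B \<in> gen_verts G \<Longrightarrow> free_gen (Proj (A \<union> B)) - (free_gen (Proj A) +
      free_gen (Proj B) - free_gen (Proj (A \<inter> B))) \<in> lpa_relations G"
    and "e \<in> edges G \<Longrightarrow> free_gen (Proj {src G e}) * free_gen (Edge e) - free_gen (Edge e) \<in>
      lpa_relations G"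
    and "e \<in> edges G \<Longrightarrow> free_gen (Edge e) * free_gen (Proj (rng G e)) - free_gen (Edge e) \<in>
      lpa_relations G"
    and "e \<in> edges G \<Longrightarrow> free_gen (Proj (rng G e)) * free_gen (Ghost e) - free_gen (Ghost e) \<in>
      lpa_relations G"
    and "e \<in> edges G \<Longrightarrow> free_gen (Ghost e) * free_gen (Proj {src G e}) - free_gen (Ghost e) \<in>
      lpa_relations G"
    and "e \<in> edges G \<Longrightarrow> f \<in> edges G \<Longrightarrow> free_gen (Ghost e) * free_gen (Edge f) - (if e = f then
      free_gen (Proj (rng G e)) else 0) \<in> lpa_relations G"
    and "v \<in> verts G \<Longrightarrow> finite (out_edges G v) \<Longrightarrow> out_edges G v \<noteq> {} \<Longrightarrow> free_gen (Proj {v}) -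
      (\<Sum>e\<in>out_edges G v. free_gen (Edge e) * free_gen (Ghost e)) \<in> lpa_relations G"
  unfolding lpa_relations_def Let_def
  subgoal by (rule UnI1, rule UnI1, rule UnI1, rule UnI1, rule UnI1, rule UnI1, rule UnI1, rule
      UnI1, blast)
  subgoal by (rule UnI1, rule UnI1, rule UnI1, rule UnI1, rule UnI1, rule UnI1, rule UnI1, rule
      UnI2, blast)
  subgoal by (rule UnI1, rule UnI1, rule UnI1, rule UnI1, rule UnI1, rule UnI1, rule UnI2, blast)
  subgoal by (rule UnI1, rule UnI1, rule UnI1, rule UnI1, rule UnI1, rule UnI2, blast)
  subgoal by (rule UnI1, rule UnI1, rule UnI1, rule UnI1, rule UnI2, blast)
  subgoal by (rule UnI1, rule UnI1, rule UnI1, rule UnI2, blast)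
  subgoal by (rule UnI1, rule UnI1, rule UnI2, blast)
  subgoal by (rule UnI1, rule UnI2, blast)
  subgoal by (rule UnI2, blast)
  done

text \<open>A ring homomorphism \<open>L\<close> from the free algebra with kernel \<open>N\<close>, so that calculations modulo an
  ideal become calculations in a ring.\<close>

locale quotient_rep = ultragraph G
  for G :: "('v, 'e) ultragraph" +
  fixes N :: "('v, 'e, 'k::field) lpa_free set"
    and L :: "('v, 'e, 'k) lpa_free \<Rightarrow> 'r::ring_1"
    and sc :: "'k \<Rightarrow> 'r"
  assumes N_over: "over_ideal N"
    and L_add: "x \<in> FA (lpa_gens G) \<Longrightarrow> y \<in> FA (lpa_gens G) \<Longrightarrow> L (x + y) = L x + L y"
    and L_mult: "x \<in> FA (lpa_gens G) \<Longrightarrow> y \<in> FA (lpa_gens G) \<Longrightarrow> L (x * y) = L x * L y"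
    and L_scal: "x \<in> FA (lpa_gens G) \<Longrightarrow> L (scal c x) = sc c * L x"
    and L_zero_iff: "x \<in> FA (lpa_gens G) \<Longrightarrow> L x = 0 \<longleftrightarrow> x \<in> N"
    and rep_sc_1: "sc 1 = 1"
    and rep_sc_add: "sc (a + b) = sc a + sc b"
    and rep_sc_mult: "sc (a * b) = sc a * sc b"
    and rep_sc_comm: "x \<in> FA (lpa_gens G) \<Longrightarrow> L x * sc c = sc c * L x"
begin

abbreviation "FG \<equiv> FA (lpa_gens G) :: ('v, 'e, 'k) lpa_free set"
abbreviation p :: "'v set \<Rightarrow> ('v, 'e, 'k) lpa_free" where "p A \<equiv> free_gen (Proj A)"
abbreviation se :: "'e \<Rightarrow> ('v, 'e, 'k) lpa_free" where "se e \<equiv> free_gen (Edge e)"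
abbreviation te :: "'e \<Rightarrow> ('v, 'e, 'k) lpa_free" where "te e \<equiv> free_gen (Ghost e)"

lemma N_raw: "raw_ideal (lpa_gens G) N" using N_over by (simp add: over_ideal_def)

lemmas N_D = raw_idealD[OF N_raw]

lemma L_0 [simp]: "L 0 = 0" by (simp add: L_zero_iff N_D(2))

lemma L_diff: "x \<in> FG \<Longrightarrow> y \<in> FG \<Longrightarrow> L (x - y) = L x - L y"
  using L_add[of "x - y" y] by (simp add: FA_diff algebra_simps)

lemma L_sum: "(\<And>i. i \<in> I \<Longrightarrow> f i \<in> FG) \<Longrightarrow> L (sum f I) = (\<Sum>i\<in>I. L (f i))"
proof (induction I rule: infinite_finite_induct)
  case (insert i I)
  then show ?case using L_add[of "f i" "sum f I"] by (simp add: FA_sum)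
qed simp_all

lemma L_eq_iff: "x \<in> FG \<Longrightarrow> y \<in> FG \<Longrightarrow> L x = L y \<longleftrightarrow> x - y \<in> N"
  using L_zero_iff[of "x - y"] by (simp add: L_diff FA_diff)

lemma L_rel: "x \<in> lpa_relations G \<Longrightarrow> L x = 0"
proof -
  assume x: "x \<in> lpa_relations G"
  then have "scal 1 x \<in> lpa_rel_ideal G" by (rule relations_rel_ideal)
  then have "x \<in> N" using N_over unfolding over_ideal_def by (auto simp: scal_simps)
  then show ?thesis using relations_FA[OF x] by (simp add: L_zero_iff)
qed

lemma relations_hold:
  shows "L (p {}) = 0"
    and "A \<in> gen_verts G \<Longrightarrow> B \<in> gen_verts G \<Longrightarrow> L (p A) * L (p B) = L (p (A \<inter> B))"
    and "A \<in> gen_verts G \<Longrightarrow> B \<in> gen_verts G \<Longrightarrow> L (p (A \<union> B)) = L (p A) + L (p B) - L (p (A \<inter> B))"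
    and "e \<in> edges G \<Longrightarrow> L (p {src G e}) * L (se e) = L (se e)"
    and "e \<in> edges G \<Longrightarrow> L (se e) * L (p (rng G e)) = L (se e)"
    and "e \<in> edges G \<Longrightarrow> L (p (rng G e)) * L (te e) = L (te e)"
    and "e \<in> edges G \<Longrightarrow> L (te e) * L (p {src G e}) = L (te e)"
    and "e \<in> edges G \<Longrightarrow> f \<in> edges G \<Longrightarrow> L (te e) * L (se f) = (if e = f then L (p (rng G e)) else 0)"
    and "v \<in> verts G \<Longrightarrow> finite (out_edges G v) \<Longrightarrow> out_edges G v \<noteq> {} \<Longrightarrow>
      L (p {v}) = (\<Sum>e\<in>out_edges G v. L (se e) * L (te e))"
proof -
  have inj: "L x = L y" if "x - y \<in> lpa_relations G" "x \<in> FG" "y \<in> FG" for x y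
    using L_rel[OF that(1)] L_diff[OF that(2,3)] by simp
  note c = gen_FA FA_mult FA_add FA_diff gen_verts.union gen_verts.inter
  have "p {} \<in> lpa_relations G" by (rule relations_intros)
  then show "L (p {}) = 0" by (rule L_rel)
  {
    assume AB: "A \<in> gen_verts G" "B \<in> gen_verts G"
    have "p A * p B - p (A \<inter> B) \<in> lpa_relations G" using AB by (rule relations_intros)
    from inj[OF this] have "L (p A * p B) = L (p (A \<inter> B))" using AB by (simp add: c)
    then show "L (p A) * L (p B) = L (p (A \<inter> B))" using AB by (simp add: L_mult gen_FA)
    have "p (A \<union> B) - (p A + p B - p (A \<inter> B)) \<in> lpa_relations G"
      using AB by (rule relations_intros)
    from inj[OF this] have "L (p (A \<union> B)) = L (p A + p B - p (A \<inter> B))" using AB by (simp add: c)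
    then show "L (p (A \<union> B)) = L (p A) + L (p B) - L (p (A \<inter> B))"
      using AB by (simp add: L_diff L_add gen_FA FA_add gen_verts.inter)
  }
  {
    assume e: "e \<in> edges G"
    have [simp]: "{src G e} \<in> gen_verts G" "rng G e \<in> gen_verts G"
      using e by (simp_all add: gen_verts.range gen_verts.vertex src_closed)
    have "p {src G e} * se e - se e \<in> lpa_relations G" "se e * p (rng G e) - se e \<in> lpa_relations G"
      "p (rng G e) * te e - te e \<in> lpa_relations G" "te e * p {src G e} - te e \<in> lpa_relations G"
      by (rule relations_intros(4-7)[OF e])+
    note this[THEN inj]
    then have "L (p {src G e} * se e) = L (se e)" "L (se e * p (rng G e)) = L (se e)"
      "L (p (rng G e) * te e) = L (te e)" "L (te e * p {src G e}) = L (te e)"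
      using e by (simp_all add: FA_mult gen_FA)
    then show "L (p {src G e}) * L (se e) = L (se e)" "L (se e) * L (p (rng G e)) = L (se e)"
      "L (p (rng G e)) * L (te e) = L (te e)" "L (te e) * L (p {src G e}) = L (te e)"
      using e by (simp_all add: L_mult gen_FA)
    assume f: "f \<in> edges G"
    have "L (te e * se f) = L (if e = f then p (rng G e) else 0)"
    proof (rule inj)
      show "te e * se f - (if e = f then p (rng G e) else 0) \<in> lpa_relations G"
        using e f by (rule relations_intros)
    qed (use e f in \<open>auto intro!: FA_mult gen_FA gen_verts.range\<close>)
    then show "L (te e) * L (se f) = (if e = f then L (p (rng G e)) else 0)"
      using e f by (cases "e = f") (simp_all add: L_mult gen_FA)
  }
  assume v: "v \<in> verts G" "finite (out_edges G v)" "out_edges G v \<noteq> {}"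
  have o: "e \<in> edges G" if "e \<in> out_edges G v" for e using that by (simp add: out_edges_def)
  have F: "se e * te e \<in> FG" if "e \<in> out_edges G v" for e
    using o[OF that] by (auto intro!: FA_mult gen_FA)
  have "L (p {v}) = L (\<Sum>e\<in>out_edges G v. se e * te e)"
  proof (rule inj)
    show "p {v} - (\<Sum>e\<in>out_edges G v. se e * te e) \<in> lpa_relations G"
      using v by (rule relations_intros)
    show "p {v} \<in> FG" using v by (intro gen_FA gen_verts.vertex)
    show "(\<Sum>e\<in>out_edges G v. se e * te e) \<in> FG" by (rule FA_sum[OF F])
  qed
  also have "\<dots> = (\<Sum>e\<in>out_edges G v. L (se e * te e))" by (rule L_sum[OF F])
  also have "\<dots> = (\<Sum>e\<in>out_edges G v. L (se e) * L (te e))"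
    using o by (intro sum.cong refl L_mult gen_FA) auto
  finally show "L (p {v}) = (\<Sum>e\<in>out_edges G v. L (se e) * L (te e))" .
qed

sublocale leavitt_family G "\<lambda>A. L (p A)" "\<lambda>e. L (se e)" "\<lambda>e. L (te e)" sc
  by unfold_locales
    (simp_all add: relations_hold rep_sc_1 rep_sc_add rep_sc_mult rep_sc_comm gen_FA)

lemma L_word:
  "letters w \<noteq> [] \<Longrightarrow> set (letters w) \<subseteq> lpa_gens G \<Longrightarrow> \<exists>m. monomial (deg w) m (L (Poly_Mapping.single w 1))"
proof (induction "letters w" arbitrary: w)
  case (Cons g gs)
  have g: "g \<in> lpa_gens G" "free_gen g \<in> FG" using Cons.hyps(2) Cons.prems FA_gen[of g] by (auto
      simp flip: Cons.hyps(2))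
  have gen: "\<exists>m. monomial (gen_degree g) m (L (free_gen g))"
    using g(1) monomial_P monomial_S monomial_T unfolding lpa_gens_def by fastforce
  show ?case
  proof (cases "gs = []")
    case True
    then have "w = Wd [g]" using Cons.hyps(2) by (cases w) auto
    then show ?thesis using gen by (simp add: free_gen_def deg_def)
  next
    case False
    have w: "w = Wd [g] + Wd gs" using Cons.hyps(2) by (cases w) (simp add: plus_free_monoid_def)
    have gs: "set gs \<subseteq> lpa_gens G" using Cons.hyps(2) Cons.prems by (auto simp flip: Cons.hyps(2))
    have F: "Poly_Mapping.single (Wd gs) 1 \<in> FG" using False gs by (simp add: mem_FA)
    obtain m where m: "monomial (deg (Wd gs)) m (L (Poly_Mapping.single (Wd gs) 1))"
      using Cons.hyps(1)[of "Wd gs"] False gs by auto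
    have "L (Poly_Mapping.single w 1) = L (free_gen g) * L (Poly_Mapping.single (Wd gs) 1)"
      using L_mult[OF g(2) F] by (simp add: w free_gen_def mult_single)
    moreover have "\<exists>m'. monomial (gen_degree g + deg (Wd gs)) m' (L (free_gen g) * L
        (Poly_Mapping.single (Wd gs) 1))"
    proof -
      consider A where "A \<in> gen_verts G" "g = Proj A" | e where "e \<in> edges G" "g = Edge e"
        | e where "e \<in> edges G" "g = Ghost e" using g(1) unfolding lpa_gens_def by blast
      then show ?thesis
      proof cases
        case 1 then show ?thesis using P_monomial[OF _ m] by auto
      next
        case 2 then show ?thesis using S_monomial[OF _ m] by (auto simp: add.commute)
      next
        case 3 then show ?thesis using T_monomial[OF _ m] by (auto simp: algebra_simps)
      qed
    qed
    moreover have "deg w = gen_degree g + deg (Wd gs)" by (simp add: w deg_def)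
    ultimately show ?thesis by simp
  qed
qed simp

lemma L_decomp: "x \<in> FG \<Longrightarrow> L x = (\<Sum>w\<in>Poly_Mapping.keys x. sc (Poly_Mapping.lookup x w) * L
    (Poly_Mapping.single w 1))"
proof -
  assume x: "x \<in> FG"
  have s: "Poly_Mapping.single w c \<in> FG" if "w \<in> Poly_Mapping.keys x" for w c using single_FA[OF x
      that] .
  have "L x = (\<Sum>w\<in>Poly_Mapping.keys x. L (Poly_Mapping.single w (Poly_Mapping.lookup x w)))"
    by (subst (1) poly_mapping_eq_sum_single) (rule L_sum[OF s])
  also have "\<dots> = (\<Sum>w\<in>Poly_Mapping.keys x. sc (Poly_Mapping.lookup x w) * L (Poly_Mapping.single w 1))"
    using s L_scal by (intro sum.cong refl) (metis mult.right_neutral scal_single)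
  finally show ?thesis .
qed

lemma L_alg: "x \<in> FG \<Longrightarrow> L x \<in> alg"
proof -
  assume x: "x \<in> FG"
  have "L (Poly_Mapping.single w 1) \<in> alg" if "w \<in> Poly_Mapping.keys x" for w
    using L_word[of w] x that monomial_alg unfolding mem_FA by blast
  then show ?thesis unfolding L_decomp[OF x] by (intro alg_sum alg_sc)
qed

lemma alg_L: "y \<in> alg \<Longrightarrow> \<exists>x\<in>FG. y = L x"
proof (induction rule: alg.induct)
  case (alg_P A)
  then show ?case by (intro bexI[OF refl gen_FA(1)])
next
  case (alg_S e)
  then show ?case by (intro bexI[OF refl gen_FA(2)])
next
  case (alg_T e)
  then show ?case by (intro bexI[OF refl gen_FA(3)])
next
  case (alg_add x y)
  then show ?case using L_add FA_add by metis
next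
  case (alg_mult x y)
  then show ?case using L_mult FA_mult by metis
next
  case (alg_sc x c)
  then show ?case using L_scal FA_scal by metis
qed

lemma local_unit_mod: "x \<in> FG \<Longrightarrow> \<exists>A\<in>gen_verts G. x - p A * x \<in> N \<and> x - x * p A \<in> N"
proof -
  assume x: "x \<in> FG"
  obtain A where A: "A \<in> gen_verts G" "L (p A) * L x = L x" "L x * L (p A) = L x"
    using local_unit[OF L_alg[OF x]] by blast
  have "L x = L (p A * x)" "L x = L (x * p A)" using x A by (simp_all add: L_mult gen_FA)
  moreover have "p A * x \<in> FG" "x * p A \<in> FG" using x A(1) by (simp_all add: FA_mult gen_FA)
  ultimately have "x - p A * x \<in> N" "x - x * p A \<in> N" using L_eq_iff[OF x] by blast+
  then show ?thesis using A(1) by blast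
qed

text \<open>If \<open>N\<close> contains the elements \<open>p\<^sub>w\<^sup>H\<close> for the breaking vertices \<open>w\<close>, the Cuntz--Krieger relation
  for surviving edges holds.\<close>

lemma leavitt_full_rep:
  assumes "\<And>w. w \<in> breaking_verts G {A \<in> gen_verts G. p A \<in> N} \<Longrightarrow>
    p {w} - (\<Sum>e\<in>{e \<in> out_edges G w. rng G e \<notin> {A \<in> gen_verts G. p A \<in> N}}. se e * te e) \<in> N"
  shows "leavitt_full G (\<lambda>A. L (p A)) (\<lambda>e. L (se e)) (\<lambda>e. L (te e)) sc"
proof unfold_locales
  fix v assume v: "v \<in> verts G" and fin: "finite {e \<in> out_edges G v. L (p (rng G e)) \<noteq> 0}"
    and ne: "{e \<in> out_edges G v. L (p (rng G e)) \<noteq> 0} \<noteq> {}"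
  have oE: "e \<in> edges G" if "e \<in> out_edges G v" for e using that by (simp add: out_edges_def)
  have O: "{e \<in> out_edges G v. rng G e \<notin> {A \<in> gen_verts G. p A \<in> N}} = {e \<in> out_edges G v. L (p
      (rng G e)) \<noteq> 0}"
    using oE by (auto simp: L_zero_iff gen_FA)
  show "L (p {v}) = (\<Sum>e\<in>{e \<in> out_edges G v. L (p (rng G e)) \<noteq> 0}. L (se e) * L (te e))"
  proof (cases "finite (out_edges G v)")
    case True
    have "out_edges G v \<noteq> {}" using ne by auto
    then have "L (p {v}) = (\<Sum>e\<in>out_edges G v. L (se e) * L (te e))" using relations_hold(9) v True
        by blast
    also have "\<dots> = (\<Sum>e\<in>{e \<in> out_edges G v. L (p (rng G e)) \<noteq> 0}. L (se e) * L (te e))"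
    proof (intro sum.mono_neutral_right ballI)
      fix e assume "e \<in> out_edges G v - {e \<in> out_edges G v. L (p (rng G e)) \<noteq> 0}"
      then have "L (se e) = 0" using S_zero_iff[of e] oE by simp
      then show "L (se e) * L (te e) = 0" by simp
    qed (use True in auto)
    finally show ?thesis .
  next
    case False
    then have "v \<in> breaking_verts G {A \<in> gen_verts G. p A \<in> N}"
      using v fin[folded O] ne[folded O] unfolding breaking_verts_def by (simp del: mem_Collect_eq) simp
    from assms[OF this] have n: "p {v} - (\<Sum>e\<in>{e \<in> out_edges G v. L (p (rng G e)) \<noteq> 0}. se e * te e) \<in> N"
      unfolding O .
    have F: "se e * te e \<in> FG" if "e \<in> {e \<in> out_edges G v. L (p (rng G e)) \<noteq> 0}" for e
      using oE that by (auto intro!: FA_mult gen_FA)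
    have pv: "p {v} \<in> FG" using v by (intro gen_FA gen_verts.vertex)
    have "L (p {v}) = L (\<Sum>e\<in>{e \<in> out_edges G v. L (p (rng G e)) \<noteq> 0}. se e * te e)"
      by (rule iffD2[OF L_eq_iff[OF pv FA_sum[OF F]] n])
    also have "\<dots> = (\<Sum>e\<in>{e \<in> out_edges G v. L (p (rng G e)) \<noteq> 0}. L (se e * te e))" by (rule L_sum[OF F])
    also have "\<dots> = (\<Sum>e\<in>{e \<in> out_edges G v. L (p (rng G e)) \<noteq> 0}. L (se e) * L (te e))"
      using oE by (intro sum.cong refl L_mult gen_FA) auto
    finally show ?thesis .
  qed
qed

end

subsection \<open>Existence of the models\<close>

lemma vector_space_scal: "vector_space (scal :: 'k::field \<Rightarrow> ('x free_monoid \<Rightarrow>\<^sub>0 'k) \<Rightarrow> _)"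
  by unfold_locales (simp_all add: scal_simps)

text \<open>A linear projection onto a complement of \<open>N\<close> inside \<open>U\<close>.\<close>

lemma (in vector_space) exists_projection:
  assumes N: "subspace N" and U: "subspace U" and NU: "N \<subseteq> U"
  shows "\<exists>\<pi>. Vector_Spaces.linear scale scale \<pi> \<and> (\<forall>x\<in>N. \<pi> x = 0) \<and> (\<forall>x\<in>U. x - \<pi> x \<in> N) \<and> (\<forall>x. \<pi> x \<in> U)"
proof -
  interpret pair: vector_space_pair scale scale by unfold_locales
  obtain B0 where B0: "B0 \<subseteq> N" "independent B0" "N \<subseteq> span B0"
    by (rule maximal_independent_subset[of N]) (rule that; assumption)
  have "B0 \<subseteq> U" using B0 NU by auto
  from maximal_independent_subset_extend[OF this B0(2)]
  obtain B1 where B1: "B0 \<subseteq> B1" "B1 \<subseteq> U" "independent B1" "U \<subseteq> span B1" by metis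
  from maximal_independent_subset_extend[OF subset_UNIV B1(3)]
  obtain B2 where B2: "B1 \<subseteq> B2" "independent B2" "UNIV \<subseteq> span B2" by metis
  obtain \<pi> where lin: "Vector_Spaces.linear scale scale \<pi>"
    and \<pi>: "\<forall>b\<in>B2. \<pi> b = (if b \<in> B1 - B0 then b else 0)"
    using pair.linear_independent_extend[OF B2(2), of "\<lambda>b. if b \<in> B1 - B0 then b else 0"] by blast
  interpret lin: Vector_Spaces.linear scale scale \<pi> by (rule lin)
  have 1: "\<pi> x = 0" if "x \<in> N" for x
  proof -
    have "x \<in> span B0" using that B0 by blast
    then show ?thesis
    proof (induction rule: span_induct_alt)
      case (step c b y)
      then show ?case using \<pi> B1 B2 by (auto simp: lin.add lin.scale)
    qed simp
  qed
  have 2: "x - \<pi> x \<in> N" if "x \<in> U" for x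
  proof -
    have "x \<in> span B1" using that B1 by blast
    then show ?thesis
    proof (induction rule: span_induct_alt)
      case base
      then show ?case using subspace_0[OF N] by simp
    next
      case (step c b y)
      have "\<pi> b = (if b \<in> B1 - B0 then b else 0)" using \<pi> step B2 by blast
      then have "b - \<pi> b \<in> N"
        using step B0(1) subspace_0[OF N] by (cases "b \<in> B0") auto
      moreover have "scale c b + y - \<pi> (scale c b + y) = scale c (b - \<pi> b) + (y - \<pi> y)"
        by (simp add: lin.add lin.scale scale_right_diff_distrib)
      moreover have "scale c (b - \<pi> b) + (y - \<pi> y) \<in> N"
        using subspace_add[OF N] subspace_scale[OF N] step calculation(1) by blast
      ultimately show ?case by (simp only:)
    qed
  qed
  have 3: "\<pi> x \<in> U" for x
  proof -
    have "x \<in> span B2" using B2 by blast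
    then show ?thesis
    proof (induction rule: span_induct_alt)
      case base
      then show ?case using subspace_0[OF U] by simp
    next
      case (step c b y)
      have "\<pi> b \<in> U" using step \<pi> B1 subspace_0[OF U] by auto
      then show ?case using subspace_add[OF U] subspace_scale[OF U] step by (simp add: lin.add
          lin.scale)
    qed
  qed
  show ?thesis using lin 1 2 3 by blast
qed

text \<open>With a projection \<open>\<pi>\<close> that kills \<open>N\<close>, an element \<open>x\<close> acts by \<open>w \<mapsto> \<pi> (x (\<pi> w))\<close>. This is left
  multiplication on the unital free algebra modulo \<open>N\<close>, transported to a complement of \<open>N\<close>.\<close>

lemma (in ultragraph) exists_quotient_rep:
  fixes N :: "('v, 'e, 'k::field) lpa_free set"
  assumes over: "over_ideal N" and Nsc: "\<And>c x. x \<in> N \<Longrightarrow> scal c x \<in> N"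
  shows "\<exists>(L :: ('v, 'e, 'k) lpa_free \<Rightarrow> ('v, 'e, 'k) lpa_free endo) sc. quotient_rep G N L sc"
proof -
  have raw: "raw_ideal (lpa_gens G) N" using over by (simp add: over_ideal_def)
  note D = raw_idealD[OF raw]
  interpret vs: vector_space "scal :: 'k \<Rightarrow> ('v, 'e, 'k) lpa_free \<Rightarrow> _" by (rule vector_space_scal)
  \<comment> \<open>the unital free algebra; its unit makes the action below faithful\<close>
  define U :: "('v, 'e, 'k) lpa_free set" where "U = {f. \<forall>w\<in>Poly_Mapping.keys f. set (letters w) \<subseteq>
      lpa_gens G}"
  have FU: "x \<in> U" if "x \<in> FA (lpa_gens G)" for x
    using that unfolding U_def mem_FA by simp
  have U1: "1 \<in> U" by (simp add: U_def)
  have Usub: "vs.subspace U"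
  proof (rule vs.subspaceI)
    fix c x y
    show "x + y \<in> U" if "x \<in> U" "y \<in> U" using that Poly_Mapping.keys_add[of x y] unfolding U_def
        by blast
    show "scal c x \<in> U" if "x \<in> U"
      using that Poly_Mapping.keys_mult[of "Poly_Mapping.single 0 c" x] unfolding U_def scal_def
      by (fastforce split: if_splits)
  qed (simp add: U_def)
  have Nsub: "vs.subspace N" by (rule vs.subspaceI) (use D Nsc in auto)
  have "N \<subseteq> U" using D(1) FU by blast
  from vs.exists_projection[OF Nsub Usub this] obtain \<pi> where lin: "Vector_Spaces.linear scal scal \<pi>"
    and \<pi>N: "\<And>x. x \<in> N \<Longrightarrow> \<pi> x = 0" and \<pi>U: "\<And>x. x \<in> U \<Longrightarrow> x - \<pi> x \<in> N" and \<pi>in: "\<And>x. \<pi> x \<in> U"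
    by blast
  interpret lin: Vector_Spaces.linear scal scal \<pi> by (rule lin)
  have \<pi>0: "x \<in> N" if "x \<in> U" "\<pi> x = 0" for x using \<pi>U[OF that(1)] that(2) by simp
  have FUm: "x * y \<in> FA (lpa_gens G)" if "x \<in> FA (lpa_gens G)" "y \<in> U" for x y
    using FA_mult_words(1)[OF that(1)] that(2) by (auto simp: U_def)
  have NU: "x * y \<in> N" if x: "x \<in> N" and y: "y \<in> U" for x y
  proof -
    define c where "c = Poly_Mapping.lookup y 0"
    have k: "w \<noteq> 0 \<and> w \<in> Poly_Mapping.keys y" if "w \<in> Poly_Mapping.keys (y - Poly_Mapping.single 0
        c)" for w
      using that by (auto simp: in_keys_iff lookup_minus lookup_single when_def c_def split: if_splits)
    have "y - Poly_Mapping.single 0 c \<in> FA (lpa_gens G)"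
      unfolding mem_FA
    proof
      fix w assume w: "w \<in> Poly_Mapping.keys (y - Poly_Mapping.single 0 c)"
      have "letters w \<noteq> []" using k[OF w] by (cases w) (auto simp: zero_free_monoid_def)
      then show "letters w \<noteq> [] \<and> set (letters w) \<subseteq> lpa_gens G" using k[OF w] y by (auto simp: U_def)
    qed
    then have "x * (y - Poly_Mapping.single 0 c) \<in> N" using D(5)[OF _ x] by blast
    moreover have "x * y = x * (y - Poly_Mapping.single 0 c) + scal c x"
      unfolding scal_def single_0_central[of c x] by (simp add: algebra_simps)
    ultimately show ?thesis using D(7) Nsc[OF x] by simp
  qed
  define L where "L x = Endo (\<lambda>w. \<pi> (x * \<pi> w))" for x
  define sc :: "'k \<Rightarrow> ('v, 'e, 'k) lpa_free endo" where "sc c = Endo (scal c)" for c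
  have appL: "app (L x) w = \<pi> (x * \<pi> w)" for x w
    unfolding L_def by (subst Endo_inverse) (simp_all add: lin.add distrib_left)
  have appsc: "app (sc c) w = scal c w" for c w
    unfolding sc_def by (subst Endo_inverse) (simp_all add: scal_simps)
  have "quotient_rep G N L sc"
  proof unfold_locales
    fix x y :: "('v, 'e, 'k) lpa_free"
    assume x: "x \<in> FA (lpa_gens G)" and y: "y \<in> FA (lpa_gens G)"
    show "L (x + y) = L x + L y"
      by (rule endo_eqI) (simp add: appL plus_endo.rep_eq distrib_right lin.add)
    show "L (x * y) = L x * L y"
    proof (rule endo_eqI)
      fix w
      define z where "z = y * \<pi> w"
      have zU: "z \<in> U" unfolding z_def using FUm[OF y \<pi>in] FU by blast
      have "(z - \<pi> z) + (\<pi> z - \<pi> (\<pi> z)) \<in> N" using D(7)[OF \<pi>U[OF zU] \<pi>U[OF \<pi>in]] .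
      then have "x * (z - \<pi> (\<pi> z)) \<in> N" using D(4)[OF x] by simp
      then have "\<pi> (x * z - x * \<pi> (\<pi> z)) = 0" using \<pi>N by (simp add: right_diff_distrib)
      then have "\<pi> (x * z) = \<pi> (x * \<pi> (\<pi> z))" by (simp add: lin.diff)
      then show "app (L (x * y)) w = app (L x * L y) w"
        by (simp add: appL times_endo.rep_eq z_def mult.assoc)
    qed
  next
    fix x :: "('v, 'e, 'k) lpa_free" and c assume x: "x \<in> FA (lpa_gens G)"
    show "L (scal c x) = sc c * L x"
      by (rule endo_eqI) (simp add: appL appsc times_endo.rep_eq scal_simps(3)[symmetric] lin.scale)
    show "L x * sc c = sc c * L x"
      by (rule endo_eqI) (simp add: appL appsc times_endo.rep_eq lin.scale scal_mult_right[symmetric])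
  next
    fix x :: "('v, 'e, 'k) lpa_free" assume x: "x \<in> FA (lpa_gens G)"
    show "L x = 0 \<longleftrightarrow> x \<in> N"
    proof
      assume "L x = 0"
      then have "\<pi> (x * \<pi> 1) = 0" using appL[of x 1] by (simp add: zero_endo.rep_eq)
      then have "x * \<pi> 1 \<in> N" using \<pi>0 FUm[OF x \<pi>in] FU by blast
      moreover have "x * (1 - \<pi> 1) \<in> N" using D(4)[OF x \<pi>U[OF U1]] .
      ultimately have "x * (1 - \<pi> 1) + x * \<pi> 1 \<in> N" using D(7) by blast
      then show "x \<in> N" by (simp add: algebra_simps)
    next
      assume "x \<in> N"
      then show "L x = 0" using \<pi>N NU \<pi>in by (intro endo_eqI) (simp add: appL zero_endo.rep_eq)
    qed
  next
    show "sc 1 = 1" by (rule endo_eqI) (simp add: appsc one_endo.rep_eq scal_simps)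
    fix a b :: 'k
    show "sc (a + b) = sc a + sc b" by (rule endo_eqI) (simp add: appsc plus_endo.rep_eq scal_simps)
    show "sc (a * b) = sc a * sc b" by (rule endo_eqI) (simp add: appsc times_endo.rep_eq scal_simps)
  qed (rule over)
  then show ?thesis by blast
qed

context ultragraph
begin

lemma over_rel_ideal: "over_ideal (lpa_rel_ideal G)"
  using raw_rel_ideal by (simp add: over_ideal_def)

lemma local_unit_rel:
  fixes x :: "('v, 'e, 'k::field) lpa_free"
  assumes "x \<in> FA (lpa_gens G)"
  shows "\<exists>A\<in>gen_verts G. x - free_gen (Proj A) * x \<in> lpa_rel_ideal G \<and> x - x * free_gen (Proj A) \<in>
    lpa_rel_ideal G"
proof -
  obtain L :: "('v, 'e, 'k) lpa_free \<Rightarrow> ('v, 'e, 'k) lpa_free endo" and sc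
    where "quotient_rep G (lpa_rel_ideal G) L sc"
    using exists_quotient_rep[OF over_rel_ideal rel_ideal_scal] by blast
  then interpret quotient_rep G "lpa_rel_ideal G" L sc .
  show ?thesis using local_unit_mod[OF assms] .
qed

text \<open>Since there are local units, ideals are automatically subspaces.\<close>

lemma over_ideal_scal:
  assumes N: "over_ideal N" and x: "x \<in> N"
  shows "scal c x \<in> N"
proof -
  have r: "raw_ideal (lpa_gens G) N" and R: "lpa_rel_ideal G \<subseteq> N" using N by (auto simp: over_ideal_def)
  note D = raw_idealD[OF r]
  obtain A where A: "A \<in> gen_verts G" "x - free_gen (Proj A) * x \<in> lpa_rel_ideal G"
    using local_unit_rel[OF D(1)[OF x]] by blast
  have "scal c (x - free_gen (Proj A) * x) \<in> N" using rel_ideal_scal[OF A(2)] R by blast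
  moreover have "scal c (free_gen (Proj A)) * x \<in> N" using D(4)[OF FA_scal[OF gen_FA(1)[OF A(1)]] x] .
  moreover have "scal c x = scal c (x - free_gen (Proj A) * x) + scal c (free_gen (Proj A)) * x"
    by (simp add: scal_simps)
  ultimately show ?thesis using D(7) by simp
qed

lemma quotient_rep_of_over_ideal:
  fixes N :: "('v, 'e, 'k::field) lpa_free set"
  assumes "over_ideal N"
  obtains L :: "('v, 'e, 'k) lpa_free \<Rightarrow> ('v, 'e, 'k) lpa_free endo" and sc where "quotient_rep G N L sc"
  using exists_quotient_rep[OF assms over_ideal_scal[OF assms]] by blast

text \<open>Primeness in terms of elements. The two ideals multiplied in the proof are annihilators, and the
  local units give \<open>u z = u p\<^sub>A z\<close>.\<close>

lemma prime_elementwise: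
  fixes I :: "('v, 'e, 'k::field) lpa_elem set"
  assumes P: "prime_two_sided_ideal (lpa G) I"
    and xy: "x \<in> FA (lpa_gens G)" "y \<in> FA (lpa_gens G)"
    and ann: "\<And>a. a \<in> FA (lpa_gens G) \<Longrightarrow> x * a * y \<in> pre I"
  shows "x \<in> pre I \<or> y \<in> pre I"
proof -
  have I: "two_sided_ideal (lpa G) I" using P by (simp add: prime_two_sided_ideal_def)
  have o: "over_ideal (pre I)" by (rule over_ideal_pre[OF I])
  then have r: "raw_ideal (lpa_gens G) (pre I)" and R: "lpa_rel_ideal G \<subseteq> pre I" by (auto simp:
      over_ideal_def)
  note D = raw_idealD[OF r]
  let ?F = "FA (lpa_gens G)"
  define Y where "Y = {z \<in> ?F. \<forall>a\<in>?F. x * a * z \<in> pre I}"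
  define X where "X = {z \<in> ?F. \<forall>a\<in>?F. \<forall>b\<in>Y. z * a * b \<in> pre I}"
  have "raw_ideal (lpa_gens G) Y"
  proof (rule raw_idealI)
    fix c z :: "('v, 'e, 'k) lpa_free" assume c: "c \<in> ?F" and z: "z \<in> Y"
    have zF: "z \<in> ?F" and zY: "\<And>a. a \<in> ?F \<Longrightarrow> x * a * z \<in> pre I" using z by (simp_all add: Y_def)
    have "x * a * (c * z) \<in> pre I" "x * a * (z * c) \<in> pre I" if a: "a \<in> ?F" for a
      using zY[OF FA_mult[OF a c]] D(5)[OF c zY[OF a]] by (simp_all add: mult.assoc)
    then show "c * z \<in> Y" "z * c \<in> Y" using c zF by (simp_all add: Y_def FA_mult)
  qed (use D in \<open>auto simp: Y_def FA_diff right_diff_distrib\<close>)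
  moreover have "z \<in> Y" if "z \<in> lpa_rel_ideal G" for z
    using that R rel_idealD(1)[OF that] D(4) FA_mult[OF xy(1)] unfolding Y_def by blast
  ultimately have oY: "over_ideal Y" unfolding over_ideal_def by blast
  have YF: "z \<in> ?F" if "z \<in> Y" for z using that by (simp add: Y_def)
  have "raw_ideal (lpa_gens G) X"
  proof (rule raw_idealI)
    fix c z :: "('v, 'e, 'k) lpa_free" assume c: "c \<in> ?F" and z: "z \<in> X"
    have zF: "z \<in> ?F" and zX: "\<And>a b. a \<in> ?F \<Longrightarrow> b \<in> Y \<Longrightarrow> z * a * b \<in> pre I" using z by (simp_all add:
        X_def)
    have "z * c * a * b \<in> pre I" "c * z * a * b \<in> pre I" if a: "a \<in> ?F" and b: "b \<in> Y" for a b
      using zX[OF FA_mult[OF c a] b] D(4)[OF c zX[OF a b]] by (simp_all add: mult.assoc)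
    then show "c * z \<in> X" "z * c \<in> X" using c zF by (simp_all add: X_def FA_mult)
  qed (use D in \<open>auto simp: X_def FA_diff left_diff_distrib\<close>)
  moreover have "z \<in> X" if z: "z \<in> lpa_rel_ideal G" for z
  proof -
    have "z * (a * b) \<in> pre I" if "a \<in> ?F" "b \<in> Y" for a b
      using D(5)[OF FA_mult[OF that(1) YF[OF that(2)]]] z R by blast
    then show ?thesis using rel_idealD(1)[OF z] by (simp add: X_def mult.assoc)
  qed
  ultimately have oX: "over_ideal X" unfolding over_ideal_def by blast
  have XF: "z \<in> ?F" if "z \<in> X" for z using that by (simp add: X_def)
  have prod: "u * z \<in> pre I" if u: "u \<in> X" and z: "z \<in> Y" for u z
  proof -
    obtain A where A: "A \<in> gen_verts G" "z - free_gen (Proj A) * z \<in> lpa_rel_ideal G"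
      using local_unit_rel[OF YF[OF z]] by blast
    have "u * (z - free_gen (Proj A) * z) \<in> pre I" using D(4)[OF XF[OF u]] A(2) R by blast
    moreover have "u * free_gen (Proj A) * z \<in> pre I" using u z gen_FA(1)[OF A(1)] unfolding X_def
        by blast
    ultimately have "u * (z - free_gen (Proj A) * z) + u * free_gen (Proj A) * z \<in> pre I" using
        D(7) by blast
    then show ?thesis by (simp add: algebra_simps)
  qed
  have "\<forall>a\<in>lpa_class G ` X. \<forall>b\<in>lpa_class G ` Y. a \<otimes>\<^bsub>lpa G\<^esub> b \<in> I"
  proof (intro ballI)
    fix a b assume "a \<in> lpa_class G ` X" "b \<in> lpa_class G ` Y"
    then obtain u z where "a = lpa_class G u" "b = lpa_class G z" "u \<in> X" "z \<in> Y" by blast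
    then show "a \<otimes>\<^bsub>lpa G\<^esub> b \<in> I" using prod[of u z] XF YF by (simp add: lpa_mult pre_def)
  qed
  then have "lpa_class G ` X \<subseteq> I \<or> lpa_class G ` Y \<subseteq> I"
    using P two_sided_ideal_image(1)[OF oX] two_sided_ideal_image(1)[OF oY]
    unfolding prime_two_sided_ideal_def by blast
  moreover have "y \<in> Y" using xy ann by (simp add: Y_def)
  moreover have "x \<in> X" using xy by (simp add: X_def Y_def)
  ultimately show ?thesis using xy by (auto simp: pre_def)
qed

end

section \<open>Generators and loops in the free algebra\<close>

text \<open>Representatives of \<open>s\<^sub>\<gamma>\<close>, \<open>s\<^sub>\<gamma>\<^sub>*\<close>, their powers and \<open>f(s\<^sub>\<gamma>)\<close>, and of \<open>p\<^sub>w\<^sup>H\<close> in the free algebra.\<close>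

definition free_path :: "'e list \<Rightarrow> ('v, 'e, 'k::field) lpa_free" where
  "free_path \<gamma> = prod_list (map (\<lambda>e. free_gen (Edge e)) \<gamma>)"

definition free_ghost :: "'e list \<Rightarrow> ('v, 'e, 'k::field) lpa_free" where
  "free_ghost \<gamma> = prod_list (map (\<lambda>e. free_gen (Ghost e)) (rev \<gamma>))"

definition free_power :: "('v, 'e) ultragraph \<Rightarrow> 'e list \<Rightarrow> int \<Rightarrow> ('v, 'e, 'k::field) lpa_free" where
  "free_power G \<gamma> k = (if k = 0 then free_gen (Proj {path_src G \<gamma>})
     else if k > 0 then free_path \<gamma> ^ nat k else free_ghost \<gamma> ^ nat (- k))"

definition free_eval :: "('v, 'e) ultragraph \<Rightarrow> 'e list \<Rightarrow> (int \<Rightarrow>\<^sub>0 'k::field) \<Rightarrow> ('v, 'e, 'k)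
    lpa_free" where
  "free_eval G \<gamma> f = (\<Sum>k\<in>Poly_Mapping.keys f. scal (Poly_Mapping.lookup f k) (free_power G \<gamma> k))"

definition free_pH :: "('v, 'e) ultragraph \<Rightarrow> 'v set set \<Rightarrow> 'v \<Rightarrow> ('v, 'e, 'k::field) lpa_free" where
  "free_pH G H w = free_gen (Proj {w}) -
     (\<Sum>e\<in>{e \<in> out_edges G w. rng G e \<notin> H}. free_gen (Edge e) * free_gen (Ghost e))"

lemma prod_list_FA: "xs \<noteq> [] \<Longrightarrow> set xs \<subseteq> FA X \<Longrightarrow> prod_list xs \<in> FA X"
proof (induction xs)
  case (Cons x xs)
  then show ?case by (cases "xs = []") (auto intro: FA_mult)
qed simp

lemma power_FA: "x \<in> FA X \<Longrightarrow> m \<noteq> 0 \<Longrightarrow> x ^ m \<in> FA X"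
  using prod_list_FA[of "replicate m x" X] by auto

lemma free_path_FA: "\<gamma> \<noteq> [] \<Longrightarrow> set \<gamma> \<subseteq> edges G \<Longrightarrow> free_path \<gamma> \<in> FA (lpa_gens G)"
  and free_ghost_FA: "\<gamma> \<noteq> [] \<Longrightarrow> set \<gamma> \<subseteq> edges G \<Longrightarrow> free_ghost \<gamma> \<in> FA (lpa_gens G)"
  unfolding free_path_def free_ghost_def by (auto intro!: prod_list_FA gen_FA)

context ultragraph
begin

lemma nelist_prod_lpa:
  "xs \<noteq> [] \<Longrightarrow> set xs \<subseteq> FA (lpa_gens G) \<Longrightarrow>
    nelist_prod (lpa G) (map (lpa_class G) xs) = lpa_class G (prod_list xs)"
proof (induction xs)
  case (Cons x xs)
  show ?case
  proof (cases xs)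
    case (Cons y ys)
    then have "nelist_prod (lpa G) (map (lpa_class G) (x # xs)) =
        lpa_class G x \<otimes>\<^bsub>lpa G\<^esub> nelist_prod (lpa G) (map (lpa_class G) xs)" by simp
    also have "\<dots> = lpa_class G x \<otimes>\<^bsub>lpa G\<^esub> lpa_class G (prod_list xs)" using Cons.IH Cons Cons.prems
        by simp
    also have "\<dots> = lpa_class G (x * prod_list xs)"
      using Cons.prems Cons prod_list_FA[of xs "lpa_gens G"] by (intro lpa_mult) auto
    finally show ?thesis by simp
  qed simp
qed simp

lemma lpa_path_class:
  assumes "\<gamma> \<noteq> []" "set \<gamma> \<subseteq> edges G"
  shows "lpa_path G \<gamma> = lpa_class G (free_path \<gamma>)" "lpa_ghost_path G \<gamma> = lpa_class G (free_ghost \<gamma>)"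
proof -
  have 1: "set (map (\<lambda>e. free_gen (Edge e)) \<gamma>) \<subseteq> FA (lpa_gens G)"
    "set (map (\<lambda>e. free_gen (Ghost e)) (rev \<gamma>)) \<subseteq> FA (lpa_gens G)" using assms by (auto intro!: gen_FA)
  have 2: "map (lpa_s G) \<gamma> = map (lpa_class G) (map (\<lambda>e. free_gen (Edge e)) \<gamma>)"
    "map (lpa_t G) (rev \<gamma>) = map (lpa_class G) (map (\<lambda>e. free_gen (Ghost e)) (rev \<gamma>))"
    by (simp_all add: lpa_s_def lpa_t_def)
  show "lpa_path G \<gamma> = lpa_class G (free_path \<gamma>)"
    unfolding lpa_path_def free_path_def 2 using assms 1(1) by (intro nelist_prod_lpa) auto
  show "lpa_ghost_path G \<gamma> = lpa_class G (free_ghost \<gamma>)"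
    unfolding lpa_ghost_path_def free_ghost_def 2 using assms 1(2) by (intro nelist_prod_lpa) auto
qed

lemma nelist_prod_replicate:
  assumes "x \<in> FA (lpa_gens G)" "m \<noteq> 0"
  shows "nelist_prod (lpa G) (replicate m (lpa_class G x)) = lpa_class G (x ^ m)"
  using nelist_prod_lpa[of "replicate m x"] assms by simp

lemma path_src_gv: "\<gamma> \<noteq> [] \<Longrightarrow> set \<gamma> \<subseteq> edges G \<Longrightarrow> {path_src G \<gamma>} \<in> gen_verts G"
  unfolding path_src_def by (intro gen_verts.vertex src_closed) auto

lemma free_power_FA: "\<gamma> \<noteq> [] \<Longrightarrow> set \<gamma> \<subseteq> edges G \<Longrightarrow> free_power G \<gamma> k \<in> FA (lpa_gens G)"
  unfolding free_power_def
  by (auto intro!: power_FA free_path_FA free_ghost_FA gen_FA path_src_gv)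

lemma free_eval_FA: "\<gamma> \<noteq> [] \<Longrightarrow> set \<gamma> \<subseteq> edges G \<Longrightarrow> free_eval G \<gamma> f \<in> FA (lpa_gens G)"
  unfolding free_eval_def by (intro FA_sum FA_scal free_power_FA)

lemma loop_power_class:
  assumes "\<gamma> \<noteq> []" "set \<gamma> \<subseteq> edges G"
  shows "loop_power G \<gamma> k = lpa_class G (free_power G \<gamma> k)"
  using nelist_prod_replicate[OF free_path_FA[OF assms], of "nat k"]
    nelist_prod_replicate[OF free_ghost_FA[OF assms], of "nat (- k)"]
  by (auto simp: loop_power_def free_power_def lpa_p_def lpa_path_class[OF assms])

lemma laurent_eval_class:
  assumes "\<gamma> \<noteq> []" "set \<gamma> \<subseteq> edges G"
  shows "laurent_eval G f \<gamma> = lpa_class G (free_eval G \<gamma> f)"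
  unfolding laurent_eval_def free_eval_def loop_power_class[OF assms] lpa_smult
  by (intro lpa_finsum FA_scal free_power_FA assms) auto

lemma free_pH_FA: "w \<in> verts G \<Longrightarrow> free_pH G H w \<in> FA (lpa_gens G)"
  unfolding free_pH_def
  by (intro FA_diff FA_sum FA_mult gen_FA gen_verts.vertex) (auto simp: out_edges_def)

lemma lpa_pH_class:
  assumes "w \<in> breaking_verts G H"
  shows "lpa_pH G H w = (lpa_class G (free_pH G H w) :: ('v, 'e, 'k::field) lpa_elem)"
proof -
  have w: "w \<in> verts G" and fin: "finite {e \<in> out_edges G w. rng G e \<notin> H}"
    using assms by (auto simp: breaking_verts_def)
  have E: "e \<in> edges G" if "e \<in> {e \<in> out_edges G w. rng G e \<notin> H}" for e
    using that by (simp add: out_edges_def)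
  have F: "free_gen (Edge e) * free_gen (Ghost e) \<in> (FA (lpa_gens G) :: ('v, 'e, 'k) lpa_free set)"
    if "e \<in> {e \<in> out_edges G w. rng G e \<notin> H}" for e using E[OF that] by (intro FA_mult gen_FA)
  have "finsum (lpa G) (\<lambda>e. lpa_s G e \<otimes>\<^bsub>lpa G\<^esub> lpa_t G e) {e \<in> out_edges G w. rng G e \<notin> H} =
      (finsum (lpa G) (\<lambda>e. lpa_class G (free_gen (Edge e) * free_gen (Ghost e))) {e \<in> out_edges G
          w. rng G e \<notin> H}
        :: ('v, 'e, 'k) lpa_elem)"
  proof (rule abelian_monoid.finsum_cong')
    show "abelian_monoid (lpa G :: ('k, ('v, 'e, 'k) lpa_elem) module)" by (rule
        abelian_group.axioms(1)[OF abelian_group_lpa])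
    show "lpa_s G e \<otimes>\<^bsub>lpa G\<^esub> lpa_t G e =
        (lpa_class G (free_gen (Edge e) * free_gen (Ghost e)) :: ('v, 'e, 'k) lpa_elem)"
      if "e \<in> {e \<in> out_edges G w. rng G e \<notin> H}" for e
      using E[OF that] by (simp add: lpa_s_def lpa_t_def lpa_mult gen_FA)
  qed (use F in \<open>auto simp: carrier_lpa\<close>)
  also have "\<dots> = lpa_class G (\<Sum>e\<in>{e \<in> out_edges G w. rng G e \<notin> H}. free_gen (Edge e) * free_gen
      (Ghost e))"
    by (rule lpa_finsum[OF fin F])
  finally have sum: "finsum (lpa G) (\<lambda>e. lpa_s G e \<otimes>\<^bsub>lpa G\<^esub> lpa_t G e) {e \<in> out_edges G w. rng G e \<notin> H} =
      (lpa_class G (\<Sum>e\<in>{e \<in> out_edges G w. rng G e \<notin> H}. free_gen (Edge e) * free_gen (Ghost e))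
        :: ('v, 'e, 'k) lpa_elem)" .
  show ?thesis unfolding lpa_pH_def free_pH_def lpa_p_def sum
    by (intro lpa_minus FA_sum F gen_FA gen_verts.vertex w)
qed

lemma homogeneous_power: "homogeneous d x \<Longrightarrow> homogeneous (int m * d) (x ^ m)"
proof (induction m)
  case 0
  then show ?case by (simp add: homogeneous_def deg_0)
next
  case (Suc m)
  then show ?case using homogeneous_mult[of d x "int m * d" "x ^ m"] by (simp add: algebra_simps)
qed

lemma homogeneous_free_path: "homogeneous (int (length \<gamma>)) (free_path \<gamma>)"
  and homogeneous_free_ghost: "homogeneous (- int (length \<gamma>)) (free_ghost \<gamma>)"
proof (induction \<gamma>)
  case Nil
  { case 1 show ?case by (simp add: free_path_def homogeneous_def deg_0) }
  { case 2 show ?case by (simp add: free_ghost_def homogeneous_def deg_0) }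
next
  case (Cons e \<gamma>)
  { case 1
    show ?case using homogeneous_mult[OF homogeneous_gen[of "Edge e"] Cons(1)] by (simp add:
        free_path_def) }
  { case 2
    show ?case using homogeneous_mult[OF Cons(2) homogeneous_gen[of "Ghost e"]]
      by (simp add: free_ghost_def algebra_simps) }
qed

lemma homogeneous_free_power: "homogeneous (k * int (length \<gamma>)) (free_power G \<gamma> k)"
  using homogeneous_gen[of "Proj {path_src G \<gamma>}"] homogeneous_power[OF homogeneous_free_path, of
      "nat k" \<gamma>]
    homogeneous_power[OF homogeneous_free_ghost, of "nat (- k)" \<gamma>]
  by (cases "k = 0"; cases "0 < k") (simp_all add: free_power_def)

lemma homogeneous_free_pH: "homogeneous 0 (free_pH G H w)"
proof -
  have "homogeneous 0 (free_gen (Edge e) * free_gen (Ghost e))" for e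
    using homogeneous_mult[OF homogeneous_gen[of "Edge e"] homogeneous_gen[of "Ghost e"]] by simp
  then show ?thesis unfolding free_pH_def
    using homogeneous_gen[of "Proj {w}"] by (intro homogeneous_diff homogeneous_sum) auto
qed

lemma ideal_verts_pre: "ideal_verts G I = {A \<in> gen_verts G. free_gen (Proj A) \<in> pre I}"
  by (auto simp: ideal_verts_def lpa_p_def pre_def gen_FA)

lemma generators_carrier:
  assumes "H \<subseteq> gen_verts G" "S \<subseteq> breaking_verts G H"
  shows "lpa_p G ` H \<union> lpa_pH G H ` S \<subseteq> carrier (lpa G)"
proof -
  have "lpa_p G A \<in> carrier (lpa G)" if "A \<in> H" for A
    using assms(1) that by (auto simp: lpa_p_def carrier_lpa intro!: gen_FA)
  moreover have "lpa_pH G H w \<in> carrier (lpa G)" if "w \<in> S" for w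
    using assms(2) that free_pH_FA[of w H] unfolding carrier_lpa
    by (auto simp: lpa_pH_class breaking_verts_def subset_iff)
  ultimately show ?thesis by blast
qed

lemma two_sided_ideal_carrier: "two_sided_ideal R I \<Longrightarrow> I \<subseteq> carrier R"
  by (simp add: two_sided_ideal_iff)

lemma pre_mono: "I \<subseteq> J \<Longrightarrow> pre I \<subseteq> pre J"
  by (auto simp: pre_def)

text \<open>An ideal generated by homogeneous elements is graded.\<close>

lemma hproj_ideal_HS:
  fixes x :: "('v, 'e, 'k::field) lpa_free"
  assumes H: "H \<subseteq> gen_verts G"
    and x: "x \<in> pre (ideal_HS G H (breaking_verts G H))"
  shows "hproj n x \<in> pre (ideal_HS G H (breaking_verts G H))"
proof -
  let ?J = "ideal_HS G H (breaking_verts G H) :: ('v, 'e, 'k) lpa_elem set"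
  let ?M = "{x \<in> FA (lpa_gens G). \<forall>n. hproj n x \<in> pre ?J} :: ('v, 'e, 'k) lpa_free set"
  note gp = ideal_gen_props[OF generators_carrier[OF H order_refl], folded ideal_HS_def]
  have o: "over_ideal (pre ?J)" by (rule over_ideal_pre[OF gp(1)])
  then have r: "raw_ideal (lpa_gens G) (pre ?J)" and R: "lpa_rel_ideal G \<subseteq> pre ?J" by (auto simp:
      over_ideal_def)
  have "lpa_rel_ideal G \<subseteq> ?M" using rel_ideal_hproj R rel_idealD(1) by blast
  then have oM: "over_ideal ?M" using hproj_closed_ideal[OF o] by (simp add: over_ideal_def)
  have hom: "lpa_class G y \<in> lpa_class G ` ?M" if y: "homogeneous 0 y" "y \<in> FA (lpa_gens G)"
      "lpa_class G y \<in> ?J" for y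
  proof (rule imageI)
    have "hproj n y \<in> pre ?J" for n
      using y raw_idealD(2)[OF r] by (cases "n = 0") (simp_all add: hproj_homogeneous' pre_mem)
    then show "y \<in> ?M" using y by simp
  qed
  have "lpa_p G A \<in> lpa_class G ` ?M" if A: "A \<in> H" for A
    unfolding lpa_p_def using A H gp(2) homogeneous_gen[of "Proj A"]
    by (intro hom) (auto simp: lpa_p_def intro!: gen_FA)
  moreover have "lpa_pH G H w \<in> lpa_class G ` ?M" if w: "w \<in> breaking_verts G H" for w
    unfolding lpa_pH_class[OF w]
  proof (rule hom[OF homogeneous_free_pH])
    show "free_pH G H w \<in> FA (lpa_gens G)" using w by (intro free_pH_FA) (simp add: breaking_verts_def)
    have "lpa_pH G H w \<in> ?J" using gp(2) w by (intro subsetD[OF gp(2)] UnI2 imageI)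
    then show "lpa_class G (free_pH G H w) \<in> ?J" by (simp only: lpa_pH_class[OF w])
  qed
  ultimately have "lpa_p G ` H \<union> lpa_pH G H ` breaking_verts G H \<subseteq> lpa_class G ` ?M" by blast
  from ideal_gen_least[OF two_sided_ideal_image(1)[OF oM] this]
  have "?J \<subseteq> lpa_class G ` ?M" by (simp only: ideal_HS_def[of G H "breaking_verts G H"])
  from pre_mono[OF this] have "pre ?J \<subseteq> ?M" unfolding two_sided_ideal_image(2)[OF oM] .
  from subsetD[OF this x] show ?thesis by simp
qed


section \<open>Primeness and gradedness\<close>

text \<open>A prime ideal is graded as soon as it is graded on one corner not contained in it: if \<open>x\<close>
    belongs to
  the ideal, then so do all \<open>q a x b q\<close>, hence for words \<open>a\<close>, \<open>b\<close> also \<open>q a x\<^sub>n b q\<close>, which is the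
      compression
  of a homogeneous component of \<open>a x b\<close>; primeness yields \<open>x\<^sub>n\<close>.\<close>

lemma graded_by_corner:
  fixes I :: "('v, 'e, 'k::field) lpa_elem set"
  assumes P: "prime_two_sided_ideal (lpa G) I"
    and q: "q \<in> FA (lpa_gens G)" "q \<notin> pre I"
    and corner: "\<And>z n. z \<in> FA (lpa_gens G) \<Longrightarrow> q * z * q \<in> pre I \<Longrightarrow> q * hproj n z * q \<in> pre I"
  shows "graded_ideal G I"
proof -
  let ?F = "FA (lpa_gens G)"
  have I: "two_sided_ideal (lpa G) I" using P by (simp add: prime_two_sided_ideal_def)
  have r: "raw_ideal (lpa_gens G) (pre I)" using over_ideal_pre[OF I] by (simp add: over_ideal_def)
  note D = raw_idealD[OF r]
  have "hproj n x \<in> pre I" if x: "x \<in> pre I" for x n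
  proof -
    let ?y = "hproj n x"
    have xF: "x \<in> ?F" by (rule D(1)[OF x])
    have yF: "?y \<in> ?F" by (rule hproj_FA[OF xF])
    have words: "q * (a * ?y * b) * q \<in> pre I"
      if a: "a = Poly_Mapping.single w c" "a \<in> ?F" and b: "b = Poly_Mapping.single w' c'" "b \<in> ?F"
          for a b w w' c c'
    proof -
      have "q * (a * x * b) * q \<in> pre I" using D(4,5) x a b q by blast
      then have "q * hproj (n + deg w + deg w') (a * x * b) * q \<in> pre I"
        by (intro corner FA_mult a(2) b(2) xF)
      then show ?thesis by (simp add: a(1) b(1) hproj_single_mult)
    qed
    have all: "q * (a * ?y * b) * q \<in> pre I" if a: "a \<in> ?F" and b: "b \<in> ?F" for a b
    proof -
      have "q * (a * ?y * b) * q = (\<Sum>w'\<in>Poly_Mapping.keys b. \<Sum>w\<in>Poly_Mapping.keys a.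
          q * (Poly_Mapping.single w (Poly_Mapping.lookup a w) * ?y * Poly_Mapping.single w'
              (Poly_Mapping.lookup b w')) * q)"
        by (subst (1) poly_mapping_eq_sum_single[of a], subst (1) poly_mapping_eq_sum_single[of b])
          (simp only: sum_distrib_left sum_distrib_right)
      also have "\<dots> \<in> pre I"
        using single_FA[OF a] single_FA[OF b] by (intro raw_ideal_sum[OF r] words[OF refl _ refl])
      finally show ?thesis .
    qed
    have "?y * b * q \<in> pre I" if b: "b \<in> ?F" for b
    proof -
      have "q * a * (?y * b * q) \<in> pre I" if "a \<in> ?F" for a using all[OF that b] by (simp add:
          mult.assoc)
      then show ?thesis using prime_elementwise[OF P q(1), of "?y * b * q"] q yF b by (auto intro:
          FA_mult)
    qed
    then show ?thesis using prime_elementwise[OF P yF q(1)] q(2) by blast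
  qed
  then show ?thesis using graded_iff[OF I] by blast
qed

text \<open>For a breaking vertex \<open>w\<close> the corner at \<open>p\<^sub>w\<^sup>H\<close> is, modulo the ideal, one-dimensional.\<close>

lemma graded_or_breaking:
  fixes I :: "('v, 'e, 'k::field) lpa_elem set"
  assumes P: "prime_two_sided_ideal (lpa G) I" and H: "H = ideal_verts G I"
    and w: "w \<in> breaking_verts G H" and notin: "free_pH G H w \<notin> pre I"
  shows "graded_ideal G I"
proof -
  have I: "two_sided_ideal (lpa G) I" using P by (simp add: prime_two_sided_ideal_def)
  obtain L :: "('v, 'e, 'k) lpa_free \<Rightarrow> ('v, 'e, 'k) lpa_free endo" and sc
    where "quotient_rep G (pre I) L sc" using quotient_rep_of_over_ideal[OF over_ideal_pre[OF I]]
        by metis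
  then interpret quotient_rep G "pre I" L sc .
  let ?q = "free_pH G H w :: ('v, 'e, 'k) lpa_free"
  let ?O = "{e \<in> out_edges G w. r e \<notin> H}"
  have wV: "w \<in> verts G" and fin: "finite ?O" using w by (auto simp: breaking_verts_def)
  have wG: "{w} \<in> V0" using wV by (rule gen_verts.vertex)
  have qF: "?q \<in> FG" by (rule free_pH_FA[OF wV])
  have OE: "e \<in> E" if "e \<in> ?O" for e using that by (simp add: out_edges_def)
  have H0: "A \<in> H \<longleftrightarrow> L (p A) = 0" if "A \<in> V0" for A
    using that by (simp add: H ideal_verts_pre L_zero_iff gen_FA)
  have Q: "L ?q = L (p {w}) - (\<Sum>e\<in>?O. L (se e) * L (te e))"
  proof -
    have "L ?q = L (p {w}) - L (\<Sum>e\<in>?O. se e * te e)"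
      unfolding free_pH_def using OE wG by (intro L_diff FA_sum FA_mult gen_FA)
    also have "L (\<Sum>e\<in>?O. se e * te e) = (\<Sum>e\<in>?O. L (se e * te e))"
      using OE by (intro L_sum FA_mult gen_FA)
    also have "\<dots> = (\<Sum>e\<in>?O. L (se e) * L (te e))" using OE by (intro sum.cong refl L_mult gen_FA)
    finally show ?thesis .
  qed
  have QS: "L ?q * L (se e) = 0" if e: "e \<in> E" for e
  proof -
    have "(\<Sum>f\<in>?O. L (se f) * L (te f)) * L (se e) = (\<Sum>f\<in>?O. if f = e then L (se e) else 0)"
      unfolding sum_distrib_right using TS OE e SP_rng[OF e] by (intro sum.cong) (auto simp: mult.assoc)
    also have "\<dots> = (if e \<in> ?O then L (se e) else 0)" using fin by simp
    finally show ?thesis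
      using e PS[OF wG e] S_zero_iff[OF e] H0[of "r e"] by (auto simp: Q left_diff_distrib
          out_edges_def)
  qed
  have TQ: "L (te e) * L ?q = 0" if e: "e \<in> E" for e
  proof -
    have "L (te e) * (\<Sum>f\<in>?O. L (se f) * L (te f)) = (\<Sum>f\<in>?O. if f = e then L (te e) else 0)"
      unfolding sum_distrib_left using TS OE e PT_rng[OF e] by (intro sum.cong) (auto simp:
          mult.assoc[symmetric])
    also have "\<dots> = (if e \<in> ?O then L (te e) else 0)" using fin by simp
    moreover have "L (te e) = 0" if "r e \<in> H" using PT_rng[OF e] H0[of "r e"] e that by auto
    ultimately show ?thesis
      using e TP[OF wG e] by (auto simp: Q right_diff_distrib out_edges_def)
  qed
  have QP: "L ?q * L (p A) * L ?q = 0 \<or> L ?q * L (p A) * L ?q = L ?q" if A: "A \<in> V0" for A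
  proof -
    have QQ: "L ?q * L ?q = L ?q * L (p {w})"
    proof -
      have "L ?q * (L (se e) * L (te e)) = 0" if "e \<in> ?O" for e
        using QS[OF OE[OF that]] by (simp add: mult.assoc[symmetric])
      then have "L ?q * (\<Sum>e\<in>?O. L (se e) * L (te e)) = 0"
        unfolding sum_distrib_left by (intro sum.neutral ballI)
      then show ?thesis using arg_cong[OF Q, of "\<lambda>x. L ?q * x"] by (simp add: right_diff_distrib)
    qed
    have Qw: "L ?q * L (p B) = (if w \<in> B then L ?q else 0)" if B: "B \<in> V0" for B
    proof -
      have "L (te e) * L (p B) = (if w \<in> B then L (te e) else 0)" if "e \<in> ?O" for e
        using TP[OF B OE[OF that]] that by (auto simp: out_edges_def)
      then show ?thesis
        unfolding Q left_diff_distrib sum_distrib_right mult.assoc P_mult[OF wG B]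
        by (cases "w \<in> B") auto
    qed
    have "L ?q * L ?q = L ?q" unfolding QQ using Qw[OF wG] by simp
    then show ?thesis using Qw[OF A] by auto
  qed
  have mono: "\<exists>\<kappa>. L ?q * x * L ?q = sc \<kappa> * L ?q \<and> (d \<noteq> 0 \<longrightarrow> \<kappa> = 0)" if x: "monomial d m x" for d m x
  proof (cases "L ?q * x * L ?q = 0")
    case True
    then show ?thesis by (intro exI[of _ 0]) simp
  next
    case False
    then obtain \<alpha> A \<beta> where \<alpha>: "set \<alpha> \<subseteq> E" "set \<beta> \<subseteq> E" "A \<in> V0" "x = Sp \<alpha> * L (p A) * Tp \<beta>"
      "d = int (length \<alpha>) - int (length \<beta>)" using x by (auto simp: monomial_def)
    have "\<alpha> = []"
    proof (rule ccontr)
      assume "\<alpha> \<noteq> []"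
      then obtain e \<alpha>' where "\<alpha> = e # \<alpha>'" by (cases \<alpha>) auto
      then have "L ?q * Sp \<alpha> = 0" using QS[of e] \<alpha> by (simp add: Sp_Cons mult.assoc[symmetric])
      then show False using False \<alpha>(4) by (simp add: mult.assoc[symmetric])
    qed
    moreover have "\<beta> = []"
    proof (rule ccontr)
      assume "\<beta> \<noteq> []"
      then obtain e \<beta>' where "\<beta> = e # \<beta>'" by (cases \<beta>) auto
      then have "Tp \<beta> * L ?q = 0" using TQ[of e] \<alpha> by (simp add: Tp_Cons mult.assoc)
      then show False using False \<alpha>(4) by (simp add: mult.assoc)
    qed
    ultimately have "L ?q * x * L ?q = L ?q" "d = 0" using QP[OF \<alpha>(3)] \<alpha>(4,5) False by auto
    then show ?thesis by (intro exI[of _ 1]) simp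
  qed
  \<comment> \<open>the scalar by which a word acts in the corner\<close>
  have "\<exists>\<kappa>. \<forall>w. letters w \<noteq> [] \<longrightarrow> set (letters w) \<subseteq> lpa_gens G \<longrightarrow>
      L ?q * L (Poly_Mapping.single w 1) * L ?q = sc (\<kappa> w) * L ?q \<and> (deg w \<noteq> 0 \<longrightarrow> \<kappa> w = 0)"
    by (rule choice) (use mono L_word in metis)
  then obtain \<kappa> where \<kappa>: "\<And>w. letters w \<noteq> [] \<Longrightarrow> set (letters w) \<subseteq> lpa_gens G \<Longrightarrow>
      L ?q * L (Poly_Mapping.single w 1) * L ?q = sc (\<kappa> w) * L ?q \<and> (deg w \<noteq> 0 \<longrightarrow> \<kappa> w = 0)" by blast
  have Lz: "L (?q * z * ?q) = (\<Sum>w\<in>Poly_Mapping.keys z. sc (Poly_Mapping.lookup z w * \<kappa> w) * L ?q)"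
      if z: "z \<in> FG" for z
  proof -
    have "L (?q * z * ?q) = L ?q * L z * L ?q" using z qF by (simp add: L_mult FA_mult)
    also have "\<dots> = (\<Sum>w\<in>Poly_Mapping.keys z. L ?q * (sc (Poly_Mapping.lookup z w) * L
        (Poly_Mapping.single w 1)) * L ?q)"
      unfolding L_decomp[OF z] by (simp add: sum_distrib_left sum_distrib_right)
    also have "\<dots> = (\<Sum>w\<in>Poly_Mapping.keys z. sc (Poly_Mapping.lookup z w * \<kappa> w) * L ?q)"
    proof (intro sum.cong refl)
      fix w assume "w \<in> Poly_Mapping.keys z"
      then have "L ?q * L (Poly_Mapping.single w 1) * L ?q = sc (\<kappa> w) * L ?q" using \<kappa> z unfolding
          mem_FA by blast
      moreover have "L ?q * (sc (Poly_Mapping.lookup z w) * L (Poly_Mapping.single w 1)) * L ?q =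
          sc (Poly_Mapping.lookup z w) * (L ?q * L (Poly_Mapping.single w 1) * L ?q)"
        using rep_sc_comm[OF qF] by (simp only: mult.assoc[symmetric])
      ultimately show "L ?q * (sc (Poly_Mapping.lookup z w) * L (Poly_Mapping.single w 1)) * L ?q =
          sc (Poly_Mapping.lookup z w * \<kappa> w) * L ?q" by (simp only: rep_sc_mult mult.assoc)
    qed
    finally show ?thesis .
  qed
  show ?thesis
  proof (rule graded_by_corner[OF P qF notin])
    fix z n assume z: "z \<in> FG" and qz: "?q * z * ?q \<in> pre I"
    have hz: "hproj n z \<in> FG" by (rule hproj_FA[OF z])
    have F: "?q * y * ?q \<in> FG" if "y \<in> FG" for y using qF that by (intro FA_mult)
    have "L (?q * hproj n z * ?q) = (\<Sum>w\<in>{w \<in> Poly_Mapping.keys z. deg w = n}. sc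
        (Poly_Mapping.lookup z w * \<kappa> w) * L ?q)"
      unfolding Lz[OF hz] keys_hproj by (intro sum.cong refl) (simp add: lookup_hproj)
    also have "\<dots> = (if n = 0 then L (?q * z * ?q) else 0)"
    proof (cases "n = 0")
      case True
      have "\<kappa> w = 0" if "w \<in> Poly_Mapping.keys z" "deg w \<noteq> 0" for w
        using \<kappa>[of w] that z unfolding mem_FA by blast
      then show ?thesis unfolding Lz[OF z] using True by (simp, intro sum.mono_neutral_left) auto
    next
      case False
      have "\<kappa> w = 0" if "w \<in> Poly_Mapping.keys z" "deg w = n" for w
        using \<kappa>[of w] that z False unfolding mem_FA by blast
      then show ?thesis using False by (auto intro!: sum.neutral)
    qed
    also have "\<dots> = 0" using L_zero_iff[OF F[OF z]] qz by simp
    finally show "?q * hproj n z * ?q \<in> pre I" using L_zero_iff[OF F[OF hz]] by simp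
  qed
qed

end


section \<open>Exitless loops and their corners modulo an ideal\<close>

context quotient_rep
begin

text \<open>The collection \<open>H\<close> belonging to \<open>N\<close>.\<close>

abbreviation HN :: "'v set set" where "HN \<equiv> {A \<in> gen_verts G. p A \<in> N}"

lemma HN_iff: "A \<in> gen_verts G \<Longrightarrow> L (p A) = 0 \<longleftrightarrow> A \<in> HN"
  by (simp add: L_zero_iff gen_FA)

lemma outside_iff: "A \<in> gen_verts G - HN \<longleftrightarrow> A \<in> gen_verts G \<and> L (p A) \<noteq> 0"
  using HN_iff by blast

lemma exitless_cycle_iff:
  assumes full: "leavitt_full G (\<lambda>A. L (p A)) (\<lambda>e. L (se e)) (\<lambda>e. L (te e)) sc"
  shows "exitless_cycle G (\<lambda>A. L (p A)) (\<lambda>e. L (se e)) (\<lambda>e. L (te e)) sc \<gamma> \<longleftrightarrow>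
    loop_outside G HN \<gamma> \<and> distinct (map (src G) \<gamma>) \<and> \<not> has_exit_outside G HN \<gamma>"
proof
  assume c: "exitless_cycle G (\<lambda>A. L (p A)) (\<lambda>e. L (se e)) (\<lambda>e. L (te e)) sc \<gamma>"
  note C = exitless_cycle.cycle_ne[OF c] exitless_cycle.cycle_edges[OF c]
      exitless_cycle.cycle_distinct[OF c]
    exitless_cycle.cycle_live[OF c] exitless_cycle.cycle_next[OF c] exitless_cycle.cycle_rng[OF c]
        exitless_cycle.cycle_edge[OF c]
  have nth: "\<gamma> ! i \<in> E" if "i < length \<gamma>" for i using C(2) that nth_mem by blast
  have path: "is_path G \<gamma>"
    unfolding is_path_def
  proof (intro conjI allI impI)
    fix i assume "Suc i < length \<gamma>"
    then show "src G (\<gamma> ! Suc i) \<in> rng G (\<gamma> ! i)" using C(5)[of i] by simp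
  qed (use C in auto)
  have "length \<gamma> > 0" using C(1) by simp
  then have l: "last \<gamma> = \<gamma> ! (length \<gamma> - 1)" "hd \<gamma> = \<gamma> ! 0" "length \<gamma> - 1 < length \<gamma>" "Suc (length
      \<gamma> - 1) = length \<gamma>"
    using C(1) by (simp_all add: last_conv_nth hd_conv_nth)
  have "src G (hd \<gamma>) \<in> rng G (last \<gamma>)" using C(5)[OF l(3)] unfolding l(1,2) l(4) by simp
  moreover have "rng G (last \<gamma>) \<in> gen_verts G - HN"
    unfolding outside_iff l(1) using C(4)[OF l(3)] nth[OF l(3)] by simp
  ultimately have "loop_outside G HN \<gamma>"
    using path by (simp add: loop_outside_def is_loop_def path_src_def path_rng_def)
  moreover have "\<not> has_exit_outside G HN \<gamma>"
    unfolding has_exit_outside_def outside_iff using C(6,7) by blast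
  ultimately show "loop_outside G HN \<gamma> \<and> distinct (map (src G) \<gamma>) \<and> \<not> has_exit_outside G HN \<gamma>"
    using C(3) by blast
next
  assume l: "loop_outside G HN \<gamma> \<and> distinct (map (src G) \<gamma>) \<and> \<not> has_exit_outside G HN \<gamma>"
  interpret leavitt_full G "\<lambda>A. L (p A)" "\<lambda>e. L (se e)" "\<lambda>e. L (te e)" sc by (rule full)
  have path: "\<gamma> \<noteq> []" "set \<gamma> \<subseteq> E" "\<And>i. Suc i < length \<gamma> \<Longrightarrow> s (\<gamma> ! Suc i) \<in> r (\<gamma> ! i)"
    and closed: "s (hd \<gamma>) \<in> r (last \<gamma>)" and last: "L (p (r (last \<gamma>))) \<noteq> 0"
    using l unfolding loop_outside_def is_loop_def is_path_def path_src_def path_rng_def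
        outside_iff by blast+
  have nth: "\<gamma> ! i \<in> E" if "i < length \<gamma>" for i using path(2) that nth_mem by blast
  have pos: "0 < length \<gamma>" using path(1) by simp
  have next_in: "s (\<gamma> ! (Suc i mod length \<gamma>)) \<in> r (\<gamma> ! i)" if i: "i < length \<gamma>" for i
  proof (cases "Suc i < length \<gamma>")
    case True
    then show ?thesis using path(3) by simp
  next
    case False
    then have "Suc i = length \<gamma>" using i by simp
    moreover from this have "i = length \<gamma> - 1" by simp
    ultimately show ?thesis using closed path(1) by (simp add: hd_conv_nth last_conv_nth)
  qed
  show "exitless_cycle G (\<lambda>A. L (p A)) (\<lambda>e. L (se e)) (\<lambda>e. L (te e)) sc \<gamma>"
  proof unfold_locales
    show "L (p (r (\<gamma> ! i))) \<noteq> 0" if i: "i < length \<gamma>" for i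
    proof
      assume z: "L (p (r (\<gamma> ! i))) = 0"
      have "i + j < length \<gamma> \<Longrightarrow> L (p (r (\<gamma> ! (i + j)))) = 0" for j
      proof (induction j)
        case (Suc j)
        have e: "\<gamma> ! (i + j) \<in> E" "\<gamma> ! Suc (i + j) \<in> E" using nth Suc.prems by simp_all
        have "{s (\<gamma> ! Suc (i + j))} \<subseteq> r (\<gamma> ! (i + j))" using path(3) Suc.prems by simp
        then have "L (p {s (\<gamma> ! Suc (i + j))}) = 0"
          using P_zero_mono[of "r (\<gamma> ! (i + j))"] Suc e by simp
        then have "L (se (\<gamma> ! Suc (i + j))) = 0" using PS_src[OF e(2)] by simp
        then show ?case using S_zero_iff[OF e(2)] by simp
      qed (use z in simp)
      from this[of "length \<gamma> - 1 - i"] show False using i last path(1) by (simp add: last_conv_nth)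
    qed
    show "L (p (r (\<gamma> ! i) - {s (\<gamma> ! (Suc i mod length \<gamma>))})) = 0" if i: "i < length \<gamma>" for i
    proof -
      have "r (\<gamma> ! i) - {s (\<gamma> ! (Suc i mod length \<gamma>))} \<in> V0"
        using nth[OF i] nth[of "Suc i mod length \<gamma>"] pos by (intro gen_verts.diff) auto
      then show ?thesis using l i unfolding has_exit_outside_def outside_iff by blast
    qed
    show "f = \<gamma> ! (Suc i mod length \<gamma>)"
      if "f \<in> E" "i < length \<gamma>" "s f \<in> r (\<gamma> ! i)" "L (p (r f)) \<noteq> 0" for f i
      using l that rng_gv[OF that(1)] unfolding has_exit_outside_def outside_iff by blast
  qed (use path l next_in in auto)
qed

end

text \<open>A model of a quotient together with an exitless loop outside of \<open>H\<close>.\<close>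

locale cycle_rep =
  quotient_rep G N L sc +
  exitless_cycle G "\<lambda>A. L (free_gen (Proj A))" "\<lambda>e. L (free_gen (Edge e))" "\<lambda>e. L (free_gen (Ghost
      e))" sc \<gamma>
  for G :: "('v, 'e) ultragraph" and N :: "('v, 'e, 'k::field) lpa_free set"
    and L :: "('v, 'e, 'k) lpa_free \<Rightarrow> 'r::ring_1" and sc :: "'k \<Rightarrow> 'r" and \<gamma> :: "'e list"
begin

abbreviation pv :: "('v, 'e, 'k) lpa_free" where "pv \<equiv> p {v}"

lemma v_eq: "path_src G \<gamma> = v"
  by (simp add: path_src_def cyc_def hd_conv_nth)

lemma pv_FA: "pv \<in> FG" by (rule gen_FA(1)[OF u_gv])

lemma L_free_path: "set \<alpha> \<subseteq> E \<Longrightarrow> \<alpha> \<noteq> [] \<Longrightarrow> L (free_path \<alpha>) = Sp \<alpha>"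
proof (induction \<alpha>)
  case (Cons e \<alpha>)
  show ?case
  proof (cases "\<alpha> = []")
    case True
    then show ?thesis by (simp add: free_path_def Sp_Cons)
  next
    case False
    have "L (free_path (e # \<alpha>)) = L (se e * free_path \<alpha>)" by (simp add: free_path_def)
    also have "\<dots> = L (se e) * L (free_path \<alpha>)"
      using Cons.prems False by (intro L_mult gen_FA free_path_FA) auto
    finally show ?thesis using Cons False by (simp add: Sp_Cons)
  qed
qed simp

lemma L_free_ghost: "set \<alpha> \<subseteq> E \<Longrightarrow> \<alpha> \<noteq> [] \<Longrightarrow> L (free_ghost \<alpha>) = Tp \<alpha>"
proof (induction \<alpha>)
  case (Cons e \<alpha>)
  show ?case
  proof (cases "\<alpha> = []")
    case True
    then show ?thesis by (simp add: free_ghost_def Tp_Cons)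
  next
    case False
    have "L (free_ghost (e # \<alpha>)) = L (free_ghost \<alpha> * te e)" by (simp add: free_ghost_def)
    also have "\<dots> = L (free_ghost \<alpha>) * L (te e)"
      using Cons.prems False by (intro L_mult gen_FA free_ghost_FA) auto
    finally show ?thesis using Cons False by (simp add: Tp_Cons)
  qed
qed simp

lemma L_power: "x \<in> FG \<Longrightarrow> m \<noteq> 0 \<Longrightarrow> L (x ^ m) = L x ^ m"
proof (induction m)
  case (Suc m)
  then show ?case by (cases "m = 0") (simp_all add: L_mult power_FA)
qed simp

lemma Sp_gamma: "Sp \<gamma> = Cp 0 n" and Tp_gamma: "Tp \<gamma> = Cq 0 n"
  using P_Sp[OF cycle_ne cycle_edges u_gv, of 0] Tp_P[OF cycle_ne cycle_edges u_gv, of 0]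
  by (simp_all add: Cp_def Cq_def seg_gamma hd_conv_nth cyc_def)

lemma Cp_power: "m \<noteq> 0 \<Longrightarrow> Cp 0 n ^ m = Cp 0 (m * n)" and Cq_power: "m \<noteq> 0 \<Longrightarrow> Cq 0 n ^ m = Cq 0 (m * n)"
proof (induction m)
  case (Suc m)
  { case 1 show ?case using Suc Cp_mult_n[of 1 "m * n"] by (cases "m = 0") simp_all }
  { case 2 show ?case using Suc Cq_mult_n[of n m] by (cases "m = 0") (simp_all add: add.commute) }
qed simp_all

lemma L_free_power: "L (free_power G \<gamma> k) = lp k"
proof -
  have F: "free_path \<gamma> \<in> FG" "free_ghost \<gamma> \<in> FG" by (intro free_path_FA free_ghost_FA cycle_ne
      cycle_edges)+
  consider "k = 0" | "k > 0" | "k < 0" by linarith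
  then show ?thesis
  proof cases
    case 1
    then show ?thesis by (simp add: free_power_def lp_0 v_eq)
  next
    case 2
    then show ?thesis using F
      by (simp add: free_power_def lp_def L_power L_free_path[OF cycle_edges cycle_ne] Sp_gamma
          Cp_power)
  next
    case 3
    then show ?thesis using F
      by (simp add: free_power_def lp_def L_power L_free_ghost[OF cycle_edges cycle_ne] Tp_gamma
          Cq_power)
  qed
qed

abbreviation EV :: "(int \<Rightarrow>\<^sub>0 'k) \<Rightarrow> ('v, 'e, 'k) lpa_free" where "EV \<equiv> free_eval G \<gamma>"

lemma EV_FA: "EV f \<in> FG" by (rule free_eval_FA[OF cycle_ne cycle_edges])

lemma L_EV: "L (EV f) = ev f"
proof -
  have F: "free_power G \<gamma> k \<in> FG" for k by (rule free_power_FA[OF cycle_ne cycle_edges])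
  have "L (EV f) = (\<Sum>k\<in>Poly_Mapping.keys f. L (scal (Poly_Mapping.lookup f k) (free_power G \<gamma> k)))"
    unfolding free_eval_def by (intro L_sum FA_scal F)
  then show ?thesis by (simp add: L_scal[OF F] L_free_power ev_def)
qed

lemma EV_N: "EV f \<in> N \<longleftrightarrow> ev f = 0"
  using L_zero_iff[OF EV_FA] by (simp add: L_EV)

lemma pv_notin: "pv \<notin> N"
  using L_zero_iff[OF pv_FA] P_u_nz[of 0] by simp

lemma directed_to_cycle:
  assumes dd: "downward_directed G (gen_verts G - HN)" and B: "B \<in> V0" "L (p B) \<noteq> 0"
  shows "\<exists>C\<in>V0. L (p C) \<noteq> 0 \<and> uge G B C \<and> uge G {v} C"
proof -
  have "B \<in> gen_verts G - HN" "{v} \<in> gen_verts G - HN" 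
    using outside_iff[of B] outside_iff[of "{v}"] B P_u_nz[of 0] u_gv[of 0] by blast+
  then obtain C where "C \<in> gen_verts G - HN" "uge G B C" "uge G {v} C"
    using dd unfolding downward_directed_def by blast
  then show ?thesis unfolding outside_iff by blast
qed

text \<open>Every element outside \<open>N\<close> generates, together with \<open>N\<close>, an element \<open>g(s\<^sub>\<gamma>)\<close> outside \<open>N\<close>.\<close>

lemma corner_witness:
  assumes dd: "downward_directed G (gen_verts G - HN)" and x: "x \<in> FG" "x \<notin> N"
  shows "\<exists>a\<in>FG. \<exists>b\<in>FG. \<exists>g. L (a * x * b) = ev g \<and> ev g \<noteq> 0"
proof -
  have "L x \<noteq> 0" using L_zero_iff[OF x(1)] x(2) by blast
  from corner_essential[OF directed_to_cycle[OF dd] L_alg[OF x(1)] this]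
  obtain a b where ab: "a \<in> alg" "b \<in> alg" "L pv * a * L x * b * L pv \<noteq> 0" by blast
  obtain a' b' where ab': "a' \<in> FG" "b' \<in> FG" "a = L a'" "b = L b'" using alg_L[OF ab(1)] alg_L[OF
      ab(2)] by blast
  have "L pv * a * L x * b * L pv = L pv * (a * L x * b) * L pv" by (simp only: mult.assoc)
  moreover have "a * L x * b \<in> alg" by (intro alg_mult ab L_alg x)
  ultimately obtain g where g: "L pv * a * L x * b * L pv = ev g" using corner by metis
  have "L (pv * a' * x * (b' * pv)) = L pv * a * L x * b * L pv"
    using ab' x pv_FA by (simp add: L_mult FA_mult mult.assoc)
  then have "L (pv * a' * x * (b' * pv)) = ev g" "ev g \<noteq> 0" using g ab(3) by simp_all
  moreover have "pv * a' \<in> FG" "b' * pv \<in> FG" using ab' pv_FA by (auto intro: FA_mult)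
  ultimately show ?thesis by blast
qed

text \<open>If evaluation at the cycle is injective, the corner at \<open>v\<close> is graded by the exponents.\<close>

lemma corner_graded:
  assumes inj: "\<And>f. ev f = 0 \<Longrightarrow> f = 0" and z: "z \<in> FG" and pz: "pv * z * pv \<in> N"
  shows "pv * hproj m z * pv \<in> N"
proof -
  \<comment> \<open>the Laurent monomial (or zero) that represents a word in the corner; its exponent is determined by
    the degree of the word\<close>
  have "\<exists>\<kappa>. \<forall>w. letters w \<noteq> [] \<longrightarrow> set (letters w) \<subseteq> lpa_gens G \<longrightarrow>
      L pv * L (Poly_Mapping.single w 1) * L pv = ev (\<kappa> w) \<and>
      (\<forall>k. Poly_Mapping.lookup (\<kappa> w) k \<noteq> 0 \<longrightarrow> k * int n = deg w)"
  proof (rule choice, rule allI)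
    fix w :: "('v, 'e) lpa_gen free_monoid"
    show "\<exists>g. letters w \<noteq> [] \<longrightarrow> set (letters w) \<subseteq> lpa_gens G \<longrightarrow>
      L pv * L (Poly_Mapping.single w 1) * L pv = ev g \<and> (\<forall>k. Poly_Mapping.lookup g k \<noteq> 0 \<longrightarrow> k *
          int n = deg w)"
    proof (cases "letters w \<noteq> [] \<and> set (letters w) \<subseteq> lpa_gens G")
      case True
      then obtain j where "monomial (deg w) j (L (Poly_Mapping.single w 1))" using L_word by blast
      from corner_monomial[OF this] show ?thesis
      proof
        assume "L pv * L (Poly_Mapping.single w 1) * L pv = 0"
        then show ?thesis by (intro exI[of _ 0]) simp
      next
        assume "\<exists>k. L pv * L (Poly_Mapping.single w 1) * L pv = lp k \<and> deg w = k * int n"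
        then obtain k where k: "L pv * L (Poly_Mapping.single w 1) * L pv = lp k" "deg w = k * int
            n" by blast
        then show ?thesis
          by (intro exI[of _ "Poly_Mapping.single k 1"]) (auto simp: ev_single lookup_single when_def)
      qed
    qed blast
  qed
  then obtain \<kappa> where \<kappa>: "\<And>w. letters w \<noteq> [] \<Longrightarrow> set (letters w) \<subseteq> lpa_gens G \<Longrightarrow>
      L pv * L (Poly_Mapping.single w 1) * L pv = ev (\<kappa> w) \<and>
      (\<forall>k. Poly_Mapping.lookup (\<kappa> w) k \<noteq> 0 \<longrightarrow> k * int n = deg w)" by blast
  \<comment> \<open>a lift of the compression \<open>y \<mapsto> p\<^sub>v y p\<^sub>v\<close> to Laurent polynomials\<close>
  define \<Phi> where "\<Phi> y = (\<Sum>w\<in>Poly_Mapping.keys y. Poly_Mapping.single 0 (Poly_Mapping.lookup y w) *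
      \<kappa> w)" for y
  have L\<Phi>: "L (pv * y * pv) = ev (\<Phi> y)" if y: "y \<in> FG" for y
  proof -
    have "L (pv * y * pv) = L pv * L y * L pv" using y pv_FA by (simp add: L_mult FA_mult)
    also have "\<dots> = (\<Sum>w\<in>Poly_Mapping.keys y. L pv * (sc (Poly_Mapping.lookup y w) * L
        (Poly_Mapping.single w 1)) * L pv)"
      unfolding L_decomp[OF y] by (simp add: sum_distrib_left sum_distrib_right)
    also have "\<dots> = (\<Sum>w\<in>Poly_Mapping.keys y. ev (Poly_Mapping.single 0 (Poly_Mapping.lookup y w) * \<kappa> w))"
    proof (intro sum.cong refl)
      fix w assume "w \<in> Poly_Mapping.keys y"
      then have k: "L pv * L (Poly_Mapping.single w 1) * L pv = ev (\<kappa> w)" using \<kappa> y unfolding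
          mem_FA by blast
      have "L pv * (sc (Poly_Mapping.lookup y w) * L (Poly_Mapping.single w 1)) * L pv =
          sc (Poly_Mapping.lookup y w) * (L pv * L (Poly_Mapping.single w 1) * L pv)"
        using rep_sc_comm[OF pv_FA] by (simp only: mult.assoc[symmetric])
      also have "\<dots> = sc (Poly_Mapping.lookup y w) * (L pv * (L pv * L (Poly_Mapping.single w 1) *
          L pv))"
        using P_idem[OF u_gv, of 0] by (simp only: mult.assoc[symmetric])
      also have "\<dots> = ev (Poly_Mapping.single 0 (Poly_Mapping.lookup y w) * \<kappa> w)"
        unfolding k ev_mult ev_single lp_0 by (simp only: mult.assoc)
      finally show "L pv * (sc (Poly_Mapping.lookup y w) * L (Poly_Mapping.single w 1)) * L pv =
        ev (Poly_Mapping.single 0 (Poly_Mapping.lookup y w) * \<kappa> w)" .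
    qed
    finally show ?thesis by (simp add: \<Phi>_def ev_sum)
  qed
  have F: "pv * y * pv \<in> FG" if "y \<in> FG" for y using pv_FA that by (intro FA_mult)
  have hz: "hproj m z \<in> FG" by (rule hproj_FA[OF z])
  have "ev (\<Phi> z) = 0" using L_zero_iff[OF F[OF z]] pz L\<Phi>[OF z] by simp
  then have \<Phi>0: "\<Phi> z = 0" by (rule inj)
  have lk: "Poly_Mapping.lookup (\<Phi> y) k = (\<Sum>w\<in>Poly_Mapping.keys y. Poly_Mapping.lookup y w *
      Poly_Mapping.lookup (\<kappa> w) k)" for y k
    by (simp add: \<Phi>_def lookup_sum lookup_single_mult_int)
  have "\<Phi> (hproj m z) = 0"
  proof (rule poly_mapping_eqI)
    fix k
    have "Poly_Mapping.lookup (\<Phi> (hproj m z)) k =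
        (\<Sum>w\<in>{w \<in> Poly_Mapping.keys z. deg w = m}. Poly_Mapping.lookup z w * Poly_Mapping.lookup (\<kappa>
            w) k)"
      unfolding lk keys_hproj by (intro sum.cong refl) (simp add: lookup_hproj)
    also have "\<dots> = (if k * int n = m then Poly_Mapping.lookup (\<Phi> z) k else 0)"
    proof (cases "k * int n = m")
      case True
      have "deg w = m" if "w \<in> Poly_Mapping.keys z" "Poly_Mapping.lookup (\<kappa> w) k \<noteq> 0" for w
        using \<kappa>[of w] that z True unfolding mem_FA by auto
      then show ?thesis unfolding lk using True by (auto intro!: sum.mono_neutral_left)
    next
      case False
      have "Poly_Mapping.lookup (\<kappa> w) k = 0" if "w \<in> Poly_Mapping.keys z" "deg w = m" for w
        using \<kappa>[of w] that z False unfolding mem_FA by auto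
      then show ?thesis using False by (auto intro!: sum.neutral)
    qed
    finally show "Poly_Mapping.lookup (\<Phi> (hproj m z)) k = Poly_Mapping.lookup 0 k" using \<Phi>0 by simp
  qed
  then have "L (pv * hproj m z * pv) = 0" using L\<Phi>[OF hz] by simp
  then show ?thesis using L_zero_iff[OF F[OF hz]] by blast
qed

text \<open>Different exponents of \<open>s\<^sub>\<gamma>\<close> have different degrees.\<close>

lemma hproj_EV: "hproj (k * int n) (EV f) = scal (Poly_Mapping.lookup f k) (free_power G \<gamma> k)"
proof -
  have "hproj (k * int n) (EV f) = (\<Sum>l\<in>Poly_Mapping.keys f.
      if l = k then scal (Poly_Mapping.lookup f k) (free_power G \<gamma> k) else 0)"
    unfolding free_eval_def hproj_sum
    by (intro sum.cong refl) (auto simp: cycle_ne hproj_homogeneous'[OF homogeneous_scal[OF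
        homogeneous_free_power]])
  then show ?thesis by (simp add: in_keys_iff scal_simps)
qed

end

section \<open>Characterization of the non-graded prime ideals\<close>

text \<open>If \<open>p\<^sub>A x p\<^sub>B \<noteq> 0\<close>, then some monomial \<open>s\<^sub>\<alpha> p\<^sub>D s\<^sub>\<beta>\<^sub>*\<close> connects \<open>A\<close> and \<open>B\<close> through a common
  set.\<close>

lemma (in leavitt_family) connected_by_nonzero:
  assumes x: "x \<in> alg" and A: "A \<in> V0" and B: "B \<in> V0" and nz: "P A * x * P B \<noteq> 0"
  shows "\<exists>C\<in>V0. P C \<noteq> 0 \<and> uge G A C \<and> uge G B C"
proof -
  have ex: "x \<in> spn m \<Longrightarrow> P A * x * P B \<noteq> 0 \<Longrightarrow> \<exists>d y. monomial d m y \<and> P A * y * P B \<noteq> 0" for x m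
  proof (induction rule: spn.induct)
    case (spn_add x y)
    then have "P A * x * P B \<noteq> 0 \<or> P A * y * P B \<noteq> 0" by (auto simp: distrib_left distrib_right)
    then show ?case using spn_add.IH by blast
  next
    case (spn_mono d x c)
    have "P A * (sc c * x) * P B = (P A * sc c) * x * P B" by (simp only: mult.assoc)
    also have "\<dots> = sc c * (P A * x * P B)" unfolding sc_P[OF A] by (simp only: mult.assoc)
    finally have "P A * x * P B \<noteq> 0" using spn_mono.prems by auto
    then show ?case using spn_mono.hyps by blast
  qed simp
  obtain m where "x \<in> spn m" using alg_spn[OF x] by blast
  then obtain d y where y: "monomial d m y" "P A * y * P B \<noteq> 0" using ex nz by blast
  then obtain \<alpha> D \<beta> where *: "set \<alpha> \<subseteq> E" "set \<beta> \<subseteq> E" "D \<in> V0" "y = Sp \<alpha> * P D * Tp \<beta>"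
    unfolding monomial_def by auto
  have eq: "P A * y * P B = (P A * Sp \<alpha>) * P D * (Tp \<beta> * P B)" unfolding *(4) by (simp only: mult.assoc)
  have nzA: "P A * Sp \<alpha> \<noteq> 0" and nzB: "Tp \<beta> * P B \<noteq> 0" using y(2) unfolding eq by auto
  define A' where "A' = (if \<alpha> = [] then A else r (last \<alpha>))"
  define B' where "B' = (if \<beta> = [] then B else r (last \<beta>))"
  have V: "A' \<in> V0" "B' \<in> V0" using A B last_E * by (auto simp: A'_def B'_def)
  have l: "P A * Sp \<alpha> * P A' = P A * Sp \<alpha>"
    using P_idem[OF A] Sp_rng[of \<alpha>] * by (simp add: A'_def mult.assoc)
  have rr: "P B' * (Tp \<beta> * P B) = Tp \<beta> * P B"
    using P_idem[OF B] rng_Tp[of \<beta>] * by (simp add: B'_def mult.assoc[symmetric])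
  have "P A * y * P B = (P A * Sp \<alpha> * P A') * P D * (P B' * (Tp \<beta> * P B))" unfolding l rr eq ..
  also have "\<dots> = (P A * Sp \<alpha>) * (P A' * P D * P B') * (Tp \<beta> * P B)" by (simp only: mult.assoc)
  also have "P A' * P D * P B' = P (A' \<inter> D \<inter> B')" using V * by (simp add: P_mult gen_verts.inter)
  finally have C: "P (A' \<inter> D \<inter> B') \<noteq> 0" using y(2) by auto
  have "uge G A (A' \<inter> D \<inter> B')"
  proof (cases "\<alpha> = []")
    case False
    have "s (hd \<alpha>) \<in> A" using P_Sp[OF False *(1) A] nzA by (auto split: if_splits)
    moreover have "is_path G \<alpha>" using Sp_nz_iff_path[OF *(1) False] mult_not_zero[OF nzA] by blast
    ultimately show ?thesis using False by (auto simp: uge_def path_src_def path_rng_def A'_def)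
  qed (auto simp: uge_def A'_def)
  moreover have "uge G B (A' \<inter> D \<inter> B')"
  proof (cases "\<beta> = []")
    case False
    have "s (hd \<beta>) \<in> B" using Tp_P[OF False *(2) B] nzB by (auto split: if_splits)
    moreover have "Sp \<beta> \<noteq> 0" using Tp_nz_Sp[OF *(2)] mult_not_zero[OF nzB] by blast
    then have "is_path G \<beta>" using Sp_nz_iff_path[OF *(2) False] by blast
    ultimately show ?thesis using False by (auto simp: uge_def path_src_def path_rng_def B'_def)
  qed (auto simp: uge_def B'_def)
  moreover have "A' \<inter> D \<inter> B' \<in> V0" using V * by (intro gen_verts.inter)
  ultimately show ?thesis using C by blast
qed

context ultragraph
begin

lemma prime_downward_directed:
  fixes I :: "('v, 'e, 'k::field) lpa_elem set"
  assumes P: "prime_two_sided_ideal (lpa G) I" and H: "H = ideal_verts G I"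
  shows "downward_directed G (gen_verts G - H)"
proof -
  have I: "two_sided_ideal (lpa G) I" using P by (simp add: prime_two_sided_ideal_def)
  have o: "over_ideal (pre I)" by (rule over_ideal_pre[OF I])
  then have r: "raw_ideal (lpa_gens G) (pre I)" and R: "lpa_rel_ideal G \<subseteq> pre I" by (auto simp:
      over_ideal_def)
  note D = raw_idealD[OF r]
  obtain L :: "('v, 'e, 'k) lpa_free \<Rightarrow> ('v, 'e, 'k) lpa_free endo" and sc
    where "quotient_rep G (pre I) L sc" using quotient_rep_of_over_ideal[OF o] by metis
  then interpret quotient_rep G "pre I" L sc .
  have HH: "H = HN" using H by (simp add: ideal_verts_pre)
  show ?thesis
    unfolding downward_directed_def HH
  proof (intro conjI ballI)
    show "gen_verts G - HN \<noteq> {}"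
    proof
      assume "gen_verts G - HN = {}"
      then have all: "p A \<in> pre I" if "A \<in> gen_verts G" for A using that by blast
      have "x \<in> pre I" if x: "x \<in> FG" for x
      proof -
        obtain A where A: "A \<in> gen_verts G" "x - p A * x \<in> lpa_rel_ideal G" using
            local_unit_rel[OF x] by blast
        have "(x - p A * x) + p A * x \<in> pre I" using A(2) R D(5)[OF x all[OF A(1)]] D(7) by blast
        then show ?thesis by simp
      qed
      then have "carrier (lpa G) \<subseteq> I" by (auto simp: carrier_lpa pre_def)
      then have "I = carrier (lpa G)" using two_sided_ideal_carrier[OF I] by blast
      then show False using P by (simp add: prime_two_sided_ideal_def)
    qed
    fix A B assume AB: "A \<in> gen_verts G - HN" "B \<in> gen_verts G - HN"
    have pF: "p A \<in> FG" "p B \<in> FG" using AB by (auto intro: gen_FA)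
    have "\<not> (\<forall>a\<in>FG. p A * a * p B \<in> pre I)" using prime_elementwise[OF P pF] AB by blast
    then obtain a where a: "a \<in> FG" "p A * a * p B \<notin> pre I" by blast
    then have "L (p A) * L a * L (p B) \<noteq> 0"
      using L_zero_iff[of "p A * a * p B"] pF by (simp add: L_mult FA_mult)
    then obtain C where "C \<in> V0" "L (p C) \<noteq> 0" "uge G A C" "uge G B C"
      using connected_by_nonzero[OF L_alg[OF a(1)]] AB by blast
    then show "\<exists>C\<in>gen_verts G - HN. C \<noteq> {} \<and> uge G A C \<and> uge G B C"
      unfolding outside_iff Bex_def by auto
  qed blast
qed

lemma ideal_HS_over:
  fixes H :: "'v set set"
  assumes H: "H \<subseteq> gen_verts G"
  shows "two_sided_ideal (lpa G) (ideal_HS G H (breaking_verts G H) :: ('v, 'e, 'k::field)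
    lpa_elem set)"
    and "A \<in> H \<Longrightarrow> free_gen (Proj A) \<in> pre (ideal_HS G H (breaking_verts G H) :: ('v, 'e, 'k)
      lpa_elem set)"
    and "w \<in> breaking_verts G H \<Longrightarrow> free_pH G H w \<in> pre (ideal_HS G H (breaking_verts G H) :: ('v,
      'e, 'k) lpa_elem set)"
proof -
  let ?J = "ideal_HS G H (breaking_verts G H) :: ('v, 'e, 'k) lpa_elem set"
  note gp = ideal_gen_props[OF generators_carrier[OF H order_refl], folded ideal_HS_def]
  show "two_sided_ideal (lpa G) ?J" by (rule gp(1))
  show "free_gen (Proj A) \<in> pre ?J" if A: "A \<in> H"
  proof -
    have "lpa_p G A \<in> ?J" using A by (intro subsetD[OF gp(2)] UnI1 imageI)
    then show ?thesis using A H by (subst pre_mem) (auto simp: lpa_p_def intro!: gen_FA)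
  qed
  show "free_pH G H w \<in> pre ?J" if w: "w \<in> breaking_verts G H"
  proof -
    have "lpa_pH G H w \<in> ?J" using w by (intro subsetD[OF gp(2)] UnI2 imageI)
    moreover have "w \<in> verts G" using w by (simp add: breaking_verts_def)
    ultimately show ?thesis by (simp add: pre_mem free_pH_FA lpa_pH_class[OF w])
  qed
qed

lemma ideal_HSy_over:
  fixes H :: "'v set set" and y :: "('v, 'e, 'k::field) lpa_free"
  assumes H: "H \<subseteq> gen_verts G" and y: "y \<in> FA (lpa_gens G)"
  defines "J \<equiv> ideal_HSy G H (breaking_verts G H) (lpa_class G y)"
  shows "two_sided_ideal (lpa G) J" "y \<in> pre J" "ideal_HS G H (breaking_verts G H) \<subseteq> J"
proof -
  have "ideal_HS G H (breaking_verts G H) \<union> {lpa_class G y} \<subseteq> carrier (lpa G)"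
    using two_sided_ideal_carrier[OF ideal_HS_over(1)[OF H]] y by (auto simp: carrier_lpa)
  note gp = ideal_gen_props[OF this, folded ideal_HSy_def, folded J_def]
  show "two_sided_ideal (lpa G) J" by (rule gp(1))
  show "ideal_HS G H (breaking_verts G H) \<subseteq> J" using gp(2) by blast
  show "y \<in> pre J" using gp(2) y by (simp add: pre_mem)
qed

text \<open>The model of a quotient by an ideal that contains \<open>p\<^sub>w\<^sup>H\<close> for all breaking vertices \<open>w\<close>.\<close>

lemma model:
  fixes N :: "('v, 'e, 'k::field) lpa_free set"
  assumes o: "over_ideal N" and H: "H = {A \<in> gen_verts G. free_gen (Proj A) \<in> N}"
    and pH: "\<And>w. w \<in> breaking_verts G H \<Longrightarrow> free_pH G H w \<in> N"
  obtains L :: "('v, 'e, 'k) lpa_free \<Rightarrow> ('v, 'e, 'k) lpa_free endo" and sc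
  where "quotient_rep G N L sc"
    and "leavitt_full G (\<lambda>A. L (free_gen (Proj A))) (\<lambda>e. L (free_gen (Edge e))) (\<lambda>e. L (free_gen
      (Ghost e))) sc"
proof -
  obtain L :: "('v, 'e, 'k) lpa_free \<Rightarrow> ('v, 'e, 'k) lpa_free endo" and sc
    where q: "quotient_rep G N L sc" using quotient_rep_of_over_ideal[OF o] by metis
  have "leavitt_full G (\<lambda>A. L (free_gen (Proj A))) (\<lambda>e. L (free_gen (Edge e))) (\<lambda>e. L (free_gen
      (Ghost e))) sc"
    by (rule quotient_rep.leavitt_full_rep[OF q]) (use pH in \<open>simp only: H free_pH_def\<close>)
  then show ?thesis using that q by blast
qed

lemma cycle_model:
  fixes N :: "('v, 'e, 'k::field) lpa_free set"
  assumes o: "over_ideal N" and H: "H = {A \<in> gen_verts G. free_gen (Proj A) \<in> N}"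
    and pH: "\<And>w. w \<in> breaking_verts G H \<Longrightarrow> free_pH G H w \<in> N"
    and \<gamma>: "loop_outside G H \<gamma>" "distinct (map (src G) \<gamma>)" "\<not> has_exit_outside G H \<gamma>"
  obtains L :: "('v, 'e, 'k) lpa_free \<Rightarrow> ('v, 'e, 'k) lpa_free endo" and sc
  where "cycle_rep G N L sc \<gamma>"
proof -
  obtain L :: "('v, 'e, 'k) lpa_free \<Rightarrow> ('v, 'e, 'k) lpa_free endo" and sc
    where q: "quotient_rep G N L sc"
      and full: "leavitt_full G (\<lambda>A. L (free_gen (Proj A))) (\<lambda>e. L (free_gen (Edge e))) (\<lambda>e. L
        (free_gen (Ghost e))) sc"
    by (rule model[OF o H pH])
  have "exitless_cycle G (\<lambda>A. L (free_gen (Proj A))) (\<lambda>e. L (free_gen (Edge e))) (\<lambda>e. L (free_gen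
      (Ghost e))) sc \<gamma>"
    using quotient_rep.exitless_cycle_iff[OF q full] \<gamma> by (simp only: H[symmetric]) blast
  then show ?thesis using that q by (simp add: cycle_rep_def)
qed

lemma ideal_verts_between:
  assumes "N' \<subseteq> pre I" "\<And>A. A \<in> ideal_verts G I \<Longrightarrow> free_gen (Proj A) \<in> N'"
  shows "ideal_verts G I = {A \<in> gen_verts G. free_gen (Proj A) \<in> N'}"
  using assms unfolding ideal_verts_pre by blast

text \<open>Without exitless loops, an ideal containing all \<open>p\<^sub>w\<^sup>H\<close> is generated by these and the \<open>p\<^sub>A\<close> with
  \<open>A \<in> H\<close>.\<close>

lemma graded_without_exitless_loops:
  fixes I :: "('v, 'e, 'k::field) lpa_elem set"
  assumes I: "two_sided_ideal (lpa G) I" and H: "H = ideal_verts G I"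
    and pH: "\<And>w. w \<in> breaking_verts G H \<Longrightarrow> free_pH G H w \<in> pre I"
    and no: "\<And>\<gamma>. \<not> (loop_outside G H \<gamma> \<and> distinct (map (src G) \<gamma>) \<and> \<not> has_exit_outside G H \<gamma>)"
  shows "graded_ideal G I"
proof -
  let ?J = "ideal_HS G H (breaking_verts G H) :: ('v, 'e, 'k) lpa_elem set"
  have HV: "H \<subseteq> gen_verts G" unfolding H by (auto simp: ideal_verts_def)
  note J = ideal_HS_over[OF HV]
  have rI: "raw_ideal (lpa_gens G) (pre I)" using over_ideal_pre[OF I] by (simp add: over_ideal_def)
  note D = raw_idealD[OF rI]
  have JI: "?J \<subseteq> I"
    unfolding ideal_HS_def
  proof (rule ideal_gen_least[OF I], safe)
    fix A assume "A \<in> H"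
    then show "lpa_p G A \<in> I" unfolding H by (simp add: ideal_verts_def)
  next
    fix w assume w: "w \<in> breaking_verts G H"
    then show "lpa_pH G H w \<in> I" using pH[OF w] by (simp add: lpa_pH_class pre_def)
  qed
  have sub: "pre ?J \<subseteq> pre I" by (rule pre_mono[OF JI])
  have HJ: "H = {A \<in> gen_verts G. free_gen (Proj A) \<in> pre ?J}"
    using ideal_verts_between[OF sub J(2)] unfolding H[symmetric] by simp
  have oJ: "over_ideal (pre ?J)" by (rule over_ideal_pre[OF J(1)])
  obtain L :: "('v, 'e, 'k) lpa_free \<Rightarrow> ('v, 'e, 'k) lpa_free endo" and sc
    where q: "quotient_rep G (pre ?J) L sc"
      and full: "leavitt_full G (\<lambda>A. L (free_gen (Proj A))) (\<lambda>e. L (free_gen (Edge e))) (\<lambda>e. L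
        (free_gen (Ghost e))) sc"
    by (rule model[OF oJ HJ J(3)])
  interpret quotient_rep G "pre ?J" L sc by (rule q)
  have no': "\<not> exitless_cycle G (\<lambda>A. L (p A)) (\<lambda>e. L (se e)) (\<lambda>e. L (te e)) sc \<gamma>" for \<gamma>
    using exitless_cycle_iff[OF full, of \<gamma>] no[of \<gamma>] by (simp only: HJ[symmetric]) blast
  have "x \<in> pre ?J" if x: "x \<in> pre I" for x
  proof (rule ccontr)
    assume "x \<notin> pre ?J"
    then have nz: "L x \<noteq> 0" using L_zero_iff D(1)[OF x] by blast
    obtain a b A where ab: "a \<in> alg" "b \<in> alg" "A \<in> V0" "L (p A) \<noteq> 0" "a * L x * b = L (p A)"
      using leavitt_full.reduces_to_projection[OF full L_alg[OF D(1)[OF x]] nz no'] by blast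
    obtain a' b' where a'b': "a' \<in> FG" "b' \<in> FG" "a = L a'" "b = L b'"
      using alg_L[OF ab(1)] alg_L[OF ab(2)] by blast
    have F: "a' * x * b' \<in> FG" "p A \<in> FG" using a'b' D(1)[OF x] ab(3) by (auto intro: FA_mult gen_FA)
    have "L (p A) = L (a' * x * b')" using a'b' ab(5) D(1)[OF x] by (simp add: L_mult FA_mult)
    then have "p A - a' * x * b' \<in> pre ?J" using L_eq_iff[OF F(2,1)] by blast
    moreover have "a' * x * b' \<in> pre I" using D(4,5) x a'b' by blast
    ultimately have "(p A - a' * x * b') + a' * x * b' \<in> pre I" using sub D(7) by blast
    then have "A \<in> H" using ab(3) by (simp add: H ideal_verts_pre)
    then show False using HJ HN_iff[OF ab(3)] ab(4) by blast
  qed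
  then have eq: "pre ?J = pre I" using sub by blast
  then have "\<forall>x\<in>pre I. \<forall>n. hproj n x \<in> pre I" using hproj_ideal_HS[OF HV] by blast
  then show ?thesis using graded_iff[OF I] by blast
qed

theorem nongraded_prime_imp:
  fixes I :: "('v, 'e, 'k::field) lpa_elem set"
  assumes P: "prime_two_sided_ideal (lpa G) I" and ng: "\<not> graded_ideal G I" and H: "H = ideal_verts G I"
  shows "downward_directed G (gen_verts G - H) \<and>
    (\<exists>\<gamma>. loop_outside G H \<gamma> \<and> distinct (map (src G) \<gamma>) \<and> \<not> has_exit_outside G H \<gamma> \<and>
      (\<exists>f :: int \<Rightarrow>\<^sub>0 'k. irreducible f \<and> I = ideal_HSy G H (breaking_verts G H) (laurent_eval G f \<gamma>)))"
proof -
  have I: "two_sided_ideal (lpa G) I" using P by (simp add: prime_two_sided_ideal_def)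
  have o: "over_ideal (pre I)" by (rule over_ideal_pre[OF I])
  then have rI: "raw_ideal (lpa_gens G) (pre I)" by (simp add: over_ideal_def)
  note D = raw_idealD[OF rI]
  have dd: "downward_directed G (gen_verts G - H)" by (rule prime_downward_directed[OF P H])
  have HV: "H \<subseteq> gen_verts G" unfolding H by (auto simp: ideal_verts_def)
  have pH: "free_pH G H w \<in> pre I" if "w \<in> breaking_verts G H" for w
    using graded_or_breaking[OF P H that] ng by blast
  obtain \<gamma> where \<gamma>: "loop_outside G H \<gamma>" "distinct (map (src G) \<gamma>)" "\<not> has_exit_outside G H \<gamma>"
    using graded_without_exitless_loops[OF I H pH] ng by blast
  have HI: "H = {A \<in> gen_verts G. free_gen (Proj A) \<in> pre I}" using H by (simp add: ideal_verts_pre)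
  obtain L :: "('v, 'e, 'k) lpa_free \<Rightarrow> ('v, 'e, 'k) lpa_free endo" and sc
    where "cycle_rep G (pre I) L sc \<gamma>" by (rule cycle_model[OF o HI pH \<gamma>])
  then interpret c: cycle_rep G "pre I" L sc \<gamma> .
  obtain f0 where f0: "c.ev f0 = 0" "f0 \<noteq> 0"
    using graded_by_corner[OF P c.pv_FA c.pv_notin] c.corner_graded ng by blast
  \<comment> \<open>the kernel of the evaluation is prime, since the corner is commutative\<close>
  have "\<exists>f\<in>{f. c.ev f = 0}. irreducible f \<and> (\<forall>g\<in>{f. c.ev f = 0}. f dvd g)"
  proof (rule laurent_prime_principal[of _ f0])
    show "1 \<notin> {f. c.ev f = 0}" using c.P_u_nz[of 0] by (simp add: c.ev_1)
    fix f g assume fg: "f * g \<in> {f. c.ev f = 0}"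
    have "c.EV f * a * c.EV g \<in> pre I" if a: "a \<in> FA (lpa_gens G)" for a
    proof -
      obtain h where h: "L c.pv * L a * L c.pv = c.ev h" using c.corner[OF c.L_alg[OF a]] by blast
      have e: "c.ev f * L c.pv = c.ev f" "L c.pv * c.ev g = c.ev g"
        using c.ev_mult[of f 1] c.ev_mult[of 1 g] by (simp_all add: c.ev_1)
      have "c.ev f * L a * c.ev g = (c.ev f * L c.pv) * L a * (L c.pv * c.ev g)" unfolding e ..
      also have "\<dots> = c.ev f * (L c.pv * L a * L c.pv) * c.ev g" by (simp only: mult.assoc)
      also have "\<dots> = c.ev (h * (f * g))" unfolding h by (simp only: c.ev_mult[symmetric] ac_simps)
      also have "\<dots> = 0" using fg by (simp add: c.ev_mult)
      finally have "L (c.EV f * a * c.EV g) = 0" using a c.EV_FA by (simp add: c.L_mult FA_mult c.L_EV)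
      then show ?thesis using c.L_zero_iff a c.EV_FA by (simp add: FA_mult)
    qed
    then have "c.EV f \<in> pre I \<or> c.EV g \<in> pre I" using prime_elementwise[OF P c.EV_FA c.EV_FA] by blast
    then show "f \<in> {f. c.ev f = 0} \<or> g \<in> {f. c.ev f = 0}" by (simp add: c.EV_N)
  qed (use f0 in \<open>auto simp: c.ev_minus c.ev_mult\<close>)
  then obtain f where f: "c.ev f = 0" "irreducible f" "\<And>g. c.ev g = 0 \<Longrightarrow> f dvd g" by blast
  define J where "J = ideal_HSy G H (breaking_verts G H) (lpa_class G (c.EV f))"
  note J = ideal_HSy_over[OF HV c.EV_FA[of f], folded J_def]
  have JI: "J \<subseteq> I"
  proof -
    have "ideal_HS G H (breaking_verts G H) \<subseteq> I"
      unfolding ideal_HS_def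
    proof (rule ideal_gen_least[OF I], safe)
      fix A assume "A \<in> H"
      then show "lpa_p G A \<in> I" unfolding H by (simp add: ideal_verts_def)
    next
      fix w assume w: "w \<in> breaking_verts G H"
      then show "lpa_pH G H w \<in> I" using pH[OF w] by (simp add: lpa_pH_class pre_def)
    qed
    moreover have "lpa_class G (c.EV f) \<in> I" using f(1) c.EV_N[of f] by (simp add: pre_def)
    ultimately show ?thesis unfolding J_def ideal_HSy_def by (intro ideal_gen_least[OF I]) blast
  qed
  have sub: "pre J \<subseteq> pre I" by (rule pre_mono[OF JI])
  have HSJ: "pre (ideal_HS G H (breaking_verts G H)) \<subseteq> pre J" by (rule pre_mono[OF J(3)])
  have HJ: "H = {A \<in> gen_verts G. free_gen (Proj A) \<in> pre J}"
    using ideal_verts_between[OF sub] ideal_HS_over(2)[OF HV] HSJ H by blast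
  have pHJ: "free_pH G H w \<in> pre J" if "w \<in> breaking_verts G H" for w
    using ideal_HS_over(3)[OF HV that] HSJ by blast
  have oJ: "over_ideal (pre J)" by (rule over_ideal_pre[OF J(1)])
  obtain L' :: "('v, 'e, 'k) lpa_free \<Rightarrow> ('v, 'e, 'k) lpa_free endo" and sc'
    where "cycle_rep G (pre J) L' sc' \<gamma>" by (rule cycle_model[OF oJ HJ pHJ \<gamma>])
  then interpret d: cycle_rep G "pre J" L' sc' \<gamma> .
  have "x \<in> pre J" if x: "x \<in> pre I" for x
  proof (rule ccontr)
    assume nx: "x \<notin> pre J"
    obtain a b g where abg: "a \<in> FA (lpa_gens G)" "b \<in> FA (lpa_gens G)" "L' (a * x * b) = d.ev g"
        "d.ev g \<noteq> 0"
      using d.corner_witness[OF dd[unfolded HJ] D(1)[OF x] nx] by blast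
    have F: "a * x * b \<in> FA (lpa_gens G)" using abg D(1)[OF x] by (intro FA_mult)
    have "L' (d.EV g) = L' (a * x * b)" using abg(3) by (simp add: d.L_EV)
    then have "d.EV g - a * x * b \<in> pre J" using d.L_eq_iff[OF d.EV_FA F] by blast
    moreover have "a * x * b \<in> pre I" using D(4,5) x abg by blast
    ultimately have "(d.EV g - a * x * b) + a * x * b \<in> pre I" using sub D(7) by blast
    then have "c.ev g = 0" using c.EV_N[of g] by simp
    then obtain h where "g = f * h" using f(3) by blast
    moreover have "d.ev f = 0" using J(2) d.EV_N by blast
    ultimately show False using abg(4) by (simp add: d.ev_mult)
  qed
  then have "pre J = pre I" using sub by blast
  then have "I = J" using image_pre[OF I] image_pre[OF J(1)] by simp
  moreover have "lpa_class G (c.EV f) = laurent_eval G f \<gamma>"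
    by (rule laurent_eval_class[OF c.cycle_ne c.cycle_edges, symmetric])
  ultimately have "I = ideal_HSy G H (breaking_verts G H) (laurent_eval G f \<gamma>)" unfolding J_def by simp
  then show ?thesis using dd \<gamma> f(2) by blast
qed

theorem nongraded_prime_if:
  fixes I :: "('v, 'e, 'k::field) lpa_elem set" and f :: "int \<Rightarrow>\<^sub>0 'k"
  assumes I: "two_sided_ideal (lpa G) I" and H: "H = ideal_verts G I"
    and dd: "downward_directed G (gen_verts G - H)"
    and \<gamma>: "loop_outside G H \<gamma>" "distinct (map (src G) \<gamma>)" "\<not> has_exit_outside G H \<gamma>"
    and f: "irreducible f" and I_eq: "I = ideal_HSy G H (breaking_verts G H) (laurent_eval G f \<gamma>)"
  shows "prime_two_sided_ideal (lpa G) I" "\<not> graded_ideal G I"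
proof -
  have o: "over_ideal (pre I)" by (rule over_ideal_pre[OF I])
  then have rI: "raw_ideal (lpa_gens G) (pre I)" by (simp add: over_ideal_def)
  note D = raw_idealD[OF rI]
  have HV: "H \<subseteq> gen_verts G" unfolding H by (auto simp: ideal_verts_def)
  have HI: "H = {A \<in> gen_verts G. free_gen (Proj A) \<in> pre I}" using H by (simp add: ideal_verts_pre)
  have g: "\<gamma> \<noteq> []" "set \<gamma> \<subseteq> edges G" using \<gamma>(1) by (auto simp: loop_outside_def is_loop_def is_path_def)
  have I_eq': "I = ideal_HSy G H (breaking_verts G H) (lpa_class G (free_eval G \<gamma> f))"
    unfolding laurent_eval_class[OF g, symmetric] by (rule I_eq)
  note J = ideal_HSy_over[OF HV free_eval_FA[OF g, of f], folded I_eq']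
  have pH: "free_pH G H w \<in> pre I" if "w \<in> breaking_verts G H" for w
    using ideal_HS_over(3)[OF HV that] pre_mono[OF J(3)] by blast
  obtain L :: "('v, 'e, 'k) lpa_free \<Rightarrow> ('v, 'e, 'k) lpa_free endo" and sc
    where "cycle_rep G (pre I) L sc \<gamma>" by (rule cycle_model[OF o HI pH \<gamma>])
  then interpret c: cycle_rep G "pre I" L sc \<gamma> .
  have evf: "c.ev f = 0" using J(2) c.EV_N by blast
  \<comment> \<open>the corner at the cycle is a field\<close>
  have inverse: "\<exists>b. c.ev (b * h) = c.ev 1" if h: "c.ev h \<noteq> 0" for h
  proof -
    have "\<not> f dvd h"
    proof
      assume "f dvd h"
      then obtain k where "h = f * k" by blast
      then show False using h evf by (simp add: c.ev_mult)
    qed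
    then obtain a b where "a * f + b * h = 1" using laurent_bezout[OF f] by blast
    then have "c.ev 1 = c.ev (a * f) + c.ev (b * h)" by (metis c.ev_add)
    then show ?thesis using evf by (auto simp: c.ev_mult[of a f])
  qed
  have ev1: "c.ev 1 \<noteq> 0" using c.P_u_nz[of 0] by (simp add: c.ev_1)
  show "prime_two_sided_ideal (lpa G) I"
    unfolding prime_two_sided_ideal_def
  proof (intro conjI allI impI I)
    show "I \<noteq> carrier (lpa G)"
    proof
      assume "I = carrier (lpa G)"
      then have "lpa_class G c.pv \<in> I" using c.pv_FA by (simp add: carrier_lpa)
      then show False using c.pv_notin c.pv_FA by (simp add: pre_def)
    qed
    fix A B assume A: "two_sided_ideal (lpa G) A" and B: "two_sided_ideal (lpa G) B"
      and prod: "\<forall>a\<in>A. \<forall>b\<in>B. a \<otimes>\<^bsub>lpa G\<^esub> b \<in> I"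
    have wit: "\<exists>y\<in>pre C. \<exists>h. L y = c.ev h \<and> c.ev h \<noteq> 0" if C: "two_sided_ideal (lpa G) C" "\<not> C \<subseteq>
        I" for C
    proof -
      have rC: "raw_ideal (lpa_gens G) (pre C)" using over_ideal_pre[OF C(1)] by (simp add:
          over_ideal_def)
      obtain X where "X \<in> C" "X \<notin> I" using C(2) by blast
      then have "X \<in> lpa_class G ` pre C" by (simp only: image_pre[OF C(1)])
      then obtain x where x: "x \<in> pre C" "lpa_class G x \<notin> I" using \<open>X \<notin> I\<close> by blast
      then have xF: "x \<in> FA (lpa_gens G)" "x \<notin> pre I" by (auto simp: pre_def)
      obtain a b h where "a \<in> FA (lpa_gens G)" "b \<in> FA (lpa_gens G)" "L (a * x * b) = c.ev h"
          "c.ev h \<noteq> 0"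
        using c.corner_witness[OF dd[unfolded HI] xF] by blast
      moreover from calculation(1,2) have "a * x * b \<in> pre C" by (intro raw_idealD(4,5)[OF rC] x(1))
      ultimately show ?thesis by (intro bexI[of _ "a * x * b"] exI[of _ h] conjI)
    qed
    show "A \<subseteq> I \<or> B \<subseteq> I"
    proof (rule ccontr)
      assume "\<not> (A \<subseteq> I \<or> B \<subseteq> I)"
      then obtain x y h k where xy: "x \<in> pre A" "y \<in> pre B" "L x = c.ev h" "c.ev h \<noteq> 0" "L y =
          c.ev k" "c.ev k \<noteq> 0"
        using wit[OF A] wit[OF B] by blast
      have F: "x \<in> FA (lpa_gens G)" "y \<in> FA (lpa_gens G)" using xy by (auto simp: pre_def)
      have "lpa_class G x \<otimes>\<^bsub>lpa G\<^esub> lpa_class G y \<in> I" using prod xy by (auto simp: pre_def)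
      then have "x * y \<in> pre I" using F by (simp add: lpa_mult pre_def FA_mult)
      then have "L (x * y) = 0" using c.L_zero_iff F by (simp add: FA_mult)
      then have hk: "c.ev (h * k) = 0" using F xy by (simp add: c.L_mult c.ev_mult)
      obtain b b' where "c.ev (b * h) = c.ev 1" "c.ev (b' * k) = c.ev 1" using inverse xy by blast
      then have "c.ev (1 * 1) = c.ev (b * h) * c.ev (b' * k)" by (simp only: c.ev_mult)
      also have "\<dots> = c.ev (b * b' * (h * k))" by (simp only: c.ev_mult[symmetric] ac_simps)
      also have "\<dots> = 0" using hk by (simp add: c.ev_mult)
      finally show False using ev1 by simp
    qed
  qed
  show "\<not> graded_ideal G I"
  proof
    assume "graded_ideal G I"
    then have "hproj n (c.EV f) \<in> pre I" for n using graded_iff[OF I] J(2) by blast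
    then have z: "L (scal (Poly_Mapping.lookup f k) (free_power G \<gamma> k)) = 0" for k
      using c.L_zero_iff[OF FA_scal[OF free_power_FA[OF g]]] c.hproj_EV[of k f] by metis
    have "f \<noteq> 0" using f by auto
    then obtain k where k: "Poly_Mapping.lookup f k \<noteq> 0" by (metis lookup_zero poly_mapping_eqI)
    have "sc (Poly_Mapping.lookup f k) * c.lp k = 0"
      using z[of k] c.L_scal[OF free_power_FA[OF g]] by (simp add: c.L_free_power)
    then show False using c.sc_cancel[OF k] c.lp_nz by blast
  qed
qed

end

theorem theorem3p11:
  fixes G :: "('v, 'e) ultragraph"
    and I :: "('v, 'e, 'k::field) lpa_elem set"
    and H :: "'v set set"
  assumes "ultragraph G"
    and "two_sided_ideal (lpa G) I"
    and "H = ideal_verts G I"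
  shows "prime_two_sided_ideal (lpa G) I \<and> \<not> graded_ideal G I \<longleftrightarrow>
    downward_directed G (gen_verts G - H) \<and>
    (\<exists>\<gamma>. loop_outside G H \<gamma> \<and> distinct (map (src G) \<gamma>) \<and> \<not> has_exit_outside G H \<gamma> \<and>
      (\<exists>f :: int \<Rightarrow>\<^sub>0 'k. irreducible f \<and>
        I = ideal_HSy G H (breaking_verts G H) (laurent_eval G f \<gamma>)))"
  using ultragraph.nongraded_prime_imp[OF assms(1) _ _ assms(3)]
    ultragraph.nongraded_prime_if[OF assms] by blast

end
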